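(* Let $\mathsf G$ be a rigidly symmetric discrete group and let $(\mathcal A,\alpha,\omega)$ be a twisted $C^*$-dynamical system with group $\mathsf G$ and unital $\mathcal A$. Then for every $\alpha$-invariant ideal $\mathcal J$ of $\mathcal A$, the Banach $*$-algebra $\ell^1_{\alpha,\omega}(\mathsf G;\mathcal A)$ is $\mathcal J\rtimes_\alpha^\omega\mathsf G$-inverse closed in the twisted crossed product $\mathcal A\rtimes_\alpha^\omega\mathsf G$.
   Context: A Banach $*$-algebra is symmetric if the spectrum of $B^*B$ is contained in $[0,\infty)$ for every element $B$ (spectrum in the unitization if there is no unit). A discrete group $\mathsf G$ (unit $\mathsf e$) is rigidly symmetric if for every $C^*$-algebra $\mathcal B$ the Banach $*$-algebra $\ell^1(\mathsf G;\mathcal B)\cong\ell^1(\mathsf G)\widehat\otimes\mathcal B$ (convolution $(f\star g)(x)=\sum_y f(y)g(y^{-1}x)$, involution $f^\star(x)=f(x^{-1})^*$) is symmetric. A twisted $C^*$-dynamical system $(\mathcal A,\alpha,\omega)$ with $\mathcal A$ unital consists of maps $\alpha:\mathsf G\to\mathrm{Aut}(\mathcal A)$ and $\omega:\mathsf G\times\mathsf G\to\mathcal U(\mathcal A)$ (unitary group) with, for all $x,y,z$: $\alpha_x\circ\alpha_y=\mathrm{ad}_{\omega(x,y)}\circ\alpha_{xy}$ (where $\mathrm{ad}_u(a)=uau^*$), $\omega(x,y)\omega(xy,z)=\alpha_x[\omega(y,z)]\omega(x,yz)$, $\omega(x,\mathsf e)=1=\omega(\mathsf e,x)$. The Banach $*$-algebra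 $\ell^1_{\alpha,\omega}(\mathsf G;\mathcal A)$ is $\ell^1(\mathsf G;\mathcal A)$ with product $(f\diamond g)(x)=\sum_{y}f(y)\,\alpha_y[g(y^{-1}x)]\,\omega(y,y^{-1}x)$ and involution $f^{\diamond}(x)=\omega(x,x^{-1})^*\alpha_x[f(x^{-1})]^*$; its enveloping $C^*$-algebra is $\mathcal A\rtimes_\alpha^\omega\mathsf G$, and $\ell^1_{\alpha,\omega}(\mathsf G;\mathcal A)$ is regarded as a $*$-subalgebra of it. An ideal of a $C^*$-algebra means a closed self-adjoint two-sided ideal. $\mathcal J$ is $\alpha$-invariant if $\alpha_x(\mathcal J)\subset\mathcal J$ for all $x\in\mathsf G$. Then $\alpha$ restricts to $\mathcal J$, the unitaries $\omega(x,y)$ act as multipliers of $\mathcal J$, and the twisted crossed product $\mathcal J\rtimes_\alpha^\omega\mathsf G$ (the enveloping $C^*$-algebra of $\ell^1_{\alpha,\omega}(\mathsf G;\mathcal J)$) is identified with an ideal of $\mathcal A\rtimes_\alpha^\omega\mathsf G$ by regarding $\mathcal J$-valued $\ell^1$-functions as $\mathcal A$-valued. For an ideal $\mathfrak J$ of a unital $C^*$-algebra $\mathfrak C$, a $*$-subalgebra $\mathfrak B\subset\mathfrak C$ is $\mathfrak J$-inverse closed if $\mathfrak B/(\mathfrak B\cap\mathfrak J)$, viewed as a $*$-subalgebra of $\mathfrak C/\mathfrak J$, is inverse closed in $\mathfrak C/\mathfrak J$, i.e. every element of $\mathfrak B/(\mathfrak B\cap\mathfrak J)$ that is invertible in $\mathfrak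 C/\mathfrak J$ has its inverse in $\mathfrak B/(\mathfrak B\cap\mathfrak J)$. *)

theory Defs
  imports
    "HOL-Analysis.Analysis"
    "HOL-Algebra.QuotRing"
    "HOL-Algebra.Algebraic_Closure_Type"
begin

section \<open>Banach *-algebras and C*-algebras\<close>

text \<open>
  Algebras are complex, need not be unital, and are presented by records with a carrier, in the
  style of HOL-Algebra; \<open>ring_of_type_algebra\<close> is the field of complex numbers as such a record.
\<close>

record 'a star_algebra = "(complex, 'a) module" +
  star :: "'a \<Rightarrow> 'a" (\<open>_\<^sup>\<star>\<index>\<close> [1000] 999)
  nrm :: "'a \<Rightarrow> real" (\<open>\<parallel>_\<parallel>\<index>\<close> [0] 1000)

text \<open>The value off the carrier only serves to meet the axioms of \<^locale>\<open>Metric_space\<close>.\<close>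

definition nrm_dist :: "('a, 'm) star_algebra_scheme \<Rightarrow> 'a \<Rightarrow> 'a \<Rightarrow> real" where
  "nrm_dist A a b = (if a \<in> carrier A \<and> b \<in> carrier A then \<parallel>a \<ominus>\<^bsub>A\<^esub> b\<parallel>\<^bsub>A\<^esub> else 0)"

definition nrm_topology :: "('a, 'm) star_algebra_scheme \<Rightarrow> 'a topology" where
  "nrm_topology A = Metric_space.mtopology (carrier A) (nrm_dist A)"

text \<open>
  The record field \<open>\<one>\<close> is meaningful only for unital algebras. By \<open>one_convention\<close> it is the unit
  whenever there is one, so that an algebra \<open>A\<close> is unital if and only if \<open>monoid A\<close>.
\<close>

locale banach_star_algebra = Module.module "ring_of_type_algebra :: complex ring" A
  for A :: "('a, 'm) star_algebra_scheme" (structure) +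
  assumes mult_closed: "\<lbrakk>a \<in> carrier A; b \<in> carrier A\<rbrakk> \<Longrightarrow> a \<otimes> b \<in> carrier A"
    and mult_assoc: "\<lbrakk>a \<in> carrier A; b \<in> carrier A; c \<in> carrier A\<rbrakk> \<Longrightarrow>
      (a \<otimes> b) \<otimes> c = a \<otimes> (b \<otimes> c)"
    and distrib_right: "\<lbrakk>a \<in> carrier A; b \<in> carrier A; c \<in> carrier A\<rbrakk> \<Longrightarrow>
      (a \<oplus> b) \<otimes> c = a \<otimes> c \<oplus> b \<otimes> c"
    and distrib_left: "\<lbrakk>a \<in> carrier A; b \<in> carrier A; c \<in> carrier A\<rbrakk> \<Longrightarrow>
      c \<otimes> (a \<oplus> b) = c \<otimes> a \<oplus> c \<otimes> b"
    and smult_mult_left: "\<lbrakk>a \<in> carrier A; b \<in> carrier A\<rbrakk> \<Longrightarrow> (z \<odot> a) \<otimes> b = z \<odot> (a \<otimes> b)"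
    and smult_mult_right: "\<lbrakk>a \<in> carrier A; b \<in> carrier A\<rbrakk> \<Longrightarrow> a \<otimes> (z \<odot> b) = z \<odot> (a \<otimes> b)"
    and one_convention:
      "\<lbrakk>e \<in> carrier A; \<And>a. a \<in> carrier A \<Longrightarrow> e \<otimes> a = a \<and> a \<otimes> e = a\<rbrakk> \<Longrightarrow> \<one> = e"
    and star_closed: "a \<in> carrier A \<Longrightarrow> a\<^sup>\<star> \<in> carrier A"
    and star_star: "a \<in> carrier A \<Longrightarrow> (a\<^sup>\<star>)\<^sup>\<star> = a"
    and star_add: "\<lbrakk>a \<in> carrier A; b \<in> carrier A\<rbrakk> \<Longrightarrow> (a \<oplus> b)\<^sup>\<star> = a\<^sup>\<star> \<oplus> b\<^sup>\<star>"
    and star_smult: "a \<in> carrier A \<Longrightarrow> (z \<odot> a)\<^sup>\<star> = cnj z \<odot> a\<^sup>\<star>"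
    and star_mult: "\<lbrakk>a \<in> carrier A; b \<in> carrier A\<rbrakk> \<Longrightarrow> (a \<otimes> b)\<^sup>\<star> = b\<^sup>\<star> \<otimes> a\<^sup>\<star>"
    and nrm_eq_0_iff: "a \<in> carrier A \<Longrightarrow> \<parallel>a\<parallel> = 0 \<longleftrightarrow> a = \<zero>"
    and nrm_triangle: "\<lbrakk>a \<in> carrier A; b \<in> carrier A\<rbrakk> \<Longrightarrow> \<parallel>a \<oplus> b\<parallel> \<le> \<parallel>a\<parallel> + \<parallel>b\<parallel>"
    and nrm_smult: "a \<in> carrier A \<Longrightarrow> \<parallel>z \<odot> a\<parallel> = cmod z * \<parallel>a\<parallel>"
    and nrm_mult: "\<lbrakk>a \<in> carrier A; b \<in> carrier A\<rbrakk> \<Longrightarrow> \<parallel>a \<otimes> b\<parallel> \<le> \<parallel>a\<parallel> * \<parallel>b\<parallel>"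
    and nrm_star: "a \<in> carrier A \<Longrightarrow> \<parallel>a\<^sup>\<star>\<parallel> = \<parallel>a\<parallel>"
    and complete: "Metric_space.mcomplete (carrier A) (nrm_dist A)"

locale cstar_algebra = banach_star_algebra +
  assumes cstar_identity: "a \<in> carrier A \<Longrightarrow> \<parallel>a\<^sup>\<star> \<otimes> a\<parallel> = \<parallel>a\<parallel>\<^sup>2"

definition star_hom ::
  "('a, 'm) star_algebra_scheme \<Rightarrow> ('b, 'n) star_algebra_scheme \<Rightarrow> ('a \<Rightarrow> 'b) set" where
  "star_hom A B = {h. h \<in> carrier A \<rightarrow> carrier B \<and>
     (\<forall>a\<in>carrier A. \<forall>b\<in>carrier A. h (a \<oplus>\<^bsub>A\<^esub> b) = h a \<oplus>\<^bsub>B\<^esub> h b) \<and>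
     (\<forall>a\<in>carrier A. \<forall>b\<in>carrier A. h (a \<otimes>\<^bsub>A\<^esub> b) = h a \<otimes>\<^bsub>B\<^esub> h b) \<and>
     (\<forall>z. \<forall>a\<in>carrier A. h (z \<odot>\<^bsub>A\<^esub> a) = z \<odot>\<^bsub>B\<^esub> h a) \<and>
     (\<forall>a\<in>carrier A. h (a\<^sup>\<star>\<^bsub>A\<^esub>) = (h a)\<^sup>\<star>\<^bsub>B\<^esub>)}"

definition star_aut :: "('a, 'm) star_algebra_scheme \<Rightarrow> ('a \<Rightarrow> 'a) set" where
  "star_aut A = {h \<in> star_hom A A. bij_betw h (carrier A) (carrier A)}"

definition unitaries :: "('a, 'm) star_algebra_scheme \<Rightarrow> 'a set" where
  "unitaries A =
     {u \<in> carrier A. u\<^sup>\<star>\<^bsub>A\<^esub> \<otimes>\<^bsub>A\<^esub> u = \<one>\<^bsub>A\<^esub> \<and> u \<otimes>\<^bsub>A\<^esub> u\<^sup>\<star>\<^bsub>A\<^esub> = \<one>\<^bsub>A\<^esub>}"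

text \<open>The library notion \<open>ideal\<close> is that of a two-sided ideal of a unital ring.\<close>

definition cstar_ideal :: "'a set \<Rightarrow> ('a, 'm) star_algebra_scheme \<Rightarrow> bool" where
  "cstar_ideal J A \<longleftrightarrow> ideal J A \<and> closedin (nrm_topology A) J \<and> (\<forall>a\<in>J. a\<^sup>\<star>\<^bsub>A\<^esub> \<in> J)"


section \<open>Spectrum and symmetry\<close>

definition unitization :: "('a, 'm) star_algebra_scheme \<Rightarrow> (complex, 'a \<times> complex) module" where
  "unitization A =
     \<lparr>carrier = carrier A \<times> UNIV,
      monoid.mult = (\<lambda>(a, s) (b, t). (a \<otimes>\<^bsub>A\<^esub> b \<oplus>\<^bsub>A\<^esub> s \<odot>\<^bsub>A\<^esub> b \<oplus>\<^bsub>A\<^esub> t \<odot>\<^bsub>A\<^esub> a, s * t)),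
      one = (\<zero>\<^bsub>A\<^esub>, 1),
      zero = (\<zero>\<^bsub>A\<^esub>, 0),
      add = (\<lambda>(a, s) (b, t). (a \<oplus>\<^bsub>A\<^esub> b, s + t)),
      smult = (\<lambda>z (a, s). (z \<odot>\<^bsub>A\<^esub> a, z * s))\<rparr>"

definition unital_spectrum :: "(complex, 'a, 'm) module_scheme \<Rightarrow> 'a \<Rightarrow> complex set" where
  "unital_spectrum A a = {z. z \<odot>\<^bsub>A\<^esub> \<one>\<^bsub>A\<^esub> \<ominus>\<^bsub>A\<^esub> a \<notin> Units A}"

definition spectrum :: "('a, 'm) star_algebra_scheme \<Rightarrow> 'a \<Rightarrow> complex set" where
  "spectrum A a =
     (if monoid A then unital_spectrum A a else unital_spectrum (unitization A) (a, 0))"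

definition symmetric_algebra :: "('a, 'm) star_algebra_scheme \<Rightarrow> bool" where
  "symmetric_algebra A \<longleftrightarrow>
     (\<forall>b\<in>carrier A. spectrum A (b\<^sup>\<star>\<^bsub>A\<^esub> \<otimes>\<^bsub>A\<^esub> b) \<subseteq> complex_of_real ` {0..})"


section \<open>The algebra of summable functions and rigid symmetry\<close>

text \<open>Unconditional sum, in norm, of a family of elements of \<open>A\<close>.\<close>

definition alg_sum :: "('a, 'm) star_algebra_scheme \<Rightarrow> ('i \<Rightarrow> 'a) \<Rightarrow> 'i set \<Rightarrow> 'a" where
  "alg_sum A f I =
     (THE s. limitin (nrm_topology A) (\<lambda>F. finsum A f F) s (finite_subsets_at_top I))"

definition l1_functions ::
  "('g, 'k) monoid_scheme \<Rightarrow> ('a, 'm) star_algebra_scheme \<Rightarrow> ('g \<Rightarrow> 'a) set" where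
  "l1_functions G A =
     {f \<in> carrier G \<rightarrow>\<^sub>E carrier A. (\<lambda>x. \<parallel>f x\<parallel>\<^bsub>A\<^esub>) summable_on carrier G}"

definition l1_algebra ::
  "('g, 'k) monoid_scheme \<Rightarrow> ('a, 'm) star_algebra_scheme \<Rightarrow> ('g \<Rightarrow> 'a) star_algebra" where
  "l1_algebra G A =
     \<lparr>carrier = l1_functions G A,
      monoid.mult = (\<lambda>f g. \<lambda>x\<in>carrier G.
        alg_sum A (\<lambda>y. f y \<otimes>\<^bsub>A\<^esub> g (inv\<^bsub>G\<^esub> y \<otimes>\<^bsub>G\<^esub> x)) (carrier G)),
      one = (\<lambda>x\<in>carrier G. if x = \<one>\<^bsub>G\<^esub> then \<one>\<^bsub>A\<^esub> else \<zero>\<^bsub>A\<^esub>),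
      zero = (\<lambda>x\<in>carrier G. \<zero>\<^bsub>A\<^esub>),
      add = (\<lambda>f g. \<lambda>x\<in>carrier G. f x \<oplus>\<^bsub>A\<^esub> g x),
      smult = (\<lambda>z f. \<lambda>x\<in>carrier G. z \<odot>\<^bsub>A\<^esub> f x),
      star = (\<lambda>f. \<lambda>x\<in>carrier G. (f (inv\<^bsub>G\<^esub> x))\<^sup>\<star>\<^bsub>A\<^esub>),
      nrm = (\<lambda>f. \<Sum>\<^sub>\<infinity>x\<in>carrier G. \<parallel>f x\<parallel>\<^bsub>A\<^esub>)\<rparr>"

text \<open>
  ``For every C*-algebra \<open>B\<close>'' cannot be a quantification over all types, so \<open>B\<close> ranges over the
  C*-algebras whose carrier is a subset of \<open>nat set\<close> (any labels, arbitrary operations). Up to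
  isomorphism these are all C*-algebras with at most continuum many elements, in particular all
  separable ones, and nothing is lost: a summable \<open>f\<close> has countable support, so it takes its values
  in a separable C*-subalgebra \<open>B\<^sub>0\<close> of \<open>B\<close>, and the spectrum of \<open>f\<^sup>\<star> \<star> f\<close> over \<open>B\<close> is, up to the
  point 0, contained in the spectrum over \<open>B\<^sub>0\<close>.
\<close>

definition rigidly_symmetric :: "('g, 'k) monoid_scheme \<Rightarrow> bool" where
  "rigidly_symmetric G \<longleftrightarrow>
     (\<forall>B :: nat set star_algebra. cstar_algebra B \<longrightarrow> symmetric_algebra (l1_algebra G B))"


section \<open>Twisted C*-dynamical systems and crossed products\<close>

locale twisted_cstar_system =
  fixes G :: "('g, 'k) monoid_scheme" (structure)
    and A :: "('a, 'm) star_algebra_scheme"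
    and \<alpha> :: "'g \<Rightarrow> 'a \<Rightarrow> 'a"
    and \<omega> :: "'g \<Rightarrow> 'g \<Rightarrow> 'a"
  assumes group: "group G"
    and cstar: "cstar_algebra A"
    and unital: "monoid A"
    and aut: "x \<in> carrier G \<Longrightarrow> \<alpha> x \<in> star_aut A"
    and unitary: "\<lbrakk>x \<in> carrier G; y \<in> carrier G\<rbrakk> \<Longrightarrow> \<omega> x y \<in> unitaries A"
    and twisted_action: "\<lbrakk>x \<in> carrier G; y \<in> carrier G; a \<in> carrier A\<rbrakk> \<Longrightarrow>
      \<alpha> x (\<alpha> y a) = \<omega> x y \<otimes>\<^bsub>A\<^esub> \<alpha> (x \<otimes> y) a \<otimes>\<^bsub>A\<^esub> (\<omega> x y)\<^sup>\<star>\<^bsub>A\<^esub>"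
    and cocycle: "\<lbrakk>x \<in> carrier G; y \<in> carrier G; z \<in> carrier G\<rbrakk> \<Longrightarrow>
      \<omega> x y \<otimes>\<^bsub>A\<^esub> \<omega> (x \<otimes> y) z = \<alpha> x (\<omega> y z) \<otimes>\<^bsub>A\<^esub> \<omega> x (y \<otimes> z)"
    and normalized: "x \<in> carrier G \<Longrightarrow> \<omega> x \<one> = \<one>\<^bsub>A\<^esub> \<and> \<omega> \<one> x = \<one>\<^bsub>A\<^esub>"

definition twisted_l1 ::
  "('g, 'k) monoid_scheme \<Rightarrow> ('a, 'm) star_algebra_scheme \<Rightarrow> ('g \<Rightarrow> 'a \<Rightarrow> 'a) \<Rightarrow>
   ('g \<Rightarrow> 'g \<Rightarrow> 'a) \<Rightarrow> ('g \<Rightarrow> 'a) star_algebra" where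
  "twisted_l1 G A \<alpha> \<omega> = (l1_algebra G A)
     \<lparr>monoid.mult := (\<lambda>f g. \<lambda>x\<in>carrier G.
        alg_sum A (\<lambda>y. f y \<otimes>\<^bsub>A\<^esub> \<alpha> y (g (inv\<^bsub>G\<^esub> y \<otimes>\<^bsub>G\<^esub> x)) \<otimes>\<^bsub>A\<^esub> \<omega> y (inv\<^bsub>G\<^esub> y \<otimes>\<^bsub>G\<^esub> x))
          (carrier G)),
      star := (\<lambda>f. \<lambda>x\<in>carrier G.
        (\<omega> x (inv\<^bsub>G\<^esub> x))\<^sup>\<star>\<^bsub>A\<^esub> \<otimes>\<^bsub>A\<^esub> (\<alpha> x (f (inv\<^bsub>G\<^esub> x)))\<^sup>\<star>\<^bsub>A\<^esub>)\<rparr>"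

definition invariant_under ::
  "('g, 'k) monoid_scheme \<Rightarrow> ('g \<Rightarrow> 'a \<Rightarrow> 'a) \<Rightarrow> 'a set \<Rightarrow> bool" where
  "invariant_under G \<alpha> J \<longleftrightarrow> (\<forall>x\<in>carrier G. \<alpha> x ` J \<subseteq> J)"

text \<open>
  The norm of the enveloping C*-algebra of a Banach *-algebra \<open>L\<close> is the supremum of the seminorms
  \<open>f \<mapsto> \<parallel>\<pi>(f)\<parallel>\<close> over all *-representations \<open>\<pi>\<close> of \<open>L\<close>. These are exactly the C*-seminorms on \<open>L\<close>;
  *-representations of Banach *-algebras are contractive, so they are bounded by the norm of \<open>L\<close>.
\<close>

definition cstar_seminorm :: "('a, 'm) star_algebra_scheme \<Rightarrow> ('a \<Rightarrow> real) \<Rightarrow> bool" where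
  "cstar_seminorm L q \<longleftrightarrow>
     (\<forall>f\<in>carrier L. 0 \<le> q f \<and> q f \<le> \<parallel>f\<parallel>\<^bsub>L\<^esub> \<and> q (f\<^sup>\<star>\<^bsub>L\<^esub> \<otimes>\<^bsub>L\<^esub> f) = (q f)\<^sup>2) \<and>
     (\<forall>z. \<forall>f\<in>carrier L. q (z \<odot>\<^bsub>L\<^esub> f) = cmod z * q f) \<and>
     (\<forall>f\<in>carrier L. \<forall>g\<in>carrier L.
        q (f \<oplus>\<^bsub>L\<^esub> g) \<le> q f + q g \<and> q (f \<otimes>\<^bsub>L\<^esub> g) \<le> q f * q g)"

definition enveloping_nrm :: "('a, 'm) star_algebra_scheme \<Rightarrow> 'a \<Rightarrow> real" where
  "enveloping_nrm L f = (SUP q\<in>{q. cstar_seminorm L q}. q f)"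

text \<open>
  \<open>C\<close> with the canonical map \<open>\<iota>\<close> is an enveloping C*-algebra of \<open>L\<close>, i.e. the Hausdorff completion
  of \<open>L\<close> for the enveloping norm; this determines \<open>(C, \<iota>)\<close> up to unique isomorphism. The crossed
  product of a twisted system is an enveloping C*-algebra of its \<open>twisted_l1\<close>.
\<close>

definition enveloping_cstar_algebra ::
  "('a, 'm) star_algebra_scheme \<Rightarrow> ('c, 'n) star_algebra_scheme \<Rightarrow> ('a \<Rightarrow> 'c) \<Rightarrow> bool" where
  "enveloping_cstar_algebra L C \<iota> \<longleftrightarrow>
     cstar_algebra C \<and> \<iota> \<in> star_hom L C \<and>
     Abstract_Topology.closure_of (nrm_topology C) (\<iota> ` carrier L) = carrier C \<and>
     (\<forall>f\<in>carrier L. \<parallel>\<iota> f\<parallel>\<^bsub>C\<^esub> = enveloping_nrm L f)"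

text \<open>
  The crossed product of an invariant ideal \<open>J\<close>, as an ideal of the crossed product \<open>(C, \<iota>)\<close> of \<open>A\<close>:
  the closure of the \<open>J\<close>-valued summable functions, regarded as \<open>A\<close>-valued ones.
\<close>

definition crossed_product_ideal ::
  "('g, 'k) monoid_scheme \<Rightarrow> ('a, 'm) star_algebra_scheme \<Rightarrow> 'a set \<Rightarrow>
   ('c, 'n) star_algebra_scheme \<Rightarrow> (('g \<Rightarrow> 'a) \<Rightarrow> 'c) \<Rightarrow> 'c set" where
  "crossed_product_ideal G A J C \<iota> =
     Abstract_Topology.closure_of (nrm_topology C) (\<iota> ` {f \<in> l1_functions G A. f ` carrier G \<subseteq> J})"


section \<open>Inverse closedness relative to an ideal\<close>

definition inverse_closed :: "'a set \<Rightarrow> ('a, 'm) monoid_scheme \<Rightarrow> bool" where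
  "inverse_closed S R \<longleftrightarrow> (\<forall>x\<in>S \<inter> Units R. inv\<^bsub>R\<^esub> x \<in> S)"

text \<open>\<open>B / (B \<inter> I)\<close>, viewed inside \<open>C / I\<close>, is the set of cosets of the elements of \<open>B\<close>.\<close>

definition ideal_inverse_closed :: "'c set \<Rightarrow> 'c set \<Rightarrow> ('c, 'm) ring_scheme \<Rightarrow> bool" where
  "ideal_inverse_closed I B C \<longleftrightarrow> inverse_closed ((\<lambda>b. I +>\<^bsub>C\<^esub> b) ` B) (C Quot I)"

end

theory Submission imports Defs begin

text \<open>
  The proof leaves the twisted crossed product for an untwisted algebra of summable functions, where
  rigid symmetry applies. Write \<open>L\<close> for the twisted algebra of summable functions, \<open>\<iota>\<close> for its map into
  the crossed product \<open>C\<close>, \<open>I\<close> for the closed ideal of \<open>C\<close> generated by the \<open>J\<close>-valued functions, and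
  \<open>D\<close> for the C*-algebra \<open>C / I\<close>. Sending \<open>f\<close> to the function \<open>x \<mapsto> [\<iota> (f x \<delta>\<^sub>x)]\<close> defines a contractive
  *-homomorphism \<open>\<Psi>\<close> from \<open>L\<close> into the ordinary convolution algebra of \<open>D\<close>-valued summable functions:
  since the products \<open>(a \<delta>\<^sub>y) (b \<delta>\<^sub>z)\<close> are formed inside \<open>C\<close>, the action and the cocycle are absorbed
  into the coefficients. Moreover \<open>\<Psi>\<close> annihilates the \<open>J\<close>-valued functions.

  Rigid symmetry, after a reduction to separable coefficients
  (\<open>rigidly_symmetric_one_plus_square\<close>), says that the target \<open>S\<close> of \<open>\<Psi>\<close> is symmetric. On a
  symmetric Banach *-algebra there is a C*-seminorm \<open>p\<close> such that \<open>p u < 1\<close> forces some power of \<open>u\<close> to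
  have norm less than one (\<open>cone_norm_power_small\<close>). The composite \<open>p \<circ> \<Psi>\<close> is a C*-seminorm on \<open>L\<close>, so
  it is dominated by the enveloping norm; as \<open>\<Psi>\<close> kills \<open>J\<close>-valued functions, \<open>p (\<Psi> u)\<close> is small as
  soon as \<open>\<iota> u\<close> is close to \<open>I\<close>.

  Now let \<open>\<iota> f\<close> be invertible modulo \<open>I\<close> and choose \<open>g\<close> in \<open>L\<close> such that \<open>\<iota> g\<close> is close to an inverse.
  For \<open>u = 1 - f g\<close> we get \<open>p (\<Psi> u) < 1\<close>, hence \<open>\<parallel>\<Psi> h\<parallel> < 1\<close> for some power \<open>h\<close> of \<open>u\<close>. This
  estimate is lifted to \<open>L\<close> one coefficient at a time: the norms of the coefficients of \<open>\<Psi> h\<close> dominate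
  a C*-seminorm on \<open>A\<close>, every C*-seminorm on a C*-algebra is the quotient norm of its kernel
  (\<open>cstar_seminorm_is_quotient_norm\<close>), and functions with values in this kernel are mapped into
  \<open>I\<close>. So \<open>h\<close> agrees modulo \<open>I\<close> with some \<open>w\<close> in \<open>L\<close> of norm less than one (\<open>lift_small\<close>). The Neumann
  series of \<open>w\<close> converges in \<open>L\<close> and inverts \<open>1 - h\<close> modulo \<open>I\<close>; since \<open>1 - u = f g\<close> divides \<open>1 - h\<close>,
  this gives an inverse of \<open>f\<close> modulo \<open>I\<close> that lies in \<open>L\<close>.

  The facts about symmetric Banach *-algebras and about C*-algebras are proved by elementary means,
  without characters or states. Two tools suffice: an averaging argument over roots of unity in place
  of the spectral radius formula (\<open>spectral_radius\<close>), and square roots of \<open>1 - x\<close> for power bounded \<open>x\<close>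
  (\<open>square_root_exists\<close>). They are developed for a type class and then carried over to algebras
  presented by records (\<open>all_transferred_facts\<close>).
\<close>

section \<open>Unital Banach *-algebras as a type class\<close>

text \<open>
  The class does not extend \<open>real_normed_algebra_1\<close>: the zero algebra and units of norm other than one
  have to be included, since quotients may vanish and the algebras of summable functions inherit the
  norm of the unit of their coefficients.
\<close>

class banach_star = banach + real_normed_algebra + monoid_mult +
  fixes scaleC :: "complex \<Rightarrow> 'a \<Rightarrow> 'a"  (infixr "*\<^sub>C" 75)
    and adj :: "'a \<Rightarrow> 'a"
  assumes scaleC_add_right: "a *\<^sub>C (x + y) = a *\<^sub>C x + a *\<^sub>C y"
    and scaleC_add_left: "(a + b) *\<^sub>C x = a *\<^sub>C x + b *\<^sub>C x"
    and scaleC_scaleC: "a *\<^sub>C b *\<^sub>C x = (a * b) *\<^sub>C x"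
    and scaleC_of_real: "complex_of_real r *\<^sub>C x = r *\<^sub>R x"
    and mult_scaleC_left: "(a *\<^sub>C x) * y = a *\<^sub>C (x * y)"
    and mult_scaleC_right: "x * (a *\<^sub>C y) = a *\<^sub>C (x * y)"
    and norm_scaleC: "norm (a *\<^sub>C x) = cmod a * norm x"
    and adj_adj: "adj (adj x) = x"
    and adj_add: "adj (x + y) = adj x + adj y"
    and adj_mult: "adj (x * y) = adj y * adj x"
    and adj_scaleC: "adj (a *\<^sub>C x) = cnj a *\<^sub>C adj x"
    and norm_adj: "norm (adj x) = norm x"

lemma scaleC_one [simp]: "1 *\<^sub>C x = x"
  using scaleC_of_real[of 1 x] by simp

lemma scaleC_zero [simp]: "0 *\<^sub>C x = 0"
  using scaleC_of_real[of 0 x] by simp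

lemma scaleC_minus1: "(-1) *\<^sub>C x = - x"
  using scaleC_of_real[of "-1" x] by simp

lemma scaleC_zero_right [simp]: "a *\<^sub>C 0 = 0"
  using scaleC_scaleC[of a 0 0] by simp

lemma scaleC_minus_left [simp]: "(- a) *\<^sub>C x = - (a *\<^sub>C x)"
  using scaleC_scaleC[of "-1" a x] by (simp add: scaleC_minus1)

lemma scaleC_minus_right [simp]: "a *\<^sub>C (- x) = - (a *\<^sub>C x)"
  using scaleC_scaleC[of a "-1" x] by (simp add: scaleC_minus1)

lemma scaleC_diff_right: "a *\<^sub>C (x - y) = a *\<^sub>C x - a *\<^sub>C y"
  using scaleC_add_right[of a x "- y"] by simp

lemma scaleC_diff_left: "(a - b) *\<^sub>C x = a *\<^sub>C x - b *\<^sub>C x"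
  using scaleC_add_left[of a "- b" x] by simp

lemma scaleC_sum_left: "(\<Sum>i\<in>I. f i) *\<^sub>C x = (\<Sum>i\<in>I. f i *\<^sub>C x)"
  by (induction I rule: infinite_finite_induct) (auto simp: scaleC_add_left)

lemma scaleC_power: "(a *\<^sub>C x) ^ n = a ^ n *\<^sub>C x ^ n"
  by (induction n) (auto simp: mult_scaleC_left mult_scaleC_right scaleC_scaleC mult_ac)

lemma adj_0 [simp]: "adj 0 = 0"
  using adj_add[of 0 0] by simp

lemma adj_minus [simp]: "adj (- x) = - adj x"
  using adj_add[of x "- x"] by (simp add: eq_neg_iff_add_eq_0 add.commute)

lemma adj_diff: "adj (x - y) = adj x - adj y"
  using adj_add[of x "- y"] by simp

lemma adj_1 [simp]: "adj 1 = 1"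
  by (metis adj_adj adj_mult mult_1_left mult_1_right)

lemma adj_scaleR [simp]: "adj (r *\<^sub>R x) = r *\<^sub>R adj x"
  using adj_scaleC[of "complex_of_real r" x] by (simp add: scaleC_of_real)

lemma adj_power: "adj (x ^ n) = adj x ^ n"
  by (induction n) (simp_all add: adj_mult power_commutes)

lemma power_scaleR: "(r *\<^sub>R x) ^ n = r ^ n *\<^sub>R (x::'a::banach_star) ^ n"
  using scaleC_power[of "complex_of_real r" x n]
  by (simp add: scaleC_of_real flip: of_real_power)

lemma norm_power_le: "norm (x ^ Suc n) \<le> norm (x::'a::banach_star) ^ Suc n"
proof (induction n)
  case (Suc n)
  have "norm (x ^ Suc (Suc n)) \<le> norm x * norm (x ^ Suc n)"
    by (metis norm_mult_ineq power_Suc)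
  also have "\<dots> \<le> norm x * norm x ^ Suc n"
    using Suc by (intro mult_left_mono) auto
  finally show ?case by simp
qed auto

lemma tendsto_adj: "(f \<longlonglongrightarrow> a) \<Longrightarrow> (\<lambda>n. adj (f n)) \<longlonglongrightarrow> adj (a::'a::banach_star)"
  by (simp add: LIMSEQ_iff norm_adj flip: adj_diff)

section \<open>Invertible elements\<close>

definition inv_elt :: "'a::banach_star \<Rightarrow> bool" where
  "inv_elt x \<longleftrightarrow> (\<exists>y. x * y = 1 \<and> y * x = 1)"

lemma inv_eltI:
  assumes "x * y = 1" "z * x = 1"
  shows "inv_elt x"
proof -
  have "z = y"
    by (metis assms mult.assoc mult_1_left mult_1_right)
  then show ?thesis
    using assms inv_elt_def by blast
qed

lemma inv_elt_one: "inv_elt 1"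
  by (auto simp: inv_elt_def intro: exI[of _ 1])

lemma inv_elt_mult: "inv_elt a \<Longrightarrow> inv_elt b \<Longrightarrow> inv_elt (a * b)"
  unfolding inv_elt_def by (metis (no_types, opaque_lifting) mult.assoc mult_1_left)

text \<open>
  A factor of an invertible element need not be invertible; commuting with the other factor gives it an
  inverse on both sides.
\<close>

lemma inv_elt_factor:
  assumes "inv_elt (a * b)" "a * b = b * a"
  shows "inv_elt a"
proof -
  from assms(1) obtain c where c: "(a * b) * c = 1" "c * (a * b) = 1"
    by (auto simp: inv_elt_def)
  show ?thesis
    by (rule inv_eltI[of a "b * c" "c * b"]) (metis c assms(2) mult.assoc)+
qed

lemma inv_elt_scaleC:
  assumes "a \<noteq> 0" "inv_elt x"
  shows "inv_elt (a *\<^sub>C x)"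
proof -
  obtain y where "x * y = 1" "y * x = 1"
    using assms by (auto simp: inv_elt_def)
  then show ?thesis
    by (intro inv_eltI[of _ "(1 / a) *\<^sub>C y" "(1 / a) *\<^sub>C y"])
       (use assms in \<open>auto simp: mult_scaleC_left mult_scaleC_right scaleC_scaleC\<close>)
qed

lemma inv_elt_scaleC_iff: "a \<noteq> 0 \<Longrightarrow> inv_elt (a *\<^sub>C x) \<longleftrightarrow> inv_elt x"
  using inv_elt_scaleC[of a x] inv_elt_scaleC[of "1 / a" "a *\<^sub>C x"]
  by (auto simp: scaleC_scaleC)

lemma inv_elt_scaleR_iff: "r \<noteq> 0 \<Longrightarrow> inv_elt (r *\<^sub>R x) \<longleftrightarrow> inv_elt x"
  using inv_elt_scaleC_iff[of "complex_of_real r" x] by (simp add: scaleC_of_real)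

lemma inv_elt_minus: "inv_elt (- x) \<longleftrightarrow> inv_elt x"
  using inv_elt_scaleC_iff[of "-1" x] by simp

lemma inv_elt_adj: "inv_elt x \<Longrightarrow> inv_elt (adj x)"
  unfolding inv_elt_def by (metis adj_1 adj_mult)

lemma neumann:
  fixes x :: "'a::banach_star"
  assumes "norm x < 1"
  shows "inv_elt (1 - x)"
proof -
  have "summable (\<lambda>n. norm x ^ Suc n)"
    using assms by (subst summable_Suc_iff) (simp add: summable_geometric)
  then have "summable (\<lambda>n. norm (x ^ Suc n))"
    by (rule summable_comparison_test_ev[OF eventuallyI, rotated]) (simp add: norm_power_le del: power_Suc)
  then have sm: "summable (\<lambda>n. x ^ Suc n)"
    by (rule summable_norm_cancel)
  then have sm0: "summable (\<lambda>n. x ^ n)"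
    by (simp only: summable_Suc_iff)
  define y where "y = (\<Sum>n. x ^ n)"
  have sp: "(\<Sum>n. x ^ Suc n) = y - 1"
    using suminf_split_head[OF sm0] by (simp add: y_def)
  have "x * y = y - 1"
    using suminf_mult[OF sm0, of x] sp by (simp add: y_def)
  moreover have "y * x = y - 1"
    using suminf_mult2[OF sm0, of x] sp by (simp add: y_def power_commutes)
  ultimately show ?thesis
    by (intro inv_eltI[of _ y y]) (simp_all add: algebra_simps)
qed

lemma neumann_scaleR:
  fixes x :: "'a::banach_star"
  assumes "norm x < r"
  shows "inv_elt (r *\<^sub>R 1 - x)" and "inv_elt (r *\<^sub>R 1 + x)"
proof -
  have r: "r > 0"
    using assms norm_ge_zero[of x] by linarith
  have "inv_elt (1 - (1 / r) *\<^sub>R x)" "inv_elt (1 - (- 1 / r) *\<^sub>R x)"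
    using assms r by (intro neumann; simp)+
  then have "inv_elt (r *\<^sub>R (1 - (1 / r) *\<^sub>R x))" "inv_elt (r *\<^sub>R (1 - (- 1 / r) *\<^sub>R x))"
    using r by (simp_all only: inv_elt_scaleR_iff)
  then show "inv_elt (r *\<^sub>R 1 - x)" and "inv_elt (r *\<^sub>R 1 + x)"
    using r by (simp_all add: scaleR_right_diff_distrib scaleR_right_distrib)
qed

lemma norm_inverse_le:
  fixes x y :: "'a::banach_star"
  assumes "(1 - x) * y = 1" "norm x < 1"
  shows "norm y \<le> norm (1::'a) / (1 - norm x)"
proof -
  have "y = 1 + x * y"
    using assms(1) by (simp add: algebra_simps)
  then have "norm y \<le> norm (1::'a) + norm x * norm y"
    by (metis norm_triangle_mono norm_mult_ineq order_refl)
  then show ?thesis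
    using assms(2) by (simp add: field_simps)
qed

section \<open>Elements of spectral radius less than one\<close>

text \<open>
  Equivalent to the spectral radius being less than one.
\<close>

definition power_small :: "'a::banach_star \<Rightarrow> bool" where
  "power_small x \<longleftrightarrow> (\<exists>n\<ge>1. norm (x ^ n) < 1)"

lemma geo_sum:
  fixes x :: "'a::banach_star"
  shows "(1 - x) * (\<Sum>i<n. x ^ i) = 1 - x ^ n" and "(\<Sum>i<n. x ^ i) * (1 - x) = 1 - x ^ n"
proof -
  show "(1 - x) * (\<Sum>i<n. x ^ i) = 1 - x ^ n"
    by (induction n) (simp_all add: distrib_left left_diff_distrib)
  show "(\<Sum>i<n. x ^ i) * (1 - x) = 1 - x ^ n"
  proof (induction n)
    case (Suc n)
    have "(\<Sum>i<Suc n. x ^ i) * (1 - x) = (\<Sum>i<n. x ^ i) * (1 - x) + x ^ n * (1 - x)"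
      by (simp only: sum.lessThan_Suc distrib_right)
    also have "\<dots> = 1 - x ^ n + (x ^ n - x ^ n * x)"
      by (subst Suc) (simp only: right_diff_distrib mult_1_right)
    finally show ?case
      by (simp add: power_commutes)
  qed simp
qed

lemma power_small_inv_elt:
  assumes "power_small x"
  shows "inv_elt (1 - x)"
proof -
  obtain n where "norm (x ^ n) < 1"
    using assms by (auto simp: power_small_def)
  then have "inv_elt (1 - x ^ n)"
    by (rule neumann)
  then have "inv_elt ((1 - x) * (\<Sum>i<n. x ^ i))"
    by (simp add: geo_sum)
  then show ?thesis
    by (rule inv_elt_factor) (simp add: geo_sum)
qed

lemma power_small_scaleC:
  assumes "cmod z \<le> 1" "power_small x"
  shows "power_small (z *\<^sub>C x)"
proof -
  obtain n where n: "n \<ge> 1" "norm (x ^ n) < 1"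
    using assms by (auto simp: power_small_def)
  have "norm ((z *\<^sub>C x) ^ n) = cmod z ^ n * norm (x ^ n)"
    by (simp add: scaleC_power norm_scaleC norm_power)
  also have "\<dots> \<le> 1 * norm (x ^ n)"
    using assms by (intro mult_right_mono power_le_one) auto
  finally show ?thesis
    using n by (auto simp: power_small_def)
qed

lemma norm_power_le_one:
  fixes x :: "'a::banach_star"
  shows "norm (x ^ n) \<le> norm (1::'a) * norm x ^ n"
proof (induction n)
  case (Suc n)
  have "norm (x ^ Suc n) \<le> norm x * norm (x ^ n)"
    by (simp add: norm_mult_ineq)
  also have "\<dots> \<le> norm x * (norm (1::'a) * norm x ^ n)"
    using Suc by (intro mult_left_mono) auto
  finally show ?case by (simp add: mult_ac)
qed auto

lemma power_small_bounded:
  fixes x :: "'a::banach_star"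
  assumes "power_small x"
  obtains C r where "0 \<le> r" "r < 1" "C > 0" "\<And>k. norm (x ^ k) \<le> C * r ^ k"
proof -
  obtain n where n: "n \<ge> 1" "norm (x ^ n) < 1"
    using assms by (auto simp: power_small_def)
  define s where "s = (norm (x ^ n) + 1) / 2"
  have s: "0 < s" "s < 1" "norm (x ^ n) \<le> s"
    using n norm_ge_zero[of "x ^ n"] by (simp_all add: s_def add_nonneg_pos)
  define r where "r = root n s"
  have r: "0 < r" "r < 1" "r ^ n = s"
    using s n by (auto simp: r_def real_root_lt_1_iff real_root_pow_pos2)
  define M where "M = (\<Sum>j<n. norm (x ^ j))"
  have M0: "M \<ge> 0" by (simp add: M_def sum_nonneg)
  have M: "norm (x ^ j) \<le> M" if "j < n" for j
    unfolding M_def using that by (intro member_le_sum) auto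
  define K where "K = norm (1::'a)"
  have K0: "K \<ge> 0" by (simp add: K_def)
  have b: "norm (x ^ k) \<le> (K * M / s + 1) * r ^ k" for k
  proof -
    have kk: "k = n * (k div n) + k mod n" by simp
    have "x ^ k = (x ^ n) ^ (k div n) * x ^ (k mod n)"
      by (metis kk power_add power_mult)
    then have "norm (x ^ k) \<le> norm ((x ^ n) ^ (k div n)) * norm (x ^ (k mod n))"
      by (simp add: norm_mult_ineq)
    also have "\<dots> \<le> (K * norm (x ^ n) ^ (k div n)) * M"
      using n M by (intro mult_mono) (auto simp: K_def norm_power_le_one)
    also have "\<dots> \<le> (K * s ^ (k div n)) * M"
      using s K0 M0 by (intro mult_right_mono mult_left_mono power_mono) auto
    also have "s ^ (k div n) = r ^ (n * (k div n))"
      using r by (simp add: power_mult)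
    also have "\<dots> \<le> r ^ k / s"
    proof -
      have "r ^ n \<le> r ^ (k mod n)"
        using r n by (intro power_decreasing) (auto intro: less_imp_le)
      then have "s * r ^ (n * (k div n)) \<le> r ^ (k mod n) * r ^ (n * (k div n))"
        using r by (intro mult_right_mono) auto
      also have "\<dots> = r ^ k"
        by (metis kk power_add mult.commute)
      finally show ?thesis using s by (simp add: field_simps)
    qed
    finally have "norm (x ^ k) \<le> K * (r ^ k / s) * M"
      using K0 M0 by (simp add: mult_left_mono mult_right_mono)
    also have "\<dots> = (K * M / s) * r ^ k" by simp
    also have "\<dots> \<le> (K * M / s + 1) * r ^ k"
      using r by (intro mult_right_mono) auto
    finally show ?thesis .
  qed
  show ?thesis
  proof (rule that[OF _ r(2) _ b])
    show "0 \<le> r" using r by simp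
    show "0 < K * M / s + 1" using K0 M0 s by (intro add_nonneg_pos) auto
  qed
qed

lemma power_small_tendsto:
  assumes "power_small x"
  shows "(\<lambda>n. norm (x ^ n)) \<longlonglongrightarrow> 0"
proof -
  obtain C r where r: "0 \<le> r" "r < 1" "\<And>k. norm (x ^ k) \<le> C * r ^ k"
    using assms by (metis power_small_bounded)
  have lim: "(\<lambda>k. C * r ^ k) \<longlonglongrightarrow> 0"
    using r by (intro tendsto_mult_right_zero LIMSEQ_power_zero) auto
  show ?thesis
    by (rule tendsto_sandwich[OF _ _ tendsto_const lim]) (use r in auto)
qed

text \<open>
  Because \<open>(b a)\<^sup>m\<^sup>+\<^sup>1 = b (a b)\<^sup>m a\<close>.
\<close>

lemma power_small_swap:
  fixes a b :: "'a::banach_star"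
  assumes "power_small (a * b)"
  shows "power_small (b * a)"
proof -
  have eq: "(b * a) ^ Suc m = b * (a * b) ^ m * a" for m
    by (induction m) (simp_all add: mult.assoc power_commutes)
  have le: "norm ((b * a) ^ Suc m) \<le> norm b * norm a * norm ((a * b) ^ m)" for m
  proof -
    have "norm ((b * a) ^ Suc m) \<le> norm (b * (a * b) ^ m) * norm a"
      unfolding eq by (rule norm_mult_ineq)
    also have "\<dots> \<le> (norm b * norm ((a * b) ^ m)) * norm a"
      by (intro mult_right_mono norm_mult_ineq) auto
    finally show ?thesis by (simp add: mult_ac)
  qed
  have "(\<lambda>m. norm b * norm a * norm ((a * b) ^ m)) \<longlonglongrightarrow> 0"
    using power_small_tendsto[OF assms] by (rule tendsto_mult_right_zero)
  then have "eventually (\<lambda>m. norm b * norm a * norm ((a * b) ^ m) < 1) sequentially"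
    by (rule order_tendstoD) simp
  then obtain m where "norm b * norm a * norm ((a * b) ^ m) < 1"
    by (auto simp: eventually_sequentially)
  then have "norm ((b * a) ^ Suc m) < 1"
    using le[of m] by linarith
  then show ?thesis
    unfolding power_small_def by (metis One_nat_def Suc_le_mono le0)
qed

lemma sum_roots_of_unity_powers:
  fixes n i :: nat
  assumes "i < n"
  defines "w j \<equiv> exp (2 * of_real pi * \<i> * of_nat j / of_nat n)"
  shows "(\<Sum>j<n. w j ^ i) = (if i = 0 then of_nat n else 0)"
proof (cases "i = 0")
  case False
  have n: "n \<noteq> 0" using assms by auto
  have w: "w j ^ i = w i ^ j" for j
    unfolding w_def by (simp add: mult_ac flip: exp_of_nat_mult)
  have "w i \<noteq> 1"
    using complex_root_unity_eq_1[of n i] assms False n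
    by (auto simp: w_def dest: dvd_imp_le)
  moreover have "w i ^ n = 1"
    unfolding w_def by (rule complex_root_unity[OF n])
  ultimately have "(\<Sum>j<n. w i ^ j) = 0"
    by (simp add: geometric_sum)
  then show ?thesis using False by (simp add: w)
qed (simp add: w_def)

text \<open>
  By the resolvent identity, \<open>\<parallel>R z\<parallel>\<close> is at most twice \<open>\<parallel>R l\<parallel>\<close> for \<open>z\<close> near \<open>l\<close>, so compactness of the disc
  bounds the resolvent, and the identity then makes it Lipschitz.
\<close>

lemma inverse_bounded_on_disc:
  fixes x :: "'a::banach_star"
  assumes R: "\<And>z. cmod z \<le> 1 \<Longrightarrow> (1 - z *\<^sub>C x) * R z = 1 \<and> R z * (1 - z *\<^sub>C x) = 1"
  obtains M where "M > 0" "\<And>z. cmod z \<le> 1 \<Longrightarrow> norm (R z) \<le> M"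
    "\<And>z z'. cmod z \<le> 1 \<Longrightarrow> cmod z' \<le> 1 \<Longrightarrow> norm (R z - R z') \<le> cmod (z - z') * (M * norm x * M)"
proof -
  have res: "R z - R w = (z - w) *\<^sub>C (R z * x * R w)" if "cmod z \<le> 1" "cmod w \<le> 1" for z w
  proof -
    have "R z - R w = R z * ((1 - w *\<^sub>C x) * R w) - (R z * (1 - z *\<^sub>C x)) * R w"
      using R that by simp
    also have "\<dots> = (z - w) *\<^sub>C (R z * x * R w)"
      by (simp add: algebra_simps mult_scaleC_left mult_scaleC_right scaleC_diff_left)
    finally show ?thesis .
  qed
  have le: "norm (R z - R w) \<le> cmod (z - w) * (norm (R z) * norm x * norm (R w))"
    if "cmod z \<le> 1" "cmod w \<le> 1" for z w
  proof -
    have "norm (R z * x * R w) \<le> norm (R z) * norm x * norm (R w)"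
      by (meson mult_right_mono norm_ge_zero norm_mult_ineq order_trans)
    then show ?thesis
      unfolding res[OF that] norm_scaleC by (intro mult_left_mono) auto
  qed
  have "\<exists>M. \<forall>z. cmod z \<le> 1 \<longrightarrow> norm (R z) \<le> M"
  proof (rule ccontr)
    assume "\<not> ?thesis"
    then have "\<forall>n::nat. \<exists>z. cmod z \<le> 1 \<and> norm (R z) > real n"
      by (meson not_le)
    then obtain Z where Z: "\<And>n. cmod (Z n) \<le> 1" "\<And>n. norm (R (Z n)) > real n"
      by metis
    have "seq_compact (cball (0::complex) 1)"
      by (simp add: compact_imp_seq_compact)
    then obtain l r where l: "l \<in> cball 0 1" "strict_mono (r::nat\<Rightarrow>nat)" "(Z \<circ> r) \<longlonglongrightarrow> l"
      by (rule seq_compactE[where f = Z]) (use Z in auto)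
    define D where "D = norm x * norm (R l) + 1"
    have D: "D > 0" by (simp add: D_def add_nonneg_pos)
    have "(\<lambda>n. cmod (Z (r n) - l) * D) \<longlonglongrightarrow> 0"
      using l(3) by (intro tendsto_mult_left_zero tendsto_norm_zero) (simp add: LIM_zero o_def)
    then have "eventually (\<lambda>n. cmod (Z (r n) - l) * D < 1 / 2) sequentially"
      by (rule order_tendstoD) simp
    moreover have "eventually (\<lambda>n. real n > 2 * norm (R l)) sequentially"
      using filterlim_real_sequentially filterlim_at_top_dense by blast
    ultimately have "eventually (\<lambda>n. cmod (Z (r n) - l) * D < 1 / 2 \<and> real n > 2 * norm (R l)) sequentially"
      by (rule eventually_conj)
    then obtain n where n: "cmod (Z (r n) - l) * D < 1 / 2" "real n > 2 * norm (R l)"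
      by (auto simp: eventually_sequentially)
    define z where "z = Z (r n)"
    have zl: "cmod z \<le> 1" "cmod l \<le> 1"
      using l Z by (auto simp: z_def)
    have "norm (R z) \<le> norm (R l) + norm (R z - R l)"
      using norm_triangle_sub by blast
    also have "norm (R z - R l) \<le> cmod (z - l) * (norm (R z) * norm x * norm (R l))"
      by (rule le[OF zl])
    also have "\<dots> \<le> (cmod (z - l) * D) * norm (R z)"
      by (simp add: D_def algebra_simps)
    also have "\<dots> \<le> 1 / 2 * norm (R z)"
      using n by (intro mult_right_mono) (auto simp: z_def)
    finally have "norm (R z) \<le> 2 * norm (R l)" by simp
    moreover have "norm (R z) > real n"
      using Z(2)[of "r n"] seq_suble[OF l(2), of n] by (simp add: z_def)
    ultimately show False using n by simp
  qed
  then obtain M0 where M0: "\<And>z. cmod z \<le> 1 \<Longrightarrow> norm (R z) \<le> M0" by auto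
  define M where "M = \<bar>M0\<bar> + 1"
  have M: "M > 0" "\<And>z. cmod z \<le> 1 \<Longrightarrow> norm (R z) \<le> M"
    using M0 by (force simp: M_def)+
  show ?thesis
  proof (rule that[OF M])
    fix z z' assume z: "cmod z \<le> 1" "cmod z' \<le> 1"
    have "norm (R z - R z') \<le> cmod (z - z') * (norm (R z) * norm x * norm (R z'))"
      by (rule le[OF z])
    also have "\<dots> \<le> cmod (z - z') * (M * norm x * M)"
      using M z by (intro mult_left_mono mult_mono) auto
    finally show "norm (R z - R z') \<le> cmod (z - z') * (M * norm x * M)" .
  qed
qed

text \<open>
  Averaging the resolvent over the \<open>n\<close>-th roots of unity leaves, of each geometric sum
  \<open>\<Sum>i<n. (w t x)\<^sup>i\<close>, only the constant term. So the inverse of \<open>1 - (t x)\<^sup>n\<close> is bounded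
  independently of \<open>n\<close>.
\<close>

lemma inverse_of_one_minus_power:
  fixes x :: "'a::banach_star"
  assumes R: "\<And>z. cmod z \<le> 1 \<Longrightarrow> (1 - z *\<^sub>C x) * R z = 1"
    and n: "n \<ge> 1" and t: "0 \<le> t" "t \<le> 1"
  defines "w j \<equiv> exp (2 * of_real pi * \<i> * of_nat j / of_nat n)"
  shows "(1 - (t *\<^sub>R x) ^ n) * ((1 / real n) *\<^sub>R (\<Sum>j<n. R (w j * of_real t))) = 1"
proof -
  have cw: "cmod (w j) = 1" for j
    by (simp add: w_def norm_exp_eq_Re)
  have wn: "w j ^ n = 1" for j
    unfolding w_def using n by (intro complex_root_unity) auto
  have 1: "(1 - (t *\<^sub>R x) ^ n) * R (w j * of_real t) = (\<Sum>i<n. (w j ^ i) *\<^sub>C (t *\<^sub>R x) ^ i)" for j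
  proof -
    define u where "u = (w j * of_real t) *\<^sub>C x"
    have u: "u ^ i = (w j ^ i) *\<^sub>C (t *\<^sub>R x) ^ i" for i
      by (simp add: u_def scaleC_power power_scaleR scaleC_scaleC power_mult_distrib flip: scaleC_of_real)
    have "(1 - u) * R (w j * of_real t) = 1"
      unfolding u_def using R cw t by (simp add: norm_mult)
    moreover have "1 - (t *\<^sub>R x) ^ n = (\<Sum>i<n. u ^ i) * (1 - u)"
      using u[of n] wn by (simp add: geo_sum)
    ultimately have "(1 - (t *\<^sub>R x) ^ n) * R (w j * of_real t) = (\<Sum>i<n. u ^ i)"
      by (simp add: mult.assoc)
    then show ?thesis by (simp add: u)
  qed
  have "(1 - (t *\<^sub>R x) ^ n) * (\<Sum>j<n. R (w j * of_real t)) = (\<Sum>j<n. \<Sum>i<n. (w j ^ i) *\<^sub>C (t *\<^sub>R x) ^ i)"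
    by (simp add: sum_distrib_left 1)
  also have "\<dots> = (\<Sum>i<n. (\<Sum>j<n. w j ^ i) *\<^sub>C (t *\<^sub>R x) ^ i)"
    by (subst sum.swap) (simp add: scaleC_sum_left)
  also have "\<dots> = (\<Sum>i<n. (if i = 0 then of_nat n else 0) *\<^sub>C (t *\<^sub>R x) ^ i)"
    using sum_roots_of_unity_powers[of _ n] by (intro sum.cong) (auto simp: w_def)
  also have "\<dots> = (\<Sum>i\<in>{0}. of_nat n *\<^sub>C (t *\<^sub>R x) ^ i)"
    using n by (intro sum.mono_neutral_cong_right) auto
  also have "\<dots> = real n *\<^sub>R 1"
    using scaleC_of_real[of "real n" "1::'a"] by simp
  finally show ?thesis
    using n by simp
qed

text \<open>
  This replaces the spectral radius formula, following Rickart: if the resolvent exists on the closed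
  unit disc then \<open>(t x)\<^sup>n\<close> tends to zero for all \<open>t\<close> in the unit interval. For \<open>t = 0\<close> this is clear,
  and it propagates from \<open>s\<close> to every \<open>t\<close> in \<open>[s, s + \<delta>]\<close> for a fixed \<open>\<delta>\<close>: the averaged resolvents \<open>F\<close>
  are equi-Lipschitz in \<open>t\<close>, \<open>F s\<close> is close to 1 for large \<open>n\<close>, hence so is \<open>F t\<close>, and this makes
  \<open>(t x)\<^sup>n\<close> small.
\<close>

lemma spectral_radius:
  fixes x :: "'a::banach_star"
  assumes "\<And>z. cmod z \<le> 1 \<Longrightarrow> inv_elt (1 - z *\<^sub>C x)"
  shows "power_small x"
proof -
  obtain R where R: "\<And>z. cmod z \<le> 1 \<Longrightarrow> (1 - z *\<^sub>C x) * R z = 1 \<and> R z * (1 - z *\<^sub>C x) = 1"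
    using assms unfolding inv_elt_def by metis
  obtain M where M: "M > 0" "\<And>z. cmod z \<le> 1 \<Longrightarrow> norm (R z) \<le> M"
    "\<And>z z'. cmod z \<le> 1 \<Longrightarrow> cmod z' \<le> 1 \<Longrightarrow> norm (R z - R z') \<le> cmod (z - z') * (M * norm x * M)"
    by (rule inverse_bounded_on_disc[OF R]) blast+
  define K where "K = norm (1::'a) + 1"
  have K: "K \<ge> 1" by (simp add: K_def)
  define L where "L = M * norm x * M + 1"
  have L: "L > 0" using M by (simp add: L_def add_nonneg_pos)
  (* The step length is the same at every stage, so finitely many steps lead from 0 to 1. *)
  define \<delta> where "\<delta> = 1 / (3 * K * L)"
  have \<delta>: "\<delta> > 0" using K L by (simp add: \<delta>_def)
  have step: "power_small (t *\<^sub>R x)" if s: "0 \<le> s" "s \<le> t" "t \<le> 1" "t - s \<le> \<delta>" "power_small (s *\<^sub>R x)" for s t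
  proof -
    have "(\<lambda>n. M * norm ((s *\<^sub>R x) ^ n)) \<longlonglongrightarrow> 0"
      using power_small_tendsto[OF s(5)] by (rule tendsto_mult_right_zero)
    then have "eventually (\<lambda>n. M * norm ((s *\<^sub>R x) ^ n) < 1 / (3 * K)) sequentially"
      by (rule order_tendstoD) (use K in simp)
    then obtain N where N: "\<And>n. n \<ge> N \<Longrightarrow> M * norm ((s *\<^sub>R x) ^ n) < 1 / (3 * K)"
      by (auto simp: eventually_sequentially)
    define n where "n = Suc N"
    have n: "n \<ge> 1" "M * norm ((s *\<^sub>R x) ^ n) < 1 / (3 * K)"
      using N[of n] by (auto simp only: n_def)
    define w where "w j = exp (2 * of_real pi * \<i> * of_nat j / of_nat n)" for j
    have cw: "cmod (w j) = 1" for j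
      by (simp add: w_def norm_exp_eq_Re)
    define F where "F t = (1 / real n) *\<^sub>R (\<Sum>j<n. R (w j * of_real t))" for t
    have F: "(1 - (r *\<^sub>R x) ^ n) * F r = 1" if "0 \<le> r" "r \<le> 1" for r
      unfolding F_def w_def by (rule inverse_of_one_minus_power) (use R n that in auto)
    have nF: "norm (F s) \<le> M"
    proof -
      have "norm (\<Sum>j<n. R (w j * of_real s)) \<le> (\<Sum>j<n. M)"
        using M s cw by (intro sum_norm_le) (simp add: norm_mult)
      then show ?thesis using n by (simp add: F_def field_simps)
    qed
    have "norm (F t - F s) \<le> 1 / (3 * K)"
    proof -
      have "norm (\<Sum>j<n. R (w j * of_real t) - R (w j * of_real s)) \<le> (\<Sum>j<n. \<delta> * L)"
      proof (intro sum_norm_le)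
        fix j
        have "norm (R (w j * of_real t) - R (w j * of_real s)) \<le> cmod (w j * of_real t - w j * of_real s) * (M * norm x * M)"
          using s cw by (intro M(3)) (auto simp: norm_mult)
        also have "cmod (w j * of_real t - w j * of_real s) = t - s"
          using s by (simp add: cw norm_mult flip: right_diff_distrib of_real_diff)
        also have "(t - s) * (M * norm x * M) \<le> \<delta> * L"
          using s M L by (intro mult_mono) (auto simp: L_def)
        finally show "norm (R (w j * of_real t) - R (w j * of_real s)) \<le> \<delta> * L" .
      qed
      also have "\<delta> * L = 1 / (3 * K)"
        using L by (simp add: \<delta>_def)
      finally have "norm (\<Sum>j<n. R (w j * of_real t) - R (w j * of_real s)) \<le> real n * (1 / (3 * K))" by simp
      moreover have "F t - F s = (1 / real n) *\<^sub>R (\<Sum>j<n. R (w j * of_real t) - R (w j * of_real s))"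
        by (simp add: F_def sum_subtractf scaleR_diff_right)
      ultimately show ?thesis using n by (simp add: field_simps)
    qed
    moreover have "norm (F s - 1) \<le> 1 / (3 * K)"
    proof -
      have "F s - 1 = (s *\<^sub>R x) ^ n * F s"
        using F[of s] s by (simp add: algebra_simps)
      then have "norm (F s - 1) \<le> norm ((s *\<^sub>R x) ^ n) * M"
        using nF by (metis mult_left_mono norm_ge_zero norm_mult_ineq order_trans)
      then show ?thesis using n by (simp add: mult_ac)
    qed
    ultimately have Ft: "norm (F t - 1) \<le> 2 / (3 * K)"
      using norm_triangle_ineq[of "F t - F s" "F s - 1"] by simp
    define y where "y = (t *\<^sub>R x) ^ n"
    have "y = (1 - y) * (F t - 1)"
      using F[of t] s by (simp add: right_diff_distrib y_def)
    then have "norm y \<le> norm (1 - y) * norm (F t - 1)"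
      by (metis norm_mult_ineq)
    also have "\<dots> \<le> (norm (1::'a) + norm y) * (2 / (3 * K))"
      using Ft K by (intro mult_mono norm_triangle_ineq4) auto
    finally have "3 * K * norm y \<le> 2 * (norm (1::'a) + norm y)"
      using K by (simp add: field_simps)
    then have "3 * K * norm y \<le> 2 * (K - 1 + norm y)" by (simp add: K_def)
    then have "norm y * (3 * K - 2) \<le> 2 * (K - 1)" by (simp add: algebra_simps)
    also have "\<dots> < 3 * K - 2" using K by simp
    finally have "norm y < 1"
      using K by (simp add: mult_less_cancel_right2)
    then show ?thesis
      using n by (auto simp: power_small_def y_def)
  qed
  have "power_small (min 1 (real k * \<delta>) *\<^sub>R x)" for k
  proof (induction k)
    case 0
    show ?case unfolding power_small_def by (rule exI[of _ 1]) simp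
  next
    case (Suc k)
    show ?case
      by (rule step[OF _ _ _ _ Suc]) (use \<delta> in \<open>auto simp: min_def algebra_simps\<close>)
  qed
  moreover obtain k :: nat where "real k * \<delta> \<ge> 1"
    using \<delta> by (metis less_eq_real_def reals_Archimedean3)
  ultimately show ?thesis
    by (metis min.absorb1 scaleR_one)
qed

section \<open>Square roots\<close>

text \<open>
  The element is a combination of positive powers of \<open>x\<close> with nonnegative coefficients; the real number
  is the sum of these coefficients.
\<close>

inductive pos_comb :: "'a::banach_star \<Rightarrow> 'a \<Rightarrow> real \<Rightarrow> bool" for x where
  pos_comb_zero: "pos_comb x 0 0"
| pos_comb_power: "k \<ge> 1 \<Longrightarrow> s \<ge> 0 \<Longrightarrow> pos_comb x (s *\<^sub>R x ^ k) s"
| pos_comb_add: "pos_comb x a r \<Longrightarrow> pos_comb x b s \<Longrightarrow> pos_comb x (a + b) (r + s)"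

lemma pos_comb_scale: "pos_comb x a r \<Longrightarrow> s \<ge> 0 \<Longrightarrow> pos_comb x (s *\<^sub>R a) (s * r)"
proof (induction rule: pos_comb.induct)
  case (pos_comb_power k t)
  then show ?case using pos_comb.pos_comb_power[of k "s * t" x] by simp
qed (auto simp: scaleR_right_distrib distrib_left intro: pos_comb.intros)

lemma pos_comb_mult:
  assumes "pos_comb x a r" "pos_comb x b s"
  shows "pos_comb x (a * b) (r * s)"
  using assms
proof (induction rule: pos_comb.induct)
  case (pos_comb_power k t)
  show ?case using pos_comb_power(3)
  proof (induction rule: pos_comb.induct)
    case (pos_comb_power l u)
    then show ?case
      using pos_comb.pos_comb_power[of "k + l" "t * u" x] \<open>k \<ge> 1\<close> \<open>t \<ge> 0\<close> by (simp add: power_add mult_ac)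
  qed (auto simp: distrib_left intro: pos_comb.intros)
qed (auto simp: distrib_right intro: pos_comb.intros)

lemma pos_comb_norm:
  assumes "pos_comb x a r" "\<And>k. k \<ge> 1 \<Longrightarrow> norm (x ^ k) \<le> C"
  shows "norm a \<le> C * r \<and> r \<ge> 0"
  using assms(1)
proof (induction rule: pos_comb.induct)
  case (pos_comb_power k s)
  then show ?case using assms(2)[of k] by (metis abs_of_nonneg mult.commute mult_left_mono norm_scaleR)
next
  case (pos_comb_add a r b s)
  then show ?case using norm_triangle_ineq[of a b] by (auto simp: distrib_left)
qed auto

text \<open>
  The iteration solves \<open>2 y = x + y\<^sup>2\<close>, that is, \<open>(1 - y)\<^sup>2 = 1 - x\<close>. Its \<open>n\<close>-th term is a polynomial in
  \<open>x\<close> with nonnegative coefficients, whose sum \<open>sqrt_mass n\<close> is the value of the iteration at \<open>x = 1\<close>.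
\<close>

primrec sqrt_iter :: "'a::banach_star \<Rightarrow> nat \<Rightarrow> 'a" where
  "sqrt_iter x 0 = 0"
| "sqrt_iter x (Suc n) = (1 / 2) *\<^sub>R (x + sqrt_iter x n * sqrt_iter x n)"

primrec sqrt_mass :: "nat \<Rightarrow> real" where
  "sqrt_mass 0 = 0"
| "sqrt_mass (Suc n) = (1 / 2) * (1 + sqrt_mass n * sqrt_mass n)"

lemma pos_comb_sqrt_iter: "pos_comb x (sqrt_iter x n) (sqrt_mass n)"
proof (induction n)
  case (Suc n)
  have "pos_comb x (1 *\<^sub>R x ^ 1) 1" by (rule pos_comb_power) auto
  then have "pos_comb x (x + sqrt_iter x n * sqrt_iter x n) (1 + sqrt_mass n * sqrt_mass n)"
    using Suc by (auto intro: pos_comb_mult pos_comb_add)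
  then show ?case
    using pos_comb_scale[of x _ _ "1 / 2"] by (simp del: scaleR_add_right scaleR_right_distrib)
qed (auto intro: pos_comb_zero)

text \<open>
  The increments have nonnegative coefficients too, by
  \<open>2 (y\<^sub>n\<^sub>+\<^sub>2 - y\<^sub>n\<^sub>+\<^sub>1) = (y\<^sub>n\<^sub>+\<^sub>1 - y\<^sub>n) y\<^sub>n\<^sub>+\<^sub>1 + y\<^sub>n (y\<^sub>n\<^sub>+\<^sub>1 - y\<^sub>n)\<close>. Hence the numerical sequence of
  masses controls the convergence of the iteration.
\<close>

lemma pos_comb_sqrt_iter_step:
  "pos_comb x (sqrt_iter x (Suc n) - sqrt_iter x n) (sqrt_mass (Suc n) - sqrt_mass n)"
proof (induction n)
  case 0
  show ?case using pos_comb_power[of 1 "1/2" x] by simp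
next
  case (Suc n)
  define d where "d = sqrt_iter x (Suc n) - sqrt_iter x n"
  define m where "m = sqrt_mass (Suc n) - sqrt_mass n"
  have "pos_comb x ((1 / 2) *\<^sub>R (d * sqrt_iter x (Suc n) + sqrt_iter x n * d))
          ((1 / 2) * (m * sqrt_mass (Suc n) + sqrt_mass n * m))"
    using Suc unfolding d_def m_def
    by (intro pos_comb_scale pos_comb_add pos_comb_mult pos_comb_sqrt_iter) auto
  also have "(1 / 2) *\<^sub>R (d * sqrt_iter x (Suc n) + sqrt_iter x n * d)
    = sqrt_iter x (Suc (Suc n)) - sqrt_iter x (Suc n)"
  proof -
    have "d * sqrt_iter x (Suc n) + sqrt_iter x n * d
      = sqrt_iter x (Suc n) * sqrt_iter x (Suc n) - sqrt_iter x n * sqrt_iter x n"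
      unfolding d_def left_diff_distrib right_diff_distrib by simp
    then have "(1 / 2) *\<^sub>R (d * sqrt_iter x (Suc n) + sqrt_iter x n * d) =
        (1 / 2) *\<^sub>R ((x + sqrt_iter x (Suc n) * sqrt_iter x (Suc n)) - (x + sqrt_iter x n * sqrt_iter x n))"
      by (simp only: add_diff_cancel_left)
    also have "\<dots> = (1 / 2) *\<^sub>R (x + sqrt_iter x (Suc n) * sqrt_iter x (Suc n))
        - (1 / 2) *\<^sub>R (x + sqrt_iter x n * sqrt_iter x n)"
      by (rule scaleR_right_diff_distrib)
    finally show ?thesis
      by (simp only: sqrt_iter.simps(2))
  qed
  also have "(1 / 2) * (m * sqrt_mass (Suc n) + sqrt_mass n * m) = sqrt_mass (Suc (Suc n)) - sqrt_mass (Suc n)"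
    by (subst (3) sqrt_mass.simps) (simp add: m_def algebra_simps power2_eq_square)
  finally show ?case .
qed

lemma pos_comb_sqrt_iter_diff:
  "n \<le> m \<Longrightarrow> pos_comb x (sqrt_iter x m - sqrt_iter x n) (sqrt_mass m - sqrt_mass n)"
proof (induction m rule: dec_induct)
  case (step m)
  from pos_comb_add[OF step.IH pos_comb_sqrt_iter_step[of x m]] show ?case
    by (simp del: sqrt_iter.simps sqrt_mass.simps)
qed (simp add: pos_comb_zero)

lemma sqrt_mass_le_1: "0 \<le> sqrt_mass n \<and> sqrt_mass n \<le> 1"
proof (induction n)
  case (Suc n)
  then have "sqrt_mass n * sqrt_mass n \<le> 1 * 1" by (intro mult_mono) auto
  then show ?case by simp
qed auto

text \<open>
  The binomial series of \<open>1 - (1 - x)\<^sup>1\<^sup>/\<^sup>2\<close> has nonnegative coefficients with sum 1, so bounded powers of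
  \<open>x\<close> suffice for convergence, even at the edge of the spectral disc. The commutation clause and the
  self-adjointness clause hold for the limit because they hold for each iterate.
\<close>

lemma square_root_exists:
  fixes x :: "'a::banach_star"
  assumes C: "\<And>k. k \<ge> 1 \<Longrightarrow> norm (x ^ k) \<le> C"
  obtains y where "(1 - y) * (1 - y) = 1 - x" "norm y \<le> C"
    "\<And>z. z * x = x * z \<Longrightarrow> z * y = y * z" "adj x = x \<Longrightarrow> adj y = y"
proof -
  have C0: "C \<ge> 0" using C[of 1] order_trans[OF norm_ge_zero, of x C] by simp
  have diff: "norm (sqrt_iter x m - sqrt_iter x n) \<le> C * (sqrt_mass m - sqrt_mass n) \<and> sqrt_mass n \<le> sqrt_mass m"
    if "n \<le> m" for m n
    using pos_comb_norm[OF pos_comb_sqrt_iter_diff[OF that] C] by simp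
  have "incseq sqrt_mass"
    using diff by (auto simp: incseq_def)
  then obtain l where "sqrt_mass \<longlonglongrightarrow> l"
    by (rule incseq_convergent[of _ 1]) (use sqrt_mass_le_1 in blast)
  then have "convergent sqrt_mass"
    by (rule convergentI)
  then have cm: "Cauchy sqrt_mass" by (rule convergent_Cauchy)
  have "Cauchy (sqrt_iter x)"
  proof (rule CauchyI)
    fix e :: real assume e: "e > 0"
    have "e / (C + 1) > 0" using e C0 by simp
    then obtain M where M: "\<And>m n. m \<ge> M \<Longrightarrow> n \<ge> M \<Longrightarrow> norm (sqrt_mass m - sqrt_mass n) < e / (C + 1)"
      using CauchyD[OF cm] by metis
    have *: "norm (sqrt_iter x m - sqrt_iter x n) < e" if "n \<ge> M" "n \<le> m" for m n
    proof -
      have "norm (sqrt_iter x m - sqrt_iter x n) \<le> C * (sqrt_mass m - sqrt_mass n)"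
        using diff[OF that(2)] by simp
      also have "\<dots> \<le> (C + 1) * norm (sqrt_mass m - sqrt_mass n)"
        using diff[OF that(2)] C0 by (intro mult_mono) auto
      also have "\<dots> < e"
        using M[of m n] that C0 by (simp add: field_simps)
      finally show ?thesis .
    qed
    show "\<exists>M. \<forall>m\<ge>M. \<forall>n\<ge>M. norm (sqrt_iter x m - sqrt_iter x n) < e"
    proof (intro exI[of _ M] allI impI)
      fix m n assume "m \<ge> M" "n \<ge> M"
      then show "norm (sqrt_iter x m - sqrt_iter x n) < e"
        using *[of n m] *[of m n] by (cases "n \<le> m") (auto simp: norm_minus_commute)
    qed
  qed
  then obtain y where y: "sqrt_iter x \<longlonglongrightarrow> y"
    using Cauchy_convergent convergentD by blast
  have "(\<lambda>n. sqrt_iter x (Suc n)) \<longlonglongrightarrow> (1 / 2) *\<^sub>R (x + y * y)"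
    unfolding sqrt_iter.simps by (intro tendsto_intros y)
  then have fp: "y = (1 / 2) *\<^sub>R (x + y * y)"
    by (rule LIMSEQ_unique[OF LIMSEQ_Suc[OF y]])
  show ?thesis
  proof (rule that)
    have "y + y = 2 *\<^sub>R y" by (simp add: scaleR_2)
    also have "\<dots> = 2 *\<^sub>R (1 / 2) *\<^sub>R (x + y * y)"
      using fp by simp
    finally have "y + y = x + y * y" by simp
    then show "(1 - y) * (1 - y) = 1 - x"
      by (simp add: algebra_simps)
    show "norm y \<le> C"
    proof (rule LIMSEQ_le_const2[OF tendsto_norm[OF y]], intro exI allI impI)
      fix n
      have "norm (sqrt_iter x n) \<le> C * sqrt_mass n"
        using pos_comb_norm[OF pos_comb_sqrt_iter C] by blast
      also have "\<dots> \<le> C" using sqrt_mass_le_1[of n] C0 by (simp add: mult_left_le)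
      finally show "norm (sqrt_iter x n) \<le> C" .
    qed
    show "z * y = y * z" if z: "z * x = x * z" for z
    proof -
      have "z * sqrt_iter x n = sqrt_iter x n * z" for n
      proof (induction n)
        case (Suc n)
        have "z * (sqrt_iter x n * sqrt_iter x n) = sqrt_iter x n * sqrt_iter x n * z"
          by (metis Suc mult.assoc)
        then show ?case by (simp add: z distrib_left distrib_right)
      qed simp
      then have "(\<lambda>n. z * sqrt_iter x n) \<longlonglongrightarrow> y * z"
        using tendsto_mult[OF y tendsto_const[of z]] by simp
      moreover have "(\<lambda>n. z * sqrt_iter x n) \<longlonglongrightarrow> z * y"
        by (rule tendsto_mult[OF tendsto_const y])
      ultimately show ?thesis
        using LIMSEQ_unique by blast
    qed
    show "adj y = y" if "adj x = x"
    proof -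
      have "adj (sqrt_iter x n) = sqrt_iter x n" for n
        by (induction n) (simp_all add: that adj_add adj_mult)
      then show ?thesis
        using tendsto_adj[OF y] LIMSEQ_unique[OF y, of "adj y"] by simp
    qed
  qed
qed

section \<open>Automatic contractivity\<close>

lemma half_sum: "(1 / 2) *\<^sub>R (a + a) = (a::'a::real_vector)"
  by (metis scaleR_half_double)

text \<open>
  Contractivity is automatic. A self-adjoint contraction is the mean of
  a unitary and its adjoint, and \<open>q\<close> is at most 1 on unitaries by the C*-identity; the identity then
  extends the bound from self-adjoint elements to all elements.
\<close>

lemma cstar_seminorm_le_norm:
  fixes q :: "'a::banach_star \<Rightarrow> real"
  assumes add: "\<And>x y. q (x + y) \<le> q x + q y"
    and scale: "\<And>z x. q (z *\<^sub>C x) = cmod z * q x"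
    and cs: "\<And>x. q (adj x * x) = (q x)\<^sup>2"
    and nonneg: "\<And>x. 0 \<le> q x"
  shows "q x \<le> norm x"
proof -
  have scaleR: "q (r *\<^sub>R x) = \<bar>r\<bar> * q x" for r x
    using scale[of "complex_of_real r" x] by (simp add: scaleC_of_real)
  have "q 1 * q 1 = q 1 * 1"
    using cs[of 1] by (simp only: adj_1 mult_1_left mult_1_right power2_eq_square)
  then have q1: "q 1 \<le> 1" by (simp only: mult_cancel_left) auto
  have unit_ball: "q h \<le> 1" if h: "adj h = h" "norm h < 1" for h
  proof -
    have "norm ((h * h) ^ k) \<le> 1" if "k \<ge> 1" for k
    proof -
      have "norm (h ^ Suc (2 * k - 1)) \<le> norm h ^ Suc (2 * k - 1)" by (rule norm_power_le)
      also have "\<dots> \<le> 1" using h by (intro power_le_one) auto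
      also have "h ^ Suc (2 * k - 1) = (h * h) ^ k"
        using that by (simp add: power_mult power2_eq_square)
      finally show ?thesis .
    qed
    then obtain y where y: "(1 - y) * (1 - y) = 1 - h * h" "\<And>z. z * (h * h) = h * h * z \<Longrightarrow> z * y = y * z"
      "adj (h * h) = h * h \<Longrightarrow> adj y = y"
      by (rule square_root_exists) blast+
    define w where "w = 1 - y"
    have w: "w * w = 1 - h * h" "adj w = w" "h * w = w * h"
      using y(1) y(3) y(2)[of h] h by (simp_all add: w_def adj_diff adj_mult algebra_simps)
    (* The unitary with real part h. *)
    define u where "u = h + \<i> *\<^sub>C w"
    have adju: "adj u = h - \<i> *\<^sub>C w"
      by (simp add: u_def adj_add adj_scaleC h w)
    have "adj u * u = 1" "u * adj u = 1"
      unfolding adju unfolding u_def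
      by (simp_all add: distrib_left distrib_right left_diff_distrib right_diff_distrib
          mult_scaleC_left mult_scaleC_right scaleC_scaleC scaleC_add_right scaleC_diff_right w)
    then have "(q u)\<^sup>2 \<le> 1" "(q (adj u))\<^sup>2 \<le> 1"
      using cs[of u] cs[of "adj u"] q1 by (simp_all add: adj_adj)
    then have "q u \<le> 1" "q (adj u) \<le> 1"
      using power2_le_imp_le[of "q u" 1] power2_le_imp_le[of "q (adj u)" 1] by simp_all
    moreover have "(1 / 2) *\<^sub>R (u + adj u) = h"
      unfolding adju unfolding u_def by (simp add: half_sum)
    then have "q h = 1 / 2 * q (u + adj u)"
      using scaleR[of "1 / 2" "u + adj u"] by (simp only: abs_divide abs_one abs_numeral)
    moreover have "q (u + adj u) \<le> q u + q (adj u)" by (rule add)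
    ultimately show ?thesis by simp
  qed
  have sa: "q h \<le> norm h" if h: "adj h = h" for h
  proof (rule field_le_epsilon)
    fix e :: real assume e: "e > 0"
    define t where "t = norm h + e"
    have t: "t > 0" using e by (simp add: t_def add_nonneg_pos)
    have "norm h < t" using e by (simp add: t_def)
    then have "q ((1 / t) *\<^sub>R h) \<le> 1"
      using t by (intro unit_ball) (simp_all add: h)
    then have "q h \<le> t"
      using t by (simp add: scaleR)
    then show "q h \<le> norm h + e" by (simp only: t_def)
  qed
  have "(q x)\<^sup>2 = q (adj x * x)" by (simp add: cs)
  also have "\<dots> \<le> norm (adj x * x)"
    by (rule sa) (simp add: adj_mult adj_adj)
  also have "\<dots> \<le> (norm x)\<^sup>2"
    using norm_mult_ineq[of "adj x" x] by (simp add: norm_adj power2_eq_square)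
  finally show ?thesis
    by (rule power2_le_imp_le) simp
qed

section \<open>Symmetric Banach *-algebras\<close>

text \<open>
  By rescaling \<open>h - Re z\<close>, the single point \<open>\<i>\<close> represents all of the complement of the real line.
\<close>

lemma hermitian_if_i_resolvent:
  assumes i: "\<And>g::'a::banach_star. adj g = g \<Longrightarrow> inv_elt (\<i> *\<^sub>C 1 - g)"
    and h: "adj h = (h::'a)" and z: "Im z \<noteq> 0"
  shows "inv_elt (z *\<^sub>C 1 - h)"
proof -
  define g where "g = (1 / Im z) *\<^sub>R (h - Re z *\<^sub>R 1)"
  have "inv_elt (\<i> *\<^sub>C 1 - g)"
    by (rule i) (simp add: g_def adj_diff h)
  then have "inv_elt (Im z *\<^sub>R (\<i> *\<^sub>C 1 - g))"
    using z by (simp add: inv_elt_scaleR_iff)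
  also have "Im z *\<^sub>R (\<i> *\<^sub>C 1 - g) = (Im z * \<i>) *\<^sub>C 1 + Re z *\<^sub>R 1 - h"
    using z by (simp add: scaleR_diff_right g_def scaleC_scaleC scaleC_diff_right flip: scaleC_of_real)
  also have "\<dots> = z *\<^sub>C 1 - h"
    by (subst complex_eq[of z]) (simp add: scaleC_add_left scaleC_of_real mult.commute)
  finally show ?thesis .
qed

lemma one_plus_square:
  "1 + g * g = (\<i> *\<^sub>C 1 - g) * ((- \<i>) *\<^sub>C 1 - g)"
  "(\<i> *\<^sub>C 1 - g) * ((- \<i>) *\<^sub>C 1 - g) = ((- \<i>) *\<^sub>C 1 - g) * (\<i> *\<^sub>C 1 - g)"
  by (simp_all add: left_diff_distrib right_diff_distrib mult_scaleC_left mult_scaleC_right scaleC_scaleC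
        scaleC_diff_right)

text \<open>
  The assumption, that \<open>-1\<close> is never in the spectrum of \<open>k\<^sup>* k\<close>, is the form in which symmetry is used; it
  implies the rest by scaling and by \<open>hermitian\<close>.
\<close>

locale symmetric_star =
  fixes T :: "'a::banach_star itself"
  assumes sym: "inv_elt (1 + adj k * (k::'a))"
begin

lemma hermitian:
  assumes h: "adj h = (h::'a)" and z: "Im z \<noteq> 0"
  shows "inv_elt (z *\<^sub>C 1 - h)"
proof (rule hermitian_if_i_resolvent[OF _ h z])
  fix g :: 'a assume "adj g = g"
  then have "inv_elt (1 + g * g)" using sym[of g] by simp
  then show "inv_elt (\<i> *\<^sub>C 1 - g)"
    unfolding one_plus_square(1) by (rule inv_elt_factor) (rule one_plus_square(2))
qed

lemma one_plus_skew:
  assumes "adj k = - (k::'a)"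
  shows "inv_elt (1 + k)"
proof -
  have "inv_elt (\<i> *\<^sub>C 1 - (- (\<i> *\<^sub>C k)))"
    by (rule hermitian) (simp_all add: adj_scaleC assms)
  then have "inv_elt ((-\<i>) *\<^sub>C (\<i> *\<^sub>C 1 - (- (\<i> *\<^sub>C k))))"
    by (subst inv_elt_scaleC_iff) auto
  then show ?thesis by (simp add: scaleC_add_right scaleC_scaleC)
qed

text \<open>
  With \<open>w\<^sup>2 = 1 - x\<^sup>* x\<close> one has \<open>(1 + x\<^sup>*) (1 - x) = w (1 + k) w\<close> where \<open>k = w\<^sup>-\<^sup>1 (x\<^sup>* - x) w\<^sup>-\<^sup>1\<close> is
  skew-adjoint.
\<close>

lemma ptak_one_sided:
  fixes x :: 'a
  assumes "power_small (adj x * x)"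
  shows "inv_elt ((1 + adj x) * (1 - x))"
proof -
  obtain C r where r: "0 \<le> r" "r < 1" "C > 0" "\<And>k. norm ((adj x * x) ^ k) \<le> C * r ^ k"
    using power_small_bounded[OF assms] by metis
  have "norm ((adj x * x) ^ k) \<le> C" for k
    using r(4)[of k] r(1-3) power_le_one[of r k] by (meson mult_left_le order_less_imp_le order_trans zero_le_power)
  then obtain y where y: "(1 - y) * (1 - y) = 1 - adj x * x"
    "adj (adj x * x) = adj x * x \<Longrightarrow> adj y = y"
    by (rule square_root_exists) blast+
  define w where "w = 1 - y"
  have w: "w * w = 1 - adj x * x" "adj w = w"
    using y by (simp_all add: w_def adj_diff adj_mult adj_adj)
  have "inv_elt (w * w)"
    using power_small_inv_elt[OF assms] by (simp add: w)
  then have "inv_elt w" by (rule inv_elt_factor) simp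
  then obtain v where v: "w * v = 1" "v * w = 1" by (auto simp: inv_elt_def)
  have "adj v * w = 1" using v w by (metis adj_1 adj_mult)
  then have av: "adj v = v" by (metis v(1) mult.assoc mult_1_left mult_1_right)
  define k where "k = v * (adj x - x) * v"
  have "adj k = - k"
    by (simp add: k_def adj_mult adj_diff adj_adj av algebra_simps)
  then have "inv_elt (w * (1 + k) * w)"
    using one_plus_skew \<open>inv_elt w\<close> by (intro inv_elt_mult) auto
  also have "w * (1 + k) * w = w * w + (w * v) * (adj x - x) * (v * w)"
    by (simp add: k_def distrib_left distrib_right mult.assoc)
  also have "\<dots> = (1 + adj x) * (1 - x)"
    by (simp add: v w algebra_simps)
  finally show ?thesis .
qed

lemma ptak_inv:
  fixes x :: 'a
  assumes "power_small (adj x * x)"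
  shows "inv_elt (1 - x)"
proof -
  have 1: "inv_elt ((1 + adj x) * (1 - x))" by (rule ptak_one_sided[OF assms])
  have "inv_elt ((1 + adj (adj x)) * (1 - adj x))"
    by (rule ptak_one_sided) (use power_small_swap[OF assms] in \<open>simp add: adj_adj\<close>)
  then have 2: "inv_elt ((1 - x) * (1 + adj x))"
    using inv_elt_adj by (fastforce simp: adj_mult adj_diff adj_add adj_adj)
  obtain c d where "c * ((1 + adj x) * (1 - x)) = 1" "((1 - x) * (1 + adj x)) * d = 1"
    using 1 2 by (auto simp: inv_elt_def)
  then show ?thesis
    by (intro inv_eltI[of _ "(1 + adj x) * d" "c * (1 + adj x)"]) (simp_all only: mult.assoc)
qed

text \<open>
  Ptak's inequality: in a symmetric algebra the square of the spectral radius of \<open>x\<close> is at most the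
  spectral radius of \<open>x\<^sup>* x\<close>.
\<close>

lemma ptak:
  fixes x :: 'a
  assumes "power_small (adj x * x)"
  shows "power_small x"
proof (rule spectral_radius, rule ptak_inv)
  fix z :: complex assume z: "cmod z \<le> 1"
  have "power_small ((cnj z * z) *\<^sub>C (adj x * x))"
    using z by (intro power_small_scaleC assms) (simp add: norm_mult mult_le_one)
  then show "power_small (adj (z *\<^sub>C x) * (z *\<^sub>C x))"
    by (simp add: adj_scaleC mult_scaleC_left mult_scaleC_right scaleC_scaleC mult.commute)
qed

text \<open>
  For self-adjoint \<open>h, k\<close>, \<open>(h k)\<^sup>* (h k) = k h\<^sup>2 k\<close> has the same spectral radius as \<open>h\<^sup>2 k\<^sup>2\<close>, so this is Ptak's
  inequality for \<open>h k\<close>.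
\<close>

lemma power_small_prod_squares:
  fixes h k :: 'a
  assumes "adj h = h" "adj k = k" "power_small ((h * h) * (k * k))"
  shows "power_small (h * k)"
proof (rule ptak)
  have "power_small ((h * h * k) * k)"
    using assms(3) by (simp add: mult.assoc)
  then have "power_small (k * (h * h * k))"
    by (rule power_small_swap)
  then show "power_small (adj (h * k) * (h * k))"
    by (simp add: adj_mult assms mult.assoc)
qed

lemma power_small_prod_iterated:
  fixes h k :: 'a
  assumes "adj h = h" "adj k = k" "power_small (h ^ (2 ^ n) * k ^ (2 ^ n))"
  shows "power_small (h * k)"
  using assms
proof (induction n arbitrary: h k)
  case (Suc n)
  have e: "x ^ (2 ^ Suc n) = (x * x) ^ (2 ^ n)" for x :: 'a
    by (simp add: power_mult power2_eq_square)
  show ?case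
    by (rule power_small_prod_squares[OF Suc.prems(1,2)], rule Suc.IH)
       (use Suc.prems in \<open>auto simp: adj_mult simp flip: e\<close>)
qed simp

text \<open>
  Iterating the passage from \<open>h, k\<close> to \<open>h\<^sup>2, k\<^sup>2\<close>, the norm of the product of the powers becomes small.
\<close>

lemma power_small_prod:
  fixes h k :: 'a
  assumes "adj h = h" "adj k = k" "power_small h" "power_small k"
  shows "power_small (h * k)"
proof -
  have sub: "strict_mono (\<lambda>n. (2::nat) ^ n)" by (rule strict_monoI) simp
  have "(\<lambda>n. norm (h ^ (2 ^ n)) * norm (k ^ (2 ^ n))) \<longlonglongrightarrow> 0 * 0"
    using LIMSEQ_subseq_LIMSEQ[OF power_small_tendsto[OF assms(3)] sub]
      LIMSEQ_subseq_LIMSEQ[OF power_small_tendsto[OF assms(4)] sub]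
    by (intro tendsto_mult) (simp_all add: o_def)
  then have "eventually (\<lambda>n. norm (h ^ (2 ^ n)) * norm (k ^ (2 ^ n)) < 1) sequentially"
    by (rule order_tendstoD) simp
  then obtain n where "norm (h ^ (2 ^ n)) * norm (k ^ (2 ^ n)) < 1"
    by (auto simp: eventually_sequentially)
  then have "norm ((h ^ (2 ^ n) * k ^ (2 ^ n)) ^ 1) < 1"
    using norm_mult_ineq[of "h ^ (2 ^ n)" "k ^ (2 ^ n)"] by simp
  then have "power_small (h ^ (2 ^ n) * k ^ (2 ^ n))"
    unfolding power_small_def by blast
  then show ?thesis
    by (rule power_small_prod_iterated[OF assms(1,2)])
qed

text \<open>
  Since self-adjoint elements have real spectrum, this says that the spectrum is contained in
  \<open>[0, \<infinity>)\<close>.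
\<close>

definition positive :: "'a \<Rightarrow> bool" where
  "positive a \<longleftrightarrow> adj a = a \<and> (\<forall>t>0. inv_elt (a + t *\<^sub>R 1))"

lemma positive_scale:
  assumes "positive a" "r > 0"
  shows "positive (r *\<^sub>R a)"
  unfolding positive_def
proof (intro conjI allI impI)
  show "adj (r *\<^sub>R a) = r *\<^sub>R a" using assms by (simp add: positive_def)
  fix t :: real assume "t > 0"
  then have "inv_elt (r *\<^sub>R (a + (t / r) *\<^sub>R 1))"
    using assms by (simp add: inv_elt_scaleR_iff positive_def)
  then show "inv_elt (r *\<^sub>R a + t *\<^sub>R 1)"
    using assms by (simp add: scaleR_right_distrib)
qed

lemma positive_square: "positive (adj k * k)"
  unfolding positive_def
proof (intro conjI allI impI)
  fix t :: real assume t: "t > 0"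
  define l where "l = (1 / sqrt t) *\<^sub>R k"
  have "inv_elt (t *\<^sub>R (1 + adj l * l))"
    using t sym by (simp add: inv_elt_scaleR_iff)
  then show "inv_elt (adj k * k + t *\<^sub>R 1)"
    using t by (simp add: l_def scaleR_right_distrib add.commute)
qed (simp add: adj_mult adj_adj)

text \<open>
  The Cayley-like transform \<open>a (1 + a)\<^sup>-\<^sup>1\<close> maps positive elements to self-adjoint elements of spectral
  radius less than one.
\<close>

lemma positive_transform:
  assumes a: "positive a"
  obtains v where "(1 + a) * v = 1" "v * (1 + a) = 1" "adj (v * a) = v * a" "v * a = a * v" "power_small (v * a)"
proof -
  have aa: "adj a = a" and inv: "inv_elt (a + t *\<^sub>R 1)" if "t > 0" for t
    using a that by (auto simp: positive_def)
  have aa: "adj a = a" using a by (auto simp: positive_def)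
  have i1: "inv_elt (1 + a)" using inv[of 1] by (simp add: add.commute)
  then obtain v where v: "(1 + a) * v = 1" "v * (1 + a) = 1" by (auto simp: inv_elt_def)
  have va: "v * a = 1 - v" "a * v = 1 - v"
    using v by (simp_all add: algebra_simps)
  have "adj v * (1 + a) = 1"
    using v(1) aa by (metis adj_1 adj_add adj_mult)
  then have av: "adj v = v" by (metis v(1) mult.assoc mult_1_left mult_1_right)
  have iv: "inv_elt v" using v by (auto simp: inv_elt_def)
  have "power_small (v * a)"
  proof (rule spectral_radius)
    fix z :: complex assume z: "cmod z \<le> 1"
    have eq: "1 - z *\<^sub>C (v * a) = v * (1 + (1 - z) *\<^sub>C a)"
      using v(2) by (simp add: distrib_left scaleC_diff_left mult_scaleC_right right_diff_distrib)
    have "inv_elt (1 + (1 - z) *\<^sub>C a)"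
    proof (cases "z = 1")
      case True
      then show ?thesis by (auto simp: inv_elt_def intro: exI[of _ 1])
    next
      case False
      define u where "u = 1 / (1 - z)"
      have "inv_elt (u *\<^sub>C 1 + a)"
      proof (cases "Im u = 0")
        case True
        define r where "r = Re u"
        have u: "u = of_real r" using True by (simp add: r_def complex_eq_iff)
        have "1 - z = 1 / u" by (simp add: u_def)
        then have "1 - z = of_real (1 / r)" by (simp add: u)
        then have "Re (1 - z) = 1 / r" by (simp only: Re_complex_of_real)
        then have "Re z = 1 - 1 / r" by simp
        moreover have "Re z \<le> 1" using z complex_Re_le_cmod[of z] by linarith
        moreover have "u \<noteq> 0" using False by (simp add: u_def)
        ultimately have "r > 0" using u by (cases "r = 0") (auto simp: zero_le_divide_1_iff less_le)
        then show ?thesis using inv[of r] by (simp add: u scaleC_of_real add.commute)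
      next
        case False
        have "inv_elt ((- u) *\<^sub>C 1 - a)" by (rule hermitian) (use aa False in auto)
        then show ?thesis using inv_elt_minus[of "u *\<^sub>C 1 + a"] by simp
      qed
      then have "inv_elt ((1 - z) *\<^sub>C (u *\<^sub>C 1 + a))"
        using False by (simp add: inv_elt_scaleC_iff)
      then show ?thesis
        using False by (simp add: u_def scaleC_add_right scaleC_scaleC)
    qed
    then show "inv_elt (1 - z *\<^sub>C (v * a))"
      unfolding eq by (rule inv_elt_mult[OF iv])
  qed
  moreover have "adj (v * a) = v * a" "v * a = a * v"
    by (simp_all add: va adj_diff av)
  ultimately show ?thesis
    by (intro that[OF v])
qed

text \<open>
  If \<open>h\<close> and \<open>k\<close> are the transforms of \<open>a\<close> and \<open>b\<close> then \<open>1 + a + b = (1 + a) (1 - h k) (1 + b)\<close>, and \<open>h k\<close> has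
  spectral radius less than one.
\<close>

lemma positive_sum_inv:
  assumes "positive a" "positive b"
  shows "inv_elt (1 + a + b)"
proof -
  obtain v where v: "(1 + a) * v = 1" "v * (1 + a) = 1" "adj (v * a) = v * a" "power_small (v * a)"
    using positive_transform[OF assms(1)] by metis
  obtain u where u: "(1 + b) * u = 1" "u * (1 + b) = 1" "adj (u * b) = u * b" "u * b = b * u" "power_small (u * b)"
    using positive_transform[OF assms(2)] by metis
  have "inv_elt (1 - (v * a) * (u * b))"
    by (intro power_small_inv_elt power_small_prod v u)
  then have "inv_elt ((1 + a) * (1 - (v * a) * (u * b)) * (1 + b))"
    using v u by (intro inv_elt_mult) (auto simp: inv_elt_def)
  also have "(1 + a) * (1 - (v * a) * (u * b)) * (1 + b) = (1 + a) * (1 + b) - ((1 + a) * v) * (a * b) * (u * (1 + b))"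
    unfolding u(4) by (simp only: right_diff_distrib left_diff_distrib mult.assoc mult_1_left)
  also have "\<dots> = (1 + a) * (1 + b) - a * b"
    by (simp only: v u mult_1_left mult_1_right)
  also have "\<dots> = 1 + a + b"
    by (simp add: distrib_left distrib_right)
  finally show ?thesis .
qed

lemma positive_add:
  assumes "positive a" "positive b"
  shows "positive (a + b)"
  unfolding positive_def
proof (intro conjI allI impI)
  show "adj (a + b) = a + b" using assms by (simp add: positive_def adj_add)
  fix t :: real assume t: "t > 0"
  have "inv_elt (t *\<^sub>R (1 + (1 / t) *\<^sub>R a + (1 / t) *\<^sub>R b))"
    using positive_sum_inv[of "(1 / t) *\<^sub>R a" "(1 / t) *\<^sub>R b"] assms t
    by (simp add: inv_elt_scaleR_iff positive_scale)
  then show "inv_elt (a + b + t *\<^sub>R 1)"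
    using t by (simp add: scaleR_right_distrib add_ac)
qed

end

section \<open>The largest C*-seminorm\<close>

inductive sum_squares :: "'a::banach_star \<Rightarrow> bool" where
  sum_squares_zero: "sum_squares 0"
| sum_squares_add: "sum_squares s \<Longrightarrow> sum_squares (s + adj k * k)"

text \<open>
  The closure of the cone of sums of squares.
\<close>

definition pos_cone :: "'a::banach_star \<Rightarrow> bool" where
  "pos_cone h \<longleftrightarrow> (\<forall>e>0. \<exists>s. sum_squares s \<and> norm (h - s) \<le> e)"

lemma sum_squares_plus: "sum_squares t \<Longrightarrow> sum_squares s \<Longrightarrow> sum_squares (s + t)"
proof (induction t rule: sum_squares.induct)
  case (sum_squares_add t k)
  then show ?case using sum_squares.sum_squares_add[of "s + t" k] by (simp add: add.assoc)
qed simp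

lemma sum_squares_conj: "sum_squares s \<Longrightarrow> sum_squares (adj l * s * l)"
proof (induction s rule: sum_squares.induct)
  case (sum_squares_add s k)
  then show ?case
    using sum_squares.sum_squares_add[of "adj l * s * l" "k * l"]
    by (simp add: distrib_left distrib_right adj_mult mult.assoc)
qed (simp add: sum_squares_zero)

lemma sum_squares_sa: "sum_squares s \<Longrightarrow> adj s = s"
  by (induction rule: sum_squares.induct) (simp_all add: adj_add adj_mult adj_adj)

lemma pos_cone_sum_squares: "sum_squares s \<Longrightarrow> pos_cone s"
  unfolding pos_cone_def by (metis diff_self less_imp_le norm_zero)

lemma pos_cone_square: "pos_cone (adj k * k)"
  using sum_squares_add[OF sum_squares_zero, of k] by (simp add: pos_cone_sum_squares)

lemma pos_cone_add:
  assumes "pos_cone a" "pos_cone b"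
  shows "pos_cone (a + b)"
  unfolding pos_cone_def
proof (intro allI impI)
  fix e :: real assume "e > 0"
  then obtain s t where "sum_squares s" "norm (a - s) \<le> e / 2" "sum_squares t" "norm (b - t) \<le> e / 2"
    using assms by (meson half_gt_zero pos_cone_def)
  then show "\<exists>s. sum_squares s \<and> norm (a + b - s) \<le> e"
    using norm_diff_triangle_le[of 0] norm_triangle_ineq[of "a - s" "b - t"]
    by (intro exI[of _ "s + t"]) (auto simp: sum_squares_plus algebra_simps)
qed

lemma pos_cone_conj:
  assumes "pos_cone a"
  shows "pos_cone (adj l * a * l)"
  unfolding pos_cone_def
proof (intro allI impI)
  fix e :: real assume e: "e > 0"
  define M where "M = norm l * norm l + 1"
  have M: "M > 0" by (simp add: M_def add_nonneg_pos)
  obtain s where s: "sum_squares s" "norm (a - s) \<le> e / M"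
    using assms e M by (meson divide_pos_pos pos_cone_def)
  have "norm (adj l * a * l - adj l * s * l) = norm (adj l * (a - s) * l)"
    by (simp add: algebra_simps)
  also have "\<dots> \<le> norm (adj l) * norm (a - s) * norm l"
    by (meson mult_right_mono norm_ge_zero norm_mult_ineq order_trans)
  also have "\<dots> \<le> M * norm (a - s)"
    by (simp add: norm_adj M_def algebra_simps)
  also have "\<dots> \<le> e" using s M by (simp add: field_simps)
  finally show "\<exists>s. sum_squares s \<and> norm (adj l * a * l - s) \<le> e"
    using sum_squares_conj[OF s(1)] by blast
qed

lemma pos_cone_scale:
  assumes "pos_cone a" "r \<ge> 0"
  shows "pos_cone (r *\<^sub>R a)"
  using pos_cone_conj[OF assms(1), of "sqrt r *\<^sub>R 1"] assms(2) by simp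

lemma pos_cone_one: "r \<ge> 0 \<Longrightarrow> pos_cone (r *\<^sub>R 1)"
  using pos_cone_scale[OF pos_cone_square[of 1]] by simp

lemma pos_cone_sa:
  assumes "pos_cone h"
  shows "adj h = h"
proof -
  have "norm (adj h - h) \<le> 0 + e" if e: "e > 0" for e
  proof -
    obtain s where s: "sum_squares s" "norm (h - s) \<le> e / 2"
      using assms e by (meson half_gt_zero pos_cone_def)
    have "norm (adj h - h) \<le> norm (adj (h - s)) + norm (h - s)"
      using norm_triangle_ineq4[of "adj (h - s)" "h - s"] sum_squares_sa[OF s(1)] by (simp add: adj_diff)
    then show ?thesis using s by (simp add: norm_adj)
  qed
  then have "norm (adj h - h) \<le> 0" by (rule field_le_epsilon)
  then show ?thesis by simp
qed

text \<open>
  A square root of \<open>t - h\<close> is again self-adjoint, so \<open>t - h\<close> is a square.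
\<close>

lemma pos_cone_norm:
  fixes h :: "'a::banach_star"
  assumes h: "adj h = h" "norm h < t"
  shows "pos_cone (t *\<^sub>R 1 - h)"
proof -
  have t: "t > 0" using h(2) norm_ge_zero[of h] by linarith
  define x where "x = (1 / t) *\<^sub>R h"
  have x: "norm x \<le> 1" "adj x = x" using h t by (auto simp: x_def)
  have "norm (x ^ k) \<le> 1" if "k \<ge> 1" for k
    using norm_power_le[of x "k - 1"] that power_le_one[OF norm_ge_zero x(1), of k] by simp
  then obtain y where y: "(1 - y) * (1 - y) = 1 - x" "adj x = x \<Longrightarrow> adj y = y"
    by (rule square_root_exists) blast+
  have "adj (1 - y) = 1 - y" using y x by (simp add: adj_diff)
  then have "pos_cone ((1 - y) * (1 - y))"
    using pos_cone_square[of "1 - y"] by simp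
  then have "pos_cone (t *\<^sub>R (1 - x))"
    using t by (simp add: y pos_cone_scale)
  then show ?thesis using t by (simp add: x_def scaleR_diff_right)
qed

text \<open>
  Any seminorm with the C*-identity that is monotone on the cone is at most \<open>t\<close> at \<open>k\<close> whenever
  \<open>k\<^sup>* k \<le> t\<^sup>2\<close> in the order of the cone. The least such \<open>t\<close> is itself a C*-seminorm, in every Banach
  *-algebra; symmetry enters only when it is compared with the spectral radius.
\<close>

definition cone_bound :: "'a::banach_star \<Rightarrow> real \<Rightarrow> bool" where
  "cone_bound k t \<longleftrightarrow> 0 < t \<and> pos_cone (t\<^sup>2 *\<^sub>R 1 - adj k * k)"

definition cone_norm :: "'a::banach_star \<Rightarrow> real" where
  "cone_norm k = Inf {t. cone_bound k t}"

lemma cone_bound_norm: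
  assumes "norm k < t"
  shows "cone_bound k t"
proof -
  have t: "t > 0" using assms norm_ge_zero[of k] by linarith
  have "norm (adj k * k) \<le> norm k * norm k"
    using norm_mult_ineq[of "adj k" k] by (simp add: norm_adj)
  also have "\<dots> < t * t" using assms t by (intro mult_strict_mono) auto
  finally show ?thesis
    using t by (auto simp: cone_bound_def adj_mult adj_adj power2_eq_square intro!: pos_cone_norm)
qed

lemma cone_bound_mono:
  assumes "cone_bound k t" "t \<le> s"
  shows "cone_bound k s"
proof -
  have "t\<^sup>2 \<le> s\<^sup>2" using assms by (intro power_mono) (auto simp: cone_bound_def)
  then have "pos_cone ((t\<^sup>2 *\<^sub>R 1 - adj k * k) + (s\<^sup>2 - t\<^sup>2) *\<^sub>R 1)"
    using assms by (intro pos_cone_add pos_cone_one) (auto simp: cone_bound_def)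
  then show ?thesis
    using assms by (auto simp: cone_bound_def scaleR_left_diff_distrib algebra_simps)
qed

lemma cone_bound_bdd: "bdd_below {t. cone_bound k t}"
  by (rule bdd_belowI[of _ 0]) (auto simp: cone_bound_def)

lemma cone_bound_nonempty: "{t. cone_bound k t} \<noteq> {}"
  using cone_bound_norm[of k "norm k + 1"] by auto

lemma cone_norm_le: "cone_bound k t \<Longrightarrow> cone_norm k \<le> t"
  unfolding cone_norm_def by (rule cInf_lower) (auto simp: cone_bound_bdd)

lemma cone_norm_less:
  assumes "cone_norm k < t"
  shows "cone_bound k t"
proof -
  obtain s where "cone_bound k s" "s < t"
    using assms cInf_less_iff[OF cone_bound_nonempty cone_bound_bdd] unfolding cone_norm_def by auto
  then show ?thesis by (auto intro: cone_bound_mono)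
qed

lemma cone_norm_nonneg: "0 \<le> cone_norm k"
  unfolding cone_norm_def by (rule cInf_greatest[OF cone_bound_nonempty]) (auto simp: cone_bound_def)

lemma cone_norm_le_norm: "cone_norm k \<le> norm k"
  by (rule field_le_epsilon, rule cone_norm_le, rule cone_bound_norm) simp

lemma cone_bound_add:
  assumes "cone_bound k t" "cone_bound l s"
  shows "cone_bound (k + l) (t + s)"
proof -
  have ts: "t > 0" "s > 0" using assms by (auto simp: cone_bound_def)
  define r where "r = s / t"
  have r: "r > 0" using ts by (simp add: r_def)
  define D where "D = sqrt r *\<^sub>R k - (1 / sqrt r) *\<^sub>R l"
  have D: "adj D * D = r *\<^sub>R (adj k * k) + (1 / r) *\<^sub>R (adj l * l) - adj k * l - adj l * k"
    using r by (simp add: D_def adj_diff left_diff_distrib right_diff_distrib scaleR_diff_right)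
  have n: "(1 + r) * t\<^sup>2 + (1 + 1 / r) * s\<^sup>2 = (t + s)\<^sup>2"
    using ts by (simp add: r_def field_simps power2_eq_square)
  have "pos_cone ((1 + r) *\<^sub>R (t\<^sup>2 *\<^sub>R 1 - adj k * k) + (1 + 1 / r) *\<^sub>R (s\<^sup>2 *\<^sub>R 1 - adj l * l) + adj D * D)"
    using assms r by (intro pos_cone_add pos_cone_scale pos_cone_square) (auto simp: cone_bound_def)
  also have "(1 + r) *\<^sub>R (t\<^sup>2 *\<^sub>R 1 - adj k * k) + (1 + 1 / r) *\<^sub>R (s\<^sup>2 *\<^sub>R 1 - adj l * l) + adj D * D
    = ((1 + r) * t\<^sup>2 + (1 + 1 / r) * s\<^sup>2) *\<^sub>R 1 - adj (k + l) * (k + l)"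
    unfolding D by (simp only: scaleR_diff_right scaleR_left_distrib scaleR_scaleR adj_add
        distrib_left distrib_right scaleR_one mult_1_left) (simp add: algebra_simps)
  finally show ?thesis using ts unfolding n by (simp add: cone_bound_def)
qed

lemma cone_bound_mult:
  assumes "cone_bound k t" "cone_bound l s"
  shows "cone_bound (k * l) (t * s)"
proof -
  have "pos_cone (adj l * (t\<^sup>2 *\<^sub>R 1 - adj k * k) * l + t\<^sup>2 *\<^sub>R (s\<^sup>2 *\<^sub>R 1 - adj l * l))"
    using assms by (intro pos_cone_add pos_cone_conj pos_cone_scale) (auto simp: cone_bound_def)
  also have "adj l * (t\<^sup>2 *\<^sub>R 1 - adj k * k) * l + t\<^sup>2 *\<^sub>R (s\<^sup>2 *\<^sub>R 1 - adj l * l)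
     = (t * s)\<^sup>2 *\<^sub>R 1 - adj (k * l) * (k * l)"
    by (simp add: left_diff_distrib right_diff_distrib scaleR_diff_right adj_mult mult.assoc power_mult_distrib)
  finally show ?thesis using assms by (simp add: cone_bound_def)
qed

lemma cone_norm_add: "cone_norm (k + l) \<le> cone_norm k + cone_norm l"
proof (rule field_le_epsilon)
  fix e :: real assume "e > 0"
  then have "cone_bound (k + l) ((cone_norm k + e / 2) + (cone_norm l + e / 2))"
    by (intro cone_bound_add cone_norm_less) auto
  then show "cone_norm (k + l) \<le> cone_norm k + cone_norm l + e"
    using cone_norm_le by fastforce
qed

lemma le_mult_epsilon:
  fixes a b c :: real
  assumes "\<And>e. e > 0 \<Longrightarrow> c \<le> (a + e) * (b + e)"
  shows "c \<le> a * b"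
proof (rule tendsto_lowerbound)
  show "((\<lambda>e. (a + e) * (b + e)) \<longlongrightarrow> a * b) (at_right 0)"
    by (auto intro!: tendsto_eq_intros)
  show "eventually (\<lambda>e. c \<le> (a + e) * (b + e)) (at_right 0)"
    using assms eventually_at_right_less[of "0::real"] by (auto elim: eventually_mono)
qed simp

lemma cone_norm_mult: "cone_norm (k * l) \<le> cone_norm k * cone_norm l"
  by (rule le_mult_epsilon, rule cone_norm_le, rule cone_bound_mult; rule cone_norm_less; simp)

lemma cone_bound_scaleC:
  assumes "cone_bound k t" "z \<noteq> 0"
  shows "cone_bound (z *\<^sub>C k) (cmod z * t)"
proof -
  have "pos_cone ((cmod z)\<^sup>2 *\<^sub>R (t\<^sup>2 *\<^sub>R 1 - adj k * k))"
    using assms by (intro pos_cone_scale) (auto simp: cone_bound_def)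
  also have "(cmod z)\<^sup>2 *\<^sub>R (t\<^sup>2 *\<^sub>R 1 - adj k * k) = (cmod z * t)\<^sup>2 *\<^sub>R 1 - adj (z *\<^sub>C k) * (z *\<^sub>C k)"
    by (simp add: adj_scaleC mult_scaleC_left mult_scaleC_right scaleC_scaleC scaleC_diff_right power_mult_distrib
        complex_norm_square mult.commute flip: scaleC_of_real of_real_power)
  finally show ?thesis using assms by (simp add: cone_bound_def)
qed

lemma cone_norm_scaleC_le: "z \<noteq> 0 \<Longrightarrow> cone_norm (z *\<^sub>C k) \<le> cmod z * cone_norm k"
proof (rule field_le_epsilon)
  fix e :: real assume "z \<noteq> 0" "e > 0"
  then have "cone_bound (z *\<^sub>C k) (cmod z * (cone_norm k + e / cmod z))"
    by (intro cone_bound_scaleC cone_norm_less) auto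
  then show "cone_norm (z *\<^sub>C k) \<le> cmod z * cone_norm k + e"
    using cone_norm_le \<open>z \<noteq> 0\<close> by (fastforce simp: distrib_left)
qed

lemma cone_norm_zero: "cone_norm (0::'a::banach_star) = 0"
  using cone_norm_le_norm[of "0::'a"] cone_norm_nonneg[of "0::'a"] by simp

lemma cone_norm_scaleC: "cone_norm (z *\<^sub>C k) = cmod z * cone_norm k"
proof (cases "z = 0")
  case False
  have "cmod z * cone_norm k = cmod z * cone_norm ((1 / z) *\<^sub>C z *\<^sub>C k)"
    using False by (simp add: scaleC_scaleC)
  also have "\<dots> \<le> cmod z * (cmod (1 / z) * cone_norm (z *\<^sub>C k))"
    using False by (intro mult_left_mono cone_norm_scaleC_le) auto
  also have "\<dots> = cone_norm (z *\<^sub>C k)"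
    using False by (simp add: norm_divide)
  finally show ?thesis using cone_norm_scaleC_le[OF False, of k] by simp
qed (simp add: cone_norm_zero)

text \<open>
  For self-adjoint \<open>a\<close> and \<open>a\<^sup>2 \<le> s\<^sup>2\<close>, the identity
  \<open>(s - a)\<^sup>2 + (s\<^sup>2 - a\<^sup>2) = 2 s (s - a)\<close> gives \<open>a \<le> s\<close>; apply it to \<open>a = k\<^sup>* k\<close>.
\<close>

lemma cone_norm_square_le: "(cone_norm k)\<^sup>2 \<le> cone_norm (adj k * k)"
proof (rule field_le_epsilon)
  fix e :: real assume e: "e > 0"
  define s where "s = cone_norm (adj k * k) + e"
  define a where "a = adj k * k"
  have s: "s > 0" using e cone_norm_nonneg[of "adj k * k"] by (simp add: s_def)
  have aa: "adj a = a" by (simp add: a_def adj_mult adj_adj)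
  have "cone_bound a s"
    using e by (intro cone_norm_less) (simp add: s_def a_def)
  then have "pos_cone (adj (s *\<^sub>R 1 - a) * (s *\<^sub>R 1 - a) + (s\<^sup>2 *\<^sub>R 1 - adj a * a))"
    by (intro pos_cone_add pos_cone_square) (simp add: cone_bound_def)
  then have "pos_cone ((1 / (2 * s)) *\<^sub>R (adj (s *\<^sub>R 1 - a) * (s *\<^sub>R 1 - a) + (s\<^sup>2 *\<^sub>R 1 - adj a * a)))"
    using s by (intro pos_cone_scale) auto
  also have "adj (s *\<^sub>R 1 - a) * (s *\<^sub>R 1 - a) + (s\<^sup>2 *\<^sub>R 1 - adj a * a) = (2 * s) *\<^sub>R (s *\<^sub>R 1 - a)"
    by (simp add: adj_diff aa left_diff_distrib right_diff_distrib power2_eq_square scaleR_2 scaleR_diff_right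
        flip: scaleR_scaleR)
  finally have "pos_cone ((sqrt s)\<^sup>2 *\<^sub>R 1 - adj k * k)"
    using s by (simp add: a_def)
  then have "cone_norm k \<le> sqrt s"
    using s by (intro cone_norm_le) (simp add: cone_bound_def)
  then have "(cone_norm k)\<^sup>2 \<le> (sqrt s)\<^sup>2"
    by (intro power_mono cone_norm_nonneg)
  then show "(cone_norm k)\<^sup>2 \<le> cone_norm (adj k * k) + e"
    using s by (simp add: s_def)
qed

lemma cone_norm_adj: "cone_norm (adj k) = cone_norm k"
proof -
  have *: "cone_norm k \<le> cone_norm (adj k)" for k :: 'a
  proof (cases "cone_norm k = 0")
    case False
    then have pos: "cone_norm k > 0" using cone_norm_nonneg[of k] by simp
    have "cone_norm k * cone_norm k \<le> cone_norm (adj k) * cone_norm k"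
      using cone_norm_square_le[of k] cone_norm_mult[of "adj k" k] by (simp add: power2_eq_square)
    then show ?thesis using pos by simp
  qed (simp add: cone_norm_nonneg)
  show ?thesis using *[of k] *[of "adj k"] by (simp add: adj_adj)
qed

lemma cone_norm_cstar: "cone_norm (adj k * k) = (cone_norm k)\<^sup>2"
  using cone_norm_square_le[of k] cone_norm_mult[of "adj k" k] by (simp add: power2_eq_square cone_norm_adj)

context symmetric_star
begin

text \<open>
  Sums of squares are positive because positive elements are closed under addition; an approximation
  error of \<open>d / 2\<close> is absorbed by the shift.
\<close>

lemma pos_cone_inv:
  fixes h :: 'a
  assumes h: "pos_cone h" and d: "d > 0"
  shows "inv_elt (h + d *\<^sub>R 1)"
proof -
  obtain s where s: "sum_squares s" "norm (h - s) \<le> d / 2"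
    using assms by (meson half_gt_zero pos_cone_def)
  have ps: "positive s"
    using s(1)
  proof (induction rule: sum_squares.induct)
    case sum_squares_zero
    have "inv_elt (t *\<^sub>R (1::'a))" if "t > 0" for t
      using that by (simp add: inv_elt_scaleR_iff inv_elt_one)
    then show ?case by (simp add: positive_def)
  qed (intro positive_add positive_square)
  define c where "c = (h - s) + (3 / 4 * d) *\<^sub>R 1"
  have "positive c"
    unfolding positive_def
  proof (intro conjI allI impI)
    show "adj c = c"
      using pos_cone_sa[OF h] sum_squares_sa[OF s(1)] by (simp add: c_def adj_add adj_diff)
    fix t :: real assume t: "t > 0"
    have "inv_elt ((3 / 4 * d + t) *\<^sub>R 1 + (h - s))"
      using s d t by (intro neumann_scaleR) auto
    then show "inv_elt (c + t *\<^sub>R 1)"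
      by (simp add: c_def scaleR_left_distrib add_ac)
  qed
  then have "inv_elt ((s + c) + (d / 4) *\<^sub>R 1)"
    using positive_add[OF ps] d by (auto simp: positive_def)
  also have "(s + c) + (d / 4) *\<^sub>R 1 = h + (3 / 4 * d + d / 4) *\<^sub>R 1"
    by (simp only: c_def scaleR_left_distrib) simp
  finally show ?thesis by simp
qed

text \<open>
  If \<open>u\<^sup>* u \<le> t\<^sup>2\<close> with \<open>t < 1\<close> then \<open>(1 - u)\<^sup>* (1 - u) \<ge> (1 - t)\<^sup>2\<close> in the order of the cone, as for
  operators on a Hilbert space.
\<close>

lemma cone_norm_inv_one_sided:
  fixes u :: 'a
  assumes "cone_norm u < 1"
  shows "inv_elt (adj (1 - u) * (1 - u))"
proof -
  define t where "t = (cone_norm u + 1) / 2"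
  have t: "0 < t" "t < 1" "cone_norm u < t"
    using assms cone_norm_nonneg[of u] by (simp_all add: t_def)
  define s where "s = 1 / t"
  have s: "s > 1" "s > 0" "s * t = 1" using t by (simp_all add: s_def)
  have st: "1 / s = t" using t by (simp add: s_def)
  (* Completing the square with the weight s > 1 leaves the multiple (s - 1) of t^2 - u^* u. *)
  define E where "E = sqrt s *\<^sub>R u - (1 / sqrt s) *\<^sub>R 1"
  have E: "adj E * E = s *\<^sub>R (adj u * u) - u - adj u + t *\<^sub>R 1"
    using s t by (simp add: E_def adj_diff left_diff_distrib right_diff_distrib scaleR_diff_right st)
  have n: "(s - 1) * t\<^sup>2 = t - t\<^sup>2" using s by (simp add: s_def field_simps power2_eq_square)
  have "pos_cone (adj E * E + (s - 1) *\<^sub>R (t\<^sup>2 *\<^sub>R 1 - adj u * u))"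
    using cone_norm_less[OF t(3)] s by (intro pos_cone_add pos_cone_square pos_cone_scale) (auto simp: cone_bound_def)
  also have "adj E * E + (s - 1) *\<^sub>R (t\<^sup>2 *\<^sub>R 1 - adj u * u) = adj (1 - u) * (1 - u) - ((1 - t)\<^sup>2) *\<^sub>R 1"
  proof -
    have "(s - 1) *\<^sub>R (t\<^sup>2 *\<^sub>R 1 - adj u * u) = ((s - 1) * t\<^sup>2) *\<^sub>R 1 - (s - 1) *\<^sub>R (adj u * u)"
      by (simp only: scaleR_diff_right scaleR_scaleR)
    also have "\<dots> = t *\<^sub>R 1 - t\<^sup>2 *\<^sub>R 1 - (s *\<^sub>R (adj u * u) - adj u * u)"
      by (simp only: n scaleR_left_diff_distrib scaleR_one)
    finally have 1: "(s - 1) *\<^sub>R (t\<^sup>2 *\<^sub>R 1 - adj u * u)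
        = t *\<^sub>R 1 - t\<^sup>2 *\<^sub>R 1 - (s *\<^sub>R (adj u * u) - adj u * u)" .
    have "(1 - t)\<^sup>2 = 1 - t - (t - t\<^sup>2)"
      by (simp add: power2_eq_square algebra_simps)
    then have 2: "(1 - t)\<^sup>2 *\<^sub>R 1 = 1 - t *\<^sub>R 1 - (t *\<^sub>R 1 - t\<^sup>2 *\<^sub>R (1::'a))"
      by (simp only: scaleR_left_diff_distrib scaleR_one)
    show ?thesis
      unfolding E 1 2 by (simp add: adj_diff left_diff_distrib right_diff_distrib)
  qed
  finally have "inv_elt (adj (1 - u) * (1 - u) - ((1 - t)\<^sup>2) *\<^sub>R 1 + ((1 - t)\<^sup>2) *\<^sub>R 1)"
    using t by (intro pos_cone_inv) auto
  then show ?thesis by simp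
qed

lemma cone_norm_inv:
  fixes u :: 'a
  assumes "cone_norm u < 1"
  shows "inv_elt (1 - u)"
proof -
  obtain c d where "c * (adj (1 - u) * (1 - u)) = 1" "(adj (1 - adj u) * (1 - adj u)) * d = 1"
    using cone_norm_inv_one_sided[of u] cone_norm_inv_one_sided[of "adj u"] assms
    by (auto simp: inv_elt_def cone_norm_adj)
  then show ?thesis
    by (intro inv_eltI[of _ "adj (1 - u) * d" "c * adj (1 - u)"])
       (simp_all only: mult.assoc adj_diff adj_1 adj_adj)
qed

text \<open>
  The cone norm of \<open>u\<close> bounds its spectral radius. This is where symmetry pays off: a bound in a C*-seminorm
  is turned into a bound for the original norm.
\<close>

lemma cone_norm_power_small:
  fixes u :: 'a
  assumes "cone_norm u < 1"
  shows "power_small u"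
proof (rule spectral_radius, rule cone_norm_inv)
  fix z :: complex assume "cmod z \<le> 1"
  then have "cmod z * cone_norm u \<le> 1 * cone_norm u"
    by (intro mult_right_mono cone_norm_nonneg)
  then show "cone_norm (z *\<^sub>C u) < 1"
    using assms by (simp add: cone_norm_scaleC)
qed

end

section \<open>C*-algebras: quotients and injective homomorphisms\<close>

locale cstar_star =
  fixes T :: "'a::banach_star itself"
  assumes cstar: "norm (adj a * (a::'a)) = (norm a)\<^sup>2"
begin

lemma norm_one: "norm (1::'a) \<le> 1"
proof -
  have "norm (1::'a) * norm (1::'a) = norm (1::'a) * 1"
    using cstar[of 1] by (simp only: adj_1 mult_1_left mult_1_right power2_eq_square)
  then show ?thesis by (simp only: mult_cancel_left) auto
qed

text \<open>
  In a C*-algebra the inverse of \<open>1 + \<i> t j\<close> is a contraction; the bound \<open>1 + e\<close> is obtained from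
  the C*-identity alone and is all that is needed for the quotient norm.
\<close>

lemma imaginary_resolvent:
  fixes j :: 'a
  assumes j: "adj j = j" and t: "t > 0" and e: "e > 0"
  obtains v where "(1 + (\<i> * of_real t) *\<^sub>C j) * v = 1" "v * (1 + (\<i> * of_real t) *\<^sub>C j) = 1" "norm v \<le> 1 + e"
proof -
  define N where "N = (norm j)\<^sup>2"
  have N: "N \<ge> 0" by (simp add: N_def)
  (* With c = 1 - i s j, the element 1 + i t j is a multiple of 1 - c / (1 + rho) for rho = s / t.
     Here the norm of c exceeds 1 only by a term of order s^2, which is small compared with rho. *)
  define s where "s = e / ((1 + e) * t * (N + 1))"
  have s: "s > 0" using N t e by (simp add: s_def)
  have sN: "t * s * N \<le> e / (1 + e)"
  proof -
    have "t * s * N = e / (1 + e) * (N / (N + 1))"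
      using N t e by (simp add: s_def)
    also have "\<dots> \<le> e / (1 + e) * 1"
      using N e by (intro mult_left_mono) (auto simp: divide_le_eq_1)
    finally show ?thesis by simp
  qed
  define \<rho> where "\<rho> = s / t"
  have \<rho>: "\<rho> > 0" using s t by (simp add: \<rho>_def)
  define c where "c = 1 - (\<i> * of_real s) *\<^sub>C j"
  have ii: "(\<i> * of_real s) * (\<i> * of_real s) = - (of_real s * (of_real s :: complex))"
    by (simp add: complex_eq_iff)
  have "adj c * c = 1 + s\<^sup>2 *\<^sub>R (j * j)"
    by (simp add: ii c_def adj_diff adj_scaleC j left_diff_distrib right_diff_distrib distrib_left distrib_right
        mult_scaleC_left mult_scaleC_right scaleC_scaleC scaleC_add_right scaleC_diff_right power2_eq_square flip: scaleC_of_real)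
  then have "(norm c)\<^sup>2 \<le> norm (1::'a) + norm (s\<^sup>2 *\<^sub>R (j * j))"
    using cstar[of c] norm_triangle_ineq by metis
  also have "norm (s\<^sup>2 *\<^sub>R (j * j)) \<le> s\<^sup>2 * N"
    using norm_mult_ineq[of j j] by (auto simp: N_def power2_eq_square intro!: mult_left_mono)
  finally have "(norm c)\<^sup>2 \<le> 1 + s\<^sup>2 * N" using norm_one by linarith
  also have "\<dots> \<le> (1 + s\<^sup>2 * N)\<^sup>2"
    using N by (intro self_le_power) auto
  finally have c: "norm c \<le> 1 + s\<^sup>2 * N"
    by (rule power2_le_imp_le) (use N in simp)
  have e1: "e / (1 + e) < 1" using e by simp
  have "s\<^sup>2 * N = \<rho> * (t * s * N)"
    using t by (simp add: \<rho>_def power2_eq_square)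
  also have "\<dots> \<le> \<rho> * (e / (1 + e))"
    using sN \<rho> by (intro mult_left_mono) auto
  finally have c': "norm c \<le> 1 + \<rho> * (e / (1 + e))" using c by linarith
  have lt: "\<rho> * (e / (1 + e)) < \<rho>" using \<rho> e1 e by (simp add: field_simps)
  define b where "b = (1 / (1 + \<rho>)) *\<^sub>R c"
  have nb: "norm b = norm c / (1 + \<rho>)" using \<rho> by (simp add: b_def)
  have b1: "norm b < 1" using order_le_less_trans[OF c'] lt \<rho> unfolding nb by auto
  then obtain y where y: "(1 - b) * y = 1" "y * (1 - b) = 1"
    using neumann by (auto simp: inv_elt_def)
  define w where "w = 1 + (\<i> * of_real t) *\<^sub>C j"
  have cw: "(1 + \<rho>) *\<^sub>R 1 - c = \<rho> *\<^sub>R w"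
    using t by (simp add: w_def c_def scaleC_add_left scaleC_add_right scaleC_scaleC \<rho>_def mult.commute
        flip: scaleC_of_real)
  have "1 - b = (1 / (1 + \<rho>)) *\<^sub>R ((1 + \<rho>) *\<^sub>R 1 - c)"
    using \<rho> by (simp add: b_def scaleR_diff_right)
  then have wb: "1 - b = (\<rho> / (1 + \<rho>)) *\<^sub>R w"
    unfolding cw by simp
  define v where "v = (\<rho> / (1 + \<rho>)) *\<^sub>R y"
  have "norm y \<le> norm (1::'a) / (1 - norm b)" by (rule norm_inverse_le[OF y(1) b1])
  also have "\<dots> \<le> 1 / (1 - norm b)"
    using b1 norm_one by (intro divide_right_mono) auto
  finally have "norm v \<le> (\<rho> / (1 + \<rho>)) * (1 / (1 - norm b))"
    unfolding v_def norm_scaleR using \<rho> by (intro mult_mono) auto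
  also have "\<dots> = \<rho> / (1 + \<rho> - norm c)"
  proof -
    have "1 - norm b = (1 + \<rho> - norm c) / (1 + \<rho>)"
      using \<rho> by (simp add: nb diff_divide_distrib)
    then show ?thesis using \<rho> by simp
  qed
  also have "\<dots> \<le> \<rho> / (\<rho> - \<rho> * (e / (1 + e)))"
    using c' lt \<rho> by (intro divide_left_mono) auto
  also have "\<dots> = 1 + e"
    using \<rho> e by (simp add: field_simps)
  finally have "norm v \<le> 1 + e" .
  moreover have "w * v = 1" "v * w = 1"
    using y by (simp_all add: wb v_def)
  ultimately show ?thesis
    using that by (simp add: w_def)
qed

text \<open>
  The quotient norm of a C*-algebra satisfies the C*-identity. The element \<open>v = (1 + \<i> t g)\<^sup>-\<^sup>1\<close>, for
  the self-adjoint part \<open>g\<close> of \<open>j\<close>, is congruent to 1 modulo the ideal and plays the role of \<open>1 - e\<close> for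
  an approximate unit \<open>e\<close>: it makes \<open>g v\<close> small, so
  \<open>\<parallel>a v\<parallel>\<^sup>2 = \<parallel>v\<^sup>* (a\<^sup>* a) v\<parallel>\<close> is close to \<open>\<parallel>v\<^sup>* (a\<^sup>* a + g) v\<parallel>\<close>.
\<close>

lemma quotient_cstar:
  fixes a :: 'a
  assumes I: "\<And>x y. x \<in> I \<Longrightarrow> y * x \<in> I" "\<And>x y. x \<in> I \<Longrightarrow> x * y \<in> I"
      "\<And>x z. x \<in> I \<Longrightarrow> z *\<^sub>C x \<in> I" "\<And>x y. x \<in> I \<Longrightarrow> y \<in> I \<Longrightarrow> x + y \<in> I" "\<And>x. x \<in> I \<Longrightarrow> adj x \<in> I"
    and j: "j \<in> I" "norm (adj a * a + j) \<le> s" and \<epsilon>: "\<epsilon> > 0"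
  obtains k where "k \<in> I" "(norm (a + k))\<^sup>2 \<le> s + \<epsilon>"
proof -
  have s: "s \<ge> 0" using j(2) norm_ge_zero order_trans by blast
  define g where "g = (1 / 2) *\<^sub>R (j + adj j)"
  have g: "adj g = g" by (simp add: g_def adj_add adj_adj add.commute)
  have gI: "g \<in> I"
    using I(3)[OF I(4)[OF j(1) I(5)[OF j(1)]], of "of_real (1 / 2)"] by (simp only: g_def scaleC_of_real)
  have gs: "norm (adj a * a + g) \<le> s"
  proof -
    have "adj a * a + g = (1 / 2) *\<^sub>R ((adj a * a + j) + adj (adj a * a + j))"
      using half_sum[of "adj a * a"] by (simp add: g_def adj_add adj_mult adj_adj scaleR_right_distrib)
    then have "norm (adj a * a + g) \<le> (1 / 2) * (norm (adj a * a + j) + norm (adj (adj a * a + j)))"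
      using norm_triangle_ineq[of "adj a * a + j" "adj (adj a * a + j)"] by simp
    then show ?thesis using j(2) by (simp add: norm_adj)
  qed
  define e where "e = min 1 (\<epsilon> / (3 * s + 1))"
  have "e \<le> \<epsilon> / (3 * s + 1)" by (simp add: e_def)
  then have "e * (3 * s + 1) \<le> \<epsilon>"
    using s by (simp add: pos_le_divide_eq add_nonneg_pos)
  moreover have "e > 0" "e \<le> 1"
    using s \<epsilon> by (auto simp: e_def add_nonneg_pos)
  ultimately have e: "e > 0" "e \<le> 1" "e * (3 * s + 1) \<le> \<epsilon>" by simp_all
  (* This choice of t makes the error term (1 + e) * norm (g * v) at most e. *)
  define t where "t = (1 + e) * (2 + e) / e"
  have t: "t > 0" using e by (simp add: t_def)
  obtain v where v: "(1 + (\<i> * of_real t) *\<^sub>C g) * v = 1" "v * (1 + (\<i> * of_real t) *\<^sub>C g) = 1" "norm v \<le> 1 + e"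
    using imaginary_resolvent[OF g t e(1)] by metis
  have gv: "(\<i> * of_real t) *\<^sub>C (g * v) = 1 - v"
    using v(1) by (simp add: distrib_right mult_scaleC_left eq_diff_eq add.commute)
  have "t * norm (g * v) = norm (1 - v)"
    using t unfolding gv[symmetric] by (simp add: norm_scaleC norm_mult)
  also have "\<dots> \<le> 2 + e"
    using norm_triangle_ineq4[of 1 v] norm_one v(3) by linarith
  finally have ngv: "norm (g * v) \<le> (2 + e) / t"
    using t by (simp add: field_simps)
  have "(norm (a * v))\<^sup>2 = norm (adj v * (adj a * a + g) * v - adj v * (g * v))"
    by (simp add: distrib_left distrib_right adj_mult mult.assoc flip: cstar)
  also have "\<dots> \<le> norm (adj v * (adj a * a + g) * v) + norm (adj v * (g * v))"
    by (rule norm_triangle_ineq4)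
  also have "norm (adj v * (adj a * a + g) * v) \<le> norm (adj v) * norm (adj a * a + g) * norm v"
    by (meson mult_right_mono norm_ge_zero norm_mult_ineq order_trans)
  also have "\<dots> \<le> (1 + e) * s * (1 + e)"
    using gs v(3) e s by (intro mult_mono) (auto simp: norm_adj)
  also have "norm (adj v * (g * v)) \<le> norm (adj v) * norm (g * v)"
    by (rule norm_mult_ineq)
  also have "\<dots> \<le> (1 + e) * ((2 + e) / t)"
    using ngv v(3) e by (intro mult_mono) (auto simp: norm_adj)
  also have "(1 + e) * ((2 + e) / t) = e"
  proof -
    have "(1 + e) * (2 + e) = e * t" using e by (simp add: t_def)
    then show ?thesis using t by simp
  qed
  also have "(1 + e) * s * (1 + e) + e \<le> s + e * (3 * s + 1)"
  proof -
    have "e * e * s \<le> 1 * e * s" using e s by (intro mult_right_mono) auto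
    then show ?thesis by (simp add: algebra_simps)
  qed
  also have "\<dots> \<le> s + \<epsilon>" using e by simp
  finally have "(norm (a * v))\<^sup>2 \<le> s + \<epsilon>" by simp
  moreover have "a * v = a + (- 1) *\<^sub>C (a * ((\<i> * of_real t) *\<^sub>C (g * v)))"
    unfolding gv by (simp add: right_diff_distrib)
  moreover have "(- 1) *\<^sub>C (a * ((\<i> * of_real t) *\<^sub>C (g * v))) \<in> I"
    by (intro I(1,2,3) gI)
  ultimately show ?thesis using that by metis
qed

lemma hermitian:
  assumes h: "adj h = (h::'a)" and z: "Im z \<noteq> 0"
  shows "inv_elt (z *\<^sub>C 1 - h)"
proof (rule hermitian_if_i_resolvent[OF _ h z])
  fix g :: 'a assume "adj g = g"
  then obtain v where "(1 + (\<i> * of_real 1) *\<^sub>C g) * v = 1" "v * (1 + (\<i> * of_real 1) *\<^sub>C g) = 1"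
    using imaginary_resolvent[of g 1 1] by auto
  then have "inv_elt (1 + \<i> *\<^sub>C g)" by (auto simp: inv_elt_def)
  then have "inv_elt (\<i> *\<^sub>C (1 + \<i> *\<^sub>C g))" by (simp add: inv_elt_scaleC_iff)
  then show "inv_elt (\<i> *\<^sub>C 1 - g)" by (simp add: scaleC_add_right scaleC_scaleC)
qed

lemma square_plus_inv:
  assumes h: "adj h = (h::'a)" and t: "t > 0"
  shows "inv_elt (h * h + t *\<^sub>R 1)"
proof -
  define g where "g = (1 / sqrt t) *\<^sub>R h"
  have g: "adj g = g" by (simp add: g_def h)
  have "inv_elt (1 + g * g)"
    unfolding one_plus_square(1) by (intro inv_elt_mult hermitian g) auto
  then have "inv_elt (t *\<^sub>R (1 + g * g))" using t by (simp add: inv_elt_scaleR_iff)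
  then show ?thesis using t by (simp add: g_def scaleR_right_distrib add.commute)
qed

lemma norm_power_two_power:
  assumes "adj x = (x::'a)"
  shows "norm (x ^ (2 ^ n)) = norm x ^ (2 ^ n)"
proof (induction n)
  case (Suc n)
  have "norm (x ^ (2 ^ Suc n)) = norm (adj (x ^ 2 ^ n) * x ^ 2 ^ n)"
    by (simp add: adj_power assms mult_2 flip: power_add)
  then show ?case
    by (simp add: cstar Suc mult_2 power2_eq_square flip: power_add)
qed simp

lemma power_small_norm_less:
  assumes x: "adj x = (x::'a)" and p: "power_small x"
  shows "norm x < 1"
proof (rule ccontr)
  assume "\<not> norm x < 1"
  then have ge: "norm (x ^ (2 ^ n)) \<ge> 1" for n
    by (simp add: norm_power_two_power[OF x] one_le_power)
  have "eventually (\<lambda>n. norm (x ^ n) < 1) sequentially"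
    using power_small_tendsto[OF p] by (rule order_tendstoD) simp
  then obtain N where N: "\<And>n. n \<ge> N \<Longrightarrow> norm (x ^ n) < 1" by (auto simp: eventually_sequentially)
  have "N \<le> 2 ^ N" by simp
  from N[OF this] ge[of N] show False by simp
qed

text \<open>
  For a self-adjoint element of a C*-algebra the norm is the spectral radius, so it can be read off from
  the real resolvent set.
\<close>

lemma selfadjoint_norm_le:
  assumes m: "adj m = (m::'a)" and c: "c \<ge> 0"
    and inv: "\<And>r. r > c \<or> r < - c \<Longrightarrow> inv_elt (r *\<^sub>R 1 - m)"
  shows "norm m \<le> c"
proof (rule field_le_epsilon)
  fix e :: real assume e: "e > 0"
  define d where "d = c + e"
  have d: "d > c" "d > 0" using e c by (simp_all add: d_def)
  have "power_small ((1 / d) *\<^sub>R m)"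
  proof (rule spectral_radius)
    fix z :: complex assume z: "cmod z \<le> 1"
    show "inv_elt (1 - z *\<^sub>C (1 / d) *\<^sub>R m)"
    proof (cases "z = 0")
      case False
      define u where "u = d / z"
      have "inv_elt (u *\<^sub>C 1 - m)"
      proof (cases "Im u = 0")
        case True
        then have u: "u = of_real (Re u)" by (simp add: complex_eq_iff)
        have "cmod u * cmod z = d" using False d by (simp add: u_def norm_divide)
        then have "cmod u \<ge> d" using z False d by (metis mult_left_le norm_ge_zero)
        then have "\<bar>Re u\<bar> \<ge> d" using u by (metis norm_of_real)
        then have "inv_elt (Re u *\<^sub>R 1 - m)" using d by (intro inv) auto
        then show ?thesis using u by (metis scaleC_of_real)
      qed (rule hermitian[OF m])
      then have "inv_elt ((z / d) *\<^sub>C (u *\<^sub>C 1 - m))"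
        using False d by (simp add: inv_elt_scaleC_iff)
      then show ?thesis
        using False d by (simp add: u_def scaleC_diff_right scaleC_scaleC flip: scaleC_of_real)
    qed (simp add: inv_elt_one)
  qed
  then have "norm ((1 / d) *\<^sub>R m) < 1"
    by (rule power_small_norm_less[rotated]) (simp add: m)
  then show "norm m \<le> c + e" using d by (simp add: d_def)
qed

lemma norm_one_minus_square:
  assumes y: "adj y = (y::'a)" "norm y \<le> 1"
  shows "norm (1 - y * y) \<le> 1"
proof (rule selfadjoint_norm_le)
  show "adj (1 - y * y) = 1 - y * y" by (simp add: adj_diff adj_mult y)
  fix r :: real assume "r > 1 \<or> r < - 1"
  then show "inv_elt (r *\<^sub>R 1 - (1 - y * y))"
  proof
    assume "r > 1"
    then have "inv_elt (y * y + (r - 1) *\<^sub>R 1)" by (intro square_plus_inv y) auto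
    then show ?thesis by (simp add: scaleR_left_diff_distrib algebra_simps)
  next
    assume r: "r < - 1"
    have "norm (y * y) \<le> 1 * 1"
      using norm_mult_ineq[of y y] y by (meson mult_mono norm_ge_zero order_trans zero_le_one)
    then have "inv_elt (- ((1 - r) *\<^sub>R 1 - y * y))"
      unfolding inv_elt_minus using r by (intro neumann_scaleR) auto
    then show ?thesis by (simp add: scaleR_left_diff_distrib algebra_simps)
  qed
qed simp

text \<open>
  The element \<open>g\<close> is \<open>R (1 - (1 - (y / R)\<^sup>2))\<^sup>1\<^sup>/\<^sup>2\<close>, the absolute value of \<open>y\<close>. The last clause encodes its
  positivity.
\<close>

lemma absolute_value_exists:
  assumes y: "adj y = (y::'a)" "norm y \<le> R" and R: "R > 0"
  obtains g where "adj g = g" "g * g = y * y" "g * y = y * g" "norm (R *\<^sub>R 1 - g) \<le> R"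
proof -
  define x where "x = 1 - ((1 / R) *\<^sub>R y) * ((1 / R) *\<^sub>R y)"
  have "norm x \<le> 1"
    unfolding x_def using y R by (intro norm_one_minus_square) auto
  moreover have "adj x = x" "y * x = x * y"
    unfolding x_def using y by (simp_all add: adj_diff adj_mult left_diff_distrib right_diff_distrib mult.assoc)
  ultimately have x: "norm x \<le> 1" "adj x = x" "y * x = x * y" by simp_all
  have "norm (x ^ k) \<le> 1" if "k \<ge> 1" for k
    using norm_power_le[of x "k - 1"] that power_le_one[OF norm_ge_zero x(1), of k] by simp
  then obtain w where w: "(1 - w) * (1 - w) = 1 - x" "norm w \<le> 1" "\<And>z. z * x = x * z \<Longrightarrow> z * w = w * z"
      "adj x = x \<Longrightarrow> adj w = w"
    by (rule square_root_exists) blast+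
  show ?thesis
  proof (rule that)
    show "adj (R *\<^sub>R (1 - w)) = R *\<^sub>R (1 - w)" using w x by (simp add: adj_diff)
    show "(R *\<^sub>R (1 - w)) * (R *\<^sub>R (1 - w)) = y * y" using R by (simp add: w x_def)
    show "(R *\<^sub>R (1 - w)) * y = y * (R *\<^sub>R (1 - w))"
      using w(3)[OF x(3)] by (simp add: left_diff_distrib right_diff_distrib)
    show "norm (R *\<^sub>R 1 - R *\<^sub>R (1 - w)) \<le> R"
      using R w(2) by (simp add: scaleR_diff_right)
  qed
qed

text \<open>
  The element \<open>k\<close> is the positive part of \<open>h\<^sup>2 - c\<close>. Cutting \<open>h\<^sup>2\<close> off at the level \<open>c\<close> does not change it
  modulo the kernel of \<open>q\<close>, because \<open>q\<close> sees \<open>h\<^sup>2\<close> as an element of norm less than \<open>c\<close>.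
\<close>

lemma square_truncation:
  fixes q :: "'a \<Rightarrow> real"
  assumes q: "\<And>x. 0 \<le> q x" "\<And>x. q x \<le> norm x" "\<And>x y. q (x * y) \<le> q x * q y"
    and h: "adj h = h" and c: "(q h)\<^sup>2 < c"
  obtains k where "q k = 0" "norm (h * h - k) \<le> c"
proof -
  have c0: "c > 0" using c by (meson le_less_trans zero_le_power2)
  define x where "x = h * h"
  define y where "y = x - c *\<^sub>R 1"
  define R where "R = norm y + 1"
  have R: "R > 0" "norm y \<le> R" by (simp_all add: R_def add_nonneg_pos)
  have xa: "adj x = x" and ya: "adj y = y" by (simp_all add: x_def y_def adj_diff adj_mult h)
  obtain g where g: "adj g = g" "g * g = y * y" "g * y = y * g" "norm (R *\<^sub>R 1 - g) \<le> R"
    using absolute_value_exists[OF ya R(2,1)] by metis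
  have g_plus: "inv_elt (g + t *\<^sub>R 1)" if "t > 0" for t
  proof -
    have "inv_elt ((R + t) *\<^sub>R 1 - (R *\<^sub>R 1 - g))"
      using g(4) that by (intro neumann_scaleR) auto
    then show ?thesis by (simp add: scaleR_left_distrib add.commute)
  qed
  (* The positive and the negative part of y = h^2 - c. *)
  define p where "p = (1 / 2) *\<^sub>R (g + y)"
  define n where "n = (1 / 2) *\<^sub>R (g - y)"
  have pn: "p * n = 0" "n * p = 0"
    by (simp_all add: p_def n_def left_diff_distrib right_diff_distrib distrib_left distrib_right g
        scaleR_right_distrib scaleR_diff_right)
  have gpn: "g = p + n" "y = p - n"
    by (simp_all add: p_def n_def flip: scaleR_right_distrib scaleR_right_diff_distrib)
  have xy: "x = y + c *\<^sub>R 1" by (simp add: y_def)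
  (* On the range of p, y agrees with g, so that (g + c) p = h^2 p; the inverse of g + c has norm
     at most 1 / c while q (h^2) < c. *)
  have "q p = 0"
  proof -
    have e: "(g + c *\<^sub>R 1) * p = x * p"
      unfolding xy gpn(1) gpn(2) by (simp add: distrib_right left_diff_distrib pn)
    define b where "b = (1 / (R + c)) *\<^sub>R (R *\<^sub>R 1 - g)"
    have nb: "norm b \<le> R / (R + c)"
      using g(4) R c0 by (simp add: b_def divide_right_mono)
    have lt: "R / (R + c) < 1" using R c0 by simp
    have gb: "1 - b = (1 / (R + c)) *\<^sub>R (g + c *\<^sub>R 1)"
    proof -
      have "1 - b = (1 / (R + c)) *\<^sub>R ((R + c) *\<^sub>R 1 - (R *\<^sub>R 1 - g))"
        using R c0 by (simp add: b_def scaleR_diff_right)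
      then show ?thesis by (simp add: scaleR_left_distrib add.commute)
    qed
    obtain z where z: "(1 - b) * z = 1" "z * (1 - b) = 1"
      using neumann[of b] nb lt by (auto simp: inv_elt_def)
    have "norm z \<le> norm (1::'a) / (1 - norm b)"
      using nb lt by (intro norm_inverse_le[OF z(1)]) auto
    also have "\<dots> \<le> 1 / (1 - R / (R + c))"
      using nb lt norm_one by (intro frac_le) auto
    also have "\<dots> = (R + c) / c" using R c0 by (simp add: field_simps)
    finally have nz: "norm z \<le> (R + c) / c" .
    define v where "v = (1 / (R + c)) *\<^sub>R z"
    have v: "v * (g + c *\<^sub>R 1) = 1" using z(2) by (simp add: v_def gb)
    have "norm v \<le> 1 / (R + c) * ((R + c) / c)"
      unfolding v_def norm_scaleR using nz R c0 by (intro mult_mono) auto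
    also have "\<dots> = 1 / c" using R c0 by simp
    finally have nv: "q v \<le> 1 / c" using q(2)[of v] by linarith
    have "p = v * ((g + c *\<^sub>R 1) * p)" using v by (simp flip: mult.assoc)
    then have "p = v * (x * p)" by (simp only: e)
    then have "q p \<le> q v * q (x * p)" using q(3)[of v "x * p"] by simp
    also have "\<dots> \<le> (1 / c) * ((q h)\<^sup>2 * q p)"
    proof (intro mult_mono nv)
      have "q (x * p) \<le> q x * q p" by (rule q)
      also have "\<dots> \<le> (q h)\<^sup>2 * q p"
        using q(3)[of h h] q(1)[of p] by (intro mult_right_mono) (auto simp: x_def power2_eq_square)
      finally show "q (x * p) \<le> (q h)\<^sup>2 * q p" .
    qed (use q c0 in auto)
    finally have "c * q p \<le> (q h)\<^sup>2 * q p" using c0 by (simp add: field_simps)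
    then have "(c - (q h)\<^sup>2) * q p \<le> 0" by (simp add: algebra_simps)
    then show ?thesis using c q(1)[of p] by (simp add: mult_le_0_iff)
  qed
  moreover have "norm (x - p) \<le> c"
  proof (rule selfadjoint_norm_le)
    show "adj (x - p) = x - p" by (simp add: adj_diff adj_add xa p_def ya g)
    have m: "x - p = c *\<^sub>R 1 - n" unfolding xy gpn(2) by simp
    fix r :: real assume "r > c \<or> r < - c"
    then show "inv_elt (r *\<^sub>R 1 - (x - p))"
    proof
      assume r: "r > c"
      define t where "t = r - c"
      have t: "t > 0" using r by (simp add: t_def)
      have e: "(n + t *\<^sub>R 1) * (p + t *\<^sub>R 1) = t *\<^sub>R (g + t *\<^sub>R 1)"
          "(p + t *\<^sub>R 1) * (n + t *\<^sub>R 1) = t *\<^sub>R (g + t *\<^sub>R 1)"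
        by (simp_all add: gpn(1) distrib_left distrib_right pn scaleR_right_distrib add_ac)
      have "inv_elt ((n + t *\<^sub>R 1) * (p + t *\<^sub>R 1))"
        unfolding e using t g_plus[OF t] by (simp add: inv_elt_scaleR_iff)
      then have "inv_elt (n + t *\<^sub>R 1)" by (rule inv_elt_factor) (simp only: e)
      then show ?thesis unfolding m by (simp add: t_def scaleR_left_diff_distrib algebra_simps)
    next
      assume r: "r < - c"
      define d where "d = c - r"
      have d: "d > 0" using r c0 by (simp add: d_def)
      have e: "(d *\<^sub>R 1 - n) * (d *\<^sub>R 1 + p) = d *\<^sub>R (y + d *\<^sub>R 1)"
          "(d *\<^sub>R 1 + p) * (d *\<^sub>R 1 - n) = d *\<^sub>R (y + d *\<^sub>R 1)"
        by (simp_all add: gpn(2) distrib_left distrib_right left_diff_distrib right_diff_distrib pn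
            scaleR_right_distrib scaleR_diff_right algebra_simps)
      have "inv_elt (x + (- r) *\<^sub>R 1)"
        unfolding x_def using r c0 by (intro square_plus_inv h) auto
      also have "x + (- r) *\<^sub>R 1 = y + d *\<^sub>R 1"
        by (simp add: y_def d_def scaleR_left_diff_distrib)
      finally have "inv_elt ((d *\<^sub>R 1 - n) * (d *\<^sub>R 1 + p))"
        unfolding e using d by (simp add: inv_elt_scaleR_iff)
      then have "inv_elt (d *\<^sub>R 1 - n)" by (rule inv_elt_factor) (simp only: e)
      then have "inv_elt (- (d *\<^sub>R 1 - n))" by (simp only: inv_elt_minus)
      then show ?thesis unfolding m by (simp add: d_def scaleR_left_diff_distrib algebra_simps)
    qed
  qed (use c0 in simp)
  ultimately show ?thesis using that by (simp add: x_def)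
qed

text \<open>
  Injective *-homomorphisms of C*-algebras are isometric, stated for seminorms. For the square of the
  self-adjoint element \<open>a\<^sup>* a\<close> the lift is a truncation; two applications of the C*-identity of the
  quotient norm descend from \<open>(a\<^sup>* a)\<^sup>2\<close> to \<open>a\<^sup>* a\<close> and then to \<open>a\<close>.
\<close>

lemma cstar_seminorm_is_quotient_norm:
  fixes q :: "'a \<Rightarrow> real"
  assumes q: "\<And>x. 0 \<le> q x" "\<And>x. q x \<le> norm x" "\<And>x y. q (x * y) \<le> q x * q y"
      "\<And>x y. q (x + y) \<le> q x + q y" "\<And>x z. q (z *\<^sub>C x) = cmod z * q x" "\<And>x. q (adj x * x) = (q x)\<^sup>2"
    and r: "q a < r"
  obtains k where "q k = 0" "norm (a - k) \<le> r"
proof -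
  have z: "q x = 0" if "q x \<le> 0" for x using q(1)[of x] that by simp
  define K where "K = {k. q k = 0}"
  have K: "\<And>x y. x \<in> K \<Longrightarrow> y * x \<in> K" "\<And>x y. x \<in> K \<Longrightarrow> x * y \<in> K"
      "\<And>x z. x \<in> K \<Longrightarrow> z *\<^sub>C x \<in> K" "\<And>x y. x \<in> K \<Longrightarrow> y \<in> K \<Longrightarrow> x + y \<in> K"
  proof -
    fix x y :: 'a and w :: complex
    assume x: "x \<in> K"
    then have x0: "q x = 0" by (simp add: K_def)
    show "y * x \<in> K" "x * y \<in> K" "w *\<^sub>C x \<in> K"
      using q(3)[of y x] q(3)[of x y] q(5)[of w x] by (simp_all add: K_def z x0)
    assume "y \<in> K"
    then show "x + y \<in> K" using q(4)[of x y] by (simp add: K_def z x0)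
  qed
  have K5: "adj x \<in> K" if "x \<in> K" for x
  proof -
    have "(q (adj x))\<^sup>2 = q (x * adj x)" using q(6)[of "adj x"] by (simp add: adj_adj)
    also have "\<dots> = 0" using K(2)[OF that, of "adj x"] by (simp add: K_def)
    finally show ?thesis by (simp add: K_def)
  qed
  define s where "s = (q a + r) / 2"
  have s: "q a < s" "s < r" "s > 0" using r q(1)[of a] by (simp_all add: s_def)
  define x where "x = adj a * a"
  have x: "adj x = x" by (simp add: x_def adj_mult adj_adj)
  have qx: "q x = (q a)\<^sup>2" by (simp add: x_def q)
  define t where "t = (q a + s) / 2"
  have t: "q a < t" "t < s" "t > 0" using s q(1)[of a] by (simp_all add: t_def)
  have "q x < t\<^sup>2" unfolding qx using t q(1)[of a] by (intro power_strict_mono) auto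
  then have "(q x)\<^sup>2 < (t\<^sup>2)\<^sup>2" using q(1)[of x] by (intro power_strict_mono) auto
  then obtain k where k: "q k = 0" "norm (x * x - k) \<le> (t\<^sup>2)\<^sup>2"
    using square_truncation[OF q(1-3) x] by metis
  have kK: "(- 1) *\<^sub>C k \<in> K" using k by (intro K) (simp add: K_def)
  have kn: "norm (adj x * x + (- 1) *\<^sub>C k) \<le> (t\<^sup>2)\<^sup>2" using k by (simp add: x)
  have "t\<^sup>2 < s\<^sup>2" using t by (intro power_strict_mono) auto
  then have st: "(s\<^sup>2)\<^sup>2 - (t\<^sup>2)\<^sup>2 > 0" using t by (simp add: power_strict_mono)
  obtain l where l: "l \<in> K" "(norm (x + l))\<^sup>2 \<le> (t\<^sup>2)\<^sup>2 + ((s\<^sup>2)\<^sup>2 - (t\<^sup>2)\<^sup>2)"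
    by (rule quotient_cstar[OF K K5 kK kn st])
  then have l2: "(norm (x + l))\<^sup>2 \<le> (s\<^sup>2)\<^sup>2" by simp
  have ln: "norm (adj a * a + l) \<le> s\<^sup>2"
    using power2_le_imp_le[OF l2] by (simp add: x_def)
  have rs: "r\<^sup>2 - s\<^sup>2 > 0" using s by (simp add: power_strict_mono)
  obtain m where m: "m \<in> K" "(norm (a + m))\<^sup>2 \<le> s\<^sup>2 + (r\<^sup>2 - s\<^sup>2)"
    by (rule quotient_cstar[OF K K5 l(1) ln rs])
  then have m2: "(norm (a + m))\<^sup>2 \<le> r\<^sup>2" by simp
  show ?thesis
  proof (rule that)
    show "q ((- 1) *\<^sub>C m) = 0" using m K(3)[of m "-1"] by (simp add: K_def)
    show "norm (a - (- 1) *\<^sub>C m) \<le> r"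
      using power2_le_imp_le[OF m2] s by simp
  qed
qed

end

section \<open>Unital Banach *-algebras presented by records\<close>

locale unital_banach = banach_star_algebra A + monoid A for A :: "('a, 'm) star_algebra_scheme" (structure)
begin

lemma additive_group: "abelian_group A"
  by unfold_locales

sublocale ring A
  by (rule ringI[OF additive_group]) (auto simp: distrib_left distrib_right monoid_axioms)

lemma scale_closed [simp]: "a \<in> carrier A \<Longrightarrow> z \<odot> a \<in> carrier A"
  by (rule smult_closed) (auto simp: ring_of_type_algebra_def)

lemma scale_l_distr: "a \<in> carrier A \<Longrightarrow> (z + w) \<odot> a = z \<odot> a \<oplus> w \<odot> a"
  using smult_l_distr[of z w a] by (simp add: ring_of_type_algebra_def)

lemma scale_r_distr: "a \<in> carrier A \<Longrightarrow> b \<in> carrier A \<Longrightarrow> z \<odot> (a \<oplus> b) = z \<odot> a \<oplus> z \<odot> b"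
  using smult_r_distr[of z a b] by (simp add: ring_of_type_algebra_def)

lemma scale_assoc: "a \<in> carrier A \<Longrightarrow> (z * w) \<odot> a = z \<odot> (w \<odot> a)"
  using smult_assoc1[of z w a] by (simp add: ring_of_type_algebra_def)

lemma scale_one [simp]: "a \<in> carrier A \<Longrightarrow> 1 \<odot> a = a"
  using smult_one[of a] by (simp add: ring_of_type_algebra_def)

lemma scale_zero [simp]: "a \<in> carrier A \<Longrightarrow> 0 \<odot> a = \<zero>"
  using scale_l_distr[of a 0 0] by (metis add.l_cancel_one add_0 scale_closed)

lemma scale_minus1: "a \<in> carrier A \<Longrightarrow> (-1) \<odot> a = \<ominus> a"
  using scale_l_distr[of a "-1" 1] by (metis add.inv_unique' add.left_inverse scale_closed scale_one scale_zero minus_equality)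

lemma nrm_zero [simp]: "\<parallel>\<zero>\<parallel> = 0"
  by (simp add: nrm_eq_0_iff)

lemma nrm_uminus [simp]: "a \<in> carrier A \<Longrightarrow> \<parallel>\<ominus> a\<parallel> = \<parallel>a\<parallel>"
  using nrm_smult[of a "-1"] by (simp add: scale_minus1)

lemma nrm_nonneg [simp]: "a \<in> carrier A \<Longrightarrow> 0 \<le> \<parallel>a\<parallel>"
  using nrm_triangle[of a "\<ominus> a"] by (simp add: r_neg)

lemma nrm_minus_commute: "a \<in> carrier A \<Longrightarrow> b \<in> carrier A \<Longrightarrow> \<parallel>a \<ominus> b\<parallel> = \<parallel>b \<ominus> a\<parallel>"
  using nrm_uminus[of "b \<ominus> a"] by (simp add: minus_eq minus_add a_comm)

lemma nrm_triangle_minus: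
  "a \<in> carrier A \<Longrightarrow> b \<in> carrier A \<Longrightarrow> c \<in> carrier A \<Longrightarrow> \<parallel>a \<ominus> c\<parallel> \<le> \<parallel>a \<ominus> b\<parallel> + \<parallel>b \<ominus> c\<parallel>"
proof -
  assume a: "a \<in> carrier A" "b \<in> carrier A" "c \<in> carrier A"
  have "a \<ominus> c = (a \<ominus> b) \<oplus> (b \<ominus> c)"
    using a by (simp add: minus_eq a_assoc) (simp add: l_neg flip: a_assoc)
  then show ?thesis using nrm_triangle[of "a \<ominus> b" "b \<ominus> c"] a by simp
qed

sublocale M: Metric_space "carrier A" "nrm_dist A"
proof
  show "0 \<le> nrm_dist A x y" for x y by (simp add: nrm_dist_def)
  show "nrm_dist A x y = nrm_dist A y x" for x y by (simp add: nrm_dist_def nrm_minus_commute)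
  show "(nrm_dist A x y = 0) = (x = y)" if "x \<in> carrier A" "y \<in> carrier A" for x y
    using that by (auto simp: nrm_dist_def nrm_eq_0_iff)
  show "nrm_dist A x z \<le> nrm_dist A x y + nrm_dist A y z"
    if "x \<in> carrier A" "y \<in> carrier A" "z \<in> carrier A" for x y z
    using that by (simp add: nrm_dist_def nrm_triangle_minus)
qed

lemma limit_iff:
  "limitin (nrm_topology A) f l F \<longleftrightarrow>
     l \<in> carrier A \<and> (\<forall>e>0. eventually (\<lambda>n. f n \<in> carrier A \<and> \<parallel>f n \<ominus> l\<parallel> < e) F)"
proof -
  have "l \<in> carrier A \<Longrightarrow> (f n \<in> carrier A \<and> nrm_dist A (f n) l < e) = (f n \<in> carrier A \<and> \<parallel>f n \<ominus> l\<parallel> < e)" for n e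
    by (auto simp: nrm_dist_def)
  then show ?thesis
    unfolding nrm_topology_def M.limitin_metric by auto
qed

lemma complete_sequences:
  fixes f :: "nat \<Rightarrow> 'a"
  assumes "\<And>n. f n \<in> carrier A"
    and "\<And>e. e > 0 \<Longrightarrow> \<exists>N. \<forall>m\<ge>N. \<forall>n\<ge>N. \<parallel>f m \<ominus> f n\<parallel> < e"
  obtains l where "l \<in> carrier A" "\<forall>e>0. \<exists>N. \<forall>n\<ge>N. \<parallel>f n \<ominus> l\<parallel> < e"
proof -
  have "M.MCauchy f"
    using assms unfolding M.MCauchy_def by (auto simp: nrm_dist_def)
  then obtain l where "limitin M.mtopology f l sequentially"
    using complete by (auto simp: M.mcomplete_def)
  then have l: "limitin (nrm_topology A) f l sequentially"
    by (simp add: nrm_topology_def)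
  show ?thesis
    by (rule that[of l]) (use l assms(1) in \<open>auto simp: limit_iff eventually_sequentially\<close>)
qed

end

text \<open>
  The next four definitions restate, for one algebra presented by a record, the results on type classes
  that are used below. Being properties of a record they can be transferred.
\<close>

definition seminorm_detects_small_powers :: "('a, 'm) star_algebra_scheme \<Rightarrow> bool" where
  "seminorm_detects_small_powers R \<longleftrightarrow>
    ((\<forall>k\<in>carrier R. \<one>\<^bsub>R\<^esub> \<oplus>\<^bsub>R\<^esub> k\<^sup>\<star>\<^bsub>R\<^esub> \<otimes>\<^bsub>R\<^esub> k \<in> Units R) \<longrightarrow>
     (\<exists>p. cstar_seminorm R p \<and> (\<forall>u\<in>carrier R. p u < 1 \<longrightarrow> (\<exists>n\<ge>1. \<parallel>u [^]\<^bsub>R\<^esub> (n::nat)\<parallel>\<^bsub>R\<^esub> < 1))))"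

definition quotient_norms_are_cstar :: "('a, 'm) star_algebra_scheme \<Rightarrow> bool" where
  "quotient_norms_are_cstar R \<longleftrightarrow>
    ((\<forall>a\<in>carrier R. \<parallel>a\<^sup>\<star>\<^bsub>R\<^esub> \<otimes>\<^bsub>R\<^esub> a\<parallel>\<^bsub>R\<^esub> = \<parallel>a\<parallel>\<^bsub>R\<^esub>\<^sup>2) \<longrightarrow>
     (\<forall>I a j s e. I \<subseteq> carrier R \<and> (\<forall>x\<in>I. \<forall>y\<in>carrier R. y \<otimes>\<^bsub>R\<^esub> x \<in> I \<and> x \<otimes>\<^bsub>R\<^esub> y \<in> I)
       \<and> (\<forall>x\<in>I. \<forall>z. z \<odot>\<^bsub>R\<^esub> x \<in> I) \<and> (\<forall>x\<in>I. \<forall>y\<in>I. x \<oplus>\<^bsub>R\<^esub> y \<in> I) \<and> (\<forall>x\<in>I. x\<^sup>\<star>\<^bsub>R\<^esub> \<in> I)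
       \<and> a \<in> carrier R \<and> j \<in> I \<and> \<parallel>a\<^sup>\<star>\<^bsub>R\<^esub> \<otimes>\<^bsub>R\<^esub> a \<oplus>\<^bsub>R\<^esub> j\<parallel>\<^bsub>R\<^esub> \<le> s \<and> e > 0
       \<longrightarrow> (\<exists>k\<in>I. \<parallel>a \<oplus>\<^bsub>R\<^esub> k\<parallel>\<^bsub>R\<^esub>\<^sup>2 \<le> s + e)))"

definition cstar_seminorms_are_quotient_norms :: "('a, 'm) star_algebra_scheme \<Rightarrow> bool" where
  "cstar_seminorms_are_quotient_norms R \<longleftrightarrow>
    ((\<forall>a\<in>carrier R. \<parallel>a\<^sup>\<star>\<^bsub>R\<^esub> \<otimes>\<^bsub>R\<^esub> a\<parallel>\<^bsub>R\<^esub> = \<parallel>a\<parallel>\<^bsub>R\<^esub>\<^sup>2) \<longrightarrow>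
     (\<forall>q a r. cstar_seminorm R q \<and> a \<in> carrier R \<and> q a < r
       \<longrightarrow> (\<exists>k\<in>carrier R. q k = 0 \<and> \<parallel>a \<ominus>\<^bsub>R\<^esub> k\<parallel>\<^bsub>R\<^esub> \<le> r)))"

definition cstar_seminorms_are_contractive :: "('a, 'm) star_algebra_scheme \<Rightarrow> bool" where
  "cstar_seminorms_are_contractive R \<longleftrightarrow>
     (\<forall>q. (\<forall>a\<in>carrier R. 0 \<le> q a \<and> q (a\<^sup>\<star>\<^bsub>R\<^esub> \<otimes>\<^bsub>R\<^esub> a) = (q a)\<^sup>2) \<and>
       (\<forall>z. \<forall>a\<in>carrier R. q (z \<odot>\<^bsub>R\<^esub> a) = cmod z * q a) \<and>
       (\<forall>a\<in>carrier R. \<forall>b\<in>carrier R. q (a \<oplus>\<^bsub>R\<^esub> b) \<le> q a + q b)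
       \<longrightarrow> (\<forall>a\<in>carrier R. q a \<le> \<parallel>a\<parallel>\<^bsub>R\<^esub>))"

definition transferred_facts :: "('a, 'm) star_algebra_scheme \<Rightarrow> bool" where
  "transferred_facts R \<longleftrightarrow> seminorm_detects_small_powers R \<and> quotient_norms_are_cstar R
     \<and> cstar_seminorms_are_quotient_norms R \<and> cstar_seminorms_are_contractive R"

text \<open>
  Results proved for a type class apply to a type, not to an arbitrary carrier set. The test algebra is
  chosen to be a counterexample to the transferred facts if there is one; its carrier can be made into
  a type. As the facts hold for that type, there is no counterexample.
\<close>

definition test_algebra :: "('a, 'm) star_algebra_scheme" where
  "test_algebra = (SOME R. unital_banach R \<and> (transferred_facts R \<longrightarrow>
     (\<forall>R' :: ('a, 'm) star_algebra_scheme. unital_banach R' \<longrightarrow> transferred_facts R')))"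

lemma zero_algebra_exists: "\<exists>R :: ('a, 'm) star_algebra_scheme. unital_banach R"
proof -
  define R :: "('a, 'm) star_algebra_scheme" where
    "R = \<lparr>carrier = {undefined}, monoid.mult = (\<lambda>x y. undefined), one = undefined, zero = undefined,
      add = (\<lambda>x y. undefined), smult = (\<lambda>z x. undefined), star = (\<lambda>x. undefined), nrm = (\<lambda>x. 0),
      \<dots> = undefined\<rparr>"
  have R: "carrier R = {undefined}" "x \<otimes>\<^bsub>R\<^esub> y = undefined" "\<one>\<^bsub>R\<^esub> = undefined" "\<zero>\<^bsub>R\<^esub> = undefined"
    "x \<oplus>\<^bsub>R\<^esub> y = undefined" "z \<odot>\<^bsub>R\<^esub> x = undefined" "x\<^sup>\<star>\<^bsub>R\<^esub> = undefined" "\<parallel>x\<parallel>\<^bsub>R\<^esub> = 0" for x y z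
    by (simp_all add: R_def)
  have d: "nrm_dist R = (\<lambda>x y. 0)" by (auto simp: nrm_dist_def R fun_eq_iff)
  interpret M: Metric_space "carrier R" "nrm_dist R"
    by unfold_locales (auto simp: R d)
  have "M.mcomplete"
    unfolding M.mcomplete_def
  proof (intro allI impI exI[of _ undefined])
    fix \<sigma> assume "M.MCauchy \<sigma>"
    then show "limitin M.mtopology \<sigma> undefined sequentially"
      unfolding M.limit_metric_sequentially M.MCauchy_def by (auto simp: R d)
  qed
  moreover have "abelian_group R"
    by (rule abelian_groupI) (auto simp: R)
  moreover have "Module.module (ring_of_type_algebra :: complex ring) R"
    by (rule module.intro[OF cring_from_type_algebra \<open>abelian_group R\<close>], unfold_locales) (auto simp: R)
  ultimately have "banach_star_algebra R"
    by (intro banach_star_algebra.intro banach_star_algebra_axioms.intro) (auto simp: R)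
  moreover have "monoid R" by (rule monoidI) (auto simp: R)
  ultimately show ?thesis unfolding unital_banach_def by blast
qed

lemma test_algebra:
  "unital_banach (test_algebra :: ('a, 'm) star_algebra_scheme)"
  "transferred_facts (test_algebra :: ('a, 'm) star_algebra_scheme) \<Longrightarrow> unital_banach R' \<Longrightarrow>
    transferred_facts (R' :: ('a, 'm) star_algebra_scheme)"
proof -
  have "\<exists>R :: ('a, 'm) star_algebra_scheme. unital_banach R \<and> (transferred_facts R \<longrightarrow>
     (\<forall>R' :: ('a, 'm) star_algebra_scheme. unital_banach R' \<longrightarrow> transferred_facts R'))"
    using zero_algebra_exists by blast
  from someI_ex[OF this] show "unital_banach (test_algebra :: ('a, 'm) star_algebra_scheme)"
  "transferred_facts (test_algebra :: ('a, 'm) star_algebra_scheme) \<Longrightarrow> unital_banach R' \<Longrightarrow>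
    transferred_facts (R' :: ('a, 'm) star_algebra_scheme)"
    unfolding test_algebra_def by blast+
qed

interpretation W: unital_banach test_algebra
  by (rule test_algebra)

typedef ('a, 'm) test_element = "carrier (test_algebra :: ('a, 'm) star_algebra_scheme)"
  using W.zero_closed by blast

setup_lifting type_definition_test_element

instantiation test_element :: (type, type) real_normed_vector
begin

lift_definition zero_test_element :: "('a, 'm) test_element" is "\<zero>\<^bsub>(test_algebra :: ('a, 'm) star_algebra_scheme)\<^esub>" by simp
lift_definition plus_test_element :: "('a, 'm) test_element \<Rightarrow> ('a, 'm) test_element \<Rightarrow> ('a, 'm) test_element"
  is "\<lambda>x y. x \<oplus>\<^bsub>(test_algebra :: ('a, 'm) star_algebra_scheme)\<^esub> y" by simp
lift_definition minus_test_element :: "('a, 'm) test_element \<Rightarrow> ('a, 'm) test_element \<Rightarrow> ('a, 'm) test_element"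
  is "\<lambda>x y. x \<ominus>\<^bsub>(test_algebra :: ('a, 'm) star_algebra_scheme)\<^esub> y" by simp
lift_definition uminus_test_element :: "('a, 'm) test_element \<Rightarrow> ('a, 'm) test_element"
  is "\<lambda>x. \<ominus>\<^bsub>(test_algebra :: ('a, 'm) star_algebra_scheme)\<^esub> x" by simp
lift_definition scaleR_test_element :: "real \<Rightarrow> ('a, 'm) test_element \<Rightarrow> ('a, 'm) test_element"
  is "\<lambda>r x. complex_of_real r \<odot>\<^bsub>(test_algebra :: ('a, 'm) star_algebra_scheme)\<^esub> x" by simp
lift_definition norm_test_element :: "('a, 'm) test_element \<Rightarrow> real" is "\<lambda>x. \<parallel>x\<parallel>\<^bsub>(test_algebra :: ('a, 'm) star_algebra_scheme)\<^esub>" .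

definition dist_test_element :: "('a, 'm) test_element \<Rightarrow> ('a, 'm) test_element \<Rightarrow> real" where
  "dist_test_element x y = norm (x - y)"
definition sgn_test_element :: "('a, 'm) test_element \<Rightarrow> ('a, 'm) test_element" where
  "sgn_test_element x = inverse (norm x) *\<^sub>R x"
definition uniformity_test_element :: "(('a, 'm) test_element \<times> ('a, 'm) test_element) filter" where
  "uniformity_test_element = (INF e\<in>{0<..}. principal {(x, y). dist x y < e})"
definition open_test_element :: "('a, 'm) test_element set \<Rightarrow> bool" where
  "open_test_element U = (\<forall>x\<in>U. \<forall>\<^sub>F (x', y) in uniformity. x' = x \<longrightarrow> y \<in> U)"

instance proof
  fix x y z :: "('a, 'm) test_element" and r s :: real
  show "x + y + z = x + (y + z)" by transfer (rule W.a_assoc)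
  show "x + y = y + x" by transfer (rule W.a_comm)
  show "0 + x = x" by transfer simp
  show "- x + x = 0" by transfer (rule W.l_neg)
  show "x - y = x + - y" by transfer (simp add: W.minus_eq)
  show "r *\<^sub>R (x + y) = r *\<^sub>R x + r *\<^sub>R y" by transfer (simp add: W.scale_r_distr)
  show "(r + s) *\<^sub>R x = r *\<^sub>R x + s *\<^sub>R x" by transfer (simp add: W.scale_l_distr)
  show "r *\<^sub>R s *\<^sub>R x = (r * s) *\<^sub>R x" by transfer (simp add: W.scale_assoc)
  show "1 *\<^sub>R x = x" by transfer simp
  show "norm x = 0 \<longleftrightarrow> x = 0" by transfer (rule W.nrm_eq_0_iff)
  show "norm (x + y) \<le> norm x + norm y" by transfer (rule W.nrm_triangle)
  show "norm (r *\<^sub>R x) = \<bar>r\<bar> * norm x" by transfer (simp add: W.nrm_smult)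
qed (rule dist_test_element_def sgn_test_element_def uniformity_test_element_def open_test_element_def)+

end

abbreviation rep :: "('a, 'm) test_element \<Rightarrow> 'a" where
  "rep \<equiv> Rep_test_element"

abbreviation abs_elt :: "'a \<Rightarrow> ('a, 'm) test_element" where
  "abs_elt \<equiv> Abs_test_element"

instance test_element :: (type, type) banach
proof
  fix f :: "nat \<Rightarrow> ('a, 'm) test_element"
  assume f: "Cauchy f"
  let ?R = "test_algebra :: ('a, 'm) star_algebra_scheme"
  have d: "norm (x - y) = \<parallel>rep x \<ominus>\<^bsub>?R\<^esub> rep y\<parallel>\<^bsub>?R\<^esub>" for x y :: "('a, 'm) test_element"
    by (simp add: norm_test_element.rep_eq minus_test_element.rep_eq)
  have c1: "rep (f n) \<in> carrier ?R" for n by (rule Rep_test_element)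
  have c2: "\<exists>N. \<forall>m\<ge>N. \<forall>n\<ge>N. \<parallel>rep (f m) \<ominus>\<^bsub>?R\<^esub> rep (f n)\<parallel>\<^bsub>?R\<^esub> < e" if "e > 0" for e
    using CauchyD[OF f that] by (simp only: d)
  obtain l where l: "l \<in> carrier ?R" "\<forall>e>0. \<exists>N. \<forall>n\<ge>N. \<parallel>rep (f n) \<ominus>\<^bsub>?R\<^esub> l\<parallel>\<^bsub>?R\<^esub> < e"
    by (rule W.complete_sequences[where f = "\<lambda>n. rep (f n)"], rule c1, erule c2)
  obtain l' :: "('a, 'm) test_element" where l': "l = rep l'"
    by (metis l(1) Abs_test_element_inverse)
  have "f \<longlonglongrightarrow> l'"
    unfolding LIMSEQ_iff d using l(2) by (simp add: l')
  then show "convergent f" by (rule convergentI)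
qed

instantiation test_element :: (type, type) banach_star
begin

lift_definition one_test_element :: "('a, 'm) test_element" is "\<one>\<^bsub>(test_algebra :: ('a, 'm) star_algebra_scheme)\<^esub>" by simp
lift_definition times_test_element :: "('a, 'm) test_element \<Rightarrow> ('a, 'm) test_element \<Rightarrow> ('a, 'm) test_element"
  is "\<lambda>x y. x \<otimes>\<^bsub>(test_algebra :: ('a, 'm) star_algebra_scheme)\<^esub> y" by simp
lift_definition scaleC_test_element :: "complex \<Rightarrow> ('a, 'm) test_element \<Rightarrow> ('a, 'm) test_element"
  is "\<lambda>z x. z \<odot>\<^bsub>(test_algebra :: ('a, 'm) star_algebra_scheme)\<^esub> x" by simp
lift_definition adj_test_element :: "('a, 'm) test_element \<Rightarrow> ('a, 'm) test_element"
  is "\<lambda>x. x\<^sup>\<star>\<^bsub>(test_algebra :: ('a, 'm) star_algebra_scheme)\<^esub>" by (rule W.star_closed)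

instance proof
  fix x y z :: "('a, 'm) test_element" and r :: real and a b :: complex
  show "x * y * z = x * (y * z)" by transfer (rule W.m_assoc)
  show "1 * x = x" "x * 1 = x" by (transfer, simp)+
  show "(x + y) * z = x * z + y * z" by transfer (rule W.l_distr)
  show "x * (y + z) = x * y + x * z" by transfer (rule W.r_distr)
  show "r *\<^sub>R x * y = r *\<^sub>R (x * y)" by transfer (rule W.smult_mult_left)
  show "x * r *\<^sub>R y = r *\<^sub>R (x * y)" by transfer (rule W.smult_mult_right)
  show "norm (x * y) \<le> norm x * norm y" by transfer (rule W.nrm_mult)
  show "a *\<^sub>C (x + y) = a *\<^sub>C x + a *\<^sub>C y" by transfer (rule W.scale_r_distr)
  show "(a + b) *\<^sub>C x = a *\<^sub>C x + b *\<^sub>C x" by transfer (rule W.scale_l_distr)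
  show "a *\<^sub>C b *\<^sub>C x = (a * b) *\<^sub>C x" by transfer (simp add: W.scale_assoc)
  show "complex_of_real r *\<^sub>C x = r *\<^sub>R x" by transfer simp
  show "a *\<^sub>C x * y = a *\<^sub>C (x * y)" by transfer (rule W.smult_mult_left)
  show "x * a *\<^sub>C y = a *\<^sub>C (x * y)" by transfer (rule W.smult_mult_right)
  show "norm (a *\<^sub>C x) = cmod a * norm x" by transfer (rule W.nrm_smult)
  show "adj (adj x) = x" by transfer (rule W.star_star)
  show "adj (x + y) = adj x + adj y" by transfer (rule W.star_add)
  show "adj (x * y) = adj y * adj x" by transfer (rule W.star_mult)
  show "adj (a *\<^sub>C x) = cnj a *\<^sub>C adj x" by transfer (rule W.star_smult)
  show "norm (adj x) = norm x" by transfer (rule W.nrm_star)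
qed

end

lemma rep_power: "rep (x ^ n) = rep (x :: ('a, 'm) test_element) [^]\<^bsub>(test_algebra :: ('a, 'm) star_algebra_scheme)\<^esub> n"
  by (induction n) (simp_all add: one_test_element.rep_eq times_test_element.rep_eq power_Suc2 del: power_Suc)

lemma inv_elt_iff: "inv_elt x \<longleftrightarrow> rep (x :: ('a, 'm) test_element) \<in> Units (test_algebra :: ('a, 'm) star_algebra_scheme)"
  unfolding inv_elt_def Units_def by transfer auto

lemmas rep_simps = plus_test_element.rep_eq times_test_element.rep_eq one_test_element.rep_eq
  scaleC_test_element.rep_eq adj_test_element.rep_eq minus_test_element.rep_eq zero_test_element.rep_eq

lemma obtain_rep:
  assumes "a \<in> carrier (test_algebra :: ('a, 'm) star_algebra_scheme)"
  obtains x :: "('a, 'm) test_element" where "a = rep x"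
  by (metis assms Abs_test_element_inverse)

lemma ball_carrier_iff:
  "(\<forall>a\<in>carrier (test_algebra :: ('a, 'm) star_algebra_scheme). P a) \<longleftrightarrow> (\<forall>x :: ('a, 'm) test_element. P (rep x))"
  by (metis Rep_test_element obtain_rep)

lemma cstar_seminorm_rep:
  "cstar_seminorm (test_algebra :: ('a, 'm) star_algebra_scheme) q \<longleftrightarrow>
     (\<forall>x :: ('a, 'm) test_element. 0 \<le> q (rep x) \<and> q (rep x) \<le> norm x \<and> q (rep (adj x * x)) = (q (rep x))\<^sup>2) \<and>
     (\<forall>z. \<forall>x :: ('a, 'm) test_element. q (rep (z *\<^sub>C x)) = cmod z * q (rep x)) \<and>
     (\<forall>x y :: ('a, 'm) test_element. q (rep (x + y)) \<le> q (rep x) + q (rep y) \<and> q (rep (x * y)) \<le> q (rep x) * q (rep y))"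
  unfolding cstar_seminorm_def ball_carrier_iff by (simp add: rep_simps norm_test_element.rep_eq)

lemma test_algebra_facts: "transferred_facts (test_algebra :: ('a, 'm) star_algebra_scheme)"
proof -
  let ?R = "test_algebra :: ('a, 'm) star_algebra_scheme"
  have "seminorm_detects_small_powers ?R"
    unfolding seminorm_detects_small_powers_def
  proof
    assume "\<forall>k\<in>carrier ?R. \<one>\<^bsub>?R\<^esub> \<oplus>\<^bsub>?R\<^esub> k\<^sup>\<star>\<^bsub>?R\<^esub> \<otimes>\<^bsub>?R\<^esub> k \<in> Units ?R"
    then interpret symmetric_star "TYPE(('a, 'm) test_element)"
      by unfold_locales (auto simp: ball_carrier_iff inv_elt_iff rep_simps)
    show "\<exists>p. cstar_seminorm ?R p \<and> (\<forall>u\<in>carrier ?R. p u < 1 \<longrightarrow> (\<exists>n\<ge>1. \<parallel>u [^]\<^bsub>?R\<^esub> (n::nat)\<parallel>\<^bsub>?R\<^esub> < 1))"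
    proof (intro exI conjI)
      show "cstar_seminorm ?R (\<lambda>a. cone_norm (abs_elt a :: ('a, 'm) test_element))"
        by (simp add: cstar_seminorm_rep Rep_test_element_inverse cone_norm_nonneg cone_norm_le_norm
            cone_norm_cstar cone_norm_scaleC cone_norm_add cone_norm_mult)
      show "\<forall>u\<in>carrier ?R. cone_norm (abs_elt u :: ('a, 'm) test_element) < 1 \<longrightarrow>
          (\<exists>n\<ge>1. \<parallel>u [^]\<^bsub>?R\<^esub> (n::nat)\<parallel>\<^bsub>?R\<^esub> < 1)"
        using cone_norm_power_small
        by (auto simp: ball_carrier_iff Rep_test_element_inverse power_small_def norm_test_element.rep_eq rep_power)
    qed
  qed
  moreover have cs: "cstar_star TYPE(('a, 'm) test_element)"
    if "\<forall>a\<in>carrier ?R. \<parallel>a\<^sup>\<star>\<^bsub>?R\<^esub> \<otimes>\<^bsub>?R\<^esub> a\<parallel>\<^bsub>?R\<^esub> = \<parallel>a\<parallel>\<^bsub>?R\<^esub>\<^sup>2"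
    using that by unfold_locales (auto simp: ball_carrier_iff norm_test_element.rep_eq rep_simps)
  have "quotient_norms_are_cstar ?R"
    unfolding quotient_norms_are_cstar_def
  proof (intro impI allI, elim conjE)
    fix I :: "'a set" and a j :: 'a and s e :: real
    assume C: "\<forall>a\<in>carrier ?R. \<parallel>a\<^sup>\<star>\<^bsub>?R\<^esub> \<otimes>\<^bsub>?R\<^esub> a\<parallel>\<^bsub>?R\<^esub> = \<parallel>a\<parallel>\<^bsub>?R\<^esub>\<^sup>2"
      and I: "I \<subseteq> carrier ?R" "\<forall>x\<in>I. \<forall>y\<in>carrier ?R. y \<otimes>\<^bsub>?R\<^esub> x \<in> I \<and> x \<otimes>\<^bsub>?R\<^esub> y \<in> I"
        "\<forall>x\<in>I. \<forall>z. z \<odot>\<^bsub>?R\<^esub> x \<in> I" "\<forall>x\<in>I. \<forall>y\<in>I. x \<oplus>\<^bsub>?R\<^esub> y \<in> I" "\<forall>x\<in>I. x\<^sup>\<star>\<^bsub>?R\<^esub> \<in> I"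
      and a: "a \<in> carrier ?R" and j: "j \<in> I" "\<parallel>a\<^sup>\<star>\<^bsub>?R\<^esub> \<otimes>\<^bsub>?R\<^esub> a \<oplus>\<^bsub>?R\<^esub> j\<parallel>\<^bsub>?R\<^esub> \<le> s" and e: "e > 0"
    interpret cstar_star "TYPE(('a, 'm) test_element)" by (rule cs[OF C])
    obtain a' :: "('a, 'm) test_element" where a': "a = rep a'" by (rule obtain_rep[OF a])
    have jR: "j \<in> carrier ?R" using j(1) I(1) by blast
    obtain j' :: "('a, 'm) test_element" where j': "j = rep j'" by (rule obtain_rep[OF jR])
    define K where "K = {x :: ('a, 'm) test_element. rep x \<in> I}"
    have K: "\<And>x y. x \<in> K \<Longrightarrow> y * x \<in> K" "\<And>x y. x \<in> K \<Longrightarrow> x * y \<in> K" "\<And>x z. x \<in> K \<Longrightarrow> z *\<^sub>C x \<in> K"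
        "\<And>x y. x \<in> K \<Longrightarrow> y \<in> K \<Longrightarrow> x + y \<in> K" "\<And>x. x \<in> K \<Longrightarrow> adj x \<in> K"
      unfolding K_def using I(2-5) by (simp_all add: rep_simps Rep_test_element)
    have j'K: "j' \<in> K" "norm (adj a' * a' + j') \<le> s"
      using j by (simp_all add: K_def a' j' rep_simps norm_test_element.rep_eq)
    obtain k where k: "k \<in> K" "(norm (a' + k))\<^sup>2 \<le> s + e"
      by (rule quotient_cstar[OF K j'K e])
    then show "\<exists>k\<in>I. \<parallel>a \<oplus>\<^bsub>?R\<^esub> k\<parallel>\<^bsub>?R\<^esub>\<^sup>2 \<le> s + e"
      by (intro bexI[of _ "rep k"]) (simp_all add: a' K_def rep_simps norm_test_element.rep_eq)
  qed
  moreover have "cstar_seminorms_are_quotient_norms ?R"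
    unfolding cstar_seminorms_are_quotient_norms_def
  proof (intro impI allI, elim conjE)
    fix q a and r :: real
    assume C: "\<forall>a\<in>carrier ?R. \<parallel>a\<^sup>\<star>\<^bsub>?R\<^esub> \<otimes>\<^bsub>?R\<^esub> a\<parallel>\<^bsub>?R\<^esub> = \<parallel>a\<parallel>\<^bsub>?R\<^esub>\<^sup>2"
      and q: "cstar_seminorm ?R q" and a: "a \<in> carrier ?R" "q a < r"
    interpret cstar_star "TYPE(('a, 'm) test_element)" by (rule cs[OF C])
    obtain a' :: "('a, 'm) test_element" where a': "a = rep a'" by (rule obtain_rep[OF a(1)])
    obtain k :: "('a, 'm) test_element" where "q (rep k) = 0" "norm (a' - k) \<le> r"
      by (rule cstar_seminorm_is_quotient_norm[of "\<lambda>x. q (rep x)" a' r])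
         (use q[unfolded cstar_seminorm_rep] a in \<open>simp_all add: a'\<close>)
    then show "\<exists>k\<in>carrier ?R. q k = 0 \<and> \<parallel>a \<ominus>\<^bsub>?R\<^esub> k\<parallel>\<^bsub>?R\<^esub> \<le> r"
      by (intro bexI[of _ "rep k"]) (simp_all add: a' rep_simps norm_test_element.rep_eq Rep_test_element)
  qed
  moreover have "cstar_seminorms_are_contractive ?R"
    unfolding cstar_seminorms_are_contractive_def
  proof (intro allI impI, elim conjE)
    fix q :: "'a \<Rightarrow> real"
    assume q: "\<forall>a\<in>carrier ?R. 0 \<le> q a \<and> q (a\<^sup>\<star>\<^bsub>?R\<^esub> \<otimes>\<^bsub>?R\<^esub> a) = (q a)\<^sup>2"
       "\<forall>z. \<forall>a\<in>carrier ?R. q (z \<odot>\<^bsub>?R\<^esub> a) = cmod z * q a"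
       "\<forall>a\<in>carrier ?R. \<forall>b\<in>carrier ?R. q (a \<oplus>\<^bsub>?R\<^esub> b) \<le> q a + q b"
    have "q (rep x) \<le> norm x" for x :: "('a, 'm) test_element"
      by (rule cstar_seminorm_le_norm[of "\<lambda>x. q (rep x)"])
         (use q[unfolded ball_carrier_iff] in \<open>simp_all add: rep_simps\<close>)
    then show "\<forall>a\<in>carrier ?R. q a \<le> \<parallel>a\<parallel>\<^bsub>?R\<^esub>"
      by (simp add: ball_carrier_iff norm_test_element.rep_eq)
  qed
  ultimately show ?thesis
    unfolding transferred_facts_def by blast
qed

lemma all_transferred_facts: "unital_banach R \<Longrightarrow> transferred_facts R"
  by (rule test_algebra(2)[OF test_algebra_facts])

section \<open>Unconditional sums\<close>

context unital_banach
begin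

lemma eq_if_small:
  assumes "a \<in> carrier A" "b \<in> carrier A" "\<And>e. e > 0 \<Longrightarrow> \<parallel>a \<ominus> b\<parallel> < e"
  shows "a = b"
proof -
  have "\<not> \<parallel>a \<ominus> b\<parallel> > 0" using assms(3) by blast
  then have "\<parallel>a \<ominus> b\<parallel> = 0" using nrm_nonneg[of "a \<ominus> b"] assms(1,2) by (metis less_eq_real_def minus_closed)
  then show ?thesis using assms(1,2) by (simp add: nrm_eq_0_iff)
qed

lemma add_minus_add:
  assumes "a \<in> carrier A" "b \<in> carrier A" "c \<in> carrier A" "d \<in> carrier A"
  shows "(a \<oplus> b) \<ominus> (c \<oplus> d) = (a \<ominus> c) \<oplus> (b \<ominus> d)"
  using assms by (simp add: minus_eq minus_add a_ac)

lemma add_minus_cancel: "a \<in> carrier A \<Longrightarrow> b \<in> carrier A \<Longrightarrow> (a \<oplus> b) \<ominus> a = b"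
  by (metis a_comm a_minus_def add.m_assoc a_inv_closed r_neg r_zero)

lemma nrm_triangle_sub: "a \<in> carrier A \<Longrightarrow> b \<in> carrier A \<Longrightarrow> \<parallel>a\<parallel> \<le> \<parallel>b\<parallel> + \<parallel>a \<ominus> b\<parallel>"
  using nrm_triangle[of b "a \<ominus> b"] by (simp add: minus_eq a_lcomm[of b a] r_neg)

lemma nrm_minus_le: "a \<in> carrier A \<Longrightarrow> b \<in> carrier A \<Longrightarrow> \<parallel>a \<ominus> b\<parallel> \<le> \<parallel>a\<parallel> + \<parallel>b\<parallel>"
  using nrm_triangle[of a "\<ominus> b"] by (simp add: minus_eq)

lemma nrm_mult_minus_mult:
  assumes "a \<in> carrier A" "b \<in> carrier A" "a' \<in> carrier A" "b' \<in> carrier A"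
  shows "\<parallel>a \<otimes> b \<ominus> a' \<otimes> b'\<parallel> \<le> \<parallel>a \<ominus> a'\<parallel> * \<parallel>b\<parallel> + \<parallel>a'\<parallel> * \<parallel>b \<ominus> b'\<parallel>"
    "\<parallel>a \<otimes> b \<ominus> a' \<otimes> b'\<parallel> \<le> \<parallel>a\<parallel> * \<parallel>b \<ominus> b'\<parallel> + \<parallel>a \<ominus> a'\<parallel> * \<parallel>b'\<parallel>"
proof -
  have "a \<otimes> b \<ominus> a' \<otimes> b' = (a \<ominus> a') \<otimes> b \<oplus> a' \<otimes> (b \<ominus> b')"
    using assms by (simp add: minus_eq l_distr r_distr l_minus r_minus a_assoc) (simp add: l_neg flip: a_assoc)
  also have "\<parallel>\<dots>\<parallel> \<le> \<parallel>a \<ominus> a'\<parallel> * \<parallel>b\<parallel> + \<parallel>a'\<parallel> * \<parallel>b \<ominus> b'\<parallel>"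
    using assms by (intro order_trans[OF nrm_triangle] add_mono nrm_mult) auto
  finally show "\<parallel>a \<otimes> b \<ominus> a' \<otimes> b'\<parallel> \<le> \<parallel>a \<ominus> a'\<parallel> * \<parallel>b\<parallel> + \<parallel>a'\<parallel> * \<parallel>b \<ominus> b'\<parallel>" .
  have "a \<otimes> b \<ominus> a' \<otimes> b' = a \<otimes> (b \<ominus> b') \<oplus> (a \<ominus> a') \<otimes> b'"
    using assms by (simp add: minus_eq l_distr r_distr l_minus r_minus a_assoc) (simp add: l_neg flip: a_assoc)
  also have "\<parallel>\<dots>\<parallel> \<le> \<parallel>a\<parallel> * \<parallel>b \<ominus> b'\<parallel> + \<parallel>a \<ominus> a'\<parallel> * \<parallel>b'\<parallel>"
    using assms by (intro order_trans[OF nrm_triangle] add_mono nrm_mult) auto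
  finally show "\<parallel>a \<otimes> b \<ominus> a' \<otimes> b'\<parallel> \<le> \<parallel>a\<parallel> * \<parallel>b \<ominus> b'\<parallel> + \<parallel>a \<ominus> a'\<parallel> * \<parallel>b'\<parallel>" .
qed

lemma nrm_finsum:
  "finite F \<Longrightarrow> f \<in> F \<rightarrow> carrier A \<Longrightarrow> \<parallel>finsum A f F\<parallel> \<le> (\<Sum>i\<in>F. \<parallel>f i\<parallel>)"
proof (induction F rule: finite_induct)
  case (insert i F)
  then have f: "f \<in> F \<rightarrow> carrier A" "f i \<in> carrier A" by auto
  then show ?case
    using insert nrm_triangle[of "f i" "finsum A f F"] by (simp add: finsum_insert)
qed simp

definition abs_summable :: "('i \<Rightarrow> 'a) \<Rightarrow> 'i set \<Rightarrow> bool" where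
  "abs_summable f I \<longleftrightarrow> f \<in> I \<rightarrow> carrier A \<and> (\<lambda>i. \<parallel>f i\<parallel>) summable_on I"

lemma abs_summable_finsum_closed: "abs_summable f I \<Longrightarrow> F \<subseteq> I \<Longrightarrow> finsum A f F \<in> carrier A"
  by (rule finsum_closed) (auto simp: abs_summable_def)

lemma abs_summable_tail:
  assumes f: "abs_summable f I" and e: "e > 0"
  obtains F where "finite F" "F \<subseteq> I"
    "\<And>G. finite G \<Longrightarrow> G \<subseteq> I \<Longrightarrow> G \<inter> F = {} \<Longrightarrow> (\<Sum>i\<in>G. \<parallel>f i\<parallel>) < e"
proof -
  let ?n = "\<lambda>i. \<parallel>f i\<parallel>"
  have s: "?n summable_on I" and c: "f \<in> I \<rightarrow> carrier A"
    using f by (auto simp: abs_summable_def)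
  have "eventually (\<lambda>F. sum ?n F > infsum ?n I - e) (finite_subsets_at_top I)"
    using e by (intro order_tendstoD(1)[OF infsum_tendsto[OF s]]) simp
  then obtain F where F: "finite F" "F \<subseteq> I" "sum ?n F > infsum ?n I - e"
    unfolding eventually_finite_subsets_at_top by blast
  have "sum ?n G < e" if G: "finite G" "G \<subseteq> I" "G \<inter> F = {}" for G
  proof -
    have "sum ?n G + sum ?n F = sum ?n (G \<union> F)"
      using G F by (simp add: sum.union_disjoint)
    also have "\<dots> \<le> infsum ?n I"
      using G F c by (intro finite_sum_le_infsum s) (auto simp: Pi_iff)
    finally show ?thesis using F by simp
  qed
  then show ?thesis using that F by blast
qed

lemma finsum_minus_subset:
  assumes "abs_summable f I" "F \<subseteq> H" "finite H" "H \<subseteq> I"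
  shows "\<parallel>finsum A f H \<ominus> finsum A f F\<parallel> \<le> (\<Sum>i\<in>H - F. \<parallel>f i\<parallel>)"
proof -
  have f: "f \<in> H \<rightarrow> carrier A" using assms by (auto simp: abs_summable_def)
  have "finsum A f H = finsum A f (F \<union> (H - F))"
    using assms by (simp add: Un_absorb1)
  also have "\<dots> = finsum A f F \<oplus> finsum A f (H - F)"
    using assms f by (intro finsum_Un_disjoint) (auto intro: finite_subset)
  finally have "finsum A f H \<ominus> finsum A f F = finsum A f (H - F)"
    using assms f by (subst add_minus_cancel[symmetric, of "finsum A f F"]) (auto intro!: finsum_closed)
  then show ?thesis using assms f by (auto intro!: nrm_finsum)
qed

lemma alg_sum_exists:
  assumes f: "abs_summable f I"
  shows "\<exists>s. limitin (nrm_topology A) (\<lambda>F. finsum A f F) s (finite_subsets_at_top I)"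
proof -
  have "\<exists>F. finite F \<and> F \<subseteq> I \<and> (\<forall>G. finite G \<longrightarrow> G \<subseteq> I \<longrightarrow> G \<inter> F = {} \<longrightarrow> (\<Sum>i\<in>G. \<parallel>f i\<parallel>) < 1 / Suc n)" for n
    by (rule abs_summable_tail[OF f, of "1 / Suc n"]) auto
  then obtain F where F: "\<And>n. finite (F n)" "\<And>n. F n \<subseteq> I"
    "\<And>n G. finite G \<Longrightarrow> G \<subseteq> I \<Longrightarrow> G \<inter> F n = {} \<Longrightarrow> (\<Sum>i\<in>G. \<parallel>f i\<parallel>) < 1 / Suc n"
    by metis
  define H where "H n = (\<Union>k\<le>n. F k)" for n
  have H: "finite (H n)" "H n \<subseteq> I" "F n \<subseteq> H n" for n
    using F by (auto simp: H_def)
  have Hmono: "H m \<subseteq> H n" if "m \<le> n" for m n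
    unfolding H_def using that by (intro UN_mono) auto
  have near: "\<parallel>finsum A f K \<ominus> finsum A f (H n)\<parallel> < 1 / Suc n" if "finite K" "H n \<subseteq> K" "K \<subseteq> I" for K n
  proof -
    have "(\<Sum>i\<in>K - H n. \<parallel>f i\<parallel>) < 1 / Suc n"
      using that H(3)[of n] by (intro F) auto
    then show ?thesis using finsum_minus_subset[OF f that(2,1,3)] by simp
  qed
  have c: "finsum A f K \<in> carrier A" if "K \<subseteq> I" for K
    using abs_summable_finsum_closed[OF f that] .
  have small: "\<exists>N. 2 / Suc N < e" if "e > 0" for e :: real
  proof -
    have "0 < e / 2" using that by simp
    then obtain N where "inverse (real (Suc N)) < e / 2"
      using reals_Archimedean by blast
    moreover have "2 / real (Suc N) = 2 * inverse (real (Suc N))" by (rule divide_inverse)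
    ultimately have "2 / Suc N < e" by linarith
    then show ?thesis by blast
  qed
  obtain l where l: "l \<in> carrier A" "\<forall>e>0. \<exists>N. \<forall>n\<ge>N. \<parallel>finsum A f (H n) \<ominus> l\<parallel> < e"
  proof (rule complete_sequences[of "\<lambda>n. finsum A f (H n)"])
    show "finsum A f (H n) \<in> carrier A" for n by (intro c H)
    fix e :: real assume "e > 0"
    then obtain N where N: "2 / Suc N < e" using small by blast
    have "\<parallel>finsum A f (H m) \<ominus> finsum A f (H n)\<parallel> < e" if "m \<ge> N" "n \<ge> N" for m n
    proof -
      have "\<parallel>finsum A f (H m) \<ominus> finsum A f (H n)\<parallel>
          \<le> \<parallel>finsum A f (H m) \<ominus> finsum A f (H N)\<parallel> + \<parallel>finsum A f (H N) \<ominus> finsum A f (H n)\<parallel>"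
        using c H by (intro nrm_triangle_minus) auto
      also have "\<dots> = \<parallel>finsum A f (H m) \<ominus> finsum A f (H N)\<parallel> + \<parallel>finsum A f (H n) \<ominus> finsum A f (H N)\<parallel>"
        using c H nrm_minus_commute by simp
      also have "\<dots> < 1 / Suc N + 1 / Suc N"
        using H Hmono that by (intro add_strict_mono near) auto
      finally show ?thesis using N by simp
    qed
    then show "\<exists>N. \<forall>m\<ge>N. \<forall>n\<ge>N. \<parallel>finsum A f (H m) \<ominus> finsum A f (H n)\<parallel> < e" by blast
  qed
  have "limitin (nrm_topology A) (\<lambda>F. finsum A f F) l (finite_subsets_at_top I)"
    unfolding limit_iff eventually_finite_subsets_at_top
  proof (intro conjI allI impI l(1))
    fix e :: real assume e: "e > 0"
    obtain N where N: "2 / Suc N < e" using small e by blast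
    obtain N' where N': "\<And>n. n \<ge> N' \<Longrightarrow> \<parallel>finsum A f (H n) \<ominus> l\<parallel> < e / 2"
      using l(2) e by (meson half_gt_zero)
    define n where "n = max N N'"
    have n: "1 / Suc n \<le> 1 / Suc N" by (simp add: n_def frac_le)
    have "\<parallel>finsum A f K \<ominus> l\<parallel> < e" if K: "finite K" "H n \<subseteq> K" "K \<subseteq> I" for K
    proof -
      have "\<parallel>finsum A f K \<ominus> l\<parallel> \<le> \<parallel>finsum A f K \<ominus> finsum A f (H n)\<parallel> + \<parallel>finsum A f (H n) \<ominus> l\<parallel>"
        using c H K l by (intro nrm_triangle_minus) auto
      also have "\<dots> < 1 / Suc n + e / 2"
        using near[OF K] N'[of n] by (intro add_strict_mono) (auto simp: n_def)
      finally show ?thesis using N n by simp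
    qed
    then show "\<exists>U. finite U \<and> U \<subseteq> I \<and>
         (\<forall>Y. finite Y \<and> U \<subseteq> Y \<and> Y \<subseteq> I \<longrightarrow> finsum A f Y \<in> carrier A \<and> \<parallel>finsum A f Y \<ominus> l\<parallel> < e)"
      by (intro exI[of _ "H n"] conjI allI impI H c) simp_all
  qed
  then show ?thesis by (rule exI)
qed

lemma alg_sum_eq:
  assumes "limitin (nrm_topology A) (\<lambda>F. finsum A f F) s (finite_subsets_at_top I)"
  shows "alg_sum A f I = s"
  unfolding alg_sum_def
proof (rule the_equality)
  show "limitin (nrm_topology A) (\<lambda>F. finsum A f F) s (finite_subsets_at_top I)" by (rule assms)
  fix t assume "limitin (nrm_topology A) (\<lambda>F. finsum A f F) t (finite_subsets_at_top I)"
  then show "t = s"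
    using limitin_Hausdorff_unique[OF _ assms] M.Hausdorff_space_mtopology
    by (auto simp: nrm_topology_def)
qed

lemma alg_sum_limit:
  "abs_summable f I \<Longrightarrow> limitin (nrm_topology A) (\<lambda>F. finsum A f F) (alg_sum A f I) (finite_subsets_at_top I)"
  using alg_sum_exists alg_sum_eq by metis

lemma alg_sum_closed [simp]: "abs_summable f I \<Longrightarrow> alg_sum A f I \<in> carrier A"
  using alg_sum_limit limit_iff by blast

lemma alg_sum_near:
  assumes "abs_summable f I" "e > 0"
  obtains F where "finite F" "F \<subseteq> I"
    "\<And>H. finite H \<Longrightarrow> F \<subseteq> H \<Longrightarrow> H \<subseteq> I \<Longrightarrow> \<parallel>finsum A f H \<ominus> alg_sum A f I\<parallel> < e"
  using alg_sum_limit[OF assms(1)] assms(2) unfolding limit_iff eventually_finite_subsets_at_top by metis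

lemma alg_sum_eqI:
  assumes f: "f \<in> I \<rightarrow> carrier A" and s: "s \<in> carrier A"
    and near: "\<And>e. e > 0 \<Longrightarrow> \<exists>F. finite F \<and> F \<subseteq> I \<and> (\<forall>H. finite H \<longrightarrow> F \<subseteq> H \<longrightarrow> H \<subseteq> I \<longrightarrow> \<parallel>finsum A f H \<ominus> s\<parallel> < e)"
  shows "alg_sum A f I = s"
proof (rule alg_sum_eq)
  have "finsum A f H \<in> carrier A" if "H \<subseteq> I" for H
    using f that by (intro finsum_closed) auto
  then show "limitin (nrm_topology A) (\<lambda>F. finsum A f F) s (finite_subsets_at_top I)"
    unfolding limit_iff eventually_finite_subsets_at_top using s near by meson
qed

lemma nrm_alg_sum_le:
  assumes f: "abs_summable f I"
  shows "\<parallel>alg_sum A f I\<parallel> \<le> (\<Sum>\<^sub>\<infinity>i\<in>I. \<parallel>f i\<parallel>)"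
proof (rule field_le_epsilon)
  fix e :: real assume e: "e > 0"
  have s: "(\<lambda>i. \<parallel>f i\<parallel>) summable_on I" "f \<in> I \<rightarrow> carrier A" using f by (auto simp: abs_summable_def)
  obtain F where F: "finite F" "F \<subseteq> I" "\<parallel>finsum A f F \<ominus> alg_sum A f I\<parallel> < e"
    by (rule alg_sum_near[OF f e]) blast
  have cF: "finsum A f F \<in> carrier A" by (rule abs_summable_finsum_closed[OF f F(2)])
  have "\<parallel>alg_sum A f I\<parallel> \<le> \<parallel>finsum A f F\<parallel> + \<parallel>alg_sum A f I \<ominus> finsum A f F\<parallel>"
    by (intro nrm_triangle_sub cF alg_sum_closed f)
  also have "\<parallel>alg_sum A f I \<ominus> finsum A f F\<parallel> = \<parallel>finsum A f F \<ominus> alg_sum A f I\<parallel>"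
    by (intro nrm_minus_commute cF alg_sum_closed f)
  also have "\<parallel>finsum A f F\<parallel> \<le> (\<Sum>i\<in>F. \<parallel>f i\<parallel>)"
    using F s by (intro nrm_finsum) auto
  also have "\<dots> \<le> (\<Sum>\<^sub>\<infinity>i\<in>I. \<parallel>f i\<parallel>)"
    using F s by (intro finite_sum_le_infsum) (auto simp: Pi_iff)
  finally show "\<parallel>alg_sum A f I\<parallel> \<le> (\<Sum>\<^sub>\<infinity>i\<in>I. \<parallel>f i\<parallel>) + e" using F by simp
qed

lemma alg_sum_single:
  assumes i: "i \<in> I" and f: "f \<in> I \<rightarrow> carrier A" "\<And>j. j \<in> I \<Longrightarrow> j \<noteq> i \<Longrightarrow> f j = \<zero>"
  shows "alg_sum A f I = f i"
proof (rule alg_sum_eqI[OF f(1)])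
  show c: "f i \<in> carrier A" using i f by auto
  fix e :: real assume e: "e > 0"
  have "finsum A f H = f i" if H: "finite H" "{i} \<subseteq> H" "H \<subseteq> I" for H
  proof -
    have "finsum A f H = finsum A f ({i} \<union> (H - {i}))"
      using H by (simp add: insert_absorb)
    also have "\<dots> = finsum A f {i} \<oplus> finsum A f (H - {i})"
      using H f by (intro finsum_Un_disjoint) auto
    also have "finsum A f (H - {i}) = \<zero>"
      using H f by (intro add.finprod_one_eqI) auto
    also have "finsum A f {i} = f i" using c by (simp add: finsum_insert)
    finally show ?thesis using c by simp
  qed
  then show "\<exists>F. finite F \<and> F \<subseteq> I \<and> (\<forall>H. finite H \<longrightarrow> F \<subseteq> H \<longrightarrow> H \<subseteq> I \<longrightarrow> \<parallel>finsum A f H \<ominus> f i\<parallel> < e)"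
    using i e c by (intro exI[of _ "{i}"]) (auto simp: r_neg minus_eq)
qed

lemma abs_summable_add:
  assumes f: "abs_summable f I" and g: "abs_summable g I"
  shows "abs_summable (\<lambda>i. f i \<oplus> g i) I"
proof -
  have "(\<lambda>i. \<parallel>f i\<parallel> + \<parallel>g i\<parallel>) summable_on I"
    using f g by (intro summable_on_add) (auto simp: abs_summable_def)
  then have "(\<lambda>i. \<parallel>f i \<oplus> g i\<parallel>) summable_on I"
    by (rule summable_on_comparison_test) (use f g in \<open>auto simp: abs_summable_def Pi_iff intro: nrm_triangle\<close>)
  then show ?thesis using f g by (auto simp: abs_summable_def)
qed

lemma alg_sum_add:
  assumes f: "abs_summable f I" and g: "abs_summable g I"
  shows "alg_sum A (\<lambda>i. f i \<oplus> g i) I = alg_sum A f I \<oplus> alg_sum A g I"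
proof (rule alg_sum_eqI)
  have fc: "f \<in> I \<rightarrow> carrier A" "g \<in> I \<rightarrow> carrier A" using f g by (auto simp: abs_summable_def)
  then show "(\<lambda>i. f i \<oplus> g i) \<in> I \<rightarrow> carrier A" by auto
  show "alg_sum A f I \<oplus> alg_sum A g I \<in> carrier A" using f g by simp
  fix e :: real assume e: "e > 0"
  obtain F where F: "finite F" "F \<subseteq> I"
    "\<And>H. finite H \<Longrightarrow> F \<subseteq> H \<Longrightarrow> H \<subseteq> I \<Longrightarrow> \<parallel>finsum A f H \<ominus> alg_sum A f I\<parallel> < e / 2"
    by (rule alg_sum_near[OF f, of "e / 2"]) (use e in simp, blast)
  obtain F' where F': "finite F'" "F' \<subseteq> I"
    "\<And>H. finite H \<Longrightarrow> F' \<subseteq> H \<Longrightarrow> H \<subseteq> I \<Longrightarrow> \<parallel>finsum A g H \<ominus> alg_sum A g I\<parallel> < e / 2"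
    by (rule alg_sum_near[OF g, of "e / 2"]) (use e in simp, blast)
  have "\<parallel>finsum A (\<lambda>i. f i \<oplus> g i) H \<ominus> (alg_sum A f I \<oplus> alg_sum A g I)\<parallel> < e"
    if H: "finite H" "F \<union> F' \<subseteq> H" "H \<subseteq> I" for H
  proof -
    have c: "finsum A f H \<in> carrier A" "finsum A g H \<in> carrier A"
      using f g H by (simp_all add: abs_summable_finsum_closed)
    have "finsum A (\<lambda>i. f i \<oplus> g i) H = finsum A f H \<oplus> finsum A g H"
      using H fc by (intro finsum_addf) auto
    then have "finsum A (\<lambda>i. f i \<oplus> g i) H \<ominus> (alg_sum A f I \<oplus> alg_sum A g I)
       = (finsum A f H \<ominus> alg_sum A f I) \<oplus> (finsum A g H \<ominus> alg_sum A g I)"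
      using c f g by (simp add: add_minus_add)
    also have "\<parallel>\<dots>\<parallel> \<le> \<parallel>finsum A f H \<ominus> alg_sum A f I\<parallel> + \<parallel>finsum A g H \<ominus> alg_sum A g I\<parallel>"
      using c f g by (intro nrm_triangle) auto
    also have "\<dots> < e / 2 + e / 2"
      using H by (intro add_strict_mono F F') auto
    finally show ?thesis by simp
  qed
  then show "\<exists>F. finite F \<and> F \<subseteq> I \<and> (\<forall>H. finite H \<longrightarrow> F \<subseteq> H \<longrightarrow> H \<subseteq> I \<longrightarrow>
      \<parallel>finsum A (\<lambda>i. f i \<oplus> g i) H \<ominus> (alg_sum A f I \<oplus> alg_sum A g I)\<parallel> < e)"
    using F(1,2) F'(1,2) by (intro exI[of _ "F \<union> F'"]) simp
qed

text \<open>
  This is how closedness of an ideal of coefficients enters: convolutions are limits of finite sums.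
\<close>

lemma alg_sum_in_closed:
  assumes f: "abs_summable f I" and K: "closedin (nrm_topology A) K"
    and fin: "\<And>F. finite F \<Longrightarrow> F \<subseteq> I \<Longrightarrow> finsum A f F \<in> K"
  shows "alg_sum A f I \<in> K"
  by (rule limitin_closedin[OF alg_sum_limit[OF f] K])
     (auto simp: eventually_finite_subsets_at_top intro: fin)

end

text \<open>
  Additivity together with a bound is what it takes to commute with unconditional sums.
\<close>

locale bounded_additive = A: unital_banach A + B: unital_banach B
  for A :: "('a, 'm) star_algebra_scheme" and B :: "('b, 'n) star_algebra_scheme" +
  fixes T :: "'a \<Rightarrow> 'b" and c :: real
  assumes closed: "a \<in> carrier A \<Longrightarrow> T a \<in> carrier B"
    and add: "a \<in> carrier A \<Longrightarrow> b \<in> carrier A \<Longrightarrow> T (a \<oplus>\<^bsub>A\<^esub> b) = T a \<oplus>\<^bsub>B\<^esub> T b"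
    and bounded: "a \<in> carrier A \<Longrightarrow> \<parallel>T a\<parallel>\<^bsub>B\<^esub> \<le> c * \<parallel>a\<parallel>\<^bsub>A\<^esub>"
begin

lemma zero: "T \<zero>\<^bsub>A\<^esub> = \<zero>\<^bsub>B\<^esub>"
proof -
  have "\<parallel>T \<zero>\<^bsub>A\<^esub>\<parallel>\<^bsub>B\<^esub> \<le> 0" using bounded[of "\<zero>\<^bsub>A\<^esub>"] by simp
  moreover have "0 \<le> \<parallel>T \<zero>\<^bsub>A\<^esub>\<parallel>\<^bsub>B\<^esub>" by (simp add: closed)
  ultimately have "\<parallel>T \<zero>\<^bsub>A\<^esub>\<parallel>\<^bsub>B\<^esub> = 0" by (rule antisym)
  then show ?thesis using B.nrm_eq_0_iff[OF closed[OF A.zero_closed]] by blast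
qed

lemma uminus: "a \<in> carrier A \<Longrightarrow> T (\<ominus>\<^bsub>A\<^esub> a) = \<ominus>\<^bsub>B\<^esub> T a"
  using add[of "\<ominus>\<^bsub>A\<^esub> a" a] by (intro B.minus_equality[symmetric]) (simp_all add: closed zero A.l_neg)

lemma minus: "a \<in> carrier A \<Longrightarrow> b \<in> carrier A \<Longrightarrow> T (a \<ominus>\<^bsub>A\<^esub> b) = T a \<ominus>\<^bsub>B\<^esub> T b"
  by (simp add: a_minus_def add uminus)

lemma finsum: "finite F \<Longrightarrow> f \<in> F \<rightarrow> carrier A \<Longrightarrow> T (finsum A f F) = finsum B (\<lambda>i. T (f i)) F"
proof (induction F rule: finite_induct)
  case (insert i F)
  then have f: "f \<in> F \<rightarrow> carrier A" "f i \<in> carrier A" by auto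
  have Tf: "(\<lambda>i. T (f i)) \<in> F \<rightarrow> carrier B" using f closed by auto
  show ?case
    using insert f Tf by (simp add: A.finsum_insert B.finsum_insert add closed)
qed (simp add: zero)

lemma abs_summable:
  assumes "A.abs_summable f I"
  shows "B.abs_summable (\<lambda>i. T (f i)) I"
proof -
  have "(\<lambda>i. c * \<parallel>f i\<parallel>\<^bsub>A\<^esub>) summable_on I"
    using assms by (intro summable_on_cmult_right) (auto simp: A.abs_summable_def)
  then have "(\<lambda>i. \<parallel>T (f i)\<parallel>\<^bsub>B\<^esub>) summable_on I"
    by (rule summable_on_comparison_test) (use assms in \<open>auto simp: A.abs_summable_def Pi_iff closed intro: bounded\<close>)
  then show ?thesis using assms closed by (auto simp: A.abs_summable_def B.abs_summable_def)
qed

lemma alg_sum: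
  assumes f: "A.abs_summable f I"
  shows "T (alg_sum A f I) = alg_sum B (\<lambda>i. T (f i)) I"
proof (rule B.alg_sum_eqI[symmetric])
  have fc: "f \<in> I \<rightarrow> carrier A" using f by (auto simp: A.abs_summable_def)
  then show "(\<lambda>i. T (f i)) \<in> I \<rightarrow> carrier B" using closed by auto
  show "T (alg_sum A f I) \<in> carrier B" using f by (simp add: closed)
  fix e :: real assume e: "e > 0"
  define d where "d = \<bar>c\<bar> + 1"
  have d: "d > 0" "c \<le> d" by (simp_all add: d_def)
  obtain F where F: "finite F" "F \<subseteq> I"
    "\<And>H. finite H \<Longrightarrow> F \<subseteq> H \<Longrightarrow> H \<subseteq> I \<Longrightarrow> \<parallel>finsum A f H \<ominus>\<^bsub>A\<^esub> alg_sum A f I\<parallel>\<^bsub>A\<^esub> < e / d"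
    by (rule A.alg_sum_near[OF f, of "e / d"]) (use e d in simp, blast)
  have "\<parallel>finsum B (\<lambda>i. T (f i)) H \<ominus>\<^bsub>B\<^esub> T (alg_sum A f I)\<parallel>\<^bsub>B\<^esub> < e" if H: "finite H" "F \<subseteq> H" "H \<subseteq> I" for H
  proof -
    have cl: "finsum A f H \<in> carrier A" using f H by (intro A.abs_summable_finsum_closed)
    have "finsum B (\<lambda>i. T (f i)) H \<ominus>\<^bsub>B\<^esub> T (alg_sum A f I) = T (finsum A f H \<ominus>\<^bsub>A\<^esub> alg_sum A f I)"
    proof -
      have "f \<in> H \<rightarrow> carrier A" using fc H by auto
      then show ?thesis using H f cl by (subst minus) (simp_all add: finsum)
    qed
    also have "\<parallel>\<dots>\<parallel>\<^bsub>B\<^esub> \<le> c * \<parallel>finsum A f H \<ominus>\<^bsub>A\<^esub> alg_sum A f I\<parallel>\<^bsub>A\<^esub>"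
      using cl f by (intro bounded) auto
    also have "\<dots> \<le> d * \<parallel>finsum A f H \<ominus>\<^bsub>A\<^esub> alg_sum A f I\<parallel>\<^bsub>A\<^esub>"
      using d cl f by (intro mult_right_mono) auto
    also have "\<dots> < d * (e / d)"
      using d F(3)[OF H] by (intro mult_strict_left_mono) auto
    finally show ?thesis using d by simp
  qed
  then show "\<exists>F. finite F \<and> F \<subseteq> I \<and> (\<forall>H. finite H \<longrightarrow> F \<subseteq> H \<longrightarrow> H \<subseteq> I \<longrightarrow>
      \<parallel>finsum B (\<lambda>i. T (f i)) H \<ominus>\<^bsub>B\<^esub> T (alg_sum A f I)\<parallel>\<^bsub>B\<^esub> < e)"
    using F(1,2) by (intro exI[of _ F]) simp
qed

end

section \<open>Algebras of summable functions\<close>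

lemma metric_spaceI:
  fixes R :: "('a, 'm) star_algebra_scheme" (structure)
  assumes "abelian_group R"
    and zero: "\<And>a. a \<in> carrier R \<Longrightarrow> \<parallel>a\<parallel> = 0 \<longleftrightarrow> a = \<zero>"
    and tri: "\<And>a b. a \<in> carrier R \<Longrightarrow> b \<in> carrier R \<Longrightarrow> \<parallel>a \<oplus> b\<parallel> \<le> \<parallel>a\<parallel> + \<parallel>b\<parallel>"
    and neg: "\<And>a. a \<in> carrier R \<Longrightarrow> \<parallel>\<ominus> a\<parallel> = \<parallel>a\<parallel>"
  shows "Metric_space (carrier R) (nrm_dist R)"
proof -
  interpret abelian_group R by fact
  have pos: "0 \<le> \<parallel>a\<parallel>" if "a \<in> carrier R" for a
    using tri[OF that a_inv_closed[OF that]] neg[OF that] zero[OF zero_closed] that by (simp add: r_neg)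
  have sym: "\<parallel>a \<ominus> b\<parallel> = \<parallel>b \<ominus> a\<parallel>" if "a \<in> carrier R" "b \<in> carrier R" for a b
    using neg[of "b \<ominus> a"] that by (simp add: minus_eq minus_add a_comm)
  have tri2: "\<parallel>a \<ominus> c\<parallel> \<le> \<parallel>a \<ominus> b\<parallel> + \<parallel>b \<ominus> c\<parallel>"
    if a: "a \<in> carrier R" "b \<in> carrier R" "c \<in> carrier R" for a b c
  proof -
    have "a \<ominus> c = (a \<ominus> b) \<oplus> (b \<ominus> c)"
      using a by (simp add: minus_eq a_assoc) (simp add: l_neg flip: a_assoc)
    then show ?thesis using tri[of "a \<ominus> b" "b \<ominus> c"] a by simp
  qed
  show ?thesis
  proof
    show "0 \<le> nrm_dist R x y" for x y by (simp add: nrm_dist_def pos)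
    show "nrm_dist R x y = nrm_dist R y x" for x y by (simp add: nrm_dist_def sym)
    show "(nrm_dist R x y = 0) = (x = y)" if xy: "x \<in> carrier R" "y \<in> carrier R" for x y
    proof -
      have "x = (x \<ominus> y) \<oplus> y" using xy by (simp add: minus_eq a_assoc l_neg)
      then have "x \<ominus> y = \<zero> \<longleftrightarrow> x = y" using xy by (metis l_zero minus_eq r_neg)
      then show ?thesis using xy by (simp add: nrm_dist_def zero)
    qed
    show "nrm_dist R x z \<le> nrm_dist R x y + nrm_dist R y z"
      if "x \<in> carrier R" "y \<in> carrier R" "z \<in> carrier R" for x y z
      using that by (simp add: nrm_dist_def tri2)
  qed
qed

lemma mcompleteI:
  fixes R :: "('a, 'm) star_algebra_scheme" (structure)
  assumes "abelian_group R"
    and zero: "\<And>a. a \<in> carrier R \<Longrightarrow> \<parallel>a\<parallel> = 0 \<longleftrightarrow> a = \<zero>"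
    and tri: "\<And>a b. a \<in> carrier R \<Longrightarrow> b \<in> carrier R \<Longrightarrow> \<parallel>a \<oplus> b\<parallel> \<le> \<parallel>a\<parallel> + \<parallel>b\<parallel>"
    and neg: "\<And>a. a \<in> carrier R \<Longrightarrow> \<parallel>\<ominus> a\<parallel> = \<parallel>a\<parallel>"
    and seq: "\<And>f :: nat \<Rightarrow> 'a. (\<And>n. f n \<in> carrier R) \<Longrightarrow>
      (\<And>e. e > 0 \<Longrightarrow> \<exists>N. \<forall>m\<ge>N. \<forall>n\<ge>N. \<parallel>f m \<ominus> f n\<parallel> < e) \<Longrightarrow>
      \<exists>l\<in>carrier R. \<forall>e>0. \<exists>N. \<forall>n\<ge>N. \<parallel>f n \<ominus> l\<parallel> < e"
  shows "Metric_space.mcomplete (carrier R) (nrm_dist R)"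
proof -
  interpret abelian_group R by fact
  interpret M: Metric_space "carrier R" "nrm_dist R"
    by (rule metric_spaceI[OF abelian_group_axioms zero tri neg])
  show ?thesis
    unfolding M.mcomplete_def
  proof (intro allI impI)
    fix f :: "nat \<Rightarrow> 'a" assume f: "M.MCauchy f"
    have fc: "f n \<in> carrier R" for n using f by (auto simp: M.MCauchy_def)
    have "\<exists>N. \<forall>m\<ge>N. \<forall>n\<ge>N. \<parallel>f m \<ominus> f n\<parallel> < e" if "e > 0" for e
      using f that unfolding M.MCauchy_def by (simp add: nrm_dist_def fc)
    from seq[OF fc this] obtain l where l: "l \<in> carrier R" "\<forall>e>0. \<exists>N. \<forall>n\<ge>N. \<parallel>f n \<ominus> l\<parallel> < e" by blast
    then show "\<exists>x. limitin M.mtopology f x sequentially"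
      unfolding M.limit_metric_sequentially by (intro exI[of _ l]) (simp add: nrm_dist_def fc)
  qed
qed

text \<open>
  The convention on the field \<open>\<one>\<close> is automatic for a ring, and completeness can be tested on
  sequences with explicit estimates.
\<close>

lemma unital_banachI:
  fixes R :: "('a, 'm) star_algebra_scheme" (structure)
  assumes "ring R"
    and s1: "\<And>z a. a \<in> carrier R \<Longrightarrow> z \<odot> a \<in> carrier R"
    and s2: "\<And>z w a. a \<in> carrier R \<Longrightarrow> (z + w) \<odot> a = z \<odot> a \<oplus> w \<odot> a"
    and s3: "\<And>z a b. a \<in> carrier R \<Longrightarrow> b \<in> carrier R \<Longrightarrow> z \<odot> (a \<oplus> b) = z \<odot> a \<oplus> z \<odot> b"
    and s4: "\<And>z w a. a \<in> carrier R \<Longrightarrow> (z * w) \<odot> a = z \<odot> (w \<odot> a)"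
    and s5: "\<And>a. a \<in> carrier R \<Longrightarrow> 1 \<odot> a = a"
    and s6: "\<And>z a b. a \<in> carrier R \<Longrightarrow> b \<in> carrier R \<Longrightarrow> (z \<odot> a) \<otimes> b = z \<odot> (a \<otimes> b)"
    and s7: "\<And>z a b. a \<in> carrier R \<Longrightarrow> b \<in> carrier R \<Longrightarrow> a \<otimes> (z \<odot> b) = z \<odot> (a \<otimes> b)"
    and t1: "\<And>a. a \<in> carrier R \<Longrightarrow> a\<^sup>\<star> \<in> carrier R"
    and t2: "\<And>a. a \<in> carrier R \<Longrightarrow> (a\<^sup>\<star>)\<^sup>\<star> = a"
    and t3: "\<And>a b. a \<in> carrier R \<Longrightarrow> b \<in> carrier R \<Longrightarrow> (a \<oplus> b)\<^sup>\<star> = a\<^sup>\<star> \<oplus> b\<^sup>\<star>"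
    and t4: "\<And>z a. a \<in> carrier R \<Longrightarrow> (z \<odot> a)\<^sup>\<star> = cnj z \<odot> a\<^sup>\<star>"
    and t5: "\<And>a b. a \<in> carrier R \<Longrightarrow> b \<in> carrier R \<Longrightarrow> (a \<otimes> b)\<^sup>\<star> = b\<^sup>\<star> \<otimes> a\<^sup>\<star>"
    and n1: "\<And>a. a \<in> carrier R \<Longrightarrow> \<parallel>a\<parallel> = 0 \<longleftrightarrow> a = \<zero>"
    and n2: "\<And>a b. a \<in> carrier R \<Longrightarrow> b \<in> carrier R \<Longrightarrow> \<parallel>a \<oplus> b\<parallel> \<le> \<parallel>a\<parallel> + \<parallel>b\<parallel>"
    and n3: "\<And>z a. a \<in> carrier R \<Longrightarrow> \<parallel>z \<odot> a\<parallel> = cmod z * \<parallel>a\<parallel>"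
    and n4: "\<And>a b. a \<in> carrier R \<Longrightarrow> b \<in> carrier R \<Longrightarrow> \<parallel>a \<otimes> b\<parallel> \<le> \<parallel>a\<parallel> * \<parallel>b\<parallel>"
    and n5: "\<And>a. a \<in> carrier R \<Longrightarrow> \<parallel>a\<^sup>\<star>\<parallel> = \<parallel>a\<parallel>"
    and seq: "\<And>f :: nat \<Rightarrow> 'a. (\<And>n. f n \<in> carrier R) \<Longrightarrow>
      (\<And>e. e > 0 \<Longrightarrow> \<exists>N. \<forall>m\<ge>N. \<forall>n\<ge>N. \<parallel>f m \<ominus> f n\<parallel> < e) \<Longrightarrow>
      \<exists>l\<in>carrier R. \<forall>e>0. \<exists>N. \<forall>n\<ge>N. \<parallel>f n \<ominus> l\<parallel> < e"
  shows "unital_banach R"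
proof -
  interpret ring R by fact
  have z: "0 \<odot> a = \<zero>" if "a \<in> carrier R" for a
    using s2[OF that, of 0 0] s1[OF that, of 0] by (metis add.l_cancel_one add_0)
  have "\<ominus> a = (-1) \<odot> a" if "a \<in> carrier R" for a
    using s2[OF that, of "-1" 1] s1[OF that, of "-1"] s5[OF that] z[OF that] that
    by (intro minus_equality) auto
  then have neg: "\<parallel>\<ominus> a\<parallel> = \<parallel>a\<parallel>" if "a \<in> carrier R" for a
    using n3[OF that, of "-1"] that by simp
  have "Module.module (ring_of_type_algebra :: complex ring) R"
    by (rule moduleI[OF cring_from_type_algebra abelian_group_axioms])
       (auto simp: ring_of_type_algebra_def s1 s2 s3 s4 s5)
  moreover have "Metric_space.mcomplete (carrier R) (nrm_dist R)"
    by (rule mcompleteI[OF abelian_group_axioms n1 n2 neg seq])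
  moreover have "\<one> = e" if "e \<in> carrier R" "\<And>a. a \<in> carrier R \<Longrightarrow> e \<otimes> a = a \<and> a \<otimes> e = a" for e
    using that(2)[of \<one>] that(1) by simp
  ultimately have "banach_star_algebra R"
    by (intro banach_star_algebra.intro banach_star_algebra_axioms.intro)
       (simp_all add: m_assoc l_distr r_distr s6 s7 t1 t2 t3 t4 t5 n1 n2 n3 n4 n5)
  then show ?thesis
    by (intro unital_banach.intro) (auto intro: monoid_axioms)
qed

locale l1_space = group G + A: unital_banach A
  for G :: "('g, 'k) monoid_scheme" (structure) and A :: "('a, 'm) star_algebra_scheme"
begin

abbreviation L :: "('g \<Rightarrow> 'a) star_algebra" where "L \<equiv> l1_algebra G A"

lemma l1_simps:
  "carrier L = l1_functions G A"
  "\<zero>\<^bsub>L\<^esub> = (\<lambda>x\<in>carrier G. \<zero>\<^bsub>A\<^esub>)"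
  "f \<oplus>\<^bsub>L\<^esub> g = (\<lambda>x\<in>carrier G. f x \<oplus>\<^bsub>A\<^esub> g x)"
  "z \<odot>\<^bsub>L\<^esub> f = (\<lambda>x\<in>carrier G. z \<odot>\<^bsub>A\<^esub> f x)"
  "f\<^sup>\<star>\<^bsub>L\<^esub> = (\<lambda>x\<in>carrier G. (f (inv x))\<^sup>\<star>\<^bsub>A\<^esub>)"
  "\<parallel>f\<parallel>\<^bsub>L\<^esub> = (\<Sum>\<^sub>\<infinity>x\<in>carrier G. \<parallel>f x\<parallel>\<^bsub>A\<^esub>)"
  by (simp_all add: l1_algebra_def)

lemma l1_iff:
  "f \<in> l1_functions G A \<longleftrightarrow> f \<in> extensional (carrier G) \<and> (\<forall>x\<in>carrier G. f x \<in> carrier A)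
     \<and> (\<lambda>x. \<parallel>f x\<parallel>\<^bsub>A\<^esub>) summable_on carrier G"
  by (auto simp: l1_functions_def PiE_def)

lemma l1_value [simp]: "f \<in> l1_functions G A \<Longrightarrow> x \<in> carrier G \<Longrightarrow> f x \<in> carrier A"
  by (simp add: l1_iff)

lemma l1_summable: "f \<in> l1_functions G A \<Longrightarrow> (\<lambda>x. \<parallel>f x\<parallel>\<^bsub>A\<^esub>) summable_on carrier G"
  by (simp add: l1_iff)

lemma l1_ext_eq: "f \<in> l1_functions G A \<Longrightarrow> g \<in> l1_functions G A \<Longrightarrow>
    (\<And>x. x \<in> carrier G \<Longrightarrow> f x = g x) \<Longrightarrow> f = g"
  by (rule extensionalityI[of _ "carrier G"]) (auto simp: l1_iff)

lemma l1I:
  assumes "\<And>x. x \<in> carrier G \<Longrightarrow> h x \<in> carrier A" "(\<lambda>x. \<parallel>h x\<parallel>\<^bsub>A\<^esub>) summable_on carrier G"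
  shows "(\<lambda>x\<in>carrier G. h x) \<in> l1_functions G A"
proof -
  have "(\<lambda>x. \<parallel>restrict h (carrier G) x\<parallel>\<^bsub>A\<^esub>) summable_on carrier G"
    using assms(2) by (rule summable_on_cong[THEN iffD1, rotated]) simp
  then show ?thesis using assms(1) by (simp add: l1_iff)
qed

lemma nrm_restrict: "\<parallel>\<lambda>x\<in>carrier G. h x\<parallel>\<^bsub>L\<^esub> = (\<Sum>\<^sub>\<infinity>x\<in>carrier G. \<parallel>h x\<parallel>\<^bsub>A\<^esub>)"
  unfolding l1_simps by (rule infsum_cong) simp

lemma l1I_finite_bound:
  assumes h: "\<And>x. x \<in> carrier G \<Longrightarrow> h x \<in> carrier A"
    and b: "\<And>F. finite F \<Longrightarrow> F \<subseteq> carrier G \<Longrightarrow> (\<Sum>x\<in>F. \<parallel>h x\<parallel>\<^bsub>A\<^esub>) \<le> c"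
  shows "(\<lambda>x\<in>carrier G. h x) \<in> l1_functions G A" "\<parallel>\<lambda>x\<in>carrier G. h x\<parallel>\<^bsub>L\<^esub> \<le> c"
proof -
  have s: "(\<lambda>x. \<parallel>h x\<parallel>\<^bsub>A\<^esub>) summable_on carrier G"
    by (rule nonneg_bdd_above_summable_on) (use h b in \<open>auto intro!: bdd_aboveI[of _ c]\<close>)
  then show "(\<lambda>x\<in>carrier G. h x) \<in> l1_functions G A" using h by (intro l1I)
  show "\<parallel>\<lambda>x\<in>carrier G. h x\<parallel>\<^bsub>L\<^esub> \<le> c"
    unfolding nrm_restrict by (rule infsum_le_finite_sums[OF s b])
qed

lemma finite_sum_le_nrm:
  "f \<in> l1_functions G A \<Longrightarrow> finite F \<Longrightarrow> F \<subseteq> carrier G \<Longrightarrow> (\<Sum>x\<in>F. \<parallel>f x\<parallel>\<^bsub>A\<^esub>) \<le> \<parallel>f\<parallel>\<^bsub>L\<^esub>"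
  unfolding l1_simps by (rule finite_sum_le_infsum) (auto simp: l1_summable)

lemma value_le_nrm: "f \<in> l1_functions G A \<Longrightarrow> x \<in> carrier G \<Longrightarrow> \<parallel>f x\<parallel>\<^bsub>A\<^esub> \<le> \<parallel>f\<parallel>\<^bsub>L\<^esub>"
  using finite_sum_le_nrm[of f "{x}"] by simp

lemma nrm_l1_nonneg: "f \<in> l1_functions G A \<Longrightarrow> 0 \<le> \<parallel>f\<parallel>\<^bsub>L\<^esub>"
  unfolding l1_simps by (rule infsum_nonneg) simp

lemma l1_zero: "\<zero>\<^bsub>L\<^esub> \<in> l1_functions G A"
  unfolding l1_simps by (rule l1I) (simp_all add: summable_on_0)

lemma l1_add:
  assumes "f \<in> l1_functions G A" "g \<in> l1_functions G A"
  shows "f \<oplus>\<^bsub>L\<^esub> g \<in> l1_functions G A" "\<parallel>f \<oplus>\<^bsub>L\<^esub> g\<parallel>\<^bsub>L\<^esub> \<le> \<parallel>f\<parallel>\<^bsub>L\<^esub> + \<parallel>g\<parallel>\<^bsub>L\<^esub>"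
proof -
  have "(\<Sum>x\<in>F. \<parallel>f x \<oplus>\<^bsub>A\<^esub> g x\<parallel>\<^bsub>A\<^esub>) \<le> \<parallel>f\<parallel>\<^bsub>L\<^esub> + \<parallel>g\<parallel>\<^bsub>L\<^esub>"
    if F: "finite F" "F \<subseteq> carrier G" for F
  proof -
    have "(\<Sum>x\<in>F. \<parallel>f x \<oplus>\<^bsub>A\<^esub> g x\<parallel>\<^bsub>A\<^esub>) \<le> (\<Sum>x\<in>F. \<parallel>f x\<parallel>\<^bsub>A\<^esub> + \<parallel>g x\<parallel>\<^bsub>A\<^esub>)"
      using F assms by (intro sum_mono A.nrm_triangle) auto
    then show ?thesis
      using finite_sum_le_nrm[OF assms(1) F] finite_sum_le_nrm[OF assms(2) F] by (simp add: sum.distrib)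
  qed
  note * = l1I_finite_bound[of "\<lambda>x. f x \<oplus>\<^bsub>A\<^esub> g x", OF _ this]
  show "f \<oplus>\<^bsub>L\<^esub> g \<in> l1_functions G A" "\<parallel>f \<oplus>\<^bsub>L\<^esub> g\<parallel>\<^bsub>L\<^esub> \<le> \<parallel>f\<parallel>\<^bsub>L\<^esub> + \<parallel>g\<parallel>\<^bsub>L\<^esub>"
    unfolding l1_simps(3) by (rule *; use assms in simp)+
qed

lemma l1_smult:
  assumes "f \<in> l1_functions G A"
  shows "z \<odot>\<^bsub>L\<^esub> f \<in> l1_functions G A" "\<parallel>z \<odot>\<^bsub>L\<^esub> f\<parallel>\<^bsub>L\<^esub> = cmod z * \<parallel>f\<parallel>\<^bsub>L\<^esub>"
proof -
  have e: "\<parallel>z \<odot>\<^bsub>A\<^esub> f x\<parallel>\<^bsub>A\<^esub> = cmod z * \<parallel>f x\<parallel>\<^bsub>A\<^esub>" if "x \<in> carrier G" for x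
    using assms that by (simp add: A.nrm_smult)
  have s: "(\<lambda>x. \<parallel>z \<odot>\<^bsub>A\<^esub> f x\<parallel>\<^bsub>A\<^esub>) summable_on carrier G"
    using summable_on_cmult_right[OF l1_summable[OF assms], of "cmod z"]
    by (rule summable_on_cong[THEN iffD1, rotated]) (simp add: e)
  then show "z \<odot>\<^bsub>L\<^esub> f \<in> l1_functions G A"
    unfolding l1_simps(4) using assms by (intro l1I) auto
  have "\<parallel>z \<odot>\<^bsub>L\<^esub> f\<parallel>\<^bsub>L\<^esub> = (\<Sum>\<^sub>\<infinity>x\<in>carrier G. cmod z * \<parallel>f x\<parallel>\<^bsub>A\<^esub>)"
    unfolding l1_simps(4) nrm_restrict by (rule infsum_cong) (simp add: e)
  then show "\<parallel>z \<odot>\<^bsub>L\<^esub> f\<parallel>\<^bsub>L\<^esub> = cmod z * \<parallel>f\<parallel>\<^bsub>L\<^esub>"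
    by (simp add: infsum_cmult_right' l1_simps(6))
qed

lemma inv_bij: "bij_betw (\<lambda>x. inv x) (carrier G) (carrier G)"
  by (rule bij_betwI[of _ _ _ "\<lambda>x. inv x"]) auto

lemma l1_star:
  assumes "f \<in> l1_functions G A"
  shows "f\<^sup>\<star>\<^bsub>L\<^esub> \<in> l1_functions G A" "\<parallel>f\<^sup>\<star>\<^bsub>L\<^esub>\<parallel>\<^bsub>L\<^esub> = \<parallel>f\<parallel>\<^bsub>L\<^esub>"
proof -
  have e: "\<parallel>(f (inv x))\<^sup>\<star>\<^bsub>A\<^esub>\<parallel>\<^bsub>A\<^esub> = \<parallel>f (inv x)\<parallel>\<^bsub>A\<^esub>" if "x \<in> carrier G" for x
    using assms that by (simp add: A.nrm_star)
  have "(\<lambda>x. \<parallel>f (inv x)\<parallel>\<^bsub>A\<^esub>) summable_on carrier G"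
    using l1_summable[OF assms] summable_on_reindex_bij_betw[OF inv_bij, of "\<lambda>x. \<parallel>f x\<parallel>\<^bsub>A\<^esub>"] by simp
  then have s: "(\<lambda>x. \<parallel>(f (inv x))\<^sup>\<star>\<^bsub>A\<^esub>\<parallel>\<^bsub>A\<^esub>) summable_on carrier G"
    by (rule summable_on_cong[THEN iffD1, rotated]) (simp add: e)
  then show "f\<^sup>\<star>\<^bsub>L\<^esub> \<in> l1_functions G A"
    unfolding l1_simps(5) using assms by (intro l1I) (auto simp: A.star_closed)
  have "\<parallel>f\<^sup>\<star>\<^bsub>L\<^esub>\<parallel>\<^bsub>L\<^esub> = (\<Sum>\<^sub>\<infinity>x\<in>carrier G. \<parallel>f (inv x)\<parallel>\<^bsub>A\<^esub>)"
    unfolding l1_simps(5) nrm_restrict by (rule infsum_cong) (simp add: e)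
  then show "\<parallel>f\<^sup>\<star>\<^bsub>L\<^esub>\<parallel>\<^bsub>L\<^esub> = \<parallel>f\<parallel>\<^bsub>L\<^esub>"
    using infsum_reindex_bij_betw[OF inv_bij, of "\<lambda>x. \<parallel>f x\<parallel>\<^bsub>A\<^esub>"] by (simp add: l1_simps(6))
qed

lemma l1_uminus:
  assumes "f \<in> l1_functions G A"
  shows "(\<lambda>x\<in>carrier G. \<ominus>\<^bsub>A\<^esub> f x) \<in> l1_functions G A" "(\<lambda>x\<in>carrier G. \<ominus>\<^bsub>A\<^esub> f x) \<oplus>\<^bsub>L\<^esub> f = \<zero>\<^bsub>L\<^esub>"
proof -
  have "(\<lambda>x\<in>carrier G. \<ominus>\<^bsub>A\<^esub> f x) = (-1) \<odot>\<^bsub>L\<^esub> f"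
    unfolding l1_simps using assms by (intro restrict_ext) (simp add: A.scale_minus1)
  then show "(\<lambda>x\<in>carrier G. \<ominus>\<^bsub>A\<^esub> f x) \<in> l1_functions G A" using l1_smult[OF assms] by simp
  show "(\<lambda>x\<in>carrier G. \<ominus>\<^bsub>A\<^esub> f x) \<oplus>\<^bsub>L\<^esub> f = \<zero>\<^bsub>L\<^esub>"
    unfolding l1_simps using assms by (intro restrict_ext) (simp add: A.l_neg)
qed

lemma l1_abelian_group: "abelian_group L"
proof (rule abelian_groupI)
  fix f g h assume f: "f \<in> carrier L" and g: "g \<in> carrier L" and h: "h \<in> carrier L"
  note m = f[unfolded l1_simps(1)] g[unfolded l1_simps(1)] h[unfolded l1_simps(1)]
  show "f \<oplus>\<^bsub>L\<^esub> g \<in> carrier L" using l1_add m by (simp add: l1_simps(1))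
  show "f \<oplus>\<^bsub>L\<^esub> g \<oplus>\<^bsub>L\<^esub> h = f \<oplus>\<^bsub>L\<^esub> (g \<oplus>\<^bsub>L\<^esub> h)"
    unfolding l1_simps using m by (intro restrict_ext) (simp add: A.a_assoc)
  show "f \<oplus>\<^bsub>L\<^esub> g = g \<oplus>\<^bsub>L\<^esub> f"
    unfolding l1_simps using m by (intro restrict_ext) (simp add: A.a_comm)
  show "\<zero>\<^bsub>L\<^esub> \<oplus>\<^bsub>L\<^esub> f = f"
    by (rule l1_ext_eq[OF l1_add(1)[OF l1_zero m(1)] m(1)]) (use m in \<open>simp add: l1_simps\<close>)
  show "\<exists>y\<in>carrier L. y \<oplus>\<^bsub>L\<^esub> f = \<zero>\<^bsub>L\<^esub>"
    using l1_uminus[OF m(1)] by (auto simp: l1_simps(1))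
qed (use l1_zero in \<open>simp add: l1_simps(1)\<close>)

sublocale L: abelian_group L
  by (rule l1_abelian_group)

lemma l1_a_inv: "f \<in> l1_functions G A \<Longrightarrow> \<ominus>\<^bsub>L\<^esub> f = (\<lambda>x\<in>carrier G. \<ominus>\<^bsub>A\<^esub> f x)"
  using l1_uminus[of f] by (intro L.minus_equality) (simp_all add: l1_simps(1))

lemma l1_minus: "f \<in> l1_functions G A \<Longrightarrow> g \<in> l1_functions G A \<Longrightarrow>
    f \<ominus>\<^bsub>L\<^esub> g = (\<lambda>x\<in>carrier G. f x \<ominus>\<^bsub>A\<^esub> g x)"
  unfolding a_minus_def by (simp add: l1_a_inv l1_simps(3) cong: restrict_cong)

lemma l1_minus_closed: "f \<in> l1_functions G A \<Longrightarrow> g \<in> l1_functions G A \<Longrightarrow> f \<ominus>\<^bsub>L\<^esub> g \<in> l1_functions G A"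
  using L.minus_closed[of f g] by (simp add: l1_simps(1))

text \<open>
  Cauchy sequences converge pointwise; the bound on finite partial sums of the tail passes to the pointwise
  limit.
\<close>

lemma l1_complete:
  assumes f: "\<And>n::nat. f n \<in> l1_functions G A"
    and cauchy: "\<And>e. e > 0 \<Longrightarrow> \<exists>N. \<forall>m\<ge>N. \<forall>n\<ge>N. \<parallel>f m \<ominus>\<^bsub>L\<^esub> f n\<parallel>\<^bsub>L\<^esub> < e"
  shows "\<exists>l\<in>l1_functions G A. \<forall>e>0. \<exists>N. \<forall>n\<ge>N. \<parallel>f n \<ominus>\<^bsub>L\<^esub> l\<parallel>\<^bsub>L\<^esub> < e"
proof -
  have val: "\<parallel>f m x \<ominus>\<^bsub>A\<^esub> f n x\<parallel>\<^bsub>A\<^esub> \<le> \<parallel>f m \<ominus>\<^bsub>L\<^esub> f n\<parallel>\<^bsub>L\<^esub>" if "x \<in> carrier G" for x m n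
    using value_le_nrm[OF l1_minus_closed[OF f f] that, of m n] that by (simp add: l1_minus f)
  have "\<exists>a\<in>carrier A. \<forall>e>0. \<exists>N. \<forall>n\<ge>N. \<parallel>f n x \<ominus>\<^bsub>A\<^esub> a\<parallel>\<^bsub>A\<^esub> < e" if x: "x \<in> carrier G" for x
  proof -
    have 1: "f n x \<in> carrier A" for n using f x by simp
    have 2: "\<exists>N. \<forall>m\<ge>N. \<forall>n\<ge>N. \<parallel>f m x \<ominus>\<^bsub>A\<^esub> f n x\<parallel>\<^bsub>A\<^esub> < e" if "e > 0" for e
      using cauchy[OF that] val[OF x] by (meson le_less_trans)
    show ?thesis by (rule A.complete_sequences[of "\<lambda>n. f n x", OF 1 2]) blast+
  qed
  then obtain l where l: "\<And>x. x \<in> carrier G \<Longrightarrow> l x \<in> carrier A"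
      "\<And>x e. x \<in> carrier G \<Longrightarrow> e > 0 \<Longrightarrow> \<exists>N. \<forall>n\<ge>N. \<parallel>f n x \<ominus>\<^bsub>A\<^esub> l x\<parallel>\<^bsub>A\<^esub> < e"
    by metis
  have lim: "(\<lambda>n. \<parallel>f n x \<ominus>\<^bsub>A\<^esub> l x\<parallel>\<^bsub>A\<^esub>) \<longlonglongrightarrow> 0" if "x \<in> carrier G" for x
    unfolding LIMSEQ_iff using l(2)[OF that] l(1)[OF that] f that by simp
  have tail: "(\<lambda>x\<in>carrier G. f n x \<ominus>\<^bsub>A\<^esub> l x) \<in> l1_functions G A \<and> \<parallel>\<lambda>x\<in>carrier G. f n x \<ominus>\<^bsub>A\<^esub> l x\<parallel>\<^bsub>L\<^esub> \<le> e"
    if n: "\<And>m. m \<ge> N \<Longrightarrow> \<parallel>f n \<ominus>\<^bsub>L\<^esub> f m\<parallel>\<^bsub>L\<^esub> < e" for n N e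
  proof -
    have "(\<Sum>x\<in>F. \<parallel>f n x \<ominus>\<^bsub>A\<^esub> l x\<parallel>\<^bsub>A\<^esub>) \<le> e" if F: "finite F" "F \<subseteq> carrier G" for F
    proof (rule tendsto_lowerbound)
      have "(\<lambda>m. e + (\<Sum>x\<in>F. \<parallel>f m x \<ominus>\<^bsub>A\<^esub> l x\<parallel>\<^bsub>A\<^esub>)) \<longlonglongrightarrow> e + (\<Sum>x\<in>F. 0)"
        using F by (intro tendsto_intros lim) auto
      then show "(\<lambda>m. e + (\<Sum>x\<in>F. \<parallel>f m x \<ominus>\<^bsub>A\<^esub> l x\<parallel>\<^bsub>A\<^esub>)) \<longlonglongrightarrow> e" by simp
      have "(\<Sum>x\<in>F. \<parallel>f n x \<ominus>\<^bsub>A\<^esub> l x\<parallel>\<^bsub>A\<^esub>) \<le> e + (\<Sum>x\<in>F. \<parallel>f m x \<ominus>\<^bsub>A\<^esub> l x\<parallel>\<^bsub>A\<^esub>)" if m: "m \<ge> N" for m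
      proof -
        have "(\<Sum>x\<in>F. \<parallel>f n x \<ominus>\<^bsub>A\<^esub> l x\<parallel>\<^bsub>A\<^esub>) \<le> (\<Sum>x\<in>F. \<parallel>f n x \<ominus>\<^bsub>A\<^esub> f m x\<parallel>\<^bsub>A\<^esub> + \<parallel>f m x \<ominus>\<^bsub>A\<^esub> l x\<parallel>\<^bsub>A\<^esub>)"
          using F f l by (intro sum_mono A.nrm_triangle_minus) auto
        also have "\<dots> = (\<Sum>x\<in>F. \<parallel>(f n \<ominus>\<^bsub>L\<^esub> f m) x\<parallel>\<^bsub>A\<^esub>) + (\<Sum>x\<in>F. \<parallel>f m x \<ominus>\<^bsub>A\<^esub> l x\<parallel>\<^bsub>A\<^esub>)"
          using F by (simp add: sum.distrib l1_minus f subset_iff cong: sum.cong)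
        also have "(\<Sum>x\<in>F. \<parallel>(f n \<ominus>\<^bsub>L\<^esub> f m) x\<parallel>\<^bsub>A\<^esub>) \<le> \<parallel>f n \<ominus>\<^bsub>L\<^esub> f m\<parallel>\<^bsub>L\<^esub>"
          using F f by (intro finite_sum_le_nrm l1_minus_closed)
        finally show ?thesis using n[OF m] by simp
      qed
      then show "eventually (\<lambda>m. (\<Sum>x\<in>F. \<parallel>f n x \<ominus>\<^bsub>A\<^esub> l x\<parallel>\<^bsub>A\<^esub>) \<le> e + (\<Sum>x\<in>F. \<parallel>f m x \<ominus>\<^bsub>A\<^esub> l x\<parallel>\<^bsub>A\<^esub>)) sequentially"
        by (auto simp: eventually_sequentially)
    qed simp
    then show ?thesis
      using f l by (intro conjI l1I_finite_bound) auto
  qed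
  define l' where "l' = (\<lambda>x\<in>carrier G. l x)"
  obtain N0 where "\<And>m n. m \<ge> N0 \<Longrightarrow> n \<ge> N0 \<Longrightarrow> \<parallel>f m \<ominus>\<^bsub>L\<^esub> f n\<parallel>\<^bsub>L\<^esub> < 1"
    using cauchy[of 1] by auto
  then have r: "(\<lambda>x\<in>carrier G. f N0 x \<ominus>\<^bsub>A\<^esub> l x) \<in> l1_functions G A"
    using tail[of N0 N0 1] by blast
  have "l' = f N0 \<ominus>\<^bsub>L\<^esub> (\<lambda>x\<in>carrier G. f N0 x \<ominus>\<^bsub>A\<^esub> l x)"
    unfolding l1_minus[OF f r] l'_def using f l
    by (intro restrict_ext) (simp add: A.minus_eq A.minus_add A.r_neg1 flip: A.a_assoc, simp add: A.r_neg)
  then have l': "l' \<in> l1_functions G A" using l1_minus_closed[OF f r] by simp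
  have "\<exists>N. \<forall>n\<ge>N. \<parallel>f n \<ominus>\<^bsub>L\<^esub> l'\<parallel>\<^bsub>L\<^esub> < e" if e: "e > 0" for e
  proof -
    obtain N where N: "\<And>m n. m \<ge> N \<Longrightarrow> n \<ge> N \<Longrightarrow> \<parallel>f m \<ominus>\<^bsub>L\<^esub> f n\<parallel>\<^bsub>L\<^esub> < e / 2"
      using cauchy[of "e / 2"] e by auto
    have "\<parallel>f n \<ominus>\<^bsub>L\<^esub> l'\<parallel>\<^bsub>L\<^esub> < e" if "n \<ge> N" for n
    proof -
      have "f n \<ominus>\<^bsub>L\<^esub> l' = (\<lambda>x\<in>carrier G. f n x \<ominus>\<^bsub>A\<^esub> l x)"
        unfolding l1_minus[OF f l'] by (intro restrict_ext) (simp add: l'_def)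
      then have "\<parallel>f n \<ominus>\<^bsub>L\<^esub> l'\<parallel>\<^bsub>L\<^esub> \<le> e / 2" using tail[of N n "e / 2"] N that by simp
      then show ?thesis using e by simp
    qed
    then show ?thesis by blast
  qed
  then show ?thesis using l' by blast
qed

definition delta :: "'g \<Rightarrow> 'a \<Rightarrow> 'g \<Rightarrow> 'a" where
  "delta x a = (\<lambda>y\<in>carrier G. if y = x then a else \<zero>\<^bsub>A\<^esub>)"

lemma delta_closed [simp]:
  assumes "x \<in> carrier G" "a \<in> carrier A"
  shows "delta x a \<in> l1_functions G A"
  unfolding delta_def
proof (rule l1I_finite_bound(1))
  fix F :: "'g set" assume F: "finite F"
  have "(\<Sum>y\<in>F. \<parallel>if y = x then a else \<zero>\<^bsub>A\<^esub>\<parallel>\<^bsub>A\<^esub>) = (\<Sum>y\<in>F. if y = x then \<parallel>a\<parallel>\<^bsub>A\<^esub> else 0)"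
    by (intro sum.cong) auto
  also have "\<dots> \<le> \<parallel>a\<parallel>\<^bsub>A\<^esub>" using F assms by (simp add: sum.delta)
  finally show "(\<Sum>y\<in>F. \<parallel>if y = x then a else \<zero>\<^bsub>A\<^esub>\<parallel>\<^bsub>A\<^esub>) \<le> \<parallel>a\<parallel>\<^bsub>A\<^esub>" .
qed (use assms in auto)

lemma delta_add: "a \<in> carrier A \<Longrightarrow> b \<in> carrier A \<Longrightarrow> delta x (a \<oplus>\<^bsub>A\<^esub> b) = delta x a \<oplus>\<^bsub>L\<^esub> delta x b"
  unfolding delta_def l1_simps by (intro restrict_ext) simp

lemma nrm_delta: "x \<in> carrier G \<Longrightarrow> a \<in> carrier A \<Longrightarrow> \<parallel>delta x a\<parallel>\<^bsub>L\<^esub> = \<parallel>a\<parallel>\<^bsub>A\<^esub>"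
proof -
  assume x: "x \<in> carrier G" "a \<in> carrier A"
  have "(\<Sum>\<^sub>\<infinity>y\<in>carrier G. \<parallel>if y = x then a else \<zero>\<^bsub>A\<^esub>\<parallel>\<^bsub>A\<^esub>) = (\<Sum>\<^sub>\<infinity>y\<in>{x}. \<parallel>a\<parallel>\<^bsub>A\<^esub>)"
    using x by (intro infsum_cong_neutral) auto
  then show ?thesis unfolding delta_def nrm_restrict by simp
qed

definition bounded_op :: "(('g \<Rightarrow> 'a) \<Rightarrow> 'g \<Rightarrow> 'a) \<Rightarrow> bool" where
  "bounded_op T \<longleftrightarrow> (\<forall>f\<in>l1_functions G A. T f \<in> l1_functions G A) \<and>
     (\<forall>f\<in>l1_functions G A. \<forall>g\<in>l1_functions G A. T (f \<oplus>\<^bsub>L\<^esub> g) = T f \<oplus>\<^bsub>L\<^esub> T g) \<and>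
     (\<exists>c\<ge>0. \<forall>f\<in>l1_functions G A. \<parallel>T f\<parallel>\<^bsub>L\<^esub> \<le> c * \<parallel>f\<parallel>\<^bsub>L\<^esub>)"

lemma bounded_op_comp:
  assumes "bounded_op S" "bounded_op T"
  shows "bounded_op (\<lambda>f. S (T f))"
proof -
  obtain c d where c: "c \<ge> 0" "\<And>f. f \<in> l1_functions G A \<Longrightarrow> \<parallel>S f\<parallel>\<^bsub>L\<^esub> \<le> c * \<parallel>f\<parallel>\<^bsub>L\<^esub>"
    and d: "d \<ge> 0" "\<And>f. f \<in> l1_functions G A \<Longrightarrow> \<parallel>T f\<parallel>\<^bsub>L\<^esub> \<le> d * \<parallel>f\<parallel>\<^bsub>L\<^esub>"
    using assms by (auto simp: bounded_op_def)
  have "\<parallel>S (T f)\<parallel>\<^bsub>L\<^esub> \<le> (c * d) * \<parallel>f\<parallel>\<^bsub>L\<^esub>" if f: "f \<in> l1_functions G A" for f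
  proof -
    have "\<parallel>S (T f)\<parallel>\<^bsub>L\<^esub> \<le> c * \<parallel>T f\<parallel>\<^bsub>L\<^esub>" using assms f by (intro c) (auto simp: bounded_op_def)
    also have "\<dots> \<le> c * (d * \<parallel>f\<parallel>\<^bsub>L\<^esub>)" using c d f by (intro mult_left_mono) auto
    finally show ?thesis by (simp add: mult_ac)
  qed
  then show ?thesis
    using assms c d unfolding bounded_op_def by (auto intro!: exI[of _ "c * d"])
qed

text \<open>
  Functions with finite support are dense. All identities between convolution products are reduced
  to point masses by this lemma, which avoids rearranging double sums.
\<close>

lemma bounded_op_eqI:
  assumes S: "bounded_op S" and T: "bounded_op T"
    and eq: "\<And>x a. x \<in> carrier G \<Longrightarrow> a \<in> carrier A \<Longrightarrow> S (delta x a) = T (delta x a)"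
    and f: "f \<in> l1_functions G A"
  shows "S f = T f"
proof -
  obtain c d where c: "c \<ge> 0" "\<And>f. f \<in> l1_functions G A \<Longrightarrow> \<parallel>S f\<parallel>\<^bsub>L\<^esub> \<le> c * \<parallel>f\<parallel>\<^bsub>L\<^esub>"
    and d: "d \<ge> 0" "\<And>f. f \<in> l1_functions G A \<Longrightarrow> \<parallel>T f\<parallel>\<^bsub>L\<^esub> \<le> d * \<parallel>f\<parallel>\<^bsub>L\<^esub>"
    using S T by (auto simp: bounded_op_def)
  have Sc: "S g \<in> l1_functions G A" and Tc: "T g \<in> l1_functions G A" if "g \<in> l1_functions G A" for g
    using S T that by (auto simp: bounded_op_def)
  have Sadd: "S (g \<oplus>\<^bsub>L\<^esub> h) = S g \<oplus>\<^bsub>L\<^esub> S h" and Tadd: "T (g \<oplus>\<^bsub>L\<^esub> h) = T g \<oplus>\<^bsub>L\<^esub> T h"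
    if "g \<in> l1_functions G A" "h \<in> l1_functions G A" for g h
    using S T that by (auto simp: bounded_op_def)
  define cut where "cut F = (\<lambda>x\<in>carrier G. if x \<in> F then f x else \<zero>\<^bsub>A\<^esub>)" for F
  have cut: "cut F \<in> l1_functions G A" for F
    unfolding cut_def
  proof (rule l1I_finite_bound(1))
    fix H assume H: "finite H" "H \<subseteq> carrier G"
    have "(\<Sum>x\<in>H. \<parallel>if x \<in> F then f x else \<zero>\<^bsub>A\<^esub>\<parallel>\<^bsub>A\<^esub>) \<le> (\<Sum>x\<in>H. \<parallel>f x\<parallel>\<^bsub>A\<^esub>)"
      using H f by (intro sum_mono) auto
    then show "(\<Sum>x\<in>H. \<parallel>if x \<in> F then f x else \<zero>\<^bsub>A\<^esub>\<parallel>\<^bsub>A\<^esub>) \<le> \<parallel>f\<parallel>\<^bsub>L\<^esub>"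
      using finite_sum_le_nrm[OF f H] by simp
  qed (use f in auto)
  have fin: "S (cut F) = T (cut F)" if "finite F" "F \<subseteq> carrier G" for F
    using that
  proof (induction F rule: finite_induct)
    case empty
    have "cut {} = delta \<one> \<zero>\<^bsub>A\<^esub>" unfolding cut_def delta_def by (intro restrict_ext) simp
    then show ?case using eq[of \<one> "\<zero>\<^bsub>A\<^esub>"] by simp
  next
    case (insert x F)
    have "cut (insert x F) = cut F \<oplus>\<^bsub>L\<^esub> delta x (f x)"
      unfolding cut_def delta_def l1_simps using insert f by (intro restrict_ext) auto
    then show ?case using insert cut f by (simp add: Sadd Tadd eq)
  qed
  show ?thesis
  proof (rule l1_ext_eq[OF Sc[OF f] Tc[OF f]])
    fix z assume z: "z \<in> carrier G"
    show "S f z = T f z"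
    proof (rule A.eq_if_small)
      show "S f z \<in> carrier A" "T f z \<in> carrier A" using Sc Tc f z by simp_all
      fix e :: real assume e: "e > 0"
      have fs: "A.abs_summable f (carrier G)" using f by (simp add: A.abs_summable_def l1_iff)
      have e': "e / (c + d + 1) > 0" using e c d by simp
      obtain F where F: "finite F" "F \<subseteq> carrier G"
        "\<And>H. finite H \<Longrightarrow> H \<subseteq> carrier G \<Longrightarrow> H \<inter> F = {} \<Longrightarrow> (\<Sum>i\<in>H. \<parallel>f i\<parallel>\<^bsub>A\<^esub>) < e / (c + d + 1)"
        using A.abs_summable_tail[OF fs e'] by metis
      define r where "r = cut (- F)"
      have r: "r \<in> l1_functions G A" by (simp add: r_def cut)
      have "(\<Sum>x\<in>H. \<parallel>if x \<in> - F then f x else \<zero>\<^bsub>A\<^esub>\<parallel>\<^bsub>A\<^esub>) \<le> e / (c + d + 1)"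
        if H: "finite H" "H \<subseteq> carrier G" for H
      proof -
        have "(\<Sum>x\<in>H. \<parallel>if x \<in> - F then f x else \<zero>\<^bsub>A\<^esub>\<parallel>\<^bsub>A\<^esub>) = (\<Sum>x\<in>H - F. \<parallel>f x\<parallel>\<^bsub>A\<^esub>)"
          using H by (intro sum.mono_neutral_cong_right) auto
        also have "\<dots> < e / (c + d + 1)" using H by (intro F) auto
        finally show ?thesis by simp
      qed
      then have nr: "\<parallel>r\<parallel>\<^bsub>L\<^esub> \<le> e / (c + d + 1)"
        unfolding r_def cut_def using f by (intro l1I_finite_bound) auto
      have "f = cut F \<oplus>\<^bsub>L\<^esub> r"
        by (rule l1_ext_eq[OF f l1_add(1)[OF cut r]]) (use f in \<open>auto simp: l1_simps(3) cut_def r_def\<close>)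
      then have "S f = S (cut F) \<oplus>\<^bsub>L\<^esub> S r" "T f = S (cut F) \<oplus>\<^bsub>L\<^esub> T r"
        using Sadd[OF cut r] Tadd[OF cut r] fin[OF F(1,2)] by metis+
      then have "S f z = S (cut F) z \<oplus>\<^bsub>A\<^esub> S r z" "T f z = S (cut F) z \<oplus>\<^bsub>A\<^esub> T r z"
        using z by (simp_all add: l1_simps(3))
      then have "S f z \<ominus>\<^bsub>A\<^esub> T f z = S r z \<ominus>\<^bsub>A\<^esub> T r z"
        using Sc[OF cut[of F]] Sc[OF r] Tc[OF r] z by (simp add: A.add_minus_add)
      then have "\<parallel>S f z \<ominus>\<^bsub>A\<^esub> T f z\<parallel>\<^bsub>A\<^esub> \<le> \<parallel>S r z\<parallel>\<^bsub>A\<^esub> + \<parallel>T r z\<parallel>\<^bsub>A\<^esub>"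
        using A.nrm_minus_le[of "S r z" "T r z"] Sc[OF r] Tc[OF r] z by simp
      also have "\<dots> \<le> \<parallel>S r\<parallel>\<^bsub>L\<^esub> + \<parallel>T r\<parallel>\<^bsub>L\<^esub>"
        by (intro add_mono value_le_nrm Sc Tc r z)
      also have "\<dots> \<le> c * \<parallel>r\<parallel>\<^bsub>L\<^esub> + d * \<parallel>r\<parallel>\<^bsub>L\<^esub>"
        by (intro add_mono c d r)
      also have "\<dots> = (c + d) * \<parallel>r\<parallel>\<^bsub>L\<^esub>" by (simp add: distrib_right)
      also have "\<dots> \<le> (c + d) * (e / (c + d + 1))"
        using c d by (intro mult_left_mono nr) auto
      also have "\<dots> < (c + d + 1) * (e / (c + d + 1))"
        using e' by (intro mult_strict_right_mono) auto
      finally show "\<parallel>S f z \<ominus>\<^bsub>A\<^esub> T f z\<parallel>\<^bsub>A\<^esub> < e" using c d by simp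
    qed
  qed
qed

lemma l1_finite_approx:
  assumes f: "f \<in> l1_functions G A" and e: "e > 0"
    and P0: "P \<zero>\<^bsub>L\<^esub>"
    and P: "\<And>g x. g \<in> l1_functions G A \<Longrightarrow> P g \<Longrightarrow> x \<in> carrier G \<Longrightarrow> P (g \<oplus>\<^bsub>L\<^esub> delta x (f x))"
  shows "\<exists>g\<in>l1_functions G A. P g \<and> \<parallel>f \<ominus>\<^bsub>L\<^esub> g\<parallel>\<^bsub>L\<^esub> \<le> e"
proof -
  define cut where "cut F = (\<lambda>x\<in>carrier G. if x \<in> F then f x else \<zero>\<^bsub>A\<^esub>)" for F
  have cut: "cut F \<in> l1_functions G A \<and> P (cut F)" if "finite F" "F \<subseteq> carrier G" for F
    using that
  proof (induction F rule: finite_induct)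
    case empty
    have "cut {} = \<zero>\<^bsub>L\<^esub>" by (simp add: cut_def l1_simps(2))
    then show ?case using P0 l1_zero by simp
  next
    case (insert x F)
    have "cut (insert x F) = cut F \<oplus>\<^bsub>L\<^esub> delta x (f x)"
      unfolding cut_def delta_def l1_simps using insert f by (intro restrict_ext) auto
    then show ?case using insert f P by (simp add: l1_add)
  qed
  have fs: "A.abs_summable f (carrier G)" using f by (simp add: A.abs_summable_def l1_iff)
  obtain F where F: "finite F" "F \<subseteq> carrier G"
    "\<And>H. finite H \<Longrightarrow> H \<subseteq> carrier G \<Longrightarrow> H \<inter> F = {} \<Longrightarrow> (\<Sum>i\<in>H. \<parallel>f i\<parallel>\<^bsub>A\<^esub>) < e"
    by (rule A.abs_summable_tail[OF fs e]) blast
  have c: "cut F \<in> l1_functions G A" "P (cut F)" using cut[OF F(1,2)] by simp_all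
  have "\<parallel>f \<ominus>\<^bsub>L\<^esub> cut F\<parallel>\<^bsub>L\<^esub> \<le> e"
    unfolding l1_minus[OF f c(1)]
  proof (rule l1I_finite_bound(2))
    fix H assume H: "finite H" "H \<subseteq> carrier G"
    have "(\<Sum>x\<in>H. \<parallel>f x \<ominus>\<^bsub>A\<^esub> cut F x\<parallel>\<^bsub>A\<^esub>) = (\<Sum>x\<in>H - F. \<parallel>f x\<parallel>\<^bsub>A\<^esub>)"
      using H f by (intro sum.mono_neutral_cong_right) (auto simp: cut_def A.minus_eq A.r_neg subset_iff)
    also have "\<dots> < e" using H by (intro F) auto
    finally show "(\<Sum>x\<in>H. \<parallel>f x \<ominus>\<^bsub>A\<^esub> cut F x\<parallel>\<^bsub>A\<^esub>) \<le> e" by simp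
  qed (use f c in auto)
  then show ?thesis using c by blast
qed

end

lemma (in unital_banach) alg_sum_cong:
  assumes f: "abs_summable f I" and fg: "\<And>i. i \<in> I \<Longrightarrow> g i = f i"
  shows "alg_sum A g I = alg_sum A f I"
proof (rule alg_sum_eqI)
  have fc: "f \<in> I \<rightarrow> carrier A" using f by (simp add: abs_summable_def)
  then show "g \<in> I \<rightarrow> carrier A" using fg by auto
  show "alg_sum A f I \<in> carrier A" using f by simp
  fix e :: real assume e: "e > 0"
  obtain F where F: "finite F" "F \<subseteq> I"
    "\<And>H. finite H \<Longrightarrow> F \<subseteq> H \<Longrightarrow> H \<subseteq> I \<Longrightarrow> \<parallel>finsum A f H \<ominus> alg_sum A f I\<parallel> < e"
    by (rule alg_sum_near[OF f e]) blast
  have eq: "finsum A g H = finsum A f H" if "H \<subseteq> I" for H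
    using that fc fg by (intro add.finprod_cong') auto
  show "\<exists>F. finite F \<and> F \<subseteq> I \<and> (\<forall>H. finite H \<longrightarrow> F \<subseteq> H \<longrightarrow> H \<subseteq> I \<longrightarrow> \<parallel>finsum A g H \<ominus> alg_sum A f I\<parallel> < e)"
    using F by (intro exI[of _ F]) (simp add: eq)
qed

section \<open>Convolution products\<close>

text \<open>
  A common frame for the twisted product, with \<open>m y z a b = a \<alpha>\<^sub>y(b) \<omega>(y, z)\<close>, and the untwisted
  one, with \<open>m y z a b = a b\<close>. Norm estimates and bilinearity are proved once
  for both.
\<close>

locale l1_kernel = l1_space G A
  for G :: "('g, 'k) monoid_scheme" (structure) and A :: "('a, 'm) star_algebra_scheme" +
  fixes m :: "'g \<Rightarrow> 'g \<Rightarrow> 'a \<Rightarrow> 'a \<Rightarrow> 'a"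
  assumes m_closed: "\<lbrakk>y \<in> carrier G; z \<in> carrier G; a \<in> carrier A; b \<in> carrier A\<rbrakk> \<Longrightarrow> m y z a b \<in> carrier A"
    and m_add_left: "\<lbrakk>y \<in> carrier G; z \<in> carrier G; a \<in> carrier A; a' \<in> carrier A; b \<in> carrier A\<rbrakk> \<Longrightarrow>
      m y z (a \<oplus>\<^bsub>A\<^esub> a') b = m y z a b \<oplus>\<^bsub>A\<^esub> m y z a' b"
    and m_add_right: "\<lbrakk>y \<in> carrier G; z \<in> carrier G; a \<in> carrier A; b \<in> carrier A; b' \<in> carrier A\<rbrakk> \<Longrightarrow>
      m y z a (b \<oplus>\<^bsub>A\<^esub> b') = m y z a b \<oplus>\<^bsub>A\<^esub> m y z a b'"
    and m_norm: "\<lbrakk>y \<in> carrier G; z \<in> carrier G; a \<in> carrier A; b \<in> carrier A\<rbrakk> \<Longrightarrow>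
      \<parallel>m y z a b\<parallel>\<^bsub>A\<^esub> \<le> \<parallel>a\<parallel>\<^bsub>A\<^esub> * \<parallel>b\<parallel>\<^bsub>A\<^esub>"
begin

abbreviation fam :: "('g \<Rightarrow> 'a) \<Rightarrow> ('g \<Rightarrow> 'a) \<Rightarrow> 'g \<Rightarrow> 'g \<Rightarrow> 'a" where
  "fam f g x y \<equiv> m y (inv y \<otimes> x) (f y) (g (inv y \<otimes> x))"

definition conv :: "('g \<Rightarrow> 'a) \<Rightarrow> ('g \<Rightarrow> 'a) \<Rightarrow> 'g \<Rightarrow> 'a" where
  "conv f g = (\<lambda>x\<in>carrier G. alg_sum A (fam f g x) (carrier G))"

lemma m_zero:
  assumes "y \<in> carrier G" "z \<in> carrier G" "a \<in> carrier A"
  shows "m y z \<zero>\<^bsub>A\<^esub> a = \<zero>\<^bsub>A\<^esub>" "m y z a \<zero>\<^bsub>A\<^esub> = \<zero>\<^bsub>A\<^esub>"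
proof -
  have "\<parallel>m y z \<zero>\<^bsub>A\<^esub> a\<parallel>\<^bsub>A\<^esub> \<le> 0" "\<parallel>m y z a \<zero>\<^bsub>A\<^esub>\<parallel>\<^bsub>A\<^esub> \<le> 0"
    using m_norm[of y z "\<zero>\<^bsub>A\<^esub>" a] m_norm[of y z a "\<zero>\<^bsub>A\<^esub>"] assms by auto
  then show "m y z \<zero>\<^bsub>A\<^esub> a = \<zero>\<^bsub>A\<^esub>" "m y z a \<zero>\<^bsub>A\<^esub> = \<zero>\<^bsub>A\<^esub>"
    using A.nrm_nonneg[OF m_closed[of y z "\<zero>\<^bsub>A\<^esub>" a]] A.nrm_nonneg[OF m_closed[of y z a "\<zero>\<^bsub>A\<^esub>"]]
      A.nrm_eq_0_iff[OF m_closed[of y z "\<zero>\<^bsub>A\<^esub>" a]] A.nrm_eq_0_iff[OF m_closed[of y z a "\<zero>\<^bsub>A\<^esub>"]] assms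
    by (metis A.zero_closed antisym)+
qed

lemma fam_norm:
  assumes "f \<in> l1_functions G A" "g \<in> l1_functions G A" "x \<in> carrier G" "y \<in> carrier G"
  shows "\<parallel>fam f g x y\<parallel>\<^bsub>A\<^esub> \<le> \<parallel>f y\<parallel>\<^bsub>A\<^esub> * \<parallel>g (inv y \<otimes> x)\<parallel>\<^bsub>A\<^esub>"
  using assms by (intro m_norm) auto

lemma fam_summable:
  assumes "f \<in> l1_functions G A" "g \<in> l1_functions G A" "x \<in> carrier G"
  shows "A.abs_summable (fam f g x) (carrier G)"
proof -
  have "\<parallel>fam f g x y\<parallel>\<^bsub>A\<^esub> \<le> \<parallel>f y\<parallel>\<^bsub>A\<^esub> * \<parallel>g\<parallel>\<^bsub>L\<^esub>" if y: "y \<in> carrier G" for y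
  proof -
    have "\<parallel>fam f g x y\<parallel>\<^bsub>A\<^esub> \<le> \<parallel>f y\<parallel>\<^bsub>A\<^esub> * \<parallel>g (inv y \<otimes> x)\<parallel>\<^bsub>A\<^esub>"
      by (rule fam_norm[OF assms y])
    also have "\<dots> \<le> \<parallel>f y\<parallel>\<^bsub>A\<^esub> * \<parallel>g\<parallel>\<^bsub>L\<^esub>"
      using assms y by (intro mult_left_mono value_le_nrm A.nrm_nonneg) auto
    finally show ?thesis .
  qed
  then have "(\<lambda>y. \<parallel>fam f g x y\<parallel>\<^bsub>A\<^esub>) summable_on carrier G"
    by (rule summable_on_comparison_test[OF summable_on_cmult_left[OF l1_summable[OF assms(1)], of "\<parallel>g\<parallel>\<^bsub>L\<^esub>"]])
       (use assms in \<open>auto intro!: A.nrm_nonneg m_closed\<close>)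
  then show ?thesis using assms by (auto simp: A.abs_summable_def intro!: m_closed)
qed

lemma conv_bound:
  assumes f: "f \<in> l1_functions G A" and g: "g \<in> l1_functions G A" and F: "finite F" "F \<subseteq> carrier G"
  shows "(\<Sum>x\<in>F. \<parallel>alg_sum A (fam f g x) (carrier G)\<parallel>\<^bsub>A\<^esub>) \<le> \<parallel>f\<parallel>\<^bsub>L\<^esub> * \<parallel>g\<parallel>\<^bsub>L\<^esub>"
proof -
  have s: "(\<lambda>y. \<parallel>fam f g x y\<parallel>\<^bsub>A\<^esub>) summable_on carrier G" if "x \<in> F" for x
    using fam_summable[OF f g, of x] that F by (auto simp: A.abs_summable_def)
  have fin: "(\<Sum>x\<in>F. \<Sum>y\<in>H. \<parallel>fam f g x y\<parallel>\<^bsub>A\<^esub>) \<le> \<parallel>f\<parallel>\<^bsub>L\<^esub> * \<parallel>g\<parallel>\<^bsub>L\<^esub>"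
    if H: "finite H" "H \<subseteq> carrier G" for H
  proof -
    have "(\<Sum>x\<in>F. \<Sum>y\<in>H. \<parallel>fam f g x y\<parallel>\<^bsub>A\<^esub>) = (\<Sum>y\<in>H. \<Sum>x\<in>F. \<parallel>fam f g x y\<parallel>\<^bsub>A\<^esub>)"
      by (rule sum.swap)
    also have "\<dots> \<le> (\<Sum>y\<in>H. \<parallel>f y\<parallel>\<^bsub>A\<^esub> * \<parallel>g\<parallel>\<^bsub>L\<^esub>)"
    proof (rule sum_mono)
      fix y assume "y \<in> H"
      then have y: "y \<in> carrier G" using H by auto
      have "(\<Sum>x\<in>F. \<parallel>fam f g x y\<parallel>\<^bsub>A\<^esub>) \<le> (\<Sum>x\<in>F. \<parallel>f y\<parallel>\<^bsub>A\<^esub> * \<parallel>g (inv y \<otimes> x)\<parallel>\<^bsub>A\<^esub>)"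
        using F f g y by (intro sum_mono fam_norm) auto
      also have "\<dots> = \<parallel>f y\<parallel>\<^bsub>A\<^esub> * (\<Sum>x\<in>F. \<parallel>g (inv y \<otimes> x)\<parallel>\<^bsub>A\<^esub>)"
        by (simp add: sum_distrib_left)
      also have "(\<Sum>x\<in>F. \<parallel>g (inv y \<otimes> x)\<parallel>\<^bsub>A\<^esub>) = (\<Sum>z\<in>(\<lambda>x. inv y \<otimes> x) ` F. \<parallel>g z\<parallel>\<^bsub>A\<^esub>)"
        using F y by (subst sum.reindex) (auto simp: inj_on_def subset_iff)
      also have "\<parallel>f y\<parallel>\<^bsub>A\<^esub> * \<dots> \<le> \<parallel>f y\<parallel>\<^bsub>A\<^esub> * \<parallel>g\<parallel>\<^bsub>L\<^esub>"
        using F y f g by (intro mult_left_mono finite_sum_le_nrm) auto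
      finally show "(\<Sum>x\<in>F. \<parallel>fam f g x y\<parallel>\<^bsub>A\<^esub>) \<le> \<parallel>f y\<parallel>\<^bsub>A\<^esub> * \<parallel>g\<parallel>\<^bsub>L\<^esub>" .
    qed
    also have "\<dots> = (\<Sum>y\<in>H. \<parallel>f y\<parallel>\<^bsub>A\<^esub>) * \<parallel>g\<parallel>\<^bsub>L\<^esub>" by (simp add: sum_distrib_right)
    also have "\<dots> \<le> \<parallel>f\<parallel>\<^bsub>L\<^esub> * \<parallel>g\<parallel>\<^bsub>L\<^esub>"
      using H f g by (intro mult_right_mono finite_sum_le_nrm nrm_l1_nonneg)
    finally show ?thesis .
  qed
  have "((\<lambda>H. \<Sum>x\<in>F. \<Sum>y\<in>H. \<parallel>fam f g x y\<parallel>\<^bsub>A\<^esub>) \<longlongrightarrow> (\<Sum>x\<in>F. \<Sum>\<^sub>\<infinity>y\<in>carrier G. \<parallel>fam f g x y\<parallel>\<^bsub>A\<^esub>))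
      (finite_subsets_at_top (carrier G))"
    by (intro tendsto_sum infsum_tendsto s)
  then have lim: "(\<Sum>x\<in>F. \<Sum>\<^sub>\<infinity>y\<in>carrier G. \<parallel>fam f g x y\<parallel>\<^bsub>A\<^esub>) \<le> \<parallel>f\<parallel>\<^bsub>L\<^esub> * \<parallel>g\<parallel>\<^bsub>L\<^esub>"
    by (rule tendsto_upperbound) (auto intro!: eventually_finite_subsets_at_top_weakI fin)
  have "(\<Sum>x\<in>F. \<parallel>alg_sum A (fam f g x) (carrier G)\<parallel>\<^bsub>A\<^esub>) \<le> (\<Sum>x\<in>F. \<Sum>\<^sub>\<infinity>y\<in>carrier G. \<parallel>fam f g x y\<parallel>\<^bsub>A\<^esub>)"
    using F f g by (intro sum_mono A.nrm_alg_sum_le fam_summable) auto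
  then show ?thesis using lim by simp
qed

lemma conv_closed: "f \<in> l1_functions G A \<Longrightarrow> g \<in> l1_functions G A \<Longrightarrow> conv f g \<in> l1_functions G A"
  unfolding conv_def by (rule l1I_finite_bound(1)[OF A.alg_sum_closed[OF fam_summable] conv_bound])

lemma conv_norm: "f \<in> l1_functions G A \<Longrightarrow> g \<in> l1_functions G A \<Longrightarrow> \<parallel>conv f g\<parallel>\<^bsub>L\<^esub> \<le> \<parallel>f\<parallel>\<^bsub>L\<^esub> * \<parallel>g\<parallel>\<^bsub>L\<^esub>"
  unfolding conv_def by (rule l1I_finite_bound(2)[OF A.alg_sum_closed[OF fam_summable] conv_bound])

lemma conv_add_left:
  assumes f: "f \<in> l1_functions G A" "f' \<in> l1_functions G A" and g: "g \<in> l1_functions G A"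
  shows "conv (f \<oplus>\<^bsub>L\<^esub> f') g = conv f g \<oplus>\<^bsub>L\<^esub> conv f' g"
  unfolding l1_simps(3)[of "conv f g"] conv_def[of "f \<oplus>\<^bsub>L\<^esub> f'"]
proof (rule restrict_ext)
  fix x assume x: "x \<in> carrier G"
  have "alg_sum A (fam (f \<oplus>\<^bsub>L\<^esub> f') g x) (carrier G) = alg_sum A (\<lambda>y. fam f g x y \<oplus>\<^bsub>A\<^esub> fam f' g x y) (carrier G)"
    using f g x
    by (intro A.alg_sum_cong A.abs_summable_add fam_summable) (simp_all add: l1_simps(3) m_add_left)
  also have "\<dots> = conv f g x \<oplus>\<^bsub>A\<^esub> conv f' g x"
    using f g x by (simp add: conv_def A.alg_sum_add fam_summable)
  finally show "alg_sum A (fam (f \<oplus>\<^bsub>L\<^esub> f') g x) (carrier G) = conv f g x \<oplus>\<^bsub>A\<^esub> conv f' g x" .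
qed

lemma conv_add_right:
  assumes f: "f \<in> l1_functions G A" and g: "g \<in> l1_functions G A" "g' \<in> l1_functions G A"
  shows "conv f (g \<oplus>\<^bsub>L\<^esub> g') = conv f g \<oplus>\<^bsub>L\<^esub> conv f g'"
  unfolding l1_simps(3)[of "conv f g"] conv_def[of f "g \<oplus>\<^bsub>L\<^esub> g'"]
proof (rule restrict_ext)
  fix x assume x: "x \<in> carrier G"
  have "alg_sum A (fam f (g \<oplus>\<^bsub>L\<^esub> g') x) (carrier G) = alg_sum A (\<lambda>y. fam f g x y \<oplus>\<^bsub>A\<^esub> fam f g' x y) (carrier G)"
    using f g x
    by (intro A.alg_sum_cong A.abs_summable_add fam_summable) (simp_all add: l1_simps(3) m_add_right)
  also have "\<dots> = conv f g x \<oplus>\<^bsub>A\<^esub> conv f g' x"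
    using f g x by (simp add: conv_def A.alg_sum_add fam_summable)
  finally show "alg_sum A (fam f (g \<oplus>\<^bsub>L\<^esub> g') x) (carrier G) = conv f g x \<oplus>\<^bsub>A\<^esub> conv f g' x" .
qed

lemma conv_delta:
  assumes x: "x \<in> carrier G" and y: "y \<in> carrier G" and a: "a \<in> carrier A" and b: "b \<in> carrier A"
  shows "conv (delta x a) (delta y b) = delta (x \<otimes> y) (m x y a b)"
  unfolding conv_def delta_def[of "x \<otimes> y"]
proof (rule restrict_ext)
  fix z assume z: "z \<in> carrier G"
  have "alg_sum A (fam (delta x a) (delta y b) z) (carrier G) = fam (delta x a) (delta y b) z x"
  proof (rule A.alg_sum_single[OF x])
    show "fam (delta x a) (delta y b) z \<in> carrier G \<rightarrow> carrier A"
      using assms z by (auto intro!: m_closed)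
    fix u assume "u \<in> carrier G" "u \<noteq> x"
    moreover from this have "delta y b (inv u \<otimes> z) \<in> carrier A" using assms z by (intro l1_value) auto
    ultimately show "fam (delta x a) (delta y b) z u = \<zero>\<^bsub>A\<^esub>"
      using z by (simp add: delta_def[of x] m_zero)
  qed
  also have "\<dots> = (if z = x \<otimes> y then m x y a b else \<zero>\<^bsub>A\<^esub>)"
  proof (cases "z = x \<otimes> y")
    case True
    then show ?thesis using assms by (simp add: delta_def flip: m_assoc)
  next
    case False
    then have "inv x \<otimes> z \<noteq> y" using x y z by (metis inv_solve_left)
    then show ?thesis using False assms z by (simp add: delta_def m_zero)
  qed
  finally show "alg_sum A (fam (delta x a) (delta y b) z) (carrier G) = (if z = x \<otimes> y then m x y a b else \<zero>\<^bsub>A\<^esub>)" .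
qed

lemma bounded_op_conv_left: "g \<in> l1_functions G A \<Longrightarrow> bounded_op (\<lambda>f. conv f g)"
  unfolding bounded_op_def
  by (auto intro!: exI[of _ "\<parallel>g\<parallel>\<^bsub>L\<^esub>"] simp: conv_closed conv_add_left nrm_l1_nonneg)
     (metis conv_norm mult.commute)

lemma bounded_op_conv_right: "f \<in> l1_functions G A \<Longrightarrow> bounded_op (\<lambda>g. conv f g)"
  unfolding bounded_op_def
  by (auto intro!: exI[of _ "\<parallel>f\<parallel>\<^bsub>L\<^esub>"] simp: conv_closed conv_add_right nrm_l1_nonneg conv_norm)

end

context l1_space
begin

lemma bounded_op_id: "bounded_op (\<lambda>f. f)"
  unfolding bounded_op_def by (auto intro!: exI[of _ 1])

lemma bounded_op_smult: "bounded_op (\<lambda>f. z \<odot>\<^bsub>L\<^esub> f)"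
  unfolding bounded_op_def
proof (intro conjI ballI exI[of _ "cmod z"])
  fix f g assume "f \<in> l1_functions G A" "g \<in> l1_functions G A"
  then show "z \<odot>\<^bsub>L\<^esub> (f \<oplus>\<^bsub>L\<^esub> g) = z \<odot>\<^bsub>L\<^esub> f \<oplus>\<^bsub>L\<^esub> z \<odot>\<^bsub>L\<^esub> g"
    unfolding l1_simps by (intro restrict_ext) (simp add: A.scale_r_distr)
qed (simp_all add: l1_smult)

lemma l1_star_add:
  assumes "f \<in> l1_functions G A" "g \<in> l1_functions G A"
  shows "(f \<oplus>\<^bsub>L\<^esub> g)\<^sup>\<star>\<^bsub>L\<^esub> = f\<^sup>\<star>\<^bsub>L\<^esub> \<oplus>\<^bsub>L\<^esub> g\<^sup>\<star>\<^bsub>L\<^esub>"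
  unfolding l1_simps using assms by (intro restrict_ext) (simp add: A.star_add)

lemma bounded_op_star: "bounded_op (\<lambda>f. f\<^sup>\<star>\<^bsub>L\<^esub>)"
  unfolding bounded_op_def by (auto intro!: exI[of _ 1] simp: l1_star l1_star_add)

sublocale P: l1_kernel G A "\<lambda>y z a b. a \<otimes>\<^bsub>A\<^esub> b"
  by unfold_locales (simp_all add: A.l_distr A.r_distr A.nrm_mult)

lemma l1_mult: "f \<otimes>\<^bsub>L\<^esub> g = P.conv f g"
  by (simp add: l1_algebra_def P.conv_def)

lemma l1_one: "\<one>\<^bsub>L\<^esub> = delta \<one> \<one>\<^bsub>A\<^esub>"
  by (simp add: l1_algebra_def delta_def)

lemma smult_delta: "a \<in> carrier A \<Longrightarrow> z \<odot>\<^bsub>L\<^esub> delta x a = delta x (z \<odot>\<^bsub>A\<^esub> a)"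
proof -
  have "z \<odot>\<^bsub>A\<^esub> \<zero>\<^bsub>A\<^esub> = \<zero>\<^bsub>A\<^esub>"
    using A.nrm_smult[of "\<zero>\<^bsub>A\<^esub>" z] by (simp add: A.nrm_eq_0_iff)
  then show ?thesis unfolding delta_def l1_simps by (intro restrict_ext) simp
qed

lemma star_zero: "\<zero>\<^bsub>A\<^esub>\<^sup>\<star>\<^bsub>A\<^esub> = \<zero>\<^bsub>A\<^esub>"
  using A.nrm_star[of "\<zero>\<^bsub>A\<^esub>"] by (simp add: A.nrm_eq_0_iff A.star_closed)

lemma star_delta: "x \<in> carrier G \<Longrightarrow> a \<in> carrier A \<Longrightarrow> (delta x a)\<^sup>\<star>\<^bsub>L\<^esub> = delta (inv x) (a\<^sup>\<star>\<^bsub>A\<^esub>)"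
  unfolding delta_def l1_simps by (intro restrict_ext) (auto simp: star_zero)

lemma conv_assoc:
  assumes f: "f \<in> l1_functions G A" and g: "g \<in> l1_functions G A" and h: "h \<in> l1_functions G A"
  shows "P.conv (P.conv f g) h = P.conv f (P.conv g h)"
proof (rule bounded_op_eqI[OF _ _ _ f])
  show "bounded_op (\<lambda>f. P.conv (P.conv f g) h)"
    by (rule bounded_op_comp[OF P.bounded_op_conv_left[OF h] P.bounded_op_conv_left[OF g]])
  show "bounded_op (\<lambda>f. P.conv f (P.conv g h))"
    by (intro P.bounded_op_conv_left P.conv_closed g h)
  fix x a assume x: "x \<in> carrier G" "a \<in> carrier A"
  show "P.conv (P.conv (delta x a) g) h = P.conv (delta x a) (P.conv g h)"
  proof (rule bounded_op_eqI[OF _ _ _ g])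
    show "bounded_op (\<lambda>g. P.conv (P.conv (delta x a) g) h)"
      by (rule bounded_op_comp[OF P.bounded_op_conv_left[OF h] P.bounded_op_conv_right[OF delta_closed[OF x]]])
    show "bounded_op (\<lambda>g. P.conv (delta x a) (P.conv g h))"
      by (rule bounded_op_comp[OF P.bounded_op_conv_right[OF delta_closed[OF x]] P.bounded_op_conv_left[OF h]])
    fix y b assume y: "y \<in> carrier G" "b \<in> carrier A"
    show "P.conv (P.conv (delta x a) (delta y b)) h = P.conv (delta x a) (P.conv (delta y b) h)"
    proof (rule bounded_op_eqI[OF _ _ _ h])
      show "bounded_op (\<lambda>h. P.conv (P.conv (delta x a) (delta y b)) h)"
        by (intro P.bounded_op_conv_right P.conv_closed delta_closed x y)
      show "bounded_op (\<lambda>h. P.conv (delta x a) (P.conv (delta y b) h))"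
        by (rule bounded_op_comp[OF P.bounded_op_conv_right[OF delta_closed[OF x]] P.bounded_op_conv_right[OF delta_closed[OF y]]])
      fix z c assume "z \<in> carrier G" "c \<in> carrier A"
      then show "P.conv (P.conv (delta x a) (delta y b)) (delta z c) = P.conv (delta x a) (P.conv (delta y b) (delta z c))"
        using x y by (simp add: P.conv_delta m_assoc A.m_assoc)
    qed
  qed
qed

lemma conv_star:
  assumes f: "f \<in> l1_functions G A" and g: "g \<in> l1_functions G A"
  shows "(P.conv f g)\<^sup>\<star>\<^bsub>L\<^esub> = P.conv (g\<^sup>\<star>\<^bsub>L\<^esub>) (f\<^sup>\<star>\<^bsub>L\<^esub>)"
proof (rule bounded_op_eqI[OF _ _ _ f])
  show "bounded_op (\<lambda>f. (P.conv f g)\<^sup>\<star>\<^bsub>L\<^esub>)"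
    by (rule bounded_op_comp[OF bounded_op_star P.bounded_op_conv_left[OF g]])
  show "bounded_op (\<lambda>f. P.conv (g\<^sup>\<star>\<^bsub>L\<^esub>) (f\<^sup>\<star>\<^bsub>L\<^esub>))"
    by (rule bounded_op_comp[OF P.bounded_op_conv_right[OF l1_star(1)[OF g]] bounded_op_star])
  fix x a assume x: "x \<in> carrier G" "a \<in> carrier A"
  show "(P.conv (delta x a) g)\<^sup>\<star>\<^bsub>L\<^esub> = P.conv (g\<^sup>\<star>\<^bsub>L\<^esub>) ((delta x a)\<^sup>\<star>\<^bsub>L\<^esub>)"
  proof (rule bounded_op_eqI[OF _ _ _ g])
    show "bounded_op (\<lambda>g. (P.conv (delta x a) g)\<^sup>\<star>\<^bsub>L\<^esub>)"
      by (rule bounded_op_comp[OF bounded_op_star P.bounded_op_conv_right[OF delta_closed[OF x]]])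
    show "bounded_op (\<lambda>g. P.conv (g\<^sup>\<star>\<^bsub>L\<^esub>) ((delta x a)\<^sup>\<star>\<^bsub>L\<^esub>))"
      by (rule bounded_op_comp[OF P.bounded_op_conv_left[OF l1_star(1)[OF delta_closed[OF x]]] bounded_op_star])
    fix y b assume "y \<in> carrier G" "b \<in> carrier A"
    then show "(P.conv (delta x a) (delta y b))\<^sup>\<star>\<^bsub>L\<^esub> = P.conv ((delta y b)\<^sup>\<star>\<^bsub>L\<^esub>) ((delta x a)\<^sup>\<star>\<^bsub>L\<^esub>)"
      using x by (simp add: P.conv_delta star_delta A.star_closed A.star_mult inv_mult_group)
  qed
qed

lemma conv_smult:
  assumes f: "f \<in> l1_functions G A" and g: "g \<in> l1_functions G A"
  shows "P.conv (z \<odot>\<^bsub>L\<^esub> f) g = z \<odot>\<^bsub>L\<^esub> P.conv f g" "P.conv f (z \<odot>\<^bsub>L\<^esub> g) = z \<odot>\<^bsub>L\<^esub> P.conv f g"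
proof -
  have d: "P.conv (z \<odot>\<^bsub>L\<^esub> delta x a) g = z \<odot>\<^bsub>L\<^esub> P.conv (delta x a) g \<and>
      P.conv (delta x a) (z \<odot>\<^bsub>L\<^esub> g) = z \<odot>\<^bsub>L\<^esub> P.conv (delta x a) g"
    if x: "x \<in> carrier G" "a \<in> carrier A" for x a
  proof
    show "P.conv (z \<odot>\<^bsub>L\<^esub> delta x a) g = z \<odot>\<^bsub>L\<^esub> P.conv (delta x a) g"
    proof (rule bounded_op_eqI[OF _ _ _ g])
      show "bounded_op (\<lambda>g. P.conv (z \<odot>\<^bsub>L\<^esub> delta x a) g)"
        by (intro P.bounded_op_conv_right l1_smult delta_closed x)
      show "bounded_op (\<lambda>g. z \<odot>\<^bsub>L\<^esub> P.conv (delta x a) g)"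
        by (rule bounded_op_comp[OF bounded_op_smult P.bounded_op_conv_right[OF delta_closed[OF x]]])
    qed (use x in \<open>simp add: smult_delta P.conv_delta A.smult_mult_left\<close>)
    show "P.conv (delta x a) (z \<odot>\<^bsub>L\<^esub> g) = z \<odot>\<^bsub>L\<^esub> P.conv (delta x a) g"
    proof (rule bounded_op_eqI[OF _ _ _ g])
      show "bounded_op (\<lambda>g. P.conv (delta x a) (z \<odot>\<^bsub>L\<^esub> g))"
        by (rule bounded_op_comp[OF P.bounded_op_conv_right[OF delta_closed[OF x]] bounded_op_smult])
      show "bounded_op (\<lambda>g. z \<odot>\<^bsub>L\<^esub> P.conv (delta x a) g)"
        by (rule bounded_op_comp[OF bounded_op_smult P.bounded_op_conv_right[OF delta_closed[OF x]]])
    qed (use x in \<open>simp add: smult_delta P.conv_delta A.smult_mult_right\<close>)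
  qed
  show "P.conv (z \<odot>\<^bsub>L\<^esub> f) g = z \<odot>\<^bsub>L\<^esub> P.conv f g"
  proof (rule bounded_op_eqI[OF _ _ _ f])
    show "bounded_op (\<lambda>f. P.conv (z \<odot>\<^bsub>L\<^esub> f) g)"
      by (rule bounded_op_comp[OF P.bounded_op_conv_left[OF g] bounded_op_smult])
    show "bounded_op (\<lambda>f. z \<odot>\<^bsub>L\<^esub> P.conv f g)"
      by (rule bounded_op_comp[OF bounded_op_smult P.bounded_op_conv_left[OF g]])
  qed (use d in blast)
  show "P.conv f (z \<odot>\<^bsub>L\<^esub> g) = z \<odot>\<^bsub>L\<^esub> P.conv f g"
  proof (rule bounded_op_eqI[OF _ _ _ f])
    show "bounded_op (\<lambda>f. P.conv f (z \<odot>\<^bsub>L\<^esub> g))"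
      by (intro P.bounded_op_conv_left l1_smult g)
    show "bounded_op (\<lambda>f. z \<odot>\<^bsub>L\<^esub> P.conv f g)"
      by (rule bounded_op_comp[OF bounded_op_smult P.bounded_op_conv_left[OF g]])
  qed (use d in blast)
qed

lemma conv_one:
  assumes f: "f \<in> l1_functions G A"
  shows "P.conv (delta \<one> \<one>\<^bsub>A\<^esub>) f = f" "P.conv f (delta \<one> \<one>\<^bsub>A\<^esub>) = f"
proof -
  have d: "delta \<one> \<one>\<^bsub>A\<^esub> \<in> l1_functions G A" by simp
  show "P.conv (delta \<one> \<one>\<^bsub>A\<^esub>) f = f"
    by (rule bounded_op_eqI[OF P.bounded_op_conv_right[OF d] bounded_op_id _ f]) (simp add: P.conv_delta)
  show "P.conv f (delta \<one> \<one>\<^bsub>A\<^esub>) = f"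
    by (rule bounded_op_eqI[OF P.bounded_op_conv_left[OF d] bounded_op_id _ f]) (simp add: P.conv_delta)
qed

lemma l1_unital_banach: "unital_banach L"
proof (rule unital_banachI, goal_cases)
  case 1
  show ?case
  proof (rule ringI[OF l1_abelian_group])
    show "monoid L"
      by (rule monoidI) (simp_all add: l1_mult l1_one l1_simps(1) P.conv_closed conv_assoc conv_one)
  qed (simp_all add: l1_mult l1_simps(1) P.conv_add_left P.conv_add_right)
next
  case (3 z w a)
  then show ?case unfolding l1_simps by (intro restrict_ext) (simp add: A.scale_l_distr)
next
  case (4 z a b)
  then show ?case unfolding l1_simps by (intro restrict_ext) (simp add: A.scale_r_distr)
next
  case (5 z w a)
  then show ?case unfolding l1_simps by (intro restrict_ext) (simp add: A.scale_assoc)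
next
  case (6 a)
  then have a: "a \<in> l1_functions G A" by (simp add: l1_simps(1))
  show ?case
    by (rule l1_ext_eq[OF l1_smult(1)[OF a] a]) (use a in \<open>simp add: l1_simps(4)\<close>)
next
  case (10 a)
  then have a: "a \<in> l1_functions G A" by (simp add: l1_simps(1))
  show ?case
    by (rule l1_ext_eq[OF l1_star(1)[OF l1_star(1)[OF a]] a]) (use a in \<open>simp add: l1_simps(5) A.star_star\<close>)
next
  case (12 z a)
  then show ?case unfolding l1_simps by (intro restrict_ext) (simp add: A.star_smult)
next
  case (14 a)
  then have a: "a \<in> l1_functions G A" by (simp add: l1_simps(1))
  show ?case
  proof
    assume z: "\<parallel>a\<parallel>\<^bsub>L\<^esub> = 0"
    show "a = \<zero>\<^bsub>L\<^esub>"
    proof (rule l1_ext_eq[OF a l1_zero])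
      fix x assume x: "x \<in> carrier G"
      have "\<parallel>a x\<parallel>\<^bsub>A\<^esub> = 0"
        using value_le_nrm[OF a x] z A.nrm_nonneg[of "a x"] a x by (intro antisym) auto
      then show "a x = \<zero>\<^bsub>L\<^esub> x" using a x by (simp add: A.nrm_eq_0_iff l1_simps(2))
    qed
  next
    assume "a = \<zero>\<^bsub>L\<^esub>"
    then show "\<parallel>a\<parallel>\<^bsub>L\<^esub> = 0" by (simp add: l1_simps(2) nrm_restrict)
  qed
next
  case (19 f)
  then show ?case using l1_complete[of f] by (simp add: l1_simps(1))
qed (simp_all add: l1_simps(1) l1_smult l1_mult conv_smult l1_star l1_star_add conv_star l1_add P.conv_norm)

end

text \<open>
  The maps \<open>\<phi> x\<close> may depend on the group element, which is what allows a twisted product to be mapped to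
  an untwisted one.
\<close>

locale l1_hom = A: l1_kernel G A m + B: l1_kernel G B n
  for G :: "('g, 'k) monoid_scheme" (structure) and A :: "('a, 'm) star_algebra_scheme" and m
    and B :: "('b, 'n) star_algebra_scheme" and n +
  fixes \<phi> :: "'g \<Rightarrow> 'a \<Rightarrow> 'b"
  assumes \<phi>_bounded: "x \<in> carrier G \<Longrightarrow> bounded_additive A B (\<phi> x) 1"
    and \<phi>_mult: "\<lbrakk>y \<in> carrier G; z \<in> carrier G; a \<in> carrier A; b \<in> carrier A\<rbrakk> \<Longrightarrow>
      \<phi> (y \<otimes> z) (m y z a b) = n y z (\<phi> y a) (\<phi> z b)"
begin

definition induced :: "('g \<Rightarrow> 'a) \<Rightarrow> 'g \<Rightarrow> 'b" where
  "induced f = (\<lambda>x\<in>carrier G. \<phi> x (f x))"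

lemma \<phi>_closed: "x \<in> carrier G \<Longrightarrow> a \<in> carrier A \<Longrightarrow> \<phi> x a \<in> carrier B"
  by (rule bounded_additive.closed[OF \<phi>_bounded])

lemma \<phi>_norm: "x \<in> carrier G \<Longrightarrow> a \<in> carrier A \<Longrightarrow> \<parallel>\<phi> x a\<parallel>\<^bsub>B\<^esub> \<le> \<parallel>a\<parallel>\<^bsub>A\<^esub>"
  using bounded_additive.bounded[OF \<phi>_bounded, of x a] by simp

lemma induced_closed:
  assumes f: "f \<in> l1_functions G A"
  shows "induced f \<in> l1_functions G B" "\<parallel>induced f\<parallel>\<^bsub>l1_algebra G B\<^esub> \<le> \<parallel>f\<parallel>\<^bsub>l1_algebra G A\<^esub>"
proof -
  have "(\<Sum>x\<in>F. \<parallel>\<phi> x (f x)\<parallel>\<^bsub>B\<^esub>) \<le> \<parallel>f\<parallel>\<^bsub>l1_algebra G A\<^esub>" if F: "finite F" "F \<subseteq> carrier G" for F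
  proof -
    have "(\<Sum>x\<in>F. \<parallel>\<phi> x (f x)\<parallel>\<^bsub>B\<^esub>) \<le> (\<Sum>x\<in>F. \<parallel>f x\<parallel>\<^bsub>A\<^esub>)"
      using F f by (intro sum_mono \<phi>_norm) auto
    then show ?thesis using A.finite_sum_le_nrm[OF f F] by simp
  qed
  note * = B.l1I_finite_bound[of "\<lambda>x. \<phi> x (f x)", OF _ this]
  show "induced f \<in> l1_functions G B" "\<parallel>induced f\<parallel>\<^bsub>l1_algebra G B\<^esub> \<le> \<parallel>f\<parallel>\<^bsub>l1_algebra G A\<^esub>"
    unfolding induced_def by (rule *; use f \<phi>_closed in simp)+
qed

lemma induced_add:
  assumes "f \<in> l1_functions G A" "g \<in> l1_functions G A"
  shows "induced (f \<oplus>\<^bsub>l1_algebra G A\<^esub> g) = induced f \<oplus>\<^bsub>l1_algebra G B\<^esub> induced g"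
  unfolding induced_def A.l1_simps B.l1_simps
  by (intro restrict_ext) (use assms in \<open>simp add: bounded_additive.add[OF \<phi>_bounded]\<close>)

lemma induced_conv:
  assumes f: "f \<in> l1_functions G A" and g: "g \<in> l1_functions G A"
  shows "induced (A.conv f g) = B.conv (induced f) (induced g)"
  unfolding induced_def[of "A.conv f g"] B.conv_def
proof (rule restrict_ext)
  fix x assume x: "x \<in> carrier G"
  have "\<phi> x (A.conv f g x) = alg_sum B (\<lambda>y. \<phi> x (A.fam f g x y)) (carrier G)"
    using x bounded_additive.alg_sum[OF \<phi>_bounded[OF x] A.fam_summable[OF f g x]] by (simp add: A.conv_def)
  also have "\<dots> = alg_sum B (B.fam (induced f) (induced g) x) (carrier G)"
  proof (rule B.A.alg_sum_cong)
    show "B.A.abs_summable (B.fam (induced f) (induced g) x) (carrier G)"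
      by (intro B.fam_summable induced_closed f g x)
    fix y assume y: "y \<in> carrier G"
    have "\<phi> (y \<otimes> (inv y \<otimes> x)) (A.fam f g x y) = n y (inv y \<otimes> x) (\<phi> y (f y)) (\<phi> (inv y \<otimes> x) (g (inv y \<otimes> x)))"
      using x y f g by (intro \<phi>_mult) auto
    also have "y \<otimes> (inv y \<otimes> x) = x" using x y by (simp flip: A.m_assoc)
    finally show "\<phi> x (A.fam f g x y) = B.fam (induced f) (induced g) x y"
      using x y by (simp add: induced_def)
  qed
  finally show "\<phi> x (A.conv f g x) = alg_sum B (B.fam (induced f) (induced g) x) (carrier G)" .
qed

end

section \<open>Hausdorff quotients by seminorms\<close>

text \<open>
  The set \<open>\<kappa> ` S\<close> with the operations transported along \<open>\<kappa>\<close> and the norm induced by \<open>q\<close>. Two uses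
  are intended: \<open>\<kappa>\<close> is a map onto cosets, or an injective coding of the elements of a subalgebra.
\<close>

definition image_algebra ::
  "('a, 'm) star_algebra_scheme \<Rightarrow> 'a set \<Rightarrow> ('a \<Rightarrow> real) \<Rightarrow> ('a \<Rightarrow> 'b) \<Rightarrow> 'b star_algebra" where
  "image_algebra E S q \<kappa> = (let r = inv_into S \<kappa> in
     \<lparr>carrier = \<kappa> ` S,
      monoid.mult = (\<lambda>x y. \<kappa> (r x \<otimes>\<^bsub>E\<^esub> r y)),
      one = \<kappa> \<one>\<^bsub>E\<^esub>,
      zero = \<kappa> \<zero>\<^bsub>E\<^esub>,
      add = (\<lambda>x y. \<kappa> (r x \<oplus>\<^bsub>E\<^esub> r y)),
      smult = (\<lambda>z x. \<kappa> (z \<odot>\<^bsub>E\<^esub> r x)),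
      star = (\<lambda>x. \<kappa> ((r x)\<^sup>\<star>\<^bsub>E\<^esub>)),
      nrm = (\<lambda>x. q (r x))\<rparr>)"

text \<open>
  The elements identified by \<open>\<kappa>\<close> are those at \<open>q\<close>-distance zero, so that the image is the Hausdorff quotient
  of \<open>S\<close>.
\<close>

locale seminormed_subalgebra = unital_banach E
  for E :: "('a, 'm) star_algebra_scheme" (structure) +
  fixes S :: "'a set" and q :: "'a \<Rightarrow> real" and \<kappa> :: "'a \<Rightarrow> 'b"
  assumes S_carrier: "S \<subseteq> carrier E"
    and S_one: "\<one> \<in> S"
    and S_add: "a \<in> S \<Longrightarrow> b \<in> S \<Longrightarrow> a \<oplus> b \<in> S"
    and S_mult: "a \<in> S \<Longrightarrow> b \<in> S \<Longrightarrow> a \<otimes> b \<in> S"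
    and S_smult: "a \<in> S \<Longrightarrow> z \<odot> a \<in> S"
    and S_star: "a \<in> S \<Longrightarrow> a\<^sup>\<star> \<in> S"
    and q_add: "a \<in> S \<Longrightarrow> b \<in> S \<Longrightarrow> q (a \<oplus> b) \<le> q a + q b"
    and q_mult: "a \<in> S \<Longrightarrow> b \<in> S \<Longrightarrow> q (a \<otimes> b) \<le> q a * q b"
    and q_smult: "a \<in> S \<Longrightarrow> q (z \<odot> a) = cmod z * q a"
    and q_star: "a \<in> S \<Longrightarrow> q (a\<^sup>\<star>) = q a"
    and q_cstar: "a \<in> S \<Longrightarrow> q (a\<^sup>\<star> \<otimes> a) = (q a)\<^sup>2"
    and \<kappa>_eq: "a \<in> S \<Longrightarrow> b \<in> S \<Longrightarrow> \<kappa> a = \<kappa> b \<longleftrightarrow> q (a \<ominus> b) = 0"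
    and q_complete: "\<And>f :: nat \<Rightarrow> 'a. (\<And>n. f n \<in> S) \<Longrightarrow>
      (\<And>e. e > 0 \<Longrightarrow> \<exists>N. \<forall>m\<ge>N. \<forall>n\<ge>N. q (f m \<ominus> f n) < e) \<Longrightarrow>
      \<exists>l\<in>S. \<forall>e>0. \<exists>N. \<forall>n\<ge>N. q (f n \<ominus> l) < e"
begin

abbreviation Q where "Q \<equiv> image_algebra E S q \<kappa>"

lemma S_in [simp]: "a \<in> S \<Longrightarrow> a \<in> carrier E"
  using S_carrier by auto

lemma S_zero: "\<zero> \<in> S"
  using S_smult[OF S_one, of 0] by simp

lemma S_uminus: "a \<in> S \<Longrightarrow> \<ominus> a \<in> S"
  using S_smult[of a "-1"] by (simp add: scale_minus1)

lemma S_minus: "a \<in> S \<Longrightarrow> b \<in> S \<Longrightarrow> a \<ominus> b \<in> S"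
  by (simp add: minus_eq S_add S_uminus)

lemma q_zero: "q \<zero> = 0"
  using q_smult[OF S_zero, of 0] by simp

lemma q_uminus: "a \<in> S \<Longrightarrow> q (\<ominus> a) = q a"
  using q_smult[of a "-1"] by (simp add: scale_minus1)

lemma q_nonneg: "a \<in> S \<Longrightarrow> 0 \<le> q a"
  using q_add[of a "\<ominus> a"] by (simp add: r_neg q_zero q_uminus S_uminus)

lemma q_minus_commute: "a \<in> S \<Longrightarrow> b \<in> S \<Longrightarrow> q (a \<ominus> b) = q (b \<ominus> a)"
  using q_uminus[OF S_minus, of b a] by (simp add: minus_eq minus_add a_comm)

lemma \<kappa>_q: "a \<in> S \<Longrightarrow> b \<in> S \<Longrightarrow> \<kappa> a = \<kappa> b \<Longrightarrow> q a = q b"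
proof -
  have *: "q a \<le> q b" if "a \<in> S" "b \<in> S" "q (a \<ominus> b) = 0" for a b
    using q_add[OF that(2) S_minus[OF that(1,2)]] that
    by (simp add: minus_eq a_lcomm[of b a] r_neg)
  assume "a \<in> S" "b \<in> S" "\<kappa> a = \<kappa> b"
  then show "q a = q b" using *[of a b] *[of b a] \<kappa>_eq[of a b] q_minus_commute[of a b] by simp
qed

lemma rep:
  assumes "a \<in> S"
  shows "inv_into S \<kappa> (\<kappa> a) \<in> S" "\<kappa> (inv_into S \<kappa> (\<kappa> a)) = \<kappa> a" "q (inv_into S \<kappa> (\<kappa> a) \<ominus> a) = 0"
proof -
  show 1: "inv_into S \<kappa> (\<kappa> a) \<in> S" "\<kappa> (inv_into S \<kappa> (\<kappa> a)) = \<kappa> a"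
    using assms by (auto intro: inv_into_into f_inv_into_f)
  then show "q (inv_into S \<kappa> (\<kappa> a) \<ominus> a) = 0" using \<kappa>_eq assms by blast
qed

lemma Q_carrier: "carrier Q = \<kappa> ` S" and Q_one: "\<one>\<^bsub>Q\<^esub> = \<kappa> \<one>" and Q_zero: "\<zero>\<^bsub>Q\<^esub> = \<kappa> \<zero>"
  by (simp_all add: image_algebra_def Let_def)

lemma q_le_0: "a \<in> S \<Longrightarrow> q a \<le> 0 \<Longrightarrow> q a = 0"
  using q_nonneg[of a] by simp

lemma Q_mult: "a \<in> S \<Longrightarrow> b \<in> S \<Longrightarrow> \<kappa> a \<otimes>\<^bsub>Q\<^esub> \<kappa> b = \<kappa> (a \<otimes> b)"
proof -
  assume a: "a \<in> S" and b: "b \<in> S"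
  define a' b' where "a' = inv_into S \<kappa> (\<kappa> a)" and "b' = inv_into S \<kappa> (\<kappa> b)"
  note r = rep[OF a, folded a'_def] rep[OF b, folded b'_def]
  have "a' \<otimes> b' \<ominus> a \<otimes> b = (a' \<ominus> a) \<otimes> b' \<oplus> a \<otimes> (b' \<ominus> b)"
    using a b r by (simp add: minus_eq l_distr r_distr l_minus r_minus a_assoc) (simp add: l_neg flip: a_assoc)
  also have "q \<dots> \<le> q (a' \<ominus> a) * q b' + q a * q (b' \<ominus> b)"
    using a b r by (intro order_trans[OF q_add] add_mono q_mult S_mult S_minus)
  finally have "q (a' \<otimes> b' \<ominus> a \<otimes> b) = 0"
    using a b r by (intro q_le_0 S_minus S_mult) auto
  then have "\<kappa> (a' \<otimes> b') = \<kappa> (a \<otimes> b)" using a b r by (simp add: \<kappa>_eq S_mult)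
  then show ?thesis by (simp add: image_algebra_def Let_def a'_def b'_def)
qed

lemma Q_add: "a \<in> S \<Longrightarrow> b \<in> S \<Longrightarrow> \<kappa> a \<oplus>\<^bsub>Q\<^esub> \<kappa> b = \<kappa> (a \<oplus> b)"
proof -
  assume a: "a \<in> S" and b: "b \<in> S"
  define a' b' where "a' = inv_into S \<kappa> (\<kappa> a)" and "b' = inv_into S \<kappa> (\<kappa> b)"
  note r = rep[OF a, folded a'_def] rep[OF b, folded b'_def]
  have "(a' \<oplus> b') \<ominus> (a \<oplus> b) = (a' \<ominus> a) \<oplus> (b' \<ominus> b)"
    using a b r by (simp add: add_minus_add)
  also have "q \<dots> \<le> q (a' \<ominus> a) + q (b' \<ominus> b)"
    using a b r by (intro q_add S_minus)
  finally have "q ((a' \<oplus> b') \<ominus> (a \<oplus> b)) = 0"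
    using a b r by (intro q_le_0 S_minus S_add) auto
  then have "\<kappa> (a' \<oplus> b') = \<kappa> (a \<oplus> b)" using a b r by (simp add: \<kappa>_eq S_add)
  then show ?thesis by (simp add: image_algebra_def Let_def a'_def b'_def)
qed

lemma smult_minus: "a \<in> carrier E \<Longrightarrow> b \<in> carrier E \<Longrightarrow> z \<odot> (a \<ominus> b) = z \<odot> a \<ominus> z \<odot> b"
proof -
  assume a: "a \<in> carrier E" "b \<in> carrier E"
  have "z \<odot> (\<ominus> b) = \<ominus> (z \<odot> b)"
    using a scale_assoc[of b z "-1"] scale_assoc[of b "-1" z] by (simp flip: scale_minus1)
  then show ?thesis using a by (simp add: minus_eq scale_r_distr)
qed

lemma star_minus: "a \<in> carrier E \<Longrightarrow> b \<in> carrier E \<Longrightarrow> (a \<ominus> b)\<^sup>\<star> = a\<^sup>\<star> \<ominus> b\<^sup>\<star>"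
  using star_smult[of b "-1"] by (simp add: minus_eq star_add star_closed scale_minus1)

lemma Q_smult: "a \<in> S \<Longrightarrow> z \<odot>\<^bsub>Q\<^esub> \<kappa> a = \<kappa> (z \<odot> a)"
proof -
  assume a: "a \<in> S"
  define a' where "a' = inv_into S \<kappa> (\<kappa> a)"
  note r = rep[OF a, folded a'_def]
  have "q (z \<odot> a' \<ominus> z \<odot> a) = cmod z * q (a' \<ominus> a)"
    using a r by (simp add: q_smult S_minus flip: smult_minus)
  then have "\<kappa> (z \<odot> a') = \<kappa> (z \<odot> a)" using a r by (simp add: \<kappa>_eq S_smult)
  then show ?thesis by (simp add: image_algebra_def Let_def a'_def)
qed

lemma Q_star: "a \<in> S \<Longrightarrow> (\<kappa> a)\<^sup>\<star>\<^bsub>Q\<^esub> = \<kappa> (a\<^sup>\<star>)"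
proof -
  assume a: "a \<in> S"
  define a' where "a' = inv_into S \<kappa> (\<kappa> a)"
  note r = rep[OF a, folded a'_def]
  have "q (a'\<^sup>\<star> \<ominus> a\<^sup>\<star>) = q (a' \<ominus> a)"
    using a r by (simp add: q_star S_minus flip: star_minus)
  then have "\<kappa> (a'\<^sup>\<star>) = \<kappa> (a\<^sup>\<star>)" using a r by (simp add: \<kappa>_eq S_star)
  then show ?thesis by (simp add: image_algebra_def Let_def a'_def)
qed

lemma Q_nrm: "a \<in> S \<Longrightarrow> \<parallel>\<kappa> a\<parallel>\<^bsub>Q\<^esub> = q a"
  using \<kappa>_q[OF rep(1) _ rep(2), of a] by (simp add: image_algebra_def Let_def)

lemmas Q_simps = Q_carrier Q_one Q_zero Q_mult Q_add Q_smult Q_star Q_nrm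
lemmas S_closed = S_one S_zero S_add S_mult S_smult S_star S_uminus S_minus

lemma Q_abelian_group: "abelian_group Q"
proof (rule abelian_groupI)
  fix a assume "a \<in> carrier Q"
  then obtain b where b: "b \<in> S" "a = \<kappa> b" by (auto simp: Q_carrier)
  then have "\<kappa> (\<ominus> b) \<oplus>\<^bsub>Q\<^esub> a = \<zero>\<^bsub>Q\<^esub>" by (simp add: Q_simps S_closed l_neg)
  then show "\<exists>y\<in>carrier Q. y \<oplus>\<^bsub>Q\<^esub> a = \<zero>\<^bsub>Q\<^esub>" using b by (auto simp: Q_carrier S_closed)
qed (auto simp: Q_simps S_closed a_ac)

lemma Q_ring: "ring Q"
  by (rule ringI[OF Q_abelian_group monoidI]) (auto simp: Q_simps S_closed m_assoc l_distr r_distr)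

lemma Q_minus:
  assumes "a \<in> S" "b \<in> S"
  shows "\<kappa> a \<ominus>\<^bsub>Q\<^esub> \<kappa> b = \<kappa> (a \<ominus> b)"
proof -
  have "\<ominus>\<^bsub>Q\<^esub> \<kappa> b = \<kappa> (\<ominus> b)"
    using assms by (intro abelian_group.minus_equality[OF Q_abelian_group]) (simp_all add: Q_simps S_closed l_neg)
  then show ?thesis using assms by (simp add: a_minus_def Q_add S_closed)
qed

lemma Q_unital_banach: "unital_banach Q"
proof (rule unital_banachI[OF Q_ring], goal_cases)
  case (18 f)
  define g where "g n = inv_into S \<kappa> (f n)" for n
  have g: "g n \<in> S" "f n = \<kappa> (g n)" for n
    using 18(1)[of n] by (auto simp: g_def Q_carrier inv_into_into f_inv_into_f)
  have "\<exists>l\<in>S. \<forall>e>0. \<exists>N. \<forall>n\<ge>N. q (g n \<ominus> l) < e"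
    by (rule q_complete[OF g(1)]) (use 18(2) in \<open>simp add: g Q_minus Q_nrm S_minus\<close>)
  then obtain l where "l \<in> S" "\<forall>e>0. \<exists>N. \<forall>n\<ge>N. q (g n \<ominus> l) < e" by blast
  then show ?case
    by (intro bexI[of _ "\<kappa> l"]) (simp_all add: g Q_minus Q_nrm S_minus Q_carrier)
qed (auto simp: Q_simps S_closed scale_l_distr scale_r_distr scale_assoc smult_mult_left smult_mult_right
       star_star star_add star_smult star_mult q_add q_smult q_mult q_star \<kappa>_eq minus_eq)

lemma Q_cstar: "cstar_algebra Q"
proof -
  interpret U: unital_banach Q by (rule Q_unital_banach)
  show ?thesis
    by (intro cstar_algebra.intro U.banach_star_algebra_axioms cstar_algebra_axioms.intro)
       (auto simp: Q_simps S_closed q_cstar)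
qed

end

section \<open>Reduction to separable coefficients\<close>

text \<open>
  Terms for the *-polynomials in countably many generators, with scalars from a countable dense set. There
  are countably many of them.
\<close>

datatype star_poly = Gen nat | Sum star_poly star_poly | Prod star_poly star_poly | Adj star_poly
  | Scale nat star_poly

instance star_poly :: countable
  by countable_datatype

lemma dense_complex_sequence: "\<exists>s :: nat \<Rightarrow> complex. \<forall>z. \<forall>e>0. \<exists>n. cmod (z - s n) < e"
proof -
  obtain D :: "complex set" where D: "countable D" "\<And>U. open U \<Longrightarrow> U \<noteq> {} \<Longrightarrow> \<exists>d\<in>D. d \<in> U"
    using countable_dense_exists[where 'a = complex] by blast
  have ne: "D \<noteq> {}" using D(2)[of UNIV] by auto
  have "\<exists>n. cmod (z - from_nat_into D n) < e" if e: "e > 0" for z e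
  proof -
    obtain d where "d \<in> D" "d \<in> ball z e" using D(2)[of "ball z e"] e by auto
    then show ?thesis by (metis D(1) from_nat_into_surj dist_norm mem_ball)
  qed
  then show ?thesis by blast
qed

text \<open>
  The closed *-subalgebra generated by a sequence. An element is determined by the set of pairs of a term
  and a precision that it matches; with a coding of such pairs by natural numbers this embeds the
  subalgebra into \<open>nat set\<close>, the type over which rigid symmetry quantifies.
\<close>

locale separable_subalgebra = unital_banach D
  for D :: "('a, 'm) star_algebra_scheme" (structure) +
  fixes g :: "nat \<Rightarrow> 'a" and s :: "nat \<Rightarrow> complex"
  assumes cs: "a \<in> carrier D \<Longrightarrow> \<parallel>a\<^sup>\<star> \<otimes> a\<parallel> = \<parallel>a\<parallel>\<^sup>2"
    and g: "g n \<in> carrier D" "g 0 = \<one>"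
    and s: "e > 0 \<Longrightarrow> \<exists>n. cmod (z - s n) < e"
begin

primrec ev :: "star_poly \<Rightarrow> 'a" where
  "ev (Gen n) = g n"
| "ev (Sum p r) = ev p \<oplus> ev r"
| "ev (Prod p r) = ev p \<otimes> ev r"
| "ev (Adj p) = (ev p)\<^sup>\<star>"
| "ev (Scale n p) = s n \<odot> ev p"

lemma ev_closed [simp]: "ev p \<in> carrier D"
  by (induction p) (simp_all add: g star_closed)

definition S :: "'a set" where
  "S = {d \<in> carrier D. \<forall>e>0. \<exists>p. \<parallel>d \<ominus> ev p\<parallel> < e}"

definition code :: "'a \<Rightarrow> nat set" where
  "code d = {prod_encode (to_nat p, m) |p m. \<parallel>d \<ominus> ev p\<parallel> < 1 / Suc m}"

lemma gen_in_S: "g n \<in> S"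
  unfolding S_def using g by (auto simp: r_neg minus_eq intro!: exI[of _ "Gen n"])

lemma code_eq:
  assumes a: "a \<in> S" and b: "b \<in> S"
  shows "code a = code b \<longleftrightarrow> \<parallel>a \<ominus> b\<parallel> = 0"
proof
  assume eq: "code a = code b"
  have ab: "a \<in> carrier D" "b \<in> carrier D" using a b by (auto simp: S_def)
  have "a = b"
  proof (rule eq_if_small[OF ab])
    fix e :: real assume "e > 0"
    then obtain m where m: "inverse (real (Suc m)) < e / 2" using reals_Archimedean half_gt_zero by blast
    have ap: "\<exists>p. \<parallel>a \<ominus> ev p\<parallel> < d" if "d > 0" for d using a that by (simp add: S_def)
    obtain p where p: "\<parallel>a \<ominus> ev p\<parallel> < 1 / Suc m" using ap[of "1 / Suc m"] by auto
    then have "prod_encode (to_nat p, m) \<in> code a" unfolding code_def by blast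
    then have "prod_encode (to_nat p, m) \<in> code b" unfolding eq .
    then have p': "\<parallel>b \<ominus> ev p\<parallel> < 1 / Suc m"
      by (auto simp: code_def)
    have "\<parallel>a \<ominus> b\<parallel> \<le> \<parallel>a \<ominus> ev p\<parallel> + \<parallel>ev p \<ominus> b\<parallel>" using ab by (intro nrm_triangle_minus) auto
    also have "\<parallel>ev p \<ominus> b\<parallel> = \<parallel>b \<ominus> ev p\<parallel>" using ab by (intro nrm_minus_commute) auto
    finally have "\<parallel>a \<ominus> b\<parallel> < 1 / Suc m + 1 / Suc m" using p p' by linarith
    also have "1 / Suc m = inverse (real (Suc m))" by (simp add: divide_inverse)
    finally show "\<parallel>a \<ominus> b\<parallel> < e" using m by linarith
  qed
  then show "\<parallel>a \<ominus> b\<parallel> = 0" using ab by (simp add: r_neg minus_eq)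
next
  have ab: "a \<in> carrier D" "b \<in> carrier D" using a b by (auto simp: S_def)
  assume "\<parallel>a \<ominus> b\<parallel> = 0"
  then have "a = b" using ab by (simp add: nrm_eq_0_iff)
  then show "code a = code b" by simp
qed

lemma S_approxI:
  assumes "d \<in> carrier D" "\<And>e. e > 0 \<Longrightarrow> e \<le> 1 \<Longrightarrow> \<exists>p. \<parallel>d \<ominus> ev p\<parallel> \<le> c * e" "c \<ge> 0"
  shows "d \<in> S"
  unfolding S_def
proof (intro CollectI conjI assms allI impI)
  fix e :: real assume e: "e > 0"
  define e' where "e' = min 1 (e / (c + 1))"
  have e': "e' > 0" "e' \<le> 1" using e assms(3) by (auto simp: e'_def)
  obtain p where p: "\<parallel>d \<ominus> ev p\<parallel> \<le> c * e'" using assms(2)[OF e'] by blast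
  also have "c * e' < (c + 1) * e'" using e' by simp
  also have "\<dots> \<le> (c + 1) * (e / (c + 1))" using assms(3) by (intro mult_left_mono) (auto simp: e'_def)
  also have "\<dots> = e" using assms(3) by simp
  finally show "\<exists>p. \<parallel>d \<ominus> ev p\<parallel> < e" by blast
qed

sublocale seminormed_subalgebra D S "\<lambda>a. \<parallel>a\<parallel>" code
proof
  show "S \<subseteq> carrier D" by (auto simp: S_def)
  show "\<one> \<in> S" using gen_in_S[of 0] g by simp
  fix a assume a: "a \<in> S"
  then have aD: "a \<in> carrier D" by (simp add: S_def)
  have ap: "\<exists>p. \<parallel>a \<ominus> ev p\<parallel> < e" if "e > 0" for e using a that by (simp add: S_def)
  show "a\<^sup>\<star> \<in> S"
  proof (rule S_approxI[of _ 1])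
    fix e :: real assume "e > 0"
    then obtain p where p: "\<parallel>a \<ominus> ev p\<parallel> < e" using ap by blast
    have "a\<^sup>\<star> \<ominus> (ev p)\<^sup>\<star> = (a \<ominus> ev p)\<^sup>\<star>"
      using aD star_smult[of "ev p" "-1"] by (simp add: minus_eq star_add star_closed scale_minus1)
    then have "\<parallel>a\<^sup>\<star> \<ominus> ev (Adj p)\<parallel> = \<parallel>a \<ominus> ev p\<parallel>" using aD by (simp add: nrm_star)
    then show "\<exists>p. \<parallel>a\<^sup>\<star> \<ominus> ev p\<parallel> \<le> 1 * e" using p by (intro exI[of _ "Adj p"]) simp
  qed (use aD in \<open>simp_all add: star_closed\<close>)
  show "z \<odot> a \<in> S" for z
  proof (rule S_approxI[of _ "cmod z + \<parallel>a\<parallel> + 1"])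
    fix e :: real assume e: "e > 0" "e \<le> 1"
    obtain p where p: "\<parallel>a \<ominus> ev p\<parallel> < e" using ap e by blast
    obtain n where n: "cmod (z - s n) < e" using s e by blast
    have np: "\<parallel>ev p\<parallel> \<le> \<parallel>a\<parallel> + 1"
      using nrm_triangle_sub[of "ev p" a] nrm_minus_commute[of "ev p" a] aD p e by simp
    have "z \<odot> a \<ominus> s n \<odot> ev p = z \<odot> (a \<ominus> ev p) \<oplus> (z - s n) \<odot> ev p"
    proof -
      have "(z - s n) \<odot> ev p = z \<odot> ev p \<ominus> s n \<odot> ev p"
        using scale_l_distr[of "ev p" z "- s n"] scale_assoc[of "ev p" "-1" "s n"] by (simp add: minus_eq scale_minus1)
      moreover have "z \<odot> (a \<ominus> ev p) = z \<odot> a \<ominus> z \<odot> ev p"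
        using scale_r_distr[of a "\<ominus> ev p" z] scale_assoc[of "ev p" z "-1"] scale_assoc[of "ev p" "-1" z] aD
        by (simp add: minus_eq flip: scale_minus1)
      ultimately show ?thesis
        using aD by (simp add: minus_eq a_assoc) (simp add: l_neg flip: a_assoc)
    qed
    then have "\<parallel>z \<odot> a \<ominus> s n \<odot> ev p\<parallel> \<le> cmod z * \<parallel>a \<ominus> ev p\<parallel> + cmod (z - s n) * \<parallel>ev p\<parallel>"
      using nrm_triangle[of "z \<odot> (a \<ominus> ev p)" "(z - s n) \<odot> ev p"] aD by (simp add: nrm_smult)
    also have "\<dots> \<le> cmod z * e + e * (\<parallel>a\<parallel> + 1)"
      using p n np e aD by (intro add_mono mult_mono) auto
    finally show "\<exists>p. \<parallel>z \<odot> a \<ominus> ev p\<parallel> \<le> (cmod z + \<parallel>a\<parallel> + 1) * e"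
      by (intro exI[of _ "Scale n p"]) (simp add: algebra_simps)
  qed (use aD in simp_all)
  show "\<parallel>z \<odot> a\<parallel> = cmod z * \<parallel>a\<parallel>" for z by (rule nrm_smult[OF aD])
  show "\<parallel>a\<^sup>\<star>\<parallel> = \<parallel>a\<parallel>" by (rule nrm_star[OF aD])
  show "\<parallel>a\<^sup>\<star> \<otimes> a\<parallel> = \<parallel>a\<parallel>\<^sup>2" by (rule cs[OF aD])
  fix b assume b: "b \<in> S"
  then have bD: "b \<in> carrier D" by (simp add: S_def)
  have bp: "\<exists>p. \<parallel>b \<ominus> ev p\<parallel> < e" if "e > 0" for e using b that by (simp add: S_def)
  show "a \<oplus> b \<in> S"
  proof (rule S_approxI[of _ 2])
    fix e :: real assume "e > 0"
    then obtain p r where p: "\<parallel>a \<ominus> ev p\<parallel> < e" "\<parallel>b \<ominus> ev r\<parallel> < e" using ap bp by blast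
    have "\<parallel>(a \<oplus> b) \<ominus> (ev p \<oplus> ev r)\<parallel> \<le> \<parallel>a \<ominus> ev p\<parallel> + \<parallel>b \<ominus> ev r\<parallel>"
      using aD bD by (simp add: add_minus_add nrm_triangle)
    then show "\<exists>p. \<parallel>a \<oplus> b \<ominus> ev p\<parallel> \<le> 2 * e" using p by (intro exI[of _ "Sum p r"]) simp
  qed (use aD bD in simp_all)
  show "a \<otimes> b \<in> S"
  proof (rule S_approxI[of _ "\<parallel>b\<parallel> + \<parallel>a\<parallel> + 1"])
    fix e :: real assume e: "e > 0" "e \<le> 1"
    then obtain p r where p: "\<parallel>a \<ominus> ev p\<parallel> < e" "\<parallel>b \<ominus> ev r\<parallel> < e" using ap bp by blast
    have np: "\<parallel>ev p\<parallel> \<le> \<parallel>a\<parallel> + 1"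
      using nrm_triangle_sub[of "ev p" a] nrm_minus_commute[of "ev p" a] aD p e by simp
    have "\<parallel>a \<otimes> b \<ominus> ev p \<otimes> ev r\<parallel> \<le> \<parallel>a \<ominus> ev p\<parallel> * \<parallel>b\<parallel> + \<parallel>ev p\<parallel> * \<parallel>b \<ominus> ev r\<parallel>"
      using aD bD by (intro nrm_mult_minus_mult(1)) auto
    also have "\<dots> \<le> e * \<parallel>b\<parallel> + (\<parallel>a\<parallel> + 1) * e"
      using p np e aD bD by (intro add_mono mult_mono) auto
    finally show "\<exists>p. \<parallel>a \<otimes> b \<ominus> ev p\<parallel> \<le> (\<parallel>b\<parallel> + \<parallel>a\<parallel> + 1) * e"
      by (intro exI[of _ "Prod p r"]) (simp add: algebra_simps)
  qed (use aD bD in simp_all)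
  show "\<parallel>a \<oplus> b\<parallel> \<le> \<parallel>a\<parallel> + \<parallel>b\<parallel>" by (rule nrm_triangle[OF aD bD])
  show "\<parallel>a \<otimes> b\<parallel> \<le> \<parallel>a\<parallel> * \<parallel>b\<parallel>" by (rule nrm_mult[OF aD bD])
  show "(code a = code b) = (\<parallel>a \<ominus> b\<parallel> = 0)" by (rule code_eq[OF a b])
next
  fix f :: "nat \<Rightarrow> 'a" assume f: "\<And>n. f n \<in> S" "\<And>e. e > 0 \<Longrightarrow> \<exists>N. \<forall>m\<ge>N. \<forall>n\<ge>N. \<parallel>f m \<ominus> f n\<parallel> < e"
  have fD: "f n \<in> carrier D" for n using f(1)[of n] by (simp add: S_def)
  obtain l where l: "l \<in> carrier D" "\<forall>e>0. \<exists>N. \<forall>n\<ge>N. \<parallel>f n \<ominus> l\<parallel> < e"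
    by (rule complete_sequences[of f, OF fD f(2)])
  have "l \<in> S"
  proof (rule S_approxI[OF l(1), of 2])
    fix e :: real assume e: "e > 0"
    obtain n where n: "\<parallel>f n \<ominus> l\<parallel> < e" using l(2) e by blast
    obtain p where p: "\<parallel>f n \<ominus> ev p\<parallel> < e" using f(1)[of n] e by (auto simp: S_def)
    have "\<parallel>l \<ominus> ev p\<parallel> \<le> \<parallel>l \<ominus> f n\<parallel> + \<parallel>f n \<ominus> ev p\<parallel>" using l fD by (intro nrm_triangle_minus) auto
    then show "\<exists>p. \<parallel>l \<ominus> ev p\<parallel> \<le> 2 * e"
      using n p nrm_minus_commute[OF l(1) fD, of n] by (intro exI[of _ p]) simp
  qed simp
  then show "\<exists>l\<in>S. \<forall>e>0. \<exists>N. \<forall>n\<ge>N. \<parallel>f n \<ominus> l\<parallel> < e" using l(2) by blast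
qed

end

text \<open>
  A summable function has countable support, so its values lie in a separable subalgebra of the
  coefficients. There rigid symmetry shows that \<open>-1\<close> is not in the spectrum, and the inverse that it
  provides is carried along the inclusion of the subalgebra.
\<close>

lemma rigidly_symmetric_one_plus_square:
  fixes G :: "('g, 'k) monoid_scheme" (structure) and D :: "('a, 'm) star_algebra_scheme"
  assumes rig: "rigidly_symmetric G" and G: "group G" and D: "unital_banach D"
    and cs: "\<And>a. a \<in> carrier D \<Longrightarrow> \<parallel>a\<^sup>\<star>\<^bsub>D\<^esub> \<otimes>\<^bsub>D\<^esub> a\<parallel>\<^bsub>D\<^esub> = \<parallel>a\<parallel>\<^bsub>D\<^esub>\<^sup>2"
    and k: "k \<in> l1_functions G D"
  defines "L \<equiv> l1_algebra G D"
  shows "\<one>\<^bsub>L\<^esub> \<oplus>\<^bsub>L\<^esub> k\<^sup>\<star>\<^bsub>L\<^esub> \<otimes>\<^bsub>L\<^esub> k \<in> Units L"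
proof -
  interpret DL: l1_space G D by (intro l1_space.intro G D)
  interpret LD: unital_banach L unfolding L_def by (rule DL.l1_unital_banach)
  (* The values of k, and zero for the points outside the support. *)
  define V where "V = insert \<zero>\<^bsub>D\<^esub> (k ` {x \<in> carrier G. \<parallel>k x\<parallel>\<^bsub>D\<^esub> \<noteq> 0})"
  have V: "countable V" "V \<noteq> {}" "V \<subseteq> carrier D"
    using summable_countable_real[OF DL.l1_summable[OF k]] k by (auto simp: V_def)
  have kV: "k x \<in> V" if "x \<in> carrier G" for x
    using that k by (cases "\<parallel>k x\<parallel>\<^bsub>D\<^esub> = 0") (auto simp: V_def DL.A.nrm_eq_0_iff)
  (* The unit is put in front of the values, since the generated subalgebra has to contain it. *)
  define g where "g n = (case n of 0 \<Rightarrow> \<one>\<^bsub>D\<^esub> | Suc i \<Rightarrow> from_nat_into V i)" for n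
  obtain s :: "nat \<Rightarrow> complex" where s: "\<And>z e. e > 0 \<Longrightarrow> \<exists>n. cmod (z - s n) < e"
    using dense_complex_sequence by metis
  interpret Sp: separable_subalgebra D g s
  proof
    show "g n \<in> carrier D" for n
      using V(3) from_nat_into[OF V(2)] by (cases n) (auto simp: g_def)
  qed (simp_all add: g_def cs s)
  have kS: "k x \<in> Sp.S" if x: "x \<in> carrier G" for x
  proof -
    obtain i where "from_nat_into V i = k x" using from_nat_into_surj[OF V(1) kV[OF x]] by blast
    then show ?thesis using Sp.gen_in_S[of "Suc i"] by (simp add: g_def)
  qed
  let ?B = "Sp.Q"
  interpret BL: l1_space G ?B by (intro l1_space.intro G Sp.Q_unital_banach)
  interpret LB: unital_banach "l1_algebra G ?B" by (rule BL.l1_unital_banach)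
  define \<theta> where "\<theta> = inv_into Sp.S Sp.code"
  have \<theta>: "\<theta> (Sp.code d) = d" if "d \<in> Sp.S" for d
    using Sp.rep[OF that] that by (simp add: \<theta>_def DL.A.nrm_eq_0_iff)
  have \<theta>_bounded: "bounded_additive ?B D \<theta> 1"
    by (intro bounded_additive.intro bounded_additive_axioms.intro Sp.Q_unital_banach D)
       (auto simp: Sp.Q_simps Sp.S_closed \<theta>)
  interpret H: l1_hom G ?B "\<lambda>y z a b. a \<otimes>\<^bsub>?B\<^esub> b" D "\<lambda>y z a b. a \<otimes>\<^bsub>D\<^esub> b" "\<lambda>x. \<theta>"
    by (intro l1_hom.intro BL.P.l1_kernel_axioms DL.P.l1_kernel_axioms l1_hom_axioms.intro \<theta>_bounded)
       (auto simp: Sp.Q_simps Sp.S_closed \<theta>)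
  let ?LB = "l1_algebra G ?B"
  have hom_mult: "H.induced (f \<otimes>\<^bsub>?LB\<^esub> h) = H.induced f \<otimes>\<^bsub>L\<^esub> H.induced h"
    if "f \<in> carrier ?LB" "h \<in> carrier ?LB" for f h
    using that H.induced_conv by (simp add: L_def BL.l1_mult DL.l1_mult BL.l1_simps(1))
  have hom_bounded: "bounded_additive ?LB L H.induced 1"
    by (intro bounded_additive.intro bounded_additive_axioms.intro LB.unital_banach_axioms LD.unital_banach_axioms)
       (simp_all add: L_def H.induced_closed H.induced_add BL.l1_simps(1) DL.l1_simps(1))
  interpret Hb: bounded_additive ?LB L H.induced 1 by (rule hom_bounded)
  define k' where "k' = (\<lambda>x\<in>carrier G. Sp.code (k x))"
  have k': "k' \<in> carrier ?LB"
    unfolding k'_def BL.l1_simps(1)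
  proof (rule BL.l1I)
    show "(\<lambda>x. \<parallel>Sp.code (k x)\<parallel>\<^bsub>?B\<^esub>) summable_on carrier G"
      using DL.l1_summable[OF k] by (rule summable_on_cong[THEN iffD1, rotated]) (simp add: Sp.Q_nrm kS)
  qed (simp add: Sp.Q_carrier kS)
  have Hk: "H.induced k' = k"
    by (rule DL.l1_ext_eq[OF H.induced_closed(1) k])
       (use k' in \<open>auto simp: BL.l1_simps(1) H.induced_def k'_def \<theta> kS\<close>)
  have Hks: "H.induced (k'\<^sup>\<star>\<^bsub>?LB\<^esub>) = k\<^sup>\<star>\<^bsub>L\<^esub>"
    unfolding H.induced_def BL.l1_simps L_def DL.l1_simps
    by (intro restrict_ext) (simp add: k'_def Sp.Q_star kS \<theta> Sp.S_star)
  have H1: "H.induced \<one>\<^bsub>?LB\<^esub> = \<one>\<^bsub>L\<^esub>"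
    unfolding H.induced_def L_def BL.l1_one DL.l1_one BL.delta_def DL.delta_def
    by (intro restrict_ext) (simp add: Sp.Q_one Sp.Q_zero \<theta> Sp.S_closed)
  have "spectrum ?LB (k'\<^sup>\<star>\<^bsub>?LB\<^esub> \<otimes>\<^bsub>?LB\<^esub> k') \<subseteq> complex_of_real ` {0..}"
    using rig Sp.Q_cstar k' by (auto simp: rigidly_symmetric_def symmetric_algebra_def)
  moreover have "-1 \<notin> complex_of_real ` {0..}"
    by (auto simp: complex_eq_iff)
  ultimately have "-1 \<notin> unital_spectrum ?LB (k'\<^sup>\<star>\<^bsub>?LB\<^esub> \<otimes>\<^bsub>?LB\<^esub> k')"
    using LB.monoid_axioms by (auto simp: spectrum_def)
  then have t: "(-1) \<odot>\<^bsub>?LB\<^esub> \<one>\<^bsub>?LB\<^esub> \<ominus>\<^bsub>?LB\<^esub> (k'\<^sup>\<star>\<^bsub>?LB\<^esub> \<otimes>\<^bsub>?LB\<^esub> k') \<in> Units ?LB" (is "?t \<in> _")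
    by (simp add: unital_spectrum_def)
  then obtain w where w: "w \<in> carrier ?LB" "w \<otimes>\<^bsub>?LB\<^esub> ?t = \<one>\<^bsub>?LB\<^esub>" "?t \<otimes>\<^bsub>?LB\<^esub> w = \<one>\<^bsub>?LB\<^esub>" "?t \<in> carrier ?LB"
    by (auto simp: Units_def)
  let ?u = "\<one>\<^bsub>L\<^esub> \<oplus>\<^bsub>L\<^esub> k\<^sup>\<star>\<^bsub>L\<^esub> \<otimes>\<^bsub>L\<^esub> k"
  have kL: "k \<in> carrier L" using k by (simp add: L_def DL.l1_simps(1))
  have u: "?u \<in> carrier L" using kL by (simp add: LD.star_closed)
  have Ht: "H.induced ?t = \<ominus>\<^bsub>L\<^esub> ?u"
    using k' kL by (simp add: Hb.minus LB.scale_minus1 Hb.uminus H1 hom_mult LB.star_closed Hks Hk LD.star_closed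
        LD.minus_add LD.minus_eq)
  have "H.induced w \<otimes>\<^bsub>L\<^esub> (\<ominus>\<^bsub>L\<^esub> ?u) = \<one>\<^bsub>L\<^esub>" "(\<ominus>\<^bsub>L\<^esub> ?u) \<otimes>\<^bsub>L\<^esub> H.induced w = \<one>\<^bsub>L\<^esub>"
    using hom_mult[OF w(1,4)] hom_mult[OF w(4,1)] w by (simp_all add: Ht H1)
  then have "(\<ominus>\<^bsub>L\<^esub> H.induced w) \<otimes>\<^bsub>L\<^esub> ?u = \<one>\<^bsub>L\<^esub>" "?u \<otimes>\<^bsub>L\<^esub> (\<ominus>\<^bsub>L\<^esub> H.induced w) = \<one>\<^bsub>L\<^esub>"
    using u Hb.closed[OF w(1)] by (simp_all only: LD.l_minus LD.r_minus)
  then show ?thesis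
    using u Hb.closed[OF w(1)] unfolding Units_def by blast
qed

section \<open>The quotient of a C*-algebra by a closed ideal\<close>

text \<open>
  The ideal is given by approximation properties rather than as an \<open>ideal\<close>, since it arises as a
  closure.
\<close>

locale cstar_quotient = unital_banach C for C :: "('c, 'n) star_algebra_scheme" (structure) +
  fixes I :: "'c set"
  assumes cs: "a \<in> carrier C \<Longrightarrow> \<parallel>a\<^sup>\<star> \<otimes> a\<parallel> = \<parallel>a\<parallel>\<^sup>2"
    and I_carrier: "I \<subseteq> carrier C"
    and I_zero: "\<zero> \<in> I"
    and I_add: "x \<in> I \<Longrightarrow> y \<in> I \<Longrightarrow> x \<oplus> y \<in> I"
    and I_mult: "x \<in> I \<Longrightarrow> y \<in> carrier C \<Longrightarrow> y \<otimes> x \<in> I \<and> x \<otimes> y \<in> I"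
    and I_smult: "x \<in> I \<Longrightarrow> z \<odot> x \<in> I"
    and I_star: "x \<in> I \<Longrightarrow> x\<^sup>\<star> \<in> I"
    and I_closed: "c \<in> carrier C \<Longrightarrow> (\<And>e. e > 0 \<Longrightarrow> \<exists>j\<in>I. \<parallel>c \<ominus> j\<parallel> < e) \<Longrightarrow> c \<in> I"
begin

definition q :: "'c \<Rightarrow> real" where
  "q c = (INF j\<in>I. \<parallel>c \<oplus> j\<parallel>)"

text \<open>
  The usual coset \<open>c + I\<close>, written as the ball of radius zero for the quotient seminorm.
\<close>

definition coset :: "'c \<Rightarrow> 'c set" where
  "coset c = {d \<in> carrier C. q (c \<ominus> d) = 0}"

lemma I_in [simp]: "j \<in> I \<Longrightarrow> j \<in> carrier C"
  using I_carrier by auto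

lemma I_uminus: "j \<in> I \<Longrightarrow> \<ominus> j \<in> I"
  using I_smult[of j "-1"] by (simp add: scale_minus1)

lemma q_bdd: "c \<in> carrier C \<Longrightarrow> bdd_below ((\<lambda>j. \<parallel>c \<oplus> j\<parallel>) ` I)"
  by (rule bdd_belowI[of _ 0]) auto

lemma q_le: "c \<in> carrier C \<Longrightarrow> j \<in> I \<Longrightarrow> q c \<le> \<parallel>c \<oplus> j\<parallel>"
  unfolding q_def by (rule cINF_lower[OF q_bdd])

lemma q_le_nrm: "c \<in> carrier C \<Longrightarrow> q c \<le> \<parallel>c\<parallel>"
  using q_le[of c \<zero>] I_zero by simp

lemma q_less:
  assumes "c \<in> carrier C" "q c < e"
  obtains j where "j \<in> I" "\<parallel>c \<oplus> j\<parallel> < e"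
proof -
  have "I \<noteq> {}" using I_zero by auto
  then show ?thesis
    using assms that cINF_less_iff[OF _ q_bdd[OF assms(1)], of e] unfolding q_def by auto
qed

lemma q_nonneg': "c \<in> carrier C \<Longrightarrow> 0 \<le> q c"
  unfolding q_def using I_zero by (intro cINF_greatest) auto

lemma q_eq_0_iff: "c \<in> carrier C \<Longrightarrow> q c = 0 \<longleftrightarrow> c \<in> I"
proof
  assume c: "c \<in> carrier C" and "q c = 0"
  then have "\<exists>j\<in>I. \<parallel>c \<ominus> j\<parallel> < e" if "e > 0" for e
  proof -
    obtain j where "j \<in> I" "\<parallel>c \<oplus> j\<parallel> < e" using q_less[OF c, of e] \<open>q c = 0\<close> \<open>e > 0\<close> by auto
    then show ?thesis by (intro bexI[of _ "\<ominus> j"]) (simp_all add: minus_eq I_uminus)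
  qed
  then show "c \<in> I" by (rule I_closed[OF c])
next
  assume c: "c \<in> carrier C" and "c \<in> I"
  then have "q c \<le> 0" using q_le[OF c I_uminus[OF \<open>c \<in> I\<close>]] by (simp add: r_neg)
  then show "q c = 0" using q_nonneg'[OF c] by simp
qed

lemma add_add: "a \<in> carrier C \<Longrightarrow> b \<in> carrier C \<Longrightarrow> c \<in> carrier C \<Longrightarrow> d \<in> carrier C \<Longrightarrow>
    (a \<oplus> b) \<oplus> (c \<oplus> d) = (a \<oplus> c) \<oplus> (b \<oplus> d)"
  by (simp add: a_ac)

lemma quotient_q_add:
  assumes a: "a \<in> carrier C" and b: "b \<in> carrier C"
  shows "q (a \<oplus> b) \<le> q a + q b"
proof (rule field_le_epsilon)
  fix e :: real assume e: "e > 0"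
  obtain i where i: "i \<in> I" "\<parallel>a \<oplus> i\<parallel> < q a + e / 2" using q_less[OF a, of "q a + e / 2"] e by auto
  obtain j where j: "j \<in> I" "\<parallel>b \<oplus> j\<parallel> < q b + e / 2" using q_less[OF b, of "q b + e / 2"] e by auto
  have "q (a \<oplus> b) \<le> \<parallel>(a \<oplus> b) \<oplus> (i \<oplus> j)\<parallel>" using a b i j by (intro q_le I_add) auto
  also have "(a \<oplus> b) \<oplus> (i \<oplus> j) = (a \<oplus> i) \<oplus> (b \<oplus> j)" using a b i j by (intro add_add) auto
  also have "\<parallel>\<dots>\<parallel> \<le> \<parallel>a \<oplus> i\<parallel> + \<parallel>b \<oplus> j\<parallel>" using a b i j by (intro nrm_triangle) auto
  finally show "q (a \<oplus> b) \<le> q a + q b + e" using i j by simp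
qed

lemma quotient_q_mult:
  assumes a: "a \<in> carrier C" and b: "b \<in> carrier C"
  shows "q (a \<otimes> b) \<le> q a * q b"
proof (rule le_mult_epsilon)
  fix e :: real assume e: "e > 0"
  obtain i where i: "i \<in> I" "\<parallel>a \<oplus> i\<parallel> < q a + e" using q_less[OF a, of "q a + e"] e by auto
  obtain j where j: "j \<in> I" "\<parallel>b \<oplus> j\<parallel> < q b + e" using q_less[OF b, of "q b + e"] e by auto
  have "(a \<oplus> i) \<otimes> (b \<oplus> j) = a \<otimes> b \<oplus> (a \<otimes> j \<oplus> (i \<otimes> b \<oplus> i \<otimes> j))"
    using a b i j by (simp add: l_distr r_distr a_ac)
  moreover have "a \<otimes> j \<oplus> (i \<otimes> b \<oplus> i \<otimes> j) \<in> I"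
    using a b i j I_mult by (intro I_add) auto
  ultimately have "q (a \<otimes> b) \<le> \<parallel>(a \<oplus> i) \<otimes> (b \<oplus> j)\<parallel>" using a b by (simp add: q_le)
  also have "\<dots> \<le> \<parallel>a \<oplus> i\<parallel> * \<parallel>b \<oplus> j\<parallel>" using a b i j by (intro nrm_mult) auto
  also have "\<dots> \<le> (q a + e) * (q b + e)"
    using i j a b q_nonneg'[OF a] e by (intro mult_mono) auto
  finally show "q (a \<otimes> b) \<le> (q a + e) * (q b + e)" .
qed

lemma quotient_q_smult:
  assumes a: "a \<in> carrier C"
  shows "q (z \<odot> a) = cmod z * q a"
proof -
  have le: "q (z \<odot> a) \<le> cmod z * q a" if a: "a \<in> carrier C" for z a
  proof (rule field_le_epsilon)
    fix e :: real assume e: "e > 0"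
    define d where "d = e / (cmod z + 1)"
    have d: "d > 0" using e by (simp add: d_def add_nonneg_pos)
    have "cmod z + 1 \<noteq> 0" by (metis add_nonneg_pos less_irrefl norm_ge_zero zero_less_one)
    then have "(cmod z + 1) * d = e" by (simp add: d_def)
    then have "cmod z * d + d = e" by (simp add: ring_distribs)
    then have zd: "cmod z * d \<le> e" using d by linarith
    obtain i where i: "i \<in> I" "\<parallel>a \<oplus> i\<parallel> < q a + d" using q_less[OF a, of "q a + d"] d by auto
    have "q (z \<odot> a) \<le> \<parallel>z \<odot> (a \<oplus> i)\<parallel>"
      using a i q_le[of "z \<odot> a" "z \<odot> i"] by (simp add: scale_r_distr I_smult)
    also have "\<dots> \<le> cmod z * (q a + d)" using a i by (simp add: nrm_smult mult_left_mono)
    finally show "q (z \<odot> a) \<le> cmod z * q a + e" using zd by (simp add: ring_distribs)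
  qed
  show ?thesis
  proof (cases "z = 0")
    case True
    then show ?thesis using a q_eq_0_iff[of \<zero>] I_zero by simp
  next
    case False
    have "cmod z * q a = cmod z * q ((1 / z) \<odot> (z \<odot> a))"
      using False a by (simp flip: scale_assoc)
    also have "\<dots> \<le> cmod z * (cmod (1 / z) * q (z \<odot> a))"
      using a by (intro mult_left_mono le) auto
    also have "\<dots> = q (z \<odot> a)" using False by (simp add: norm_divide)
    finally show ?thesis using le[OF a, of z] by simp
  qed
qed

lemma quotient_q_star:
  assumes a: "a \<in> carrier C"
  shows "q (a\<^sup>\<star>) = q a"
proof -
  have le: "q (a\<^sup>\<star>) \<le> q a" if a: "a \<in> carrier C" for a
  proof (rule field_le_epsilon)
    fix e :: real assume e: "e > 0"
    obtain i where i: "i \<in> I" "\<parallel>a \<oplus> i\<parallel> < q a + e" using q_less[OF a, of "q a + e"] e by auto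
    have "q (a\<^sup>\<star>) \<le> \<parallel>a\<^sup>\<star> \<oplus> i\<^sup>\<star>\<parallel>" using a i by (intro q_le I_star star_closed)
    also have "\<dots> = \<parallel>a \<oplus> i\<parallel>" using a i by (simp add: nrm_star flip: star_add)
    finally show "q (a\<^sup>\<star>) \<le> q a + e" using i by simp
  qed
  show ?thesis using le[OF a] le[OF star_closed[OF a]] a by (simp add: star_star)
qed

lemma quotient_q_cstar:
  assumes a: "a \<in> carrier C"
  shows "q (a\<^sup>\<star> \<otimes> a) = (q a)\<^sup>2"
proof (rule antisym)
  show "q (a\<^sup>\<star> \<otimes> a) \<le> (q a)\<^sup>2"
    using quotient_q_mult[OF star_closed[OF a] a] by (simp add: quotient_q_star[OF a] power2_eq_square)
  show "(q a)\<^sup>2 \<le> q (a\<^sup>\<star> \<otimes> a)"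
  proof (rule field_le_epsilon)
    fix e :: real assume e: "e > 0"
    have aa: "a\<^sup>\<star> \<otimes> a \<in> carrier C" using a by (simp add: star_closed)
    define r where "r = q (a\<^sup>\<star> \<otimes> a) + e / 2"
    obtain j where j: "j \<in> I" "\<parallel>a\<^sup>\<star> \<otimes> a \<oplus> j\<parallel> < r"
      using q_less[OF aa, of r] e by (auto simp: r_def)
    have "quotient_norms_are_cstar C"
      using all_transferred_facts[OF unital_banach_axioms] by (simp add: transferred_facts_def)
    then have "\<exists>k\<in>I. \<parallel>a \<oplus> k\<parallel>\<^sup>2 \<le> r + e / 2"
      unfolding quotient_norms_are_cstar_def
      by (elim impE allE[of _ I] allE[of _ a] allE[of _ j] allE[of _ r] allE[of _ "e / 2"])
         (use cs I_carrier I_mult I_smult I_add I_star a j e in auto)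
    then obtain k where k: "k \<in> I" "\<parallel>a \<oplus> k\<parallel>\<^sup>2 \<le> r + e / 2" by blast
    have "(q a)\<^sup>2 \<le> \<parallel>a \<oplus> k\<parallel>\<^sup>2"
      using a k q_le[OF a k(1)] q_nonneg'[OF a] by (intro power_mono)
    then show "(q a)\<^sup>2 \<le> q (a\<^sup>\<star> \<otimes> a) + e" using k by (simp add: r_def)
  qed
qed

lemma q_triangle: "a \<in> carrier C \<Longrightarrow> b \<in> carrier C \<Longrightarrow> c \<in> carrier C \<Longrightarrow> q (a \<ominus> c) \<le> q (a \<ominus> b) + q (b \<ominus> c)"
proof -
  assume a: "a \<in> carrier C" "b \<in> carrier C" "c \<in> carrier C"
  have "a \<ominus> c = (a \<ominus> b) \<oplus> (b \<ominus> c)"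
    using a by (simp add: minus_eq a_assoc) (simp add: l_neg flip: a_assoc)
  then show ?thesis using quotient_q_add[of "a \<ominus> b" "b \<ominus> c"] a by simp
qed

lemma q_sym: "a \<in> carrier C \<Longrightarrow> b \<in> carrier C \<Longrightarrow> q (a \<ominus> b) = q (b \<ominus> a)"
  using quotient_q_smult[of "b \<ominus> a" "-1"] by (simp add: scale_minus1 minus_eq minus_add a_comm)

lemma coset_eq: "a \<in> carrier C \<Longrightarrow> b \<in> carrier C \<Longrightarrow> coset a = coset b \<longleftrightarrow> q (a \<ominus> b) = 0"
proof
  assume a: "a \<in> carrier C" "b \<in> carrier C" and "coset a = coset b"
  moreover have "b \<in> coset b" using a q_eq_0_iff[of \<zero>] I_zero by (simp add: coset_def minus_eq r_neg)
  ultimately show "q (a \<ominus> b) = 0" by (auto simp: coset_def)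
next
  assume a: "a \<in> carrier C" "b \<in> carrier C" and ab: "q (a \<ominus> b) = 0"
  have "q (a \<ominus> d) = 0 \<longleftrightarrow> q (b \<ominus> d) = 0" if d: "d \<in> carrier C" for d
    using q_triangle[OF a(1,2) d] q_triangle[OF a(2,1) d] q_sym[OF a] ab q_nonneg'[of "a \<ominus> d"] q_nonneg'[of "b \<ominus> d"] a d
    by fastforce
  then show "coset a = coset b" by (auto simp: coset_def)
qed

text \<open>
  Along a fast subsequence, the differences have representatives with summable norms; their sum in \<open>C\<close>
  represents the limit.
\<close>

lemma quotient_complete:
  fixes f :: "nat \<Rightarrow> 'c"
  assumes f: "\<And>n. f n \<in> carrier C" and cauchy: "\<And>e. e > 0 \<Longrightarrow> \<exists>N. \<forall>m\<ge>N. \<forall>n\<ge>N. q (f m \<ominus> f n) < e"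
  shows "\<exists>l\<in>carrier C. \<forall>e>0. \<exists>N. \<forall>n\<ge>N. q (f n \<ominus> l) < e"
proof -
  have "\<exists>N. \<forall>m\<ge>N. \<forall>n\<ge>N. q (f m \<ominus> f n) < (1 / 2) ^ k" for k :: nat
    by (rule cauchy) simp
  then obtain N where N: "\<And>k m n. m \<ge> N k \<Longrightarrow> n \<ge> N k \<Longrightarrow> q (f m \<ominus> f n) < (1 / 2) ^ k"
    by metis
  define M where "M k = (\<Sum>i\<le>k. N i)" for k
  have M: "N k \<le> M k" "M k \<le> M (Suc k)" for k
    by (auto simp: M_def intro: member_le_sum)
  define g where "g k = f (M k)" for k
  have g: "g k \<in> carrier C" for k by (simp add: g_def f)
  have "\<exists>j\<in>I. \<parallel>(g (Suc k) \<ominus> g k) \<oplus> j\<parallel> < (1 / 2) ^ k" for k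
  proof -
    have "q (g (Suc k) \<ominus> g k) < (1 / 2) ^ k"
      unfolding g_def using M[of k] by (intro N) auto
    then show ?thesis using q_less[of "g (Suc k) \<ominus> g k" "(1 / 2) ^ k"] g by auto
  qed
  then obtain j where j: "\<And>k. j k \<in> I" "\<And>k. \<parallel>(g (Suc k) \<ominus> g k) \<oplus> j k\<parallel> < (1 / 2) ^ k"
    by metis
  define d where "d k = (g (Suc k) \<ominus> g k) \<oplus> j k" for k
  have d: "d k \<in> carrier C" for k using g j by (simp add: d_def)
  have "summable (\<lambda>k. (1 / 2 :: real) ^ k)" by (simp add: summable_geometric)
  then have "(\<lambda>k. (1 / 2 :: real) ^ k) summable_on UNIV"
    by (rule summable_nonneg_imp_summable_on) simp
  then have "(\<lambda>k. \<parallel>d k\<parallel>) summable_on UNIV"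
    by (rule summable_on_comparison_test) (use j d in \<open>auto simp: d_def less_imp_le\<close>)
  then have sd: "abs_summable d UNIV" using d by (auto simp: abs_summable_def)
  define t where "t = alg_sum C d UNIV"
  have t: "t \<in> carrier C" using sd by (simp add: t_def)
  have partial: "q (finsum C d {..<k} \<ominus> (g k \<ominus> g 0)) = 0 \<and> finsum C d {..<k} \<in> carrier C" for k
  proof (induction k)
    case 0
    then show ?case using g q_eq_0_iff[of \<zero>] I_zero by (simp add: minus_eq r_neg)
  next
    case (Suc k)
    let ?s = "finsum C d {..<k}"
    have s: "?s \<in> carrier C" using Suc by simp
    have fs: "finsum C d {..<Suc k} = d k \<oplus> ?s"
      using d by (simp add: lessThan_Suc finsum_insert)
    have "(d k \<oplus> ?s) \<ominus> (g (Suc k) \<ominus> g 0) = (?s \<ominus> (g k \<ominus> g 0)) \<oplus> j k"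
    proof -
      have "g (Suc k) \<ominus> g 0 = (g (Suc k) \<ominus> g k) \<oplus> (g k \<ominus> g 0)"
        using g by (simp add: minus_eq a_assoc) (simp add: l_neg flip: a_assoc)
      then have "(d k \<oplus> ?s) \<ominus> (g (Suc k) \<ominus> g 0) = (d k \<ominus> (g (Suc k) \<ominus> g k)) \<oplus> (?s \<ominus> (g k \<ominus> g 0))"
        using d s g by (simp add: add_minus_add)
      also have "d k \<ominus> (g (Suc k) \<ominus> g k) = j k"
        unfolding d_def using g j by (simp add: add_minus_cancel)
      finally show ?thesis using g s j by (simp add: a_comm)
    qed
    moreover have "q ((?s \<ominus> (g k \<ominus> g 0)) \<oplus> j k) \<le> 0"
      using quotient_q_add[of "?s \<ominus> (g k \<ominus> g 0)" "j k"] Suc s g j(1)[of k] q_eq_0_iff[of "j k"] by simp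
    ultimately show ?case
      using q_nonneg'[of "(?s \<ominus> (g k \<ominus> g 0)) \<oplus> j k"] s g d j(1)[of k] unfolding fs by auto
  qed
  define l where "l = g 0 \<oplus> t"
  have l: "l \<in> carrier C" using g t by (simp add: l_def)
  have near: "q (g k \<ominus> l) \<le> \<parallel>finsum C d {..<k} \<ominus> t\<parallel>" for k
  proof -
    let ?s = "finsum C d {..<k}"
    have s: "?s \<in> carrier C" using partial by blast
    have "g k \<ominus> l = (g k \<ominus> g 0) \<ominus> t"
      using g t by (simp add: l_def minus_eq minus_add a_assoc)
    then have "q (g k \<ominus> l) \<le> q ((g k \<ominus> g 0) \<ominus> ?s) + q (?s \<ominus> t)"
      using q_triangle[of "g k \<ominus> g 0" ?s t] g s t by simp
    also have "q ((g k \<ominus> g 0) \<ominus> ?s) = 0" using partial[of k] q_sym[of ?s "g k \<ominus> g 0"] s g by simp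
    also have "q (?s \<ominus> t) \<le> \<parallel>?s \<ominus> t\<parallel>" using s t by (intro q_le_nrm) auto
    finally show ?thesis by simp
  qed
  have "\<exists>N. \<forall>n\<ge>N. q (f n \<ominus> l) < e" if e: "e > 0" for e
  proof -
    obtain F where F: "finite F" "\<And>H. finite H \<Longrightarrow> F \<subseteq> H \<Longrightarrow> \<parallel>finsum C d H \<ominus> t\<parallel> < e / 2"
      using alg_sum_near[OF sd, of "e / 2"] e unfolding t_def by (metis half_gt_zero subset_UNIV)
    obtain k0 where k0: "F \<subseteq> {..<k0}" using F(1) finite_nat_iff_bounded by blast
    obtain N' where N': "\<And>m n. m \<ge> N' \<Longrightarrow> n \<ge> N' \<Longrightarrow> q (f m \<ominus> f n) < e / 2"
      using cauchy[of "e / 2"] e by auto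
    obtain k1 where k1: "(1 / 2 :: real) ^ k1 < e / 2"
      using real_arch_pow_inv[of "e / 2" "1 / 2"] e by auto
    define k where "k = max k0 k1"
    have "\<parallel>finsum C d {..<k} \<ominus> t\<parallel> < e / 2"
      using k0 by (intro F) (auto simp: k_def)
    then have 1: "q (g k \<ominus> l) < e / 2" using near[of k] by simp
    have kp: "(1 / 2 :: real) ^ k \<le> (1 / 2) ^ k1" by (intro power_decreasing) (auto simp: k_def)
    have "q (f n \<ominus> l) < e" if n: "n \<ge> M k" for n
    proof -
      have "q (f n \<ominus> l) \<le> q (f n \<ominus> g k) + q (g k \<ominus> l)" by (intro q_triangle f g l)
      moreover have "q (f n \<ominus> g k) < (1 / 2) ^ k"
        unfolding g_def using n M(1)[of k] by (intro N) auto
      ultimately show ?thesis using 1 k1 kp by linarith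
    qed
    then show ?thesis by blast
  qed
  then show ?thesis using l by blast
qed

sublocale quot: seminormed_subalgebra C "carrier C" q coset
  by unfold_locales
     (auto simp: star_closed quotient_q_add quotient_q_mult quotient_q_smult quotient_q_star quotient_q_cstar
        coset_eq intro: quotient_complete)

end

section \<open>Twisted crossed products\<close>

lemma banach_star_algebra_abelian_group: "banach_star_algebra R \<Longrightarrow> abelian_group R"
  by (simp add: banach_star_algebra_def module_def)

lemma banach_star_algebra_metric_space:
  assumes R: "banach_star_algebra R"
  shows "Metric_space (carrier R) (nrm_dist R)"
proof -
  interpret banach_star_algebra R by fact
  interpret abelian_group R by (rule banach_star_algebra_abelian_group[OF R])
  have one: "1 \<odot>\<^bsub>R\<^esub> a = a" and scl: "z \<odot>\<^bsub>R\<^esub> a \<in> carrier R"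
    and ld: "(z + w) \<odot>\<^bsub>R\<^esub> a = z \<odot>\<^bsub>R\<^esub> a \<oplus>\<^bsub>R\<^esub> w \<odot>\<^bsub>R\<^esub> a" if "a \<in> carrier R" for a z w
    using smult_one[OF that] smult_closed[of z a] smult_l_distr[of z w a] that
    by (simp_all add: ring_of_type_algebra_def)
  have "\<parallel>\<ominus>\<^bsub>R\<^esub> a\<parallel>\<^bsub>R\<^esub> = \<parallel>a\<parallel>\<^bsub>R\<^esub>" if a: "a \<in> carrier R" for a
  proof -
    have "0 \<odot>\<^bsub>R\<^esub> a = \<zero>\<^bsub>R\<^esub>"
      using nrm_smult[OF a, of 0] scl[OF a, of 0] by (simp add: nrm_eq_0_iff)
    then have "(-1) \<odot>\<^bsub>R\<^esub> a \<oplus>\<^bsub>R\<^esub> a = \<zero>\<^bsub>R\<^esub>"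
      using ld[OF a, of "-1" 1] one[OF a] by simp
    then have "\<ominus>\<^bsub>R\<^esub> a = (-1) \<odot>\<^bsub>R\<^esub> a"
      using a scl by (intro minus_equality) auto
    then show ?thesis using nrm_smult[OF a, of "-1"] by simp
  qed
  then show ?thesis
    by (intro metric_spaceI abelian_group_axioms nrm_eq_0_iff nrm_triangle)
qed

lemma closure_of_nrm_iff:
  assumes R: "banach_star_algebra R" and S: "S \<subseteq> carrier R"
  shows "c \<in> (nrm_topology R) closure_of S \<longleftrightarrow> c \<in> carrier R \<and> (\<forall>e>0. \<exists>s\<in>S. \<parallel>c \<ominus>\<^bsub>R\<^esub> s\<parallel>\<^bsub>R\<^esub> < e)"
proof -
  interpret M: Metric_space "carrier R" "nrm_dist R" by (rule banach_star_algebra_metric_space[OF R])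
  show ?thesis
    unfolding nrm_topology_def M.metric_closure_of using S by (fastforce simp: nrm_dist_def)
qed

text \<open>
  A unit of a dense subalgebra is a unit of the whole algebra.
\<close>

lemma monoid_of_dense_unit:
  assumes R: "banach_star_algebra R" and e: "e \<in> carrier R" and S: "S \<subseteq> carrier R"
    and dense: "(nrm_topology R) closure_of S = carrier R"
    and unit: "\<And>s. s \<in> S \<Longrightarrow> e \<otimes>\<^bsub>R\<^esub> s = s \<and> s \<otimes>\<^bsub>R\<^esub> e = s"
  shows "monoid R" "\<one>\<^bsub>R\<^esub> = e"
proof -
  interpret banach_star_algebra R by fact
  interpret abelian_group R by (rule banach_star_algebra_abelian_group[OF R])
  interpret M: Metric_space "carrier R" "nrm_dist R" by (rule banach_star_algebra_metric_space[OF R])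
  have nn: "0 \<le> \<parallel>a\<parallel>\<^bsub>R\<^esub>" if "a \<in> carrier R" for a
  proof -
    have "\<ominus>\<^bsub>R\<^esub> \<zero>\<^bsub>R\<^esub> = \<zero>\<^bsub>R\<^esub>" by (intro minus_equality) simp_all
    then have "a \<ominus>\<^bsub>R\<^esub> \<zero>\<^bsub>R\<^esub> = a" unfolding a_minus_def using that by simp
    then show ?thesis using M.nonneg[of a "\<zero>\<^bsub>R\<^esub>"] that by (simp add: nrm_dist_def)
  qed
  have sym: "\<parallel>a \<ominus>\<^bsub>R\<^esub> b\<parallel>\<^bsub>R\<^esub> = \<parallel>b \<ominus>\<^bsub>R\<^esub> a\<parallel>\<^bsub>R\<^esub>" if "a \<in> carrier R" "b \<in> carrier R" for a b
    using M.commute[of a b] that by (simp add: nrm_dist_def)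
  have key: "d = c" if c: "c \<in> carrier R" and d: "d \<in> carrier R"
    and T: "\<And>s. s \<in> S \<Longrightarrow> \<parallel>d \<ominus>\<^bsub>R\<^esub> s\<parallel>\<^bsub>R\<^esub> \<le> \<parallel>e\<parallel>\<^bsub>R\<^esub> * \<parallel>c \<ominus>\<^bsub>R\<^esub> s\<parallel>\<^bsub>R\<^esub>" for c d
  proof -
    have "nrm_dist R d c \<le> 0 + t" if t: "t > 0" for t
    proof -
      define u where "u = t / (\<parallel>e\<parallel>\<^bsub>R\<^esub> + 1)"
      have e1: "\<parallel>e\<parallel>\<^bsub>R\<^esub> + 1 > 0" using nn[OF e] by simp
      have u: "u > 0" using t e1 by (simp add: u_def)
      obtain s where s: "s \<in> S" "\<parallel>c \<ominus>\<^bsub>R\<^esub> s\<parallel>\<^bsub>R\<^esub> < u"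
        using dense c u closure_of_nrm_iff[OF R S] by blast
      have sR: "s \<in> carrier R" using s S by auto
      have "nrm_dist R d c \<le> nrm_dist R d s + nrm_dist R s c" using c d sR by (intro M.triangle)
      also have "\<dots> = \<parallel>d \<ominus>\<^bsub>R\<^esub> s\<parallel>\<^bsub>R\<^esub> + \<parallel>c \<ominus>\<^bsub>R\<^esub> s\<parallel>\<^bsub>R\<^esub>" using c d sR by (simp add: nrm_dist_def sym)
      also have "\<dots> \<le> \<parallel>e\<parallel>\<^bsub>R\<^esub> * \<parallel>c \<ominus>\<^bsub>R\<^esub> s\<parallel>\<^bsub>R\<^esub> + \<parallel>c \<ominus>\<^bsub>R\<^esub> s\<parallel>\<^bsub>R\<^esub>" using T[OF s(1)] by simp
      also have "\<dots> = (\<parallel>e\<parallel>\<^bsub>R\<^esub> + 1) * \<parallel>c \<ominus>\<^bsub>R\<^esub> s\<parallel>\<^bsub>R\<^esub>" by (simp add: ring_distribs)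
      also have "\<dots> \<le> (\<parallel>e\<parallel>\<^bsub>R\<^esub> + 1) * u" using s e1 by (intro mult_left_mono) auto
      also have "\<dots> = t" using e1 by (simp add: u_def)
      finally show ?thesis by simp
    qed
    then have "nrm_dist R d c \<le> 0" by (rule field_le_epsilon)
    then show ?thesis using M.nonneg[of d c] M.zero[OF d c] by simp
  qed
  have split: "c = (c \<ominus>\<^bsub>R\<^esub> s) \<oplus>\<^bsub>R\<^esub> s" if "c \<in> carrier R" "s \<in> carrier R" for c s
    using that by (simp add: minus_eq a_assoc l_neg)
  have cancel: "(a \<oplus>\<^bsub>R\<^esub> s) \<ominus>\<^bsub>R\<^esub> s = a" if "a \<in> carrier R" "s \<in> carrier R" for a s
    using that by (simp add: minus_eq a_assoc r_neg)
  have unit': "e \<otimes>\<^bsub>R\<^esub> c = c \<and> c \<otimes>\<^bsub>R\<^esub> e = c" if c: "c \<in> carrier R" for c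
  proof
    have sR: "s \<in> carrier R" if "s \<in> S" for s using that S by auto
    show "e \<otimes>\<^bsub>R\<^esub> c = c"
    proof (rule key[OF c])
      fix s assume s: "s \<in> S"
      have "e \<otimes>\<^bsub>R\<^esub> c = e \<otimes>\<^bsub>R\<^esub> ((c \<ominus>\<^bsub>R\<^esub> s) \<oplus>\<^bsub>R\<^esub> s)" using split[OF c sR[OF s]] by simp
      also have "\<dots> = e \<otimes>\<^bsub>R\<^esub> (c \<ominus>\<^bsub>R\<^esub> s) \<oplus>\<^bsub>R\<^esub> s"
        using c e sR[OF s] unit[OF s] by (simp add: distrib_left)
      finally have "e \<otimes>\<^bsub>R\<^esub> c \<ominus>\<^bsub>R\<^esub> s = e \<otimes>\<^bsub>R\<^esub> (c \<ominus>\<^bsub>R\<^esub> s)"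
        using c e sR[OF s] by (simp add: cancel mult_closed)
      then show "\<parallel>e \<otimes>\<^bsub>R\<^esub> c \<ominus>\<^bsub>R\<^esub> s\<parallel>\<^bsub>R\<^esub> \<le> \<parallel>e\<parallel>\<^bsub>R\<^esub> * \<parallel>c \<ominus>\<^bsub>R\<^esub> s\<parallel>\<^bsub>R\<^esub>"
        using c e sR[OF s] by (simp add: nrm_mult)
    qed (use c e in \<open>simp add: mult_closed\<close>)
    show "c \<otimes>\<^bsub>R\<^esub> e = c"
    proof (rule key[OF c])
      fix s assume s: "s \<in> S"
      have "c \<otimes>\<^bsub>R\<^esub> e = ((c \<ominus>\<^bsub>R\<^esub> s) \<oplus>\<^bsub>R\<^esub> s) \<otimes>\<^bsub>R\<^esub> e" using split[OF c sR[OF s]] by simp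
      also have "\<dots> = (c \<ominus>\<^bsub>R\<^esub> s) \<otimes>\<^bsub>R\<^esub> e \<oplus>\<^bsub>R\<^esub> s"
        using c e sR[OF s] unit[OF s] by (simp add: distrib_right)
      finally have "c \<otimes>\<^bsub>R\<^esub> e \<ominus>\<^bsub>R\<^esub> s = (c \<ominus>\<^bsub>R\<^esub> s) \<otimes>\<^bsub>R\<^esub> e"
        using c e sR[OF s] by (simp add: cancel mult_closed)
      then show "\<parallel>c \<otimes>\<^bsub>R\<^esub> e \<ominus>\<^bsub>R\<^esub> s\<parallel>\<^bsub>R\<^esub> \<le> \<parallel>e\<parallel>\<^bsub>R\<^esub> * \<parallel>c \<ominus>\<^bsub>R\<^esub> s\<parallel>\<^bsub>R\<^esub>"
        using c e sR[OF s] nrm_mult[of "c \<ominus>\<^bsub>R\<^esub> s" e] by (simp add: mult.commute)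
    qed (use c e in \<open>simp add: mult_closed\<close>)
  qed
  show 1: "\<one>\<^bsub>R\<^esub> = e" using one_convention[OF e unit'] .
  show "monoid R" by (rule monoidI) (use e unit' in \<open>simp_all add: 1 mult_closed mult_assoc\<close>)
qed

text \<open>
  The crossed product enters only through the universal property: \<open>\<iota>\<close> has dense range, and the norm of \<open>\<iota> f\<close> is
  the supremum of all C*-seminorms at \<open>f\<close>.
\<close>

locale crossed_product = twisted_cstar_system G A \<alpha> \<omega>
  for G :: "('g, 'k) monoid_scheme" (structure) and A :: "('a, 'm) star_algebra_scheme"
    and \<alpha> :: "'g \<Rightarrow> 'a \<Rightarrow> 'a" and \<omega> :: "'g \<Rightarrow> 'g \<Rightarrow> 'a" +
  fixes C :: "('c, 'n) star_algebra_scheme" and \<iota> :: "('g \<Rightarrow> 'a) \<Rightarrow> 'c"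
  assumes enveloping: "enveloping_cstar_algebra (twisted_l1 G A \<alpha> \<omega>) C \<iota>"
begin

sublocale L1: l1_space G A
  using cstar unital by (intro l1_space.intro group unital_banach.intro) (simp_all add: cstar_algebra_def)

abbreviation "l1 \<equiv> l1_functions G A"
abbreviation "TL \<equiv> twisted_l1 G A \<alpha> \<omega>"

lemma A_cstar: "a \<in> carrier A \<Longrightarrow> \<parallel>a\<^sup>\<star>\<^bsub>A\<^esub> \<otimes>\<^bsub>A\<^esub> a\<parallel>\<^bsub>A\<^esub> = \<parallel>a\<parallel>\<^bsub>A\<^esub>\<^sup>2"
  by (rule cstar_algebra.cstar_identity[OF cstar])

lemma star_one_A: "\<one>\<^bsub>A\<^esub>\<^sup>\<star>\<^bsub>A\<^esub> = \<one>\<^bsub>A\<^esub>"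
  by (metis L1.A.l_one L1.A.one_closed L1.A.star_closed L1.A.star_mult L1.A.star_star)

lemma norm_le_1_if_isometry: "u \<in> carrier A \<Longrightarrow> u\<^sup>\<star>\<^bsub>A\<^esub> \<otimes>\<^bsub>A\<^esub> u = \<one>\<^bsub>A\<^esub> \<Longrightarrow> \<parallel>u\<parallel>\<^bsub>A\<^esub> \<le> 1"
proof -
  have "\<parallel>\<one>\<^bsub>A\<^esub>\<parallel>\<^bsub>A\<^esub> * \<parallel>\<one>\<^bsub>A\<^esub>\<parallel>\<^bsub>A\<^esub> = \<parallel>\<one>\<^bsub>A\<^esub>\<parallel>\<^bsub>A\<^esub> * 1"
    using A_cstar[OF L1.A.one_closed] by (simp add: star_one_A power2_eq_square)
  then have 1: "\<parallel>\<one>\<^bsub>A\<^esub>\<parallel>\<^bsub>A\<^esub> \<le> 1" by (simp only: mult_cancel_left) auto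
  assume u: "u \<in> carrier A" "u\<^sup>\<star>\<^bsub>A\<^esub> \<otimes>\<^bsub>A\<^esub> u = \<one>\<^bsub>A\<^esub>"
  then have "\<parallel>u\<parallel>\<^bsub>A\<^esub>\<^sup>2 \<le> 1\<^sup>2" using A_cstar[OF u(1)] 1 by simp
  then show "\<parallel>u\<parallel>\<^bsub>A\<^esub> \<le> 1" by (rule power2_le_imp_le) simp
qed

lemma \<omega>:
  assumes "x \<in> carrier G" "y \<in> carrier G"
  shows "\<omega> x y \<in> carrier A" "(\<omega> x y)\<^sup>\<star>\<^bsub>A\<^esub> \<otimes>\<^bsub>A\<^esub> \<omega> x y = \<one>\<^bsub>A\<^esub>" "\<omega> x y \<otimes>\<^bsub>A\<^esub> (\<omega> x y)\<^sup>\<star>\<^bsub>A\<^esub> = \<one>\<^bsub>A\<^esub>"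
    "\<parallel>\<omega> x y\<parallel>\<^bsub>A\<^esub> \<le> 1"
  using unitary[OF assms] by (auto simp: unitaries_def intro: norm_le_1_if_isometry)

lemma \<alpha>:
  assumes x: "x \<in> carrier G" and a: "a \<in> carrier A"
  shows "\<alpha> x a \<in> carrier A" "b \<in> carrier A \<Longrightarrow> \<alpha> x (a \<oplus>\<^bsub>A\<^esub> b) = \<alpha> x a \<oplus>\<^bsub>A\<^esub> \<alpha> x b"
    "b \<in> carrier A \<Longrightarrow> \<alpha> x (a \<otimes>\<^bsub>A\<^esub> b) = \<alpha> x a \<otimes>\<^bsub>A\<^esub> \<alpha> x b"
    "\<alpha> x (z \<odot>\<^bsub>A\<^esub> a) = z \<odot>\<^bsub>A\<^esub> \<alpha> x a" "\<alpha> x (a\<^sup>\<star>\<^bsub>A\<^esub>) = (\<alpha> x a)\<^sup>\<star>\<^bsub>A\<^esub>"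
  using aut[OF x] a by (auto simp: star_aut_def star_hom_def)

lemma \<alpha>_bij: "x \<in> carrier G \<Longrightarrow> bij_betw (\<alpha> x) (carrier A) (carrier A)"
  using aut by (simp add: star_aut_def)

lemma \<alpha>_one:
  assumes x: "x \<in> carrier G"
  shows "\<alpha> x \<one>\<^bsub>A\<^esub> = \<one>\<^bsub>A\<^esub>"
proof -
  obtain b where b: "b \<in> carrier A" "\<alpha> x b = \<one>\<^bsub>A\<^esub>"
    using \<alpha>_bij[OF x] by (metis L1.A.one_closed bij_betw_imp_surj_on imageE)
  have "\<alpha> x \<one>\<^bsub>A\<^esub> \<otimes>\<^bsub>A\<^esub> \<alpha> x b = \<alpha> x b"
    using \<alpha>(3)[OF x L1.A.one_closed b(1)] b by simp
  then show ?thesis using \<alpha>(1)[OF x L1.A.one_closed] by (simp add: b)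
qed

text \<open>
  The seminorm \<open>a \<mapsto> \<parallel>\<alpha>\<^sub>x(a)\<parallel>\<close> satisfies the C*-identity, so it is contractive automatically.
\<close>

lemma \<alpha>_norm:
  assumes x: "x \<in> carrier G" and a: "a \<in> carrier A"
  shows "\<parallel>\<alpha> x a\<parallel>\<^bsub>A\<^esub> \<le> \<parallel>a\<parallel>\<^bsub>A\<^esub>"
proof -
  have contr: "cstar_seminorms_are_contractive A"
    using all_transferred_facts[OF L1.A.unital_banach_axioms] by (simp add: transferred_facts_def)
  have semi: "(\<forall>a\<in>carrier A. 0 \<le> \<parallel>\<alpha> x a\<parallel>\<^bsub>A\<^esub> \<and> \<parallel>\<alpha> x (a\<^sup>\<star>\<^bsub>A\<^esub> \<otimes>\<^bsub>A\<^esub> a)\<parallel>\<^bsub>A\<^esub> = \<parallel>\<alpha> x a\<parallel>\<^bsub>A\<^esub>\<^sup>2) \<and>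
      (\<forall>z. \<forall>a\<in>carrier A. \<parallel>\<alpha> x (z \<odot>\<^bsub>A\<^esub> a)\<parallel>\<^bsub>A\<^esub> = cmod z * \<parallel>\<alpha> x a\<parallel>\<^bsub>A\<^esub>) \<and>
      (\<forall>a\<in>carrier A. \<forall>b\<in>carrier A. \<parallel>\<alpha> x (a \<oplus>\<^bsub>A\<^esub> b)\<parallel>\<^bsub>A\<^esub> \<le> \<parallel>\<alpha> x a\<parallel>\<^bsub>A\<^esub> + \<parallel>\<alpha> x b\<parallel>\<^bsub>A\<^esub>)"
    using x by (simp add: \<alpha> A_cstar L1.A.nrm_smult L1.A.nrm_triangle L1.A.star_closed)
  have "\<forall>a\<in>carrier A. \<parallel>\<alpha> x a\<parallel>\<^bsub>A\<^esub> \<le> \<parallel>a\<parallel>\<^bsub>A\<^esub>"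
    using spec[OF contr[unfolded cstar_seminorms_are_contractive_def], of "\<lambda>a. \<parallel>\<alpha> x a\<parallel>\<^bsub>A\<^esub>"] semi
    by (rule mp)
  then show ?thesis using a by blast
qed

lemma \<alpha>_unit_id: "a \<in> carrier A \<Longrightarrow> \<alpha> \<one> a = a"
proof -
  assume a: "a \<in> carrier A"
  have "\<alpha> \<one> (\<alpha> \<one> a) = \<alpha> \<one> a"
    using twisted_action[of \<one> \<one> a] normalized[of \<one>] \<alpha>(1)[of \<one> a] a by (simp add: star_one_A)
  then show ?thesis
    using \<alpha>_bij[of \<one>] \<alpha>(1)[of \<one> a] a by (auto simp: bij_betw_def inj_on_def)
qed

sublocale K: l1_kernel G A "\<lambda>y z a b. a \<otimes>\<^bsub>A\<^esub> \<alpha> y b \<otimes>\<^bsub>A\<^esub> \<omega> y z"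
proof
  fix y z a b assume yz: "y \<in> carrier G" "z \<in> carrier G" and a: "a \<in> carrier A" and b: "b \<in> carrier A"
  show "a \<otimes>\<^bsub>A\<^esub> \<alpha> y b \<otimes>\<^bsub>A\<^esub> \<omega> y z \<in> carrier A" using yz a b by (simp add: \<alpha> \<omega>)
  show "(a \<oplus>\<^bsub>A\<^esub> a') \<otimes>\<^bsub>A\<^esub> \<alpha> y b \<otimes>\<^bsub>A\<^esub> \<omega> y z = a \<otimes>\<^bsub>A\<^esub> \<alpha> y b \<otimes>\<^bsub>A\<^esub> \<omega> y z \<oplus>\<^bsub>A\<^esub> a' \<otimes>\<^bsub>A\<^esub> \<alpha> y b \<otimes>\<^bsub>A\<^esub> \<omega> y z"
    if "a' \<in> carrier A" for a'
    using yz a b that by (simp add: \<alpha> \<omega> L1.A.l_distr)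
  show "a \<otimes>\<^bsub>A\<^esub> \<alpha> y (b \<oplus>\<^bsub>A\<^esub> b') \<otimes>\<^bsub>A\<^esub> \<omega> y z = a \<otimes>\<^bsub>A\<^esub> \<alpha> y b \<otimes>\<^bsub>A\<^esub> \<omega> y z \<oplus>\<^bsub>A\<^esub> a \<otimes>\<^bsub>A\<^esub> \<alpha> y b' \<otimes>\<^bsub>A\<^esub> \<omega> y z"
    if "b' \<in> carrier A" for b'
    using yz a b that by (simp add: \<alpha> \<omega> L1.A.l_distr L1.A.r_distr)
  have "\<parallel>a \<otimes>\<^bsub>A\<^esub> \<alpha> y b \<otimes>\<^bsub>A\<^esub> \<omega> y z\<parallel>\<^bsub>A\<^esub> \<le> \<parallel>a \<otimes>\<^bsub>A\<^esub> \<alpha> y b\<parallel>\<^bsub>A\<^esub> * \<parallel>\<omega> y z\<parallel>\<^bsub>A\<^esub>"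
    using yz a b by (intro L1.A.nrm_mult) (simp_all add: \<alpha> \<omega>)
  also have "\<dots> \<le> \<parallel>a \<otimes>\<^bsub>A\<^esub> \<alpha> y b\<parallel>\<^bsub>A\<^esub> * 1"
    using yz a b by (intro mult_left_mono \<omega>) (simp_all add: \<alpha>)
  also have "\<parallel>a \<otimes>\<^bsub>A\<^esub> \<alpha> y b\<parallel>\<^bsub>A\<^esub> \<le> \<parallel>a\<parallel>\<^bsub>A\<^esub> * \<parallel>\<alpha> y b\<parallel>\<^bsub>A\<^esub>"
    using yz a b by (intro L1.A.nrm_mult) (simp_all add: \<alpha>)
  also have "\<dots> \<le> \<parallel>a\<parallel>\<^bsub>A\<^esub> * \<parallel>b\<parallel>\<^bsub>A\<^esub>"
    using yz a b by (intro mult_left_mono \<alpha>_norm) simp_all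
  finally show "\<parallel>a \<otimes>\<^bsub>A\<^esub> \<alpha> y b \<otimes>\<^bsub>A\<^esub> \<omega> y z\<parallel>\<^bsub>A\<^esub> \<le> \<parallel>a\<parallel>\<^bsub>A\<^esub> * \<parallel>b\<parallel>\<^bsub>A\<^esub>" by simp
qed

abbreviation tw_star :: "('g \<Rightarrow> 'a) \<Rightarrow> 'g \<Rightarrow> 'a" where
  "tw_star f \<equiv> f\<^sup>\<star>\<^bsub>TL\<^esub>"

lemma TL_simps:
  "carrier TL = l1" "f \<otimes>\<^bsub>TL\<^esub> g = K.conv f g" "f \<oplus>\<^bsub>TL\<^esub> g = f \<oplus>\<^bsub>L1.L\<^esub> g"
  "z \<odot>\<^bsub>TL\<^esub> f = z \<odot>\<^bsub>L1.L\<^esub> f" "\<parallel>f\<parallel>\<^bsub>TL\<^esub> = \<parallel>f\<parallel>\<^bsub>L1.L\<^esub>"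
  by (simp_all add: twisted_l1_def l1_algebra_def K.conv_def)

lemma tw_star: "tw_star f = (\<lambda>x\<in>carrier G. (\<omega> x (inv x))\<^sup>\<star>\<^bsub>A\<^esub> \<otimes>\<^bsub>A\<^esub> (\<alpha> x (f (inv x)))\<^sup>\<star>\<^bsub>A\<^esub>)"
  by (simp add: twisted_l1_def)

lemma tw_star_closed:
  assumes f: "f \<in> l1"
  shows "tw_star f \<in> l1"
proof -
  have "(\<Sum>x\<in>F. \<parallel>(\<omega> x (inv x))\<^sup>\<star>\<^bsub>A\<^esub> \<otimes>\<^bsub>A\<^esub> (\<alpha> x (f (inv x)))\<^sup>\<star>\<^bsub>A\<^esub>\<parallel>\<^bsub>A\<^esub>) \<le> \<parallel>f\<parallel>\<^bsub>L1.L\<^esub>"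
    if F: "finite F" "F \<subseteq> carrier G" for F
  proof -
    have "\<parallel>(\<omega> x (inv x))\<^sup>\<star>\<^bsub>A\<^esub> \<otimes>\<^bsub>A\<^esub> (\<alpha> x (f (inv x)))\<^sup>\<star>\<^bsub>A\<^esub>\<parallel>\<^bsub>A\<^esub> \<le> \<parallel>f (inv x)\<parallel>\<^bsub>A\<^esub>" if x: "x \<in> carrier G" for x
    proof -
      have "\<parallel>(\<omega> x (inv x))\<^sup>\<star>\<^bsub>A\<^esub> \<otimes>\<^bsub>A\<^esub> (\<alpha> x (f (inv x)))\<^sup>\<star>\<^bsub>A\<^esub>\<parallel>\<^bsub>A\<^esub> \<le> \<parallel>\<omega> x (inv x)\<parallel>\<^bsub>A\<^esub> * \<parallel>\<alpha> x (f (inv x))\<parallel>\<^bsub>A\<^esub>"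
        using L1.A.nrm_mult[of "(\<omega> x (inv x))\<^sup>\<star>\<^bsub>A\<^esub>" "(\<alpha> x (f (inv x)))\<^sup>\<star>\<^bsub>A\<^esub>"] x f
        by (simp add: \<omega> \<alpha> L1.A.star_closed L1.A.nrm_star)
      also have "\<dots> \<le> 1 * \<parallel>f (inv x)\<parallel>\<^bsub>A\<^esub>"
        using x f by (intro mult_mono \<omega> \<alpha>_norm) (simp_all add: \<alpha>)
      finally show ?thesis by simp
    qed
    then have "(\<Sum>x\<in>F. \<parallel>(\<omega> x (inv x))\<^sup>\<star>\<^bsub>A\<^esub> \<otimes>\<^bsub>A\<^esub> (\<alpha> x (f (inv x)))\<^sup>\<star>\<^bsub>A\<^esub>\<parallel>\<^bsub>A\<^esub>) \<le> (\<Sum>x\<in>F. \<parallel>f (inv x)\<parallel>\<^bsub>A\<^esub>)"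
      using F by (intro sum_mono) auto
    also have "\<dots> = (\<Sum>x\<in>(\<lambda>x. inv x) ` F. \<parallel>f x\<parallel>\<^bsub>A\<^esub>)"
      using F by (subst sum.reindex) (auto simp: inj_on_def subset_iff dest: L1.inv_inj[THEN inj_onD])
    also have "\<dots> \<le> \<parallel>f\<parallel>\<^bsub>L1.L\<^esub>"
      using F f by (intro L1.finite_sum_le_nrm) auto
    finally show ?thesis .
  qed
  then show ?thesis
    unfolding tw_star using f by (intro L1.l1I_finite_bound(1)) (auto simp: \<omega> \<alpha> L1.A.star_closed)
qed

lemma tw_star_delta:
  assumes x: "x \<in> carrier G" and a: "a \<in> carrier A"
  shows "tw_star (L1.delta (inv x) a) = L1.delta x ((\<omega> x (inv x))\<^sup>\<star>\<^bsub>A\<^esub> \<otimes>\<^bsub>A\<^esub> (\<alpha> x a)\<^sup>\<star>\<^bsub>A\<^esub>)"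
  unfolding tw_star L1.delta_def[of x]
proof (rule restrict_ext)
  fix y assume y: "y \<in> carrier G"
  have \<alpha>0: "\<alpha> y \<zero>\<^bsub>A\<^esub> = \<zero>\<^bsub>A\<^esub>"
    using \<alpha>_norm[OF y L1.A.zero_closed] \<alpha>(1)[OF y L1.A.zero_closed] L1.A.nrm_nonneg[of "\<alpha> y \<zero>\<^bsub>A\<^esub>"]
    by (metis L1.A.nrm_eq_0_iff L1.A.nrm_zero antisym)
  show "(\<omega> y (inv y))\<^sup>\<star>\<^bsub>A\<^esub> \<otimes>\<^bsub>A\<^esub> (\<alpha> y (L1.delta (inv x) a (inv y)))\<^sup>\<star>\<^bsub>A\<^esub>
      = (if y = x then (\<omega> x (inv x))\<^sup>\<star>\<^bsub>A\<^esub> \<otimes>\<^bsub>A\<^esub> (\<alpha> x a)\<^sup>\<star>\<^bsub>A\<^esub> else \<zero>\<^bsub>A\<^esub>)"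
  proof (cases "y = x")
    case False
    then have "inv y \<noteq> inv x" using x y by (metis L1.inv_inv)
    then show ?thesis using False y by (simp add: L1.delta_def \<alpha>0 L1.star_zero \<omega> L1.A.star_closed)
  qed (use x in \<open>simp add: L1.delta_def\<close>)
qed

lemma C_banach: "banach_star_algebra C"
  and \<iota>_hom: "\<iota> \<in> star_hom TL C"
  and dense: "(nrm_topology C) closure_of (\<iota> ` l1) = carrier C"
  and \<iota>_enveloping: "f \<in> l1 \<Longrightarrow> \<parallel>\<iota> f\<parallel>\<^bsub>C\<^esub> = enveloping_nrm TL f"
  and C_cstar: "c \<in> carrier C \<Longrightarrow> \<parallel>c\<^sup>\<star>\<^bsub>C\<^esub> \<otimes>\<^bsub>C\<^esub> c\<parallel>\<^bsub>C\<^esub> = \<parallel>c\<parallel>\<^bsub>C\<^esub>\<^sup>2"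
  using enveloping
  by (auto simp: enveloping_cstar_algebra_def TL_simps cstar_algebra_def cstar_algebra_axioms_def)

lemma \<iota>:
  assumes "f \<in> l1"
  shows "\<iota> f \<in> carrier C" "g \<in> l1 \<Longrightarrow> \<iota> (f \<oplus>\<^bsub>L1.L\<^esub> g) = \<iota> f \<oplus>\<^bsub>C\<^esub> \<iota> g"
    "g \<in> l1 \<Longrightarrow> \<iota> (K.conv f g) = \<iota> f \<otimes>\<^bsub>C\<^esub> \<iota> g" "\<iota> (z \<odot>\<^bsub>L1.L\<^esub> f) = z \<odot>\<^bsub>C\<^esub> \<iota> f"
    "\<iota> (tw_star f) = (\<iota> f)\<^sup>\<star>\<^bsub>C\<^esub>"
  using \<iota>_hom assms by (auto simp: star_hom_def TL_simps)

definition unit_fn :: "'g \<Rightarrow> 'a" where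
  "unit_fn = L1.delta \<one> \<one>\<^bsub>A\<^esub>"

lemma unit_fn: "unit_fn \<in> l1"
  by (simp add: unit_fn_def)

lemma conv_unit_fn:
  assumes f: "f \<in> l1"
  shows "K.conv unit_fn f = f" "K.conv f unit_fn = f"
proof -
  show "K.conv unit_fn f = f"
    by (rule L1.bounded_op_eqI[OF K.bounded_op_conv_right[OF unit_fn] L1.bounded_op_id _ f])
       (simp add: unit_fn_def K.conv_delta \<alpha>_unit_id normalized)
  show "K.conv f unit_fn = f"
    by (rule L1.bounded_op_eqI[OF K.bounded_op_conv_left[OF unit_fn] L1.bounded_op_id _ f])
       (simp add: unit_fn_def K.conv_delta \<alpha>_one normalized)
qed

text \<open>
  The crossed product is unital although this is not part of the definition of an enveloping algebra.
\<close>

lemma C_monoid: "monoid C" "\<one>\<^bsub>C\<^esub> = \<iota> unit_fn"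
  by (rule monoid_of_dense_unit[OF C_banach \<iota>(1)[OF unit_fn] _ dense];
      use conv_unit_fn in \<open>auto simp: \<iota> unit_fn simp flip: \<iota>(3)\<close>)+

sublocale C: unital_banach C
  by (intro unital_banach.intro C_banach C_monoid)

lemma seminorm_le_\<iota>:
  assumes q: "cstar_seminorm TL q" and f: "f \<in> l1"
  shows "q f \<le> \<parallel>\<iota> f\<parallel>\<^bsub>C\<^esub>"
  unfolding \<iota>_enveloping[OF f] enveloping_nrm_def
proof (rule cSUP_upper)
  show "bdd_above ((\<lambda>q. q f) ` {q. cstar_seminorm TL q})"
    using f by (intro bdd_aboveI[of _ "\<parallel>f\<parallel>\<^bsub>TL\<^esub>"]) (auto simp: cstar_seminorm_def TL_simps(1))
qed (use q in simp)

lemma \<iota>_norm: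
  assumes f: "f \<in> l1"
  shows "\<parallel>\<iota> f\<parallel>\<^bsub>C\<^esub> \<le> \<parallel>f\<parallel>\<^bsub>L1.L\<^esub>"
  unfolding \<iota>_enveloping[OF f] enveloping_nrm_def
proof (rule cSUP_least)
  have "cstar_seminorm TL (\<lambda>f. 0)"
    by (auto simp: cstar_seminorm_def TL_simps L1.nrm_l1_nonneg)
  then show "{q. cstar_seminorm TL q} \<noteq> {}" by blast
qed (use f in \<open>auto simp: cstar_seminorm_def TL_simps\<close>)

sublocale LA: unital_banach L1.L
  by (rule L1.l1_unital_banach)

sublocale \<iota>: bounded_additive L1.L C \<iota> 1
  by unfold_locales (simp_all add: L1.l1_simps(1) \<iota> \<iota>_norm)

end

section \<open>The ideal of the crossed product attached to an invariant ideal\<close>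

lemma mult_less_half:
  fixes e p r :: real
  assumes "0 \<le> r" "0 \<le> p" "p < e / (2 * (r + 1))"
  shows "p * r < e / 2"
proof -
  have "p * (2 * (r + 1)) < e" using assms by (simp add: pos_less_divide_eq)
  then have "2 * (p * r) + 2 * p < e" by (simp add: algebra_simps)
  then show ?thesis using assms(2) by linarith
qed

context unital_banach
begin

text \<open>
  The closure of a *-ideal \<open>S\<close> of a dense *-subalgebra \<open>B\<close> is an ideal of the whole algebra.
\<close>

lemma closed_ideal_of_dense_ideal:
  assumes cs: "\<And>a. a \<in> carrier A \<Longrightarrow> \<parallel>a\<^sup>\<star> \<otimes> a\<parallel> = \<parallel>a\<parallel>\<^sup>2"
    and S: "S \<subseteq> carrier A" "\<zero> \<in> S" "\<And>x y. x \<in> S \<Longrightarrow> y \<in> S \<Longrightarrow> x \<oplus> y \<in> S"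
      "\<And>x z. x \<in> S \<Longrightarrow> z \<odot> x \<in> S" "\<And>x. x \<in> S \<Longrightarrow> x\<^sup>\<star> \<in> S"
    and B: "B \<subseteq> carrier A" "\<And>c e. c \<in> carrier A \<Longrightarrow> e > 0 \<Longrightarrow> \<exists>b\<in>B. \<parallel>c \<ominus> b\<parallel> < e"
    and SB: "\<And>x b. x \<in> S \<Longrightarrow> b \<in> B \<Longrightarrow> b \<otimes> x \<in> S \<and> x \<otimes> b \<in> S"
    and I: "\<And>c. c \<in> I \<longleftrightarrow> c \<in> carrier A \<and> (\<forall>e>0. \<exists>s\<in>S. \<parallel>c \<ominus> s\<parallel> < e)"
  shows "cstar_quotient A I" "S \<subseteq> I"
proof -
  have Ic: "c \<in> I \<Longrightarrow> c \<in> carrier A" for c using I by blast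
  have Sc: "s \<in> S \<Longrightarrow> s \<in> carrier A" for s using S(1) by blast
  have Bc: "b \<in> B \<Longrightarrow> b \<in> carrier A" for b using B(1) by blast
  have near: "\<exists>s\<in>S. \<parallel>c \<ominus> s\<parallel> < e" if "c \<in> I" "e > 0" for c e using I that by blast
  have II: "c \<in> I" if "c \<in> carrier A" "\<And>e. e > 0 \<Longrightarrow> \<exists>s\<in>S. \<parallel>c \<ominus> s\<parallel> < e" for c
    using I that by blast
  show SI: "S \<subseteq> I"
  proof
    fix s assume s: "s \<in> S"
    have "\<parallel>s \<ominus> s\<parallel> = 0" using Sc[OF s] by (simp add: minus_eq r_neg)
    then have "\<exists>t\<in>S. \<parallel>s \<ominus> t\<parallel> < e" if "e > 0" for e using that s by (intro bexI[of _ s]) simp_all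
    then show "s \<in> I" by (rule II[OF Sc[OF s]])
  qed
  have add: "x \<oplus> y \<in> I" if x: "x \<in> I" and y: "y \<in> I" for x y
  proof (rule II)
    fix e :: real assume "e > 0"
    then have e2: "e / 2 > 0" by simp
    obtain s where s: "s \<in> S" "\<parallel>x \<ominus> s\<parallel> < e / 2" using near[OF x e2] by blast
    obtain t where t: "t \<in> S" "\<parallel>y \<ominus> t\<parallel> < e / 2" using near[OF y e2] by blast
    have "(x \<oplus> y) \<ominus> (s \<oplus> t) = (x \<ominus> s) \<oplus> (y \<ominus> t)"
      using Ic[OF x] Ic[OF y] Sc[OF s(1)] Sc[OF t(1)] by (simp add: add_minus_add)
    then have "\<parallel>(x \<oplus> y) \<ominus> (s \<oplus> t)\<parallel> \<le> \<parallel>x \<ominus> s\<parallel> + \<parallel>y \<ominus> t\<parallel>"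
      using Ic[OF x] Ic[OF y] Sc[OF s(1)] Sc[OF t(1)] by (simp add: nrm_triangle)
    then show "\<exists>u\<in>S. \<parallel>(x \<oplus> y) \<ominus> u\<parallel> < e" using s t S(3) by (intro bexI[of _ "s \<oplus> t"]) auto
  qed (use Ic x y in simp)
  have smult: "z \<odot> x \<in> I" if x: "x \<in> I" for x z
  proof (rule II)
    fix e :: real assume e: "e > 0"
    have "e / (2 * (cmod z + 1)) > 0" using e by (simp add: add_nonneg_pos)
    then obtain s where s: "s \<in> S" "\<parallel>x \<ominus> s\<parallel> < e / (2 * (cmod z + 1))" using near[OF x] by blast
    have "z \<odot> (\<ominus> s) = \<ominus> (z \<odot> s)"
      using Sc[OF s(1)] scale_assoc[of s z "-1"] scale_assoc[of s "-1" z] by (simp flip: scale_minus1)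
    then have "z \<odot> x \<ominus> z \<odot> s = z \<odot> (x \<ominus> s)"
      using Ic[OF x] Sc[OF s(1)] by (simp add: minus_eq scale_r_distr)
    then have "\<parallel>z \<odot> x \<ominus> z \<odot> s\<parallel> = \<parallel>x \<ominus> s\<parallel> * cmod z"
      using Ic[OF x] Sc[OF s(1)] by (simp add: nrm_smult)
    also have "\<dots> < e / 2" using s Ic[OF x] Sc[OF s(1)] by (intro mult_less_half) auto
    finally show "\<exists>u\<in>S. \<parallel>z \<odot> x \<ominus> u\<parallel> < e" using e s S(4) by (intro bexI[of _ "z \<odot> s"]) auto
  qed (use Ic x in simp)
  have star: "x\<^sup>\<star> \<in> I" if x: "x \<in> I" for x
  proof (rule II)
    fix e :: real assume e: "e > 0"
    obtain s where s: "s \<in> S" "\<parallel>x \<ominus> s\<parallel> < e" using near[OF x e] by blast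
    have "x\<^sup>\<star> \<ominus> s\<^sup>\<star> = (x \<ominus> s)\<^sup>\<star>"
      using Ic[OF x] Sc[OF s(1)] star_smult[of s "-1"] by (simp add: minus_eq star_add star_closed scale_minus1)
    then have "\<parallel>x\<^sup>\<star> \<ominus> s\<^sup>\<star>\<parallel> = \<parallel>x \<ominus> s\<parallel>" using Ic[OF x] Sc[OF s(1)] by (simp add: nrm_star)
    then show "\<exists>u\<in>S. \<parallel>x\<^sup>\<star> \<ominus> u\<parallel> < e" using s S(5) by (intro bexI[of _ "s\<^sup>\<star>"]) auto
  qed (use Ic x star_closed in simp)
  have mult: "y \<otimes> x \<in> I \<and> x \<otimes> y \<in> I" if x: "x \<in> I" and y: "y \<in> carrier A" for x y
  proof -
    note xc = Ic[OF x]
    have "\<exists>s\<in>S. \<exists>b\<in>B. \<parallel>y \<ominus> b\<parallel> * \<parallel>x\<parallel> < e / 2 \<and> \<parallel>x \<ominus> s\<parallel> * \<parallel>b\<parallel> < e / 2" if e: "e > 0" for e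
    proof -
      have "e / (2 * (\<parallel>x\<parallel> + 1)) > 0" using e xc by (simp add: add_nonneg_pos)
      then obtain b where b: "b \<in> B" "\<parallel>y \<ominus> b\<parallel> < e / (2 * (\<parallel>x\<parallel> + 1))" using B(2)[OF y] by blast
      have "e / (2 * (\<parallel>b\<parallel> + 1)) > 0" using e Bc[OF b(1)] by (simp add: add_nonneg_pos)
      then obtain s where s: "s \<in> S" "\<parallel>x \<ominus> s\<parallel> < e / (2 * (\<parallel>b\<parallel> + 1))" using near[OF x] by blast
      have "\<parallel>y \<ominus> b\<parallel> * \<parallel>x\<parallel> < e / 2" "\<parallel>x \<ominus> s\<parallel> * \<parallel>b\<parallel> < e / 2"
        using b s xc y Bc[OF b(1)] Sc[OF s(1)] by (intro mult_less_half; simp)+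
      then show ?thesis using b(1) s(1) by blast
    qed
    note approx = this
    show ?thesis
    proof (intro conjI II)
      fix e :: real assume "e > 0"
      then obtain s b where sb: "s \<in> S" "b \<in> B" "\<parallel>y \<ominus> b\<parallel> * \<parallel>x\<parallel> < e / 2" "\<parallel>x \<ominus> s\<parallel> * \<parallel>b\<parallel> < e / 2"
        using approx by blast
      have c: "s \<in> carrier A" "b \<in> carrier A" using sb Sc Bc by auto
      have "\<parallel>y \<otimes> x \<ominus> b \<otimes> s\<parallel> < e"
        using nrm_mult_minus_mult(1)[OF y xc c(2,1)] sb(3,4) by (simp add: mult.commute)
      then show "\<exists>s\<in>S. \<parallel>y \<otimes> x \<ominus> s\<parallel> < e" using SB[OF sb(1,2)] by blast
      have "\<parallel>x \<otimes> y \<ominus> s \<otimes> b\<parallel> < e"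
        using nrm_mult_minus_mult(2)[OF xc y c] sb(3,4) by (simp add: mult.commute)
      then show "\<exists>s\<in>S. \<parallel>x \<otimes> y \<ominus> s\<parallel> < e" using SB[OF sb(1,2)] by blast
    qed (use xc y in simp_all)
  qed
  have closed: "c \<in> I" if c: "c \<in> carrier A" and n: "\<And>e. e > 0 \<Longrightarrow> \<exists>j\<in>I. \<parallel>c \<ominus> j\<parallel> < e" for c
  proof (rule II[OF c])
    fix e :: real assume "e > 0"
    then have e2: "e / 2 > 0" by simp
    obtain j where j: "j \<in> I" "\<parallel>c \<ominus> j\<parallel> < e / 2" using n[OF e2] by blast
    obtain s where s: "s \<in> S" "\<parallel>j \<ominus> s\<parallel> < e / 2" using near[OF j(1) e2] by blast
    have "\<parallel>c \<ominus> s\<parallel> \<le> \<parallel>c \<ominus> j\<parallel> + \<parallel>j \<ominus> s\<parallel>" by (intro nrm_triangle_minus c Ic[OF j(1)] Sc[OF s(1)])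
    then show "\<exists>s\<in>S. \<parallel>c \<ominus> s\<parallel> < e" using s j by (intro bexI[of _ s]) auto
  qed
  show "cstar_quotient A I"
    by (intro cstar_quotient.intro unital_banach_axioms cstar_quotient_axioms.intro)
       (use cs Ic SI S(2) add smult star mult closed in auto)
qed

lemma geometric_sum:
  assumes c: "c \<in> carrier A"
  shows "(\<one> \<ominus> c) \<otimes> finsum A (\<lambda>i. c [^] (i::nat)) {..<n} = \<one> \<ominus> c [^] n"
proof (induction n)
  case 0
  then show ?case using c by (simp add: minus_eq r_neg)
next
  case (Suc n)
  define p where "p = c [^] n"
  define s where "s = finsum A (\<lambda>i. c [^] (i::nat)) {..<n}"
  have p: "p \<in> carrier A" and s: "s \<in> carrier A" using c by (simp_all add: p_def s_def)
  have "finsum A (\<lambda>i. c [^] (i::nat)) {..<Suc n} = p \<oplus> s"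
    using c by (simp add: lessThan_Suc finsum_insert p_def s_def)
  moreover have "c [^] Suc n = c \<otimes> p" unfolding p_def using c by (rule nat_pow_Suc2)
  moreover have "(\<one> \<ominus> c) \<otimes> (p \<oplus> s) = (p \<ominus> c \<otimes> p) \<oplus> (\<one> \<ominus> p)"
    using c p s Suc by (simp add: r_distr p_def s_def) (simp add: minus_eq l_distr l_minus)
  moreover have "(p \<ominus> c \<otimes> p) \<oplus> (\<one> \<ominus> p) = (p \<ominus> p) \<oplus> (\<one> \<ominus> c \<otimes> p)"
    using c p by (simp add: minus_eq a_ac)
  moreover have "p \<ominus> p = \<zero>" using p by (simp add: minus_eq r_neg)
  ultimately show ?case using c p by simp
qed

end

lemma (in cstar_quotient) ideal_I: "ideal I C"
proof (rule idealI)
  show "subgroup I (add_monoid C)"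
    by (intro subgroup.intro) (auto simp: I_add I_zero I_uminus simp flip: a_inv_def)
qed (use I_mult in \<open>auto intro: ring_axioms\<close>)

text \<open>
  From here on \<open>J\<close> is an invariant ideal of the coefficients; \<open>LJ\<close> below is the set of \<open>J\<close>-valued functions,
  an ideal of the twisted algebra whose image has closure \<open>I\<close>.
\<close>

locale invariant_ideal = crossed_product G A \<alpha> \<omega> C \<iota>
  for G :: "('g, 'k) monoid_scheme" (structure) and A :: "('a, 'm) star_algebra_scheme"
    and \<alpha> :: "'g \<Rightarrow> 'a \<Rightarrow> 'a" and \<omega> :: "'g \<Rightarrow> 'g \<Rightarrow> 'a"
    and C :: "('c, 'n) star_algebra_scheme" and \<iota> :: "('g \<Rightarrow> 'a) \<Rightarrow> 'c" +
  fixes J :: "'a set"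
  assumes J_ideal: "cstar_ideal J A" and J_invariant: "invariant_under G \<alpha> J"
begin

lemma ideal_J: "ideal J A" and J_closedin: "closedin (nrm_topology A) J"
  and J_star: "a \<in> J \<Longrightarrow> a\<^sup>\<star>\<^bsub>A\<^esub> \<in> J"
  using J_ideal by (auto simp: cstar_ideal_def)

sublocale J: ideal J A by (rule ideal_J)

lemma J_\<alpha>: "x \<in> carrier G \<Longrightarrow> a \<in> J \<Longrightarrow> \<alpha> x a \<in> J"
  using J_invariant by (auto simp: invariant_under_def)

lemma J_smult: "a \<in> J \<Longrightarrow> z \<odot>\<^bsub>A\<^esub> a \<in> J"
  using L1.A.smult_mult_left[of "\<one>\<^bsub>A\<^esub>" a z] J.I_l_closed[of a "z \<odot>\<^bsub>A\<^esub> \<one>\<^bsub>A\<^esub>"] by (simp add: J.Icarr)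

lemma J_finsum: "finite F \<Longrightarrow> (\<And>i. i \<in> F \<Longrightarrow> h i \<in> J) \<Longrightarrow> finsum A h F \<in> J"
proof (induction F rule: finite_induct)
  case (insert i F)
  then have "h \<in> F \<rightarrow> carrier A" "h i \<in> carrier A" by (auto simp: J.Icarr)
  then show ?case using insert by (simp add: L1.A.finsum_insert)
qed simp

definition LJ :: "('g \<Rightarrow> 'a) set" where
  "LJ = {f \<in> l1. f ` carrier G \<subseteq> J}"

abbreviation "I \<equiv> crossed_product_ideal G A J C \<iota>"

lemma LJ_l1: "f \<in> LJ \<Longrightarrow> f \<in> l1" and LJ_value: "f \<in> LJ \<Longrightarrow> x \<in> carrier G \<Longrightarrow> f x \<in> J"
  by (auto simp: LJ_def)

lemma LJ_I: "f \<in> l1 \<Longrightarrow> (\<And>x. x \<in> carrier G \<Longrightarrow> f x \<in> J) \<Longrightarrow> f \<in> LJ"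
  by (auto simp: LJ_def)

lemma LJ_zero: "\<zero>\<^bsub>L1.L\<^esub> \<in> LJ"
  using L1.l1_zero by (intro LJ_I) (simp_all add: L1.l1_simps(2))

lemma LJ_add: "f \<in> LJ \<Longrightarrow> g \<in> LJ \<Longrightarrow> f \<oplus>\<^bsub>L1.L\<^esub> g \<in> LJ"
  using L1.l1_add(1)[of f g] by (intro LJ_I) (simp_all add: L1.l1_simps(3) LJ_l1 LJ_value)

lemma LJ_smult: "f \<in> LJ \<Longrightarrow> z \<odot>\<^bsub>L1.L\<^esub> f \<in> LJ"
  using L1.l1_smult(1)[of f z] by (intro LJ_I) (simp_all add: L1.l1_simps(4) LJ_l1 LJ_value J_smult)

lemma LJ_star: "f \<in> LJ \<Longrightarrow> tw_star f \<in> LJ"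
proof (rule LJ_I)
  fix x assume f: "f \<in> LJ" and x: "x \<in> carrier G"
  then have "(\<alpha> x (f (inv x)))\<^sup>\<star>\<^bsub>A\<^esub> \<in> J" by (simp add: J_star J_\<alpha> LJ_value)
  then show "tw_star f x \<in> J" using x by (simp add: tw_star J.I_l_closed \<omega> L1.A.star_closed)
qed (simp add: tw_star_closed LJ_l1)

text \<open>
  Invariance of \<open>J\<close> is used when the right factor is \<open>J\<close>-valued, closedness of \<open>J\<close> for the infinite sum.
\<close>

lemma LJ_conv:
  assumes f: "f \<in> l1" and g: "g \<in> l1" and "f \<in> LJ \<or> g \<in> LJ"
  shows "K.conv f g \<in> LJ"
proof (rule LJ_I[OF K.conv_closed[OF f g]])
  fix x assume x: "x \<in> carrier G"
  have fam: "K.fam f g x y \<in> J" if y: "y \<in> carrier G" for y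
  proof -
    have fy: "f y \<in> carrier A" "g (inv y \<otimes> x) \<in> carrier A" using f g x y by simp_all
    have "f y \<in> J \<or> \<alpha> y (g (inv y \<otimes> x)) \<in> J"
      using assms(3) x y LJ_value J_\<alpha> by auto
    then have *: "f y \<otimes>\<^bsub>A\<^esub> \<alpha> y (g (inv y \<otimes> x)) \<in> J"
      using fy y by (auto intro: J.I_l_closed J.I_r_closed \<alpha>)
    show ?thesis using J.I_r_closed[OF *, of "\<omega> y (inv y \<otimes> x)"] x y by (simp add: \<omega>)
  qed
  have "alg_sum A (K.fam f g x) (carrier G) \<in> J"
    by (rule L1.A.alg_sum_in_closed[OF K.fam_summable[OF f g x] J_closedin])
       (use fam in \<open>auto intro: J_finsum\<close>)
  then show "K.conv f g x \<in> J" using x by (simp add: K.conv_def)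
qed

lemma I_closure: "c \<in> I \<longleftrightarrow> c \<in> carrier C \<and> (\<forall>e>0. \<exists>s\<in>\<iota> ` LJ. \<parallel>c \<ominus>\<^bsub>C\<^esub> s\<parallel>\<^bsub>C\<^esub> < e)"
  unfolding crossed_product_ideal_def LJ_def[symmetric]
  by (rule closure_of_nrm_iff[OF C_banach]) (auto simp: LJ_l1 \<iota>)

lemma dense_iff: "c \<in> carrier C \<Longrightarrow> e > 0 \<Longrightarrow> \<exists>g\<in>l1. \<parallel>c \<ominus>\<^bsub>C\<^esub> \<iota> g\<parallel>\<^bsub>C\<^esub> < e"
proof -
  assume c: "c \<in> carrier C" "e > 0"
  have "\<iota> ` l1 \<subseteq> carrier C" by (auto simp: \<iota>)
  then show ?thesis using dense closure_of_nrm_iff[OF C_banach, of "\<iota> ` l1" c] c by auto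
qed

lemma I_cstar_quotient: "cstar_quotient C I" and \<iota>_LJ: "j \<in> LJ \<Longrightarrow> \<iota> j \<in> I"
proof -
  have SB: "b \<otimes>\<^bsub>C\<^esub> x \<in> \<iota> ` LJ \<and> x \<otimes>\<^bsub>C\<^esub> b \<in> \<iota> ` LJ" if xb: "x \<in> \<iota> ` LJ" "b \<in> \<iota> ` l1" for x b
  proof -
    obtain j g where "j \<in> LJ" "g \<in> l1" "x = \<iota> j" "b = \<iota> g" using xb by blast
    then show ?thesis using LJ_conv LJ_l1 by (auto simp flip: \<iota>(3))
  qed
  have S: "\<iota> ` LJ \<subseteq> carrier C" "\<zero>\<^bsub>C\<^esub> \<in> \<iota> ` LJ"
    "x \<in> \<iota> ` LJ \<Longrightarrow> y \<in> \<iota> ` LJ \<Longrightarrow> x \<oplus>\<^bsub>C\<^esub> y \<in> \<iota> ` LJ"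
    "x \<in> \<iota> ` LJ \<Longrightarrow> z \<odot>\<^bsub>C\<^esub> x \<in> \<iota> ` LJ" "x \<in> \<iota> ` LJ \<Longrightarrow> x\<^sup>\<star>\<^bsub>C\<^esub> \<in> \<iota> ` LJ" for x y z
    using LJ_zero LJ_add LJ_smult LJ_star LJ_l1 \<iota>.zero
    by (auto simp: \<iota> simp flip: \<iota>(2,4,5) intro: image_eqI[of _ _ "\<zero>\<^bsub>L1.L\<^esub>"])
  have B: "\<iota> ` l1 \<subseteq> carrier C" "c \<in> carrier C \<Longrightarrow> e > 0 \<Longrightarrow> \<exists>b\<in>\<iota> ` l1. \<parallel>c \<ominus>\<^bsub>C\<^esub> b\<parallel>\<^bsub>C\<^esub> < e" for c e
    using dense_iff by (auto simp: \<iota>)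
  note * = C.closed_ideal_of_dense_ideal[OF C_cstar S B SB I_closure]
  show "cstar_quotient C I" by (rule *(1))
  show "j \<in> LJ \<Longrightarrow> \<iota> j \<in> I" using *(2) by blast
qed

sublocale CQ: cstar_quotient C I by (rule I_cstar_quotient)

abbreviation "D \<equiv> CQ.quot.Q"

sublocale DL: l1_space G D
  by (intro l1_space.intro group CQ.quot.Q_unital_banach)

text \<open>
  The coefficient map at \<open>x\<close>. It keeps \<open>\<delta>\<^sub>x\<close> inside the crossed product instead of stripping it off; this
  is what turns the twisted convolution into the ordinary one.
\<close>

definition \<phi> :: "'g \<Rightarrow> 'a \<Rightarrow> 'c set" where
  "\<phi> x a = CQ.coset (\<iota> (L1.delta x a))"

lemma \<phi>_nrm: "x \<in> carrier G \<Longrightarrow> a \<in> carrier A \<Longrightarrow> \<parallel>\<phi> x a\<parallel>\<^bsub>D\<^esub> = CQ.q (\<iota> (L1.delta x a))"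
  by (simp add: \<phi>_def CQ.quot.Q_nrm \<iota>)

lemma \<phi>_bounded_additive:
  assumes x: "x \<in> carrier G"
  shows "bounded_additive A D (\<phi> x) 1"
proof (intro bounded_additive.intro bounded_additive_axioms.intro L1.A.unital_banach_axioms CQ.quot.Q_unital_banach)
  fix a b assume a: "a \<in> carrier A"
  show "\<phi> x a \<in> carrier D" using x a by (simp add: \<phi>_def CQ.quot.Q_carrier \<iota>)
  show "\<phi> x (a \<oplus>\<^bsub>A\<^esub> b) = \<phi> x a \<oplus>\<^bsub>D\<^esub> \<phi> x b" if "b \<in> carrier A"
    using x a that by (simp add: \<phi>_def L1.delta_add \<iota> CQ.quot.Q_add)
  show "\<parallel>\<phi> x a\<parallel>\<^bsub>D\<^esub> \<le> 1 * \<parallel>a\<parallel>\<^bsub>A\<^esub>"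
    using x a CQ.q_le_nrm[of "\<iota> (L1.delta x a)"] \<iota>_norm[of "L1.delta x a"]
    by (simp add: \<phi>_nrm \<iota> L1.nrm_delta)
qed

sublocale H: l1_hom G A "\<lambda>y z a b. a \<otimes>\<^bsub>A\<^esub> \<alpha> y b \<otimes>\<^bsub>A\<^esub> \<omega> y z" D "\<lambda>y z a b. a \<otimes>\<^bsub>D\<^esub> b" \<phi>
proof (intro l1_hom.intro K.l1_kernel_axioms DL.P.l1_kernel_axioms l1_hom_axioms.intro \<phi>_bounded_additive)
  fix y z a b assume "y \<in> carrier G" "z \<in> carrier G" "a \<in> carrier A" "b \<in> carrier A"
  then show "\<phi> (y \<otimes> z) (a \<otimes>\<^bsub>A\<^esub> \<alpha> y b \<otimes>\<^bsub>A\<^esub> \<omega> y z) = \<phi> y a \<otimes>\<^bsub>D\<^esub> \<phi> z b"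
    by (simp add: \<phi>_def CQ.quot.Q_mult \<iota> flip: K.conv_delta)
qed

end

section \<open>Untwisting over the quotient\<close>

context invariant_ideal
begin

abbreviation "LD \<equiv> l1_algebra G D"
abbreviation "\<Psi> \<equiv> H.induced"

sublocale LD: unital_banach LD
  by (rule DL.l1_unital_banach)

lemma LD_carrier: "carrier LD = l1_functions G D"
  by (rule DL.l1_simps(1))

lemma \<Psi>_closed: "f \<in> l1 \<Longrightarrow> \<Psi> f \<in> carrier LD" "f \<in> l1 \<Longrightarrow> \<parallel>\<Psi> f\<parallel>\<^bsub>LD\<^esub> \<le> \<parallel>f\<parallel>\<^bsub>L1.L\<^esub>"
  using H.induced_closed by (simp_all add: LD_carrier)

lemma \<Psi>_conv: "f \<in> l1 \<Longrightarrow> g \<in> l1 \<Longrightarrow> \<Psi> (K.conv f g) = \<Psi> f \<otimes>\<^bsub>LD\<^esub> \<Psi> g"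
  by (simp add: H.induced_conv DL.l1_mult)

lemma \<Psi>_star:
  assumes f: "f \<in> l1"
  shows "\<Psi> (tw_star f) = (\<Psi> f)\<^sup>\<star>\<^bsub>LD\<^esub>"
  unfolding H.induced_def[of "tw_star f"] DL.l1_simps(5)
proof (rule restrict_ext)
  fix x assume x: "x \<in> carrier G"
  let ?a = "f (inv x)"
  have a: "?a \<in> carrier A" using f x by simp
  have "\<phi> x (tw_star f x) = CQ.coset (\<iota> (tw_star (L1.delta (inv x) ?a)))"
    using x a by (simp add: tw_star_delta \<phi>_def) (simp add: tw_star)
  also have "\<dots> = (\<phi> (inv x) ?a)\<^sup>\<star>\<^bsub>D\<^esub>"
    using x a by (simp add: \<phi>_def \<iota> CQ.quot.Q_star)
  finally show "\<phi> x (tw_star f x) = (\<Psi> f (inv x))\<^sup>\<star>\<^bsub>D\<^esub>" using x by (simp add: H.induced_def)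
qed

lemma \<phi>_zero: "x \<in> carrier G \<Longrightarrow> \<phi> x \<zero>\<^bsub>A\<^esub> = \<zero>\<^bsub>D\<^esub>"
  by (rule bounded_additive.zero[OF \<phi>_bounded_additive])

lemma \<Psi>_unit_fn: "\<Psi> unit_fn = \<one>\<^bsub>LD\<^esub>"
proof -
  have "\<phi> \<one> \<one>\<^bsub>A\<^esub> = \<one>\<^bsub>D\<^esub>" by (simp add: \<phi>_def CQ.quot.Q_one C_monoid(2) unit_fn_def)
  then show ?thesis
    unfolding H.induced_def DL.l1_one DL.delta_def unit_fn_def L1.delta_def
    by (intro restrict_ext) (simp add: \<phi>_zero)
qed

lemma \<Psi>_smult:
  assumes f: "f \<in> l1"
  shows "\<Psi> (z \<odot>\<^bsub>L1.L\<^esub> f) = z \<odot>\<^bsub>LD\<^esub> \<Psi> f"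
  unfolding H.induced_def[of "z \<odot>\<^bsub>L1.L\<^esub> f"] DL.l1_simps(4)
proof (rule restrict_ext)
  fix x assume x: "x \<in> carrier G"
  have "\<phi> x (z \<odot>\<^bsub>A\<^esub> f x) = z \<odot>\<^bsub>D\<^esub> \<phi> x (f x)"
    using f x by (simp add: \<phi>_def \<iota> CQ.quot.Q_smult flip: L1.smult_delta)
  then show "\<phi> x ((z \<odot>\<^bsub>L1.L\<^esub> f) x) = z \<odot>\<^bsub>D\<^esub> \<Psi> f x"
    using x by (simp add: H.induced_def L1.l1_simps(4))
qed

lemma \<phi>_J: "x \<in> carrier G \<Longrightarrow> a \<in> J \<Longrightarrow> \<phi> x a = \<zero>\<^bsub>D\<^esub>"
proof -
  assume x: "x \<in> carrier G" and a: "a \<in> J"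
  have "L1.delta x a \<in> LJ"
    using x a by (intro LJ_I L1.delta_closed) (auto simp: L1.delta_def J.Icarr)
  then have i: "\<iota> (L1.delta x a) \<in> I" by (rule \<iota>_LJ)
  have "CQ.coset (\<iota> (L1.delta x a)) = CQ.coset \<zero>\<^bsub>C\<^esub>"
  proof (subst CQ.coset_eq)
    show "CQ.q (\<iota> (L1.delta x a) \<ominus>\<^bsub>C\<^esub> \<zero>\<^bsub>C\<^esub>) = 0"
      using i CQ.q_eq_0_iff[of "\<iota> (L1.delta x a)"] by (simp add: C.minus_eq)
  qed (use i in simp_all)
  then show "\<phi> x a = \<zero>\<^bsub>D\<^esub>" by (simp add: \<phi>_def CQ.quot.Q_zero)
qed

lemma \<Psi>_LJ: "j \<in> LJ \<Longrightarrow> \<Psi> j = \<zero>\<^bsub>LD\<^esub>"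
  unfolding H.induced_def DL.l1_simps(2) by (intro restrict_ext) (simp add: \<phi>_J LJ_value)

text \<open>
  The norm of the crossed product dominates every C*-seminorm on the twisted algebra, in particular those
  pulled back along \<open>\<Psi>\<close>.
\<close>

lemma \<Psi>_seminorm:
  assumes p: "cstar_seminorm LD p" and f: "f \<in> l1"
  shows "p (\<Psi> f) \<le> \<parallel>\<iota> f\<parallel>\<^bsub>C\<^esub>"
proof (rule seminorm_le_\<iota>[of "\<lambda>f. p (\<Psi> f)", OF _ f])
  have p1: "0 \<le> p a" "p a \<le> \<parallel>a\<parallel>\<^bsub>LD\<^esub>" "p (a\<^sup>\<star>\<^bsub>LD\<^esub> \<otimes>\<^bsub>LD\<^esub> a) = (p a)\<^sup>2" "p (z \<odot>\<^bsub>LD\<^esub> a) = cmod z * p a"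
    "b \<in> carrier LD \<Longrightarrow> p (a \<oplus>\<^bsub>LD\<^esub> b) \<le> p a + p b" "b \<in> carrier LD \<Longrightarrow> p (a \<otimes>\<^bsub>LD\<^esub> b) \<le> p a * p b"
    if "a \<in> carrier LD" for a b z
    using p that unfolding cstar_seminorm_def by blast+
  have "p (\<Psi> f) \<le> \<parallel>f\<parallel>\<^bsub>L1.L\<^esub>" if "f \<in> l1" for f
    using p1(2)[OF \<Psi>_closed(1)[OF that]] \<Psi>_closed(2)[OF that] by simp
  then show "cstar_seminorm TL (\<lambda>f. p (\<Psi> f))"
    unfolding cstar_seminorm_def TL_simps
    by (simp add: p1 \<Psi>_closed(1) \<Psi>_conv \<Psi>_star tw_star_closed \<Psi>_smult H.induced_add)
qed

section \<open>Lifting elements of small norm\<close>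

lemma inverse_twist:
  assumes x: "x \<in> carrier G"
  obtains b where "b \<in> carrier A" "\<alpha> x b = (\<omega> x (inv x))\<^sup>\<star>\<^bsub>A\<^esub>" "\<parallel>b\<parallel>\<^bsub>A\<^esub> \<le> 1"
proof -
  have w: "\<omega> x (inv x) \<in> carrier A" "\<omega> x (inv x) \<otimes>\<^bsub>A\<^esub> (\<omega> x (inv x))\<^sup>\<star>\<^bsub>A\<^esub> = \<one>\<^bsub>A\<^esub>"
    using x \<omega> by simp_all
  have "(\<omega> x (inv x))\<^sup>\<star>\<^bsub>A\<^esub> \<in> \<alpha> x ` carrier A"
    using \<alpha>_bij[OF x] w by (simp add: bij_betw_def L1.A.star_closed)
  then obtain b where b: "b \<in> carrier A" "\<alpha> x b = (\<omega> x (inv x))\<^sup>\<star>\<^bsub>A\<^esub>" by auto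
  have "\<alpha> x (b\<^sup>\<star>\<^bsub>A\<^esub> \<otimes>\<^bsub>A\<^esub> b) = \<alpha> x \<one>\<^bsub>A\<^esub>"
    using x b w by (simp add: \<alpha> \<alpha>_one L1.A.star_closed L1.A.star_star)
  then have "b\<^sup>\<star>\<^bsub>A\<^esub> \<otimes>\<^bsub>A\<^esub> b = \<one>\<^bsub>A\<^esub>"
    using \<alpha>_bij[OF x] b by (auto simp: bij_betw_def inj_on_def L1.A.star_closed)
  then show ?thesis using that[OF b norm_le_1_if_isometry[OF b(1)]] by simp
qed

text \<open>
  Right multiplication by a suitable point mass at \<open>x\<^sup>-\<^sup>1\<close>, of norm at most one, moves \<open>a \<delta>\<^sub>x\<close> to \<open>a \<delta>\<^sub>e\<close>. So
  a single C*-seminorm on \<open>A\<close> bounds all coefficient norms from below.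
\<close>

lemma fibre_seminorm_le:
  assumes x: "x \<in> carrier G" and a: "a \<in> carrier A"
  shows "CQ.q (\<iota> (L1.delta \<one> a)) \<le> CQ.q (\<iota> (L1.delta x a))"
proof -
  obtain b where b: "b \<in> carrier A" "\<alpha> x b = (\<omega> x (inv x))\<^sup>\<star>\<^bsub>A\<^esub>" "\<parallel>b\<parallel>\<^bsub>A\<^esub> \<le> 1"
    by (rule inverse_twist[OF x])
  let ?d = "\<iota> (L1.delta x a)" and ?e = "\<iota> (L1.delta (inv x) b)"
  have de: "?d \<in> carrier C" "?e \<in> carrier C" using x a b by (simp_all add: \<iota>)
  have "a \<otimes>\<^bsub>A\<^esub> (\<omega> x (inv x))\<^sup>\<star>\<^bsub>A\<^esub> \<otimes>\<^bsub>A\<^esub> \<omega> x (inv x) = a"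
    using x a \<omega>[OF x, of "inv x"] by (simp add: L1.A.m_assoc L1.A.star_closed)
  then have "\<iota> (L1.delta \<one> a) = ?d \<otimes>\<^bsub>C\<^esub> ?e"
    using x a b by (simp add: K.conv_delta flip: \<iota>(3))
  then have "CQ.q (\<iota> (L1.delta \<one> a)) \<le> CQ.q ?d * CQ.q ?e"
    using CQ.quotient_q_mult[OF de] by simp
  also have "\<dots> \<le> CQ.q ?d * 1"
  proof (intro mult_left_mono CQ.q_nonneg' de)
    show "CQ.q ?e \<le> 1"
      using CQ.q_le_nrm[OF de(2)] \<iota>_norm[of "L1.delta (inv x) b"] b x by (simp add: L1.nrm_delta)
  qed
  finally show ?thesis by simp
qed

lemma fibre_seminorm: "cstar_seminorm A (\<lambda>a. CQ.q (\<iota> (L1.delta \<one> a)))"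
proof -
  define h where "h a = \<iota> (L1.delta \<one> a)" for a
  have h: "h a \<in> carrier C" "b \<in> carrier A \<Longrightarrow> h (a \<oplus>\<^bsub>A\<^esub> b) = h a \<oplus>\<^bsub>C\<^esub> h b"
    "h (z \<odot>\<^bsub>A\<^esub> a) = z \<odot>\<^bsub>C\<^esub> h a" "b \<in> carrier A \<Longrightarrow> h (a \<otimes>\<^bsub>A\<^esub> b) = h a \<otimes>\<^bsub>C\<^esub> h b"
    "h (a\<^sup>\<star>\<^bsub>A\<^esub>) = (h a)\<^sup>\<star>\<^bsub>C\<^esub>" "CQ.q (h a) \<le> \<parallel>a\<parallel>\<^bsub>A\<^esub>" if a: "a \<in> carrier A" for a b z
  proof -
    show hc: "h a \<in> carrier C" using a by (simp add: h_def \<iota>)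
    show "h (a \<oplus>\<^bsub>A\<^esub> b) = h a \<oplus>\<^bsub>C\<^esub> h b" if "b \<in> carrier A"
      using a that by (simp add: h_def L1.delta_add \<iota>)
    show "h (z \<odot>\<^bsub>A\<^esub> a) = z \<odot>\<^bsub>C\<^esub> h a" using a by (simp add: h_def \<iota> flip: L1.smult_delta)
    show "h (a \<otimes>\<^bsub>A\<^esub> b) = h a \<otimes>\<^bsub>C\<^esub> h b" if "b \<in> carrier A"
      using a that by (simp add: h_def K.conv_delta \<alpha>_unit_id normalized flip: \<iota>(3))
    have "tw_star (L1.delta \<one> a) = L1.delta \<one> (a\<^sup>\<star>\<^bsub>A\<^esub>)"
      using tw_star_delta[of \<one> a] a by (simp add: \<alpha>_unit_id normalized star_one_A L1.A.star_closed)
    then show "h (a\<^sup>\<star>\<^bsub>A\<^esub>) = (h a)\<^sup>\<star>\<^bsub>C\<^esub>" using a by (simp add: h_def flip: \<iota>(5))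
    show "CQ.q (h a) \<le> \<parallel>a\<parallel>\<^bsub>A\<^esub>"
      using CQ.q_le_nrm[OF hc] \<iota>_norm[of "L1.delta \<one> a"] a by (simp add: h_def L1.nrm_delta)
  qed
  show ?thesis
    unfolding cstar_seminorm_def h_def[symmetric]
    by (simp add: h CQ.q_nonneg' CQ.quotient_q_cstar CQ.quotient_q_smult CQ.quotient_q_add CQ.quotient_q_mult L1.A.star_closed)
qed

text \<open>
  Conversely \<open>a \<delta>\<^sub>x = (a \<delta>\<^sub>e) (1 \<delta>\<^sub>x)\<close>.
\<close>

lemma fibre_in_I:
  assumes x: "x \<in> carrier G" and a: "a \<in> carrier A" and q: "CQ.q (\<iota> (L1.delta \<one> a)) = 0"
  shows "\<iota> (L1.delta x a) \<in> I"
proof -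
  have "\<iota> (L1.delta \<one> a) \<in> I" using q a CQ.q_eq_0_iff by (simp add: \<iota>)
  moreover have "\<iota> (L1.delta x a) = \<iota> (L1.delta \<one> a) \<otimes>\<^bsub>C\<^esub> \<iota> (L1.delta x \<one>\<^bsub>A\<^esub>)"
    using x a by (simp add: K.conv_delta \<alpha>_one normalized flip: \<iota>(3))
  ultimately show ?thesis using CQ.I_mult x by (simp add: \<iota>)
qed

lemma pointwise_in_I:
  assumes k: "k \<in> l1" and q: "\<And>x. x \<in> carrier G \<Longrightarrow> CQ.q (\<iota> (L1.delta \<one> (k x))) = 0"
  shows "\<iota> k \<in> I"
proof (rule CQ.I_closed)
  show "\<iota> k \<in> carrier C" using k by (simp add: \<iota>)
  fix e :: real assume e: "e > 0"
  have "\<exists>g\<in>l1. \<iota> g \<in> I \<and> \<parallel>k \<ominus>\<^bsub>L1.L\<^esub> g\<parallel>\<^bsub>L1.L\<^esub> \<le> e / 2"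
  proof (rule L1.l1_finite_approx[OF k, of "e / 2" "\<lambda>g. \<iota> g \<in> I"])
    show "\<iota> \<zero>\<^bsub>L1.L\<^esub> \<in> I" by (simp add: \<iota>.zero CQ.I_zero)
    show "\<iota> (g \<oplus>\<^bsub>L1.L\<^esub> L1.delta x (k x)) \<in> I" if "g \<in> l1" "\<iota> g \<in> I" "x \<in> carrier G" for g x
      using that k fibre_in_I[OF that(3) _ q[OF that(3)]] by (simp add: \<iota> CQ.I_add)
  qed (use e in simp)
  then obtain g where g: "g \<in> l1" "\<iota> g \<in> I" "\<parallel>k \<ominus>\<^bsub>L1.L\<^esub> g\<parallel>\<^bsub>L1.L\<^esub> \<le> e / 2" by blast
  have "\<parallel>\<iota> k \<ominus>\<^bsub>C\<^esub> \<iota> g\<parallel>\<^bsub>C\<^esub> \<le> \<parallel>k \<ominus>\<^bsub>L1.L\<^esub> g\<parallel>\<^bsub>L1.L\<^esub>"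
    using \<iota>.minus[of k g] \<iota>_norm[of "k \<ominus>\<^bsub>L1.L\<^esub> g"] k g by (simp add: L1.l1_simps(1) L1.l1_minus_closed)
  then show "\<exists>j\<in>I. \<parallel>\<iota> k \<ominus>\<^bsub>C\<^esub> j\<parallel>\<^bsub>C\<^esub> < e" using g e by (intro bexI[of _ "\<iota> g"]) auto
qed

text \<open>
  Each coefficient \<open>h x\<close> is corrected by an element \<open>k x\<close> of the kernel of the fibre seminorm so that its norm
  comes within a factor \<open>c\<close> of the norm of the corresponding coefficient of \<open>\<Psi> h\<close>. Summing over \<open>x\<close> gives a
  summable function, because the norms of the coefficients of \<open>\<Psi> h\<close> are summable.
\<close>

lemma lift_small:
  assumes h: "h \<in> l1" and N: "\<parallel>\<Psi> h\<parallel>\<^bsub>LD\<^esub> < 1"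
  shows "\<exists>w\<in>l1. \<parallel>w\<parallel>\<^bsub>L1.L\<^esub> < 1 \<and> \<iota> (h \<ominus>\<^bsub>L1.L\<^esub> w) \<in> I"
proof -
  define N where "N = \<parallel>\<Psi> h\<parallel>\<^bsub>LD\<^esub>"
  have N01: "0 \<le> N" "N < 1" using N LD.nrm_nonneg[OF \<Psi>_closed(1)[OF h]] by (simp_all add: N_def)
  (* A factor greater than 1 that keeps c * N below 1. *)
  define c where "c = 1 + (1 - N) / 2"
  have c: "c > 1" using N01 by (simp add: c_def)
  have "(1 - N) * (2 - N) > 0" using N01 by (intro mult_pos_pos) auto
  then have "N * 3 < N * N + 2" by (simp add: algebra_simps)
  moreover have "2 * (c * N) = N * 3 - N * N" by (simp add: c_def algebra_simps)
  ultimately have cN: "c * N < 1" by linarith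
  define t where "t x = CQ.q (\<iota> (L1.delta x (h x)))" for x
  have t: "t x = \<parallel>\<Psi> h x\<parallel>\<^bsub>D\<^esub>" "t x \<ge> 0" if "x \<in> carrier G" for x
    using that h by (simp_all add: t_def H.induced_def \<phi>_nrm CQ.q_nonneg' \<iota>)
  have lifts: "cstar_seminorms_are_quotient_norms A"
    using all_transferred_facts[OF L1.A.unital_banach_axioms] by (simp add: transferred_facts_def)
  have "\<exists>k\<in>carrier A. CQ.q (\<iota> (L1.delta \<one> k)) = 0 \<and> \<parallel>h x \<ominus>\<^bsub>A\<^esub> k\<parallel>\<^bsub>A\<^esub> \<le> c * t x" if x: "x \<in> carrier G" for x
  (* Lifting costs the factor c > 1, which leaves no room where the seminorm vanishes; there h x
     itself is in the kernel. *)
  proof (cases "t x = 0")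
    case True
    have hx: "h x \<in> carrier A" using h x by simp
    have "CQ.q (\<iota> (L1.delta \<one> (h x))) = 0"
      using fibre_seminorm_le[OF x hx] True CQ.q_nonneg'[of "\<iota> (L1.delta \<one> (h x))"] hx
      by (simp add: t_def \<iota>)
    then show ?thesis using True hx by (intro bexI[of _ "h x"]) (simp_all add: L1.A.minus_eq L1.A.r_neg)
  next
    case False
    have hx: "h x \<in> carrier A" using h x by simp
    have "t x < c * t x" using False t(2)[OF x] c by simp
    then have "CQ.q (\<iota> (L1.delta \<one> (h x))) < c * t x"
      using fibre_seminorm_le[OF x hx] by (simp add: t_def)
    then show ?thesis
      using lifts A_cstar fibre_seminorm hx unfolding cstar_seminorms_are_quotient_norms_def by blast
  qed
  then obtain k where k: "\<And>x. x \<in> carrier G \<Longrightarrow> k x \<in> carrier A"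
    "\<And>x. x \<in> carrier G \<Longrightarrow> CQ.q (\<iota> (L1.delta \<one> (k x))) = 0"
    "\<And>x. x \<in> carrier G \<Longrightarrow> \<parallel>h x \<ominus>\<^bsub>A\<^esub> k x\<parallel>\<^bsub>A\<^esub> \<le> c * t x"
    by metis
  define w where "w = (\<lambda>x\<in>carrier G. h x \<ominus>\<^bsub>A\<^esub> k x)"
  have bound: "(\<Sum>x\<in>F. \<parallel>h x \<ominus>\<^bsub>A\<^esub> k x\<parallel>\<^bsub>A\<^esub>) \<le> c * N" if F: "finite F" "F \<subseteq> carrier G" for F
  proof -
    have "(\<Sum>x\<in>F. \<parallel>h x \<ominus>\<^bsub>A\<^esub> k x\<parallel>\<^bsub>A\<^esub>) \<le> (\<Sum>x\<in>F. c * \<parallel>\<Psi> h x\<parallel>\<^bsub>D\<^esub>)"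
      using k(3) F t(1) by (intro sum_mono) (metis subsetD)
    also have "\<dots> = c * (\<Sum>x\<in>F. \<parallel>\<Psi> h x\<parallel>\<^bsub>D\<^esub>)" by (simp add: sum_distrib_left)
    also have "\<dots> \<le> c * N"
      using c DL.finite_sum_le_nrm[OF H.induced_closed(1)[OF h] F] by (simp add: N_def)
    finally show ?thesis .
  qed
  have w: "w \<in> l1" "\<parallel>w\<parallel>\<^bsub>L1.L\<^esub> \<le> c * N"
    unfolding w_def by (rule L1.l1I_finite_bound[OF _ bound]; use h k in simp)+
  have hw: "h \<ominus>\<^bsub>L1.L\<^esub> w \<in> l1" by (intro L1.l1_minus_closed h w)
  have "(h \<ominus>\<^bsub>L1.L\<^esub> w) x = k x" if x: "x \<in> carrier G" for x
  proof -
    have hk: "h x \<in> carrier A" "k x \<in> carrier A" using h k x by simp_all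
    have "h x \<ominus>\<^bsub>A\<^esub> (h x \<ominus>\<^bsub>A\<^esub> k x) = k x"
      using hk by (simp add: L1.A.minus_eq L1.A.minus_add L1.A.r_neg flip: L1.A.a_assoc)
    then show ?thesis using x by (simp add: L1.l1_minus[OF h w(1)]) (simp add: w_def)
  qed
  then have "\<iota> (h \<ominus>\<^bsub>L1.L\<^esub> w) \<in> I" using k(2) by (intro pointwise_in_I[OF hw]) simp
  then show ?thesis using w cN by (intro bexI[of _ w]) auto
qed

section \<open>Inverses modulo the ideal\<close>

text \<open>
  The convolution powers are defined by iteration because the twisted algebra is not made into a
  monoid here; they are only ever compared through the homomorphisms \<open>\<iota>\<close> and \<open>\<Psi>\<close>.
\<close>

definition power :: "('g \<Rightarrow> 'a) \<Rightarrow> nat \<Rightarrow> 'g \<Rightarrow> 'a" where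
  "power u n = ((\<lambda>v. K.conv v u) ^^ n) unit_fn"

lemma power_closed:
  assumes u: "u \<in> l1"
  shows "power u n \<in> l1"
  by (induction n) (simp_all add: power_def unit_fn K.conv_closed u)

lemma power_Suc: "power u (Suc n) = K.conv (power u n) u"
  by (simp add: power_def)

lemma \<iota>_power:
  assumes u: "u \<in> l1"
  shows "\<iota> (power u n) = \<iota> u [^]\<^bsub>C\<^esub> n"
proof (induction n)
  case 0
  then show ?case by (simp add: power_def C_monoid(2))
qed (use u power_closed in \<open>simp add: power_Suc \<iota>\<close>)

lemma \<Psi>_power:
  assumes u: "u \<in> l1"
  shows "\<Psi> (power u n) = \<Psi> u [^]\<^bsub>LD\<^esub> n"
proof (induction n)
  case 0
  then show ?case by (simp add: power_def \<Psi>_unit_fn)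
qed (use u power_closed in \<open>simp add: power_Suc \<Psi>_conv\<close>)

lemma power_norm:
  assumes u: "u \<in> l1"
  shows "\<parallel>power u n\<parallel>\<^bsub>L1.L\<^esub> \<le> \<parallel>unit_fn\<parallel>\<^bsub>L1.L\<^esub> * \<parallel>u\<parallel>\<^bsub>L1.L\<^esub> ^ n"
proof (induction n)
  case (Suc n)
  have "\<parallel>power u (Suc n)\<parallel>\<^bsub>L1.L\<^esub> \<le> \<parallel>power u n\<parallel>\<^bsub>L1.L\<^esub> * \<parallel>u\<parallel>\<^bsub>L1.L\<^esub>"
    unfolding power_Suc by (intro K.conv_norm power_closed u)
  also have "\<dots> \<le> (\<parallel>unit_fn\<parallel>\<^bsub>L1.L\<^esub> * \<parallel>u\<parallel>\<^bsub>L1.L\<^esub> ^ n) * \<parallel>u\<parallel>\<^bsub>L1.L\<^esub>"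
    using Suc u by (intro mult_right_mono) (simp_all add: L1.nrm_l1_nonneg)
  finally show ?case by (simp add: mult_ac)
qed (simp add: power_def)

lemma \<iota>_power_sum:
  assumes u: "u \<in> l1"
  shows "finsum L1.L (power u) {..<n} \<in> l1"
    "\<iota> (finsum L1.L (power u) {..<n}) = finsum C (\<lambda>i. \<iota> u [^]\<^bsub>C\<^esub> i) {..<n}"
proof -
  have p: "power u \<in> {..<n} \<rightarrow> carrier L1.L" using power_closed[OF u] by (simp add: L1.l1_simps(1))
  show "finsum L1.L (power u) {..<n} \<in> l1" using L1.L.finsum_closed[OF p] by (simp add: L1.l1_simps(1))
  show "\<iota> (finsum L1.L (power u) {..<n}) = finsum C (\<lambda>i. \<iota> u [^]\<^bsub>C\<^esub> i) {..<n}"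
    using \<iota>.finsum[OF _ p] by (simp add: \<iota>_power u)
qed

text \<open>
  The Neumann series converges in the norm of summable functions, so its sum is again a summable function.
  That it is an inverse is checked in the crossed product.
\<close>

lemma neumann_in_l1:
  assumes w: "w \<in> l1" and lt: "\<parallel>w\<parallel>\<^bsub>L1.L\<^esub> < 1"
  shows "\<exists>s\<in>l1. (\<one>\<^bsub>C\<^esub> \<ominus>\<^bsub>C\<^esub> \<iota> w) \<otimes>\<^bsub>C\<^esub> \<iota> s = \<one>\<^bsub>C\<^esub>"
proof -
  define K0 where "K0 = \<parallel>unit_fn\<parallel>\<^bsub>L1.L\<^esub>"
  define r where "r = \<parallel>w\<parallel>\<^bsub>L1.L\<^esub>"
  have K0: "K0 \<ge> 0" and r: "0 \<le> r" "r < 1" using w lt unit_fn by (simp_all add: K0_def r_def L1.nrm_l1_nonneg)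
  have norm: "\<parallel>power w n\<parallel>\<^bsub>L1.L\<^esub> \<le> K0 * r ^ n" for n unfolding K0_def r_def by (rule power_norm[OF w])
  have "summable (\<lambda>n. K0 * r ^ n)" using r by (intro summable_mult summable_geometric) simp
  then have "(\<lambda>n. K0 * r ^ n) summable_on UNIV"
    by (rule summable_nonneg_imp_summable_on) (use K0 r in simp)
  then have "(\<lambda>n. \<parallel>power w n\<parallel>\<^bsub>L1.L\<^esub>) summable_on UNIV"
    by (rule summable_on_comparison_test) (use norm power_closed[OF w] in \<open>auto simp: L1.nrm_l1_nonneg\<close>)
  then have sd: "LA.abs_summable (power w) UNIV"
    using power_closed[OF w] by (simp add: LA.abs_summable_def L1.l1_simps(1))
  define s where "s = alg_sum L1.L (power w) UNIV"
  have s: "s \<in> l1" using LA.alg_sum_closed[OF sd] by (simp add: s_def L1.l1_simps(1))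
  define c where "c = \<iota> w"
  have c: "c \<in> carrier C" using w by (simp add: c_def \<iota>)
  define y where "y = \<one>\<^bsub>C\<^esub> \<ominus>\<^bsub>C\<^esub> c"
  have y: "y \<in> carrier C" using c by (simp add: y_def)
  have "y \<otimes>\<^bsub>C\<^esub> \<iota> s = \<one>\<^bsub>C\<^esub>"
  proof (rule C.eq_if_small)
    show "y \<otimes>\<^bsub>C\<^esub> \<iota> s \<in> carrier C" using y s by (simp add: \<iota>)
    fix e :: real assume e: "e > 0"
    define d where "d = e / (2 * (\<parallel>y\<parallel>\<^bsub>C\<^esub> + 1))"
    have d: "d > 0" using e y by (simp add: d_def add_nonneg_pos)
    obtain F where F: "finite F" "\<And>H. finite H \<Longrightarrow> F \<subseteq> H \<Longrightarrow> \<parallel>finsum L1.L (power w) H \<ominus>\<^bsub>L1.L\<^esub> s\<parallel>\<^bsub>L1.L\<^esub> < d"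
      using LA.alg_sum_near[OF sd d] unfolding s_def by (metis subset_UNIV)
    obtain k0 where k0: "F \<subseteq> {..<k0}" using F(1) finite_nat_iff_bounded by blast
    have "e / (2 * (K0 + 1)) > 0" using e K0 by (simp add: add_nonneg_pos)
    then obtain k1 where k1: "r ^ k1 < e / (2 * (K0 + 1))"
      using real_arch_pow_inv[of "e / (2 * (K0 + 1))" r] r by auto
    define k where "k = max k0 k1"
    define f where "f = finsum L1.L (power w) {..<k}"
    have f: "f \<in> l1" and \<iota>f: "\<iota> f = finsum C (\<lambda>i. c [^]\<^bsub>C\<^esub> i) {..<k}"
      using \<iota>_power_sum[OF w] by (simp_all add: f_def c_def)
    have ck: "c [^]\<^bsub>C\<^esub> k \<in> carrier C" using c by simp
    have "\<parallel>\<iota> f \<ominus>\<^bsub>C\<^esub> \<iota> s\<parallel>\<^bsub>C\<^esub> \<le> \<parallel>f \<ominus>\<^bsub>L1.L\<^esub> s\<parallel>\<^bsub>L1.L\<^esub>"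
      using \<iota>.minus[of f s] \<iota>_norm[of "f \<ominus>\<^bsub>L1.L\<^esub> s"] f s by (simp add: L1.l1_simps(1) L1.l1_minus_closed)
    also have "\<dots> < d" unfolding f_def using k0 by (intro F(2)) (auto simp: k_def)
    finally have fs: "\<parallel>\<iota> s \<ominus>\<^bsub>C\<^esub> \<iota> f\<parallel>\<^bsub>C\<^esub> < d" using C.nrm_minus_commute[of "\<iota> f" "\<iota> s"] f s by (simp add: \<iota>)
    have 1: "\<parallel>y \<otimes>\<^bsub>C\<^esub> \<iota> s \<ominus>\<^bsub>C\<^esub> y \<otimes>\<^bsub>C\<^esub> \<iota> f\<parallel>\<^bsub>C\<^esub> < e / 2"
    proof -
      have "y \<otimes>\<^bsub>C\<^esub> \<iota> s \<ominus>\<^bsub>C\<^esub> y \<otimes>\<^bsub>C\<^esub> \<iota> f = y \<otimes>\<^bsub>C\<^esub> (\<iota> s \<ominus>\<^bsub>C\<^esub> \<iota> f)"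
        using y f s by (simp add: C.minus_eq C.r_distr C.r_minus \<iota>)
      then have "\<parallel>y \<otimes>\<^bsub>C\<^esub> \<iota> s \<ominus>\<^bsub>C\<^esub> y \<otimes>\<^bsub>C\<^esub> \<iota> f\<parallel>\<^bsub>C\<^esub> \<le> \<parallel>\<iota> s \<ominus>\<^bsub>C\<^esub> \<iota> f\<parallel>\<^bsub>C\<^esub> * \<parallel>y\<parallel>\<^bsub>C\<^esub>"
        using C.nrm_mult[of y "\<iota> s \<ominus>\<^bsub>C\<^esub> \<iota> f"] y f s by (simp add: \<iota> mult.commute)
      also have "\<dots> < e / 2" using fs y f s by (intro mult_less_half) (simp_all add: d_def \<iota>)
      finally show ?thesis .
    qed
    have yf: "y \<otimes>\<^bsub>C\<^esub> \<iota> f = \<one>\<^bsub>C\<^esub> \<ominus>\<^bsub>C\<^esub> c [^]\<^bsub>C\<^esub> k"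
      unfolding y_def \<iota>f by (rule C.geometric_sum[OF c])
    have "(\<one>\<^bsub>C\<^esub> \<ominus>\<^bsub>C\<^esub> c [^]\<^bsub>C\<^esub> k) \<ominus>\<^bsub>C\<^esub> \<one>\<^bsub>C\<^esub> = \<ominus>\<^bsub>C\<^esub> (c [^]\<^bsub>C\<^esub> k)"
      using ck by (simp add: C.minus_eq C.a_ac C.r_neg1 C.r_neg2 C.r_neg)
    then have "\<parallel>y \<otimes>\<^bsub>C\<^esub> \<iota> f \<ominus>\<^bsub>C\<^esub> \<one>\<^bsub>C\<^esub>\<parallel>\<^bsub>C\<^esub> = \<parallel>\<iota> (power w k)\<parallel>\<^bsub>C\<^esub>"
      using ck by (simp add: yf \<iota>_power[OF w] flip: c_def)
    also have "\<dots> \<le> K0 * r ^ k" using \<iota>_norm[OF power_closed[OF w, of k]] norm[of k] by simp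
    also have "\<dots> \<le> K0 * r ^ k1" using K0 r by (intro mult_left_mono power_decreasing) (auto simp: k_def)
    also have "\<dots> < e / 2" using mult_less_half[OF K0 _ k1] r by (simp add: mult.commute)
    finally have 2: "\<parallel>y \<otimes>\<^bsub>C\<^esub> \<iota> f \<ominus>\<^bsub>C\<^esub> \<one>\<^bsub>C\<^esub>\<parallel>\<^bsub>C\<^esub> < e / 2" .
    have "\<parallel>y \<otimes>\<^bsub>C\<^esub> \<iota> s \<ominus>\<^bsub>C\<^esub> \<one>\<^bsub>C\<^esub>\<parallel>\<^bsub>C\<^esub> \<le> \<parallel>y \<otimes>\<^bsub>C\<^esub> \<iota> s \<ominus>\<^bsub>C\<^esub> y \<otimes>\<^bsub>C\<^esub> \<iota> f\<parallel>\<^bsub>C\<^esub> + \<parallel>y \<otimes>\<^bsub>C\<^esub> \<iota> f \<ominus>\<^bsub>C\<^esub> \<one>\<^bsub>C\<^esub>\<parallel>\<^bsub>C\<^esub>"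
      using y f s by (intro C.nrm_triangle_minus) (simp_all add: \<iota>)
    then show "\<parallel>y \<otimes>\<^bsub>C\<^esub> \<iota> s \<ominus>\<^bsub>C\<^esub> \<one>\<^bsub>C\<^esub>\<parallel>\<^bsub>C\<^esub> < e" using 1 2 by simp
  qed simp
  then show ?thesis using s by (auto simp: y_def c_def)
qed

text \<open>
  The main argument: a right inverse modulo \<open>I\<close> in the crossed product can be replaced by the image of a
  summable function. With \<open>u = 1 - f g\<close>, \<open>h = u\<^sup>n\<close> and \<open>w\<close> as in \<open>lift_small\<close>, the function is
  \<open>g (1 + u + \<dots> + u\<^sup>n\<^sup>-\<^sup>1) (1 - w)\<^sup>-\<^sup>1\<close>.
\<close>

lemma right_inverse_modulo_I:
  assumes rig: "rigidly_symmetric G" and f: "f \<in> l1" and c: "c \<in> carrier C"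
    and fc: "\<iota> f \<otimes>\<^bsub>C\<^esub> c \<ominus>\<^bsub>C\<^esub> \<one>\<^bsub>C\<^esub> \<in> I"
  shows "\<exists>v\<in>l1. \<iota> f \<otimes>\<^bsub>C\<^esub> \<iota> v \<ominus>\<^bsub>C\<^esub> \<one>\<^bsub>C\<^esub> \<in> I"
proof -
  have \<iota>f: "\<iota> f \<in> carrier C" using f by (simp add: \<iota>)
  define i where "i = \<iota> f \<otimes>\<^bsub>C\<^esub> c \<ominus>\<^bsub>C\<^esub> \<one>\<^bsub>C\<^esub>"
  have iI: "i \<in> I" and i: "i \<in> carrier C" using fc \<iota>f c by (simp_all add: i_def)
  have "(1/2) / (2 * (\<parallel>\<iota> f\<parallel>\<^bsub>C\<^esub> + 1)) > 0" using \<iota>f by (simp add: add_nonneg_pos)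
  then obtain g where g: "g \<in> l1" "\<parallel>c \<ominus>\<^bsub>C\<^esub> \<iota> g\<parallel>\<^bsub>C\<^esub> < (1/2) / (2 * (\<parallel>\<iota> f\<parallel>\<^bsub>C\<^esub> + 1))"
    using dense_iff[OF c] by blast
  have \<iota>g: "\<iota> g \<in> carrier C" using g by (simp add: \<iota>)
  obtain j where j: "j \<in> LJ" "\<parallel>i \<ominus>\<^bsub>C\<^esub> \<iota> j\<parallel>\<^bsub>C\<^esub> < 1/4"
    using iI I_closure[of i] by (metis image_iff zero_less_divide_1_iff zero_less_numeral)
  have jl: "j \<in> l1" and \<iota>j: "\<iota> j \<in> carrier C" using j LJ_l1 by (simp_all add: \<iota>)
  define u where "u = unit_fn \<ominus>\<^bsub>L1.L\<^esub> K.conv f g"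
  have fg: "K.conv f g \<in> l1" by (intro K.conv_closed f g)
  have u: "u \<in> l1" unfolding u_def by (intro L1.l1_minus_closed unit_fn fg)
  have \<iota>u: "\<iota> u = \<one>\<^bsub>C\<^esub> \<ominus>\<^bsub>C\<^esub> \<iota> f \<otimes>\<^bsub>C\<^esub> \<iota> g"
    unfolding u_def using \<iota>.minus[of unit_fn "K.conv f g"] unit_fn fg f g
    by (simp add: L1.l1_simps(1) \<iota> C_monoid(2))
  have uj: "u \<oplus>\<^bsub>L1.L\<^esub> j \<in> l1" by (intro L1.l1_add u jl)
  have "\<parallel>\<iota> (u \<oplus>\<^bsub>L1.L\<^esub> j)\<parallel>\<^bsub>C\<^esub> < 1"
  proof -
    define P Q where "P = \<iota> f \<otimes>\<^bsub>C\<^esub> c" and "Q = \<iota> f \<otimes>\<^bsub>C\<^esub> \<iota> g"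
    have PQ: "P \<in> carrier C" "Q \<in> carrier C" using \<iota>f c \<iota>g by (simp_all add: P_def Q_def)
    have iP: "i = P \<ominus>\<^bsub>C\<^esub> \<one>\<^bsub>C\<^esub>" by (simp only: i_def P_def)
    have "(P \<ominus>\<^bsub>C\<^esub> Q) \<ominus>\<^bsub>C\<^esub> (i \<ominus>\<^bsub>C\<^esub> \<iota> j) = (P \<ominus>\<^bsub>C\<^esub> P) \<oplus>\<^bsub>C\<^esub> ((\<one>\<^bsub>C\<^esub> \<ominus>\<^bsub>C\<^esub> Q) \<oplus>\<^bsub>C\<^esub> \<iota> j)"
      unfolding iP using PQ \<iota>j by (simp add: C.minus_eq C.minus_add C.a_ac)
    also have "P \<ominus>\<^bsub>C\<^esub> P = \<zero>\<^bsub>C\<^esub>" using PQ by (simp add: C.minus_eq C.r_neg)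
    also have "\<zero>\<^bsub>C\<^esub> \<oplus>\<^bsub>C\<^esub> ((\<one>\<^bsub>C\<^esub> \<ominus>\<^bsub>C\<^esub> Q) \<oplus>\<^bsub>C\<^esub> \<iota> j) = (\<one>\<^bsub>C\<^esub> \<ominus>\<^bsub>C\<^esub> Q) \<oplus>\<^bsub>C\<^esub> \<iota> j" using PQ \<iota>j by simp
    also have "\<dots> = \<iota> (u \<oplus>\<^bsub>L1.L\<^esub> j)" by (simp only: \<iota>(2)[OF u jl] \<iota>u Q_def)
    finally have "\<parallel>\<iota> (u \<oplus>\<^bsub>L1.L\<^esub> j)\<parallel>\<^bsub>C\<^esub> \<le> \<parallel>P \<ominus>\<^bsub>C\<^esub> Q\<parallel>\<^bsub>C\<^esub> + \<parallel>i \<ominus>\<^bsub>C\<^esub> \<iota> j\<parallel>\<^bsub>C\<^esub>"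
      using C.nrm_minus_le[of "P \<ominus>\<^bsub>C\<^esub> Q" "i \<ominus>\<^bsub>C\<^esub> \<iota> j"] PQ i \<iota>j by simp
    moreover have "\<parallel>P \<ominus>\<^bsub>C\<^esub> Q\<parallel>\<^bsub>C\<^esub> < (1/2) / 2"
    proof -
      have "P \<ominus>\<^bsub>C\<^esub> Q = \<iota> f \<otimes>\<^bsub>C\<^esub> (c \<ominus>\<^bsub>C\<^esub> \<iota> g)"
        unfolding P_def Q_def using \<iota>f c \<iota>g by (simp add: C.minus_eq C.r_distr C.r_minus)
      then have "\<parallel>P \<ominus>\<^bsub>C\<^esub> Q\<parallel>\<^bsub>C\<^esub> \<le> \<parallel>c \<ominus>\<^bsub>C\<^esub> \<iota> g\<parallel>\<^bsub>C\<^esub> * \<parallel>\<iota> f\<parallel>\<^bsub>C\<^esub>"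
        using C.nrm_mult[of "\<iota> f" "c \<ominus>\<^bsub>C\<^esub> \<iota> g"] \<iota>f c \<iota>g by (simp add: mult.commute)
      also have "\<dots> < (1/2) / 2" using g \<iota>f c \<iota>g by (intro mult_less_half) auto
      finally show ?thesis .
    qed
    ultimately show ?thesis using j by simp
  qed
  moreover have "\<Psi> (u \<oplus>\<^bsub>L1.L\<^esub> j) = \<Psi> u"
    using H.induced_add[OF u jl] \<Psi>_LJ[OF j(1)] \<Psi>_closed(1)[OF u] by simp
  moreover have "\<exists>p. cstar_seminorm LD p \<and> (\<forall>u\<in>carrier LD. p u < 1 \<longrightarrow> (\<exists>n\<ge>1. \<parallel>u [^]\<^bsub>LD\<^esub> (n::nat)\<parallel>\<^bsub>LD\<^esub> < 1))"
  proof -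
    have "seminorm_detects_small_powers LD"
      using all_transferred_facts[OF LD.unital_banach_axioms] by (simp add: transferred_facts_def)
    moreover have "\<one>\<^bsub>LD\<^esub> \<oplus>\<^bsub>LD\<^esub> k\<^sup>\<star>\<^bsub>LD\<^esub> \<otimes>\<^bsub>LD\<^esub> k \<in> Units LD" if "k \<in> carrier LD" for k
      using that cstar_algebra.cstar_identity[OF CQ.quot.Q_cstar]
      by (intro rigidly_symmetric_one_plus_square rig group CQ.quot.Q_unital_banach) (simp_all add: LD_carrier)
    ultimately show ?thesis unfolding seminorm_detects_small_powers_def by blast
  qed
  then obtain p where p: "cstar_seminorm LD p"
    "\<And>u. u \<in> carrier LD \<Longrightarrow> p u < 1 \<Longrightarrow> \<exists>n\<ge>1. \<parallel>u [^]\<^bsub>LD\<^esub> (n::nat)\<parallel>\<^bsub>LD\<^esub> < 1" by blast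
  ultimately have "p (\<Psi> u) < 1" using \<Psi>_seminorm[OF p(1) uj] by simp
  then obtain n :: nat where n: "\<parallel>\<Psi> u [^]\<^bsub>LD\<^esub> n\<parallel>\<^bsub>LD\<^esub> < 1" using p(2)[OF \<Psi>_closed(1)[OF u]] by blast
  define h where "h = power u n"
  have h: "h \<in> l1" by (simp add: h_def power_closed u)
  have "\<parallel>\<Psi> h\<parallel>\<^bsub>LD\<^esub> < 1" using n by (simp add: h_def \<Psi>_power u)
  then obtain w where w: "w \<in> l1" "\<parallel>w\<parallel>\<^bsub>L1.L\<^esub> < 1" "\<iota> (h \<ominus>\<^bsub>L1.L\<^esub> w) \<in> I" using lift_small[OF h] by blast
  have k: "\<iota> h \<ominus>\<^bsub>C\<^esub> \<iota> w \<in> I" using w(3) \<iota>.minus[of h w] h w(1) by (simp add: L1.l1_simps(1))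
  obtain s where s: "s \<in> l1" "(\<one>\<^bsub>C\<^esub> \<ominus>\<^bsub>C\<^esub> \<iota> w) \<otimes>\<^bsub>C\<^esub> \<iota> s = \<one>\<^bsub>C\<^esub>" using neumann_in_l1[OF w(1,2)] by blast
  define S where "S = finsum L1.L (power u) {..<n}"
  have S: "S \<in> l1" using \<iota>_power_sum(1)[OF u] by (simp add: S_def)
  have cl: "\<iota> h \<in> carrier C" "\<iota> w \<in> carrier C" "\<iota> s \<in> carrier C" "\<iota> S \<in> carrier C"
    using h w s S by (simp_all add: \<iota>)
  have "\<iota> f \<otimes>\<^bsub>C\<^esub> \<iota> g = \<one>\<^bsub>C\<^esub> \<ominus>\<^bsub>C\<^esub> \<iota> u"
    using \<iota>f \<iota>g by (simp add: \<iota>u C.minus_eq C.minus_add C.r_neg flip: C.a_assoc)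
  then have fgS: "(\<iota> f \<otimes>\<^bsub>C\<^esub> \<iota> g) \<otimes>\<^bsub>C\<^esub> \<iota> S = \<one>\<^bsub>C\<^esub> \<ominus>\<^bsub>C\<^esub> \<iota> h"
    using C.geometric_sum[of "\<iota> u" n] u by (simp add: S_def \<iota>_power_sum \<iota> h_def \<iota>_power)
  define v where "v = K.conv g (K.conv S s)"
  have v: "v \<in> l1" by (simp add: v_def K.conv_closed g S s)
  have "\<iota> f \<otimes>\<^bsub>C\<^esub> \<iota> v = ((\<iota> f \<otimes>\<^bsub>C\<^esub> \<iota> g) \<otimes>\<^bsub>C\<^esub> \<iota> S) \<otimes>\<^bsub>C\<^esub> \<iota> s"
    using \<iota>f \<iota>g cl g S s by (simp add: v_def \<iota> K.conv_closed C.m_assoc)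
  also have "\<dots> = (\<one>\<^bsub>C\<^esub> \<ominus>\<^bsub>C\<^esub> \<iota> h) \<otimes>\<^bsub>C\<^esub> \<iota> s" by (simp only: fgS)
  also have "\<one>\<^bsub>C\<^esub> \<ominus>\<^bsub>C\<^esub> \<iota> h = (\<one>\<^bsub>C\<^esub> \<ominus>\<^bsub>C\<^esub> \<iota> w) \<ominus>\<^bsub>C\<^esub> (\<iota> h \<ominus>\<^bsub>C\<^esub> \<iota> w)"
  proof -
    have "(\<one>\<^bsub>C\<^esub> \<ominus>\<^bsub>C\<^esub> \<iota> w) \<ominus>\<^bsub>C\<^esub> (\<iota> h \<ominus>\<^bsub>C\<^esub> \<iota> w) = (\<one>\<^bsub>C\<^esub> \<ominus>\<^bsub>C\<^esub> \<iota> h) \<oplus>\<^bsub>C\<^esub> (\<iota> w \<ominus>\<^bsub>C\<^esub> \<iota> w)"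
      using cl by (simp add: C.minus_eq C.minus_add C.a_ac)
    then show ?thesis using cl by (simp add: C.minus_eq C.r_neg)
  qed
  also have "\<dots> \<otimes>\<^bsub>C\<^esub> \<iota> s = \<one>\<^bsub>C\<^esub> \<ominus>\<^bsub>C\<^esub> (\<iota> h \<ominus>\<^bsub>C\<^esub> \<iota> w) \<otimes>\<^bsub>C\<^esub> \<iota> s"
  proof -
    have "(y \<ominus>\<^bsub>C\<^esub> z) \<otimes>\<^bsub>C\<^esub> \<iota> s = y \<otimes>\<^bsub>C\<^esub> \<iota> s \<ominus>\<^bsub>C\<^esub> z \<otimes>\<^bsub>C\<^esub> \<iota> s" if "y \<in> carrier C" "z \<in> carrier C" for y z
      using that cl by (simp add: C.minus_eq C.l_distr C.l_minus)
    then show ?thesis using cl s(2) by simp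
  qed
  finally have fv: "\<iota> f \<otimes>\<^bsub>C\<^esub> \<iota> v = \<one>\<^bsub>C\<^esub> \<ominus>\<^bsub>C\<^esub> (\<iota> h \<ominus>\<^bsub>C\<^esub> \<iota> w) \<otimes>\<^bsub>C\<^esub> \<iota> s" .
  define m where "m = (\<iota> h \<ominus>\<^bsub>C\<^esub> \<iota> w) \<otimes>\<^bsub>C\<^esub> \<iota> s"
  have mI: "m \<in> I" using CQ.I_mult[OF k cl(3)] by (simp add: m_def)
  then have mc: "m \<in> carrier C" by simp
  have "(\<one>\<^bsub>C\<^esub> \<ominus>\<^bsub>C\<^esub> m) \<ominus>\<^bsub>C\<^esub> \<one>\<^bsub>C\<^esub> = (\<one>\<^bsub>C\<^esub> \<ominus>\<^bsub>C\<^esub> \<one>\<^bsub>C\<^esub>) \<oplus>\<^bsub>C\<^esub> (\<ominus>\<^bsub>C\<^esub> m)"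
    using mc by (simp add: C.minus_eq C.a_ac)
  also have "\<one>\<^bsub>C\<^esub> \<ominus>\<^bsub>C\<^esub> \<one>\<^bsub>C\<^esub> = \<zero>\<^bsub>C\<^esub>" by (simp add: C.minus_eq C.r_neg)
  finally have "\<iota> f \<otimes>\<^bsub>C\<^esub> \<iota> v \<ominus>\<^bsub>C\<^esub> \<one>\<^bsub>C\<^esub> = \<ominus>\<^bsub>C\<^esub> m" using mc by (simp only: fv m_def[symmetric] C.l_zero C.a_inv_closed)
  then have "\<iota> f \<otimes>\<^bsub>C\<^esub> \<iota> v \<ominus>\<^bsub>C\<^esub> \<one>\<^bsub>C\<^esub> \<in> I" using CQ.I_uminus[OF mI] by (simp only:)
  then show ?thesis using v by (rule bexI)
qed

end

theorem theorem2p13: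
  fixes G :: "('g, 'k) monoid_scheme"
    and A :: "('a, 'm) star_algebra_scheme"
    and \<alpha> :: "'g \<Rightarrow> 'a \<Rightarrow> 'a"
    and \<omega> :: "'g \<Rightarrow> 'g \<Rightarrow> 'a"
    and C :: "('c, 'n) star_algebra_scheme"
    and \<iota> :: "('g \<Rightarrow> 'a) \<Rightarrow> 'c"
    and J :: "'a set"
  assumes "rigidly_symmetric G"
    and "twisted_cstar_system G A \<alpha> \<omega>"
    and "enveloping_cstar_algebra (twisted_l1 G A \<alpha> \<omega>) C \<iota>"
    and "cstar_ideal J A"
    and "invariant_under G \<alpha> J"
  shows "ideal_inverse_closed (crossed_product_ideal G A J C \<iota>)
           (\<iota> ` carrier (twisted_l1 G A \<alpha> \<omega>)) C"
proof -
  interpret S: invariant_ideal G A \<alpha> \<omega> C \<iota> J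
    by (intro invariant_ideal.intro crossed_product.intro crossed_product_axioms.intro
        invariant_ideal_axioms.intro assms)
  interpret I: ideal S.I C by (rule S.CQ.ideal_I)
  interpret Q: ring "C Quot S.I" by (rule I.quotient_is_ring)
  have Q_carrier: "y \<in> carrier (C Quot S.I) \<longleftrightarrow> (\<exists>c\<in>carrier C. y = S.I +>\<^bsub>C\<^esub> c)" for y
    by (auto simp: FactRing_def A_RCOSETS_def')
  have Q_mult: "(S.I +>\<^bsub>C\<^esub> c) \<otimes>\<^bsub>C Quot S.I\<^esub> (S.I +>\<^bsub>C\<^esub> d) = S.I +>\<^bsub>C\<^esub> (c \<otimes>\<^bsub>C\<^esub> d)"
    if "c \<in> carrier C" "d \<in> carrier C" for c d
    using that by (simp add: FactRing_def I.rcoset_mult_add)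
  have Q_one: "\<one>\<^bsub>C Quot S.I\<^esub> = S.I +>\<^bsub>C\<^esub> \<one>\<^bsub>C\<^esub>" by (simp add: FactRing_def)
  have Q_one_iff: "S.I +>\<^bsub>C\<^esub> c = \<one>\<^bsub>C Quot S.I\<^esub> \<longleftrightarrow> c \<ominus>\<^bsub>C\<^esub> \<one>\<^bsub>C\<^esub> \<in> S.I" if "c \<in> carrier C" for c
    using S.C.quotient_eq_iff_same_a_r_cos[OF I.is_ideal that S.C.one_closed] by (simp add: Q_one)
  show ?thesis
    unfolding ideal_inverse_closed_def inverse_closed_def S.TL_simps
  proof
    fix x assume "x \<in> (\<lambda>b. S.I +>\<^bsub>C\<^esub> b) ` \<iota> ` S.l1 \<inter> Units (C Quot S.I)"
    then obtain f where f: "f \<in> S.l1" "x = S.I +>\<^bsub>C\<^esub> \<iota> f" and x: "x \<in> Units (C Quot S.I)" by auto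
    have \<iota>f: "\<iota> f \<in> carrier C" using f by (simp add: S.\<iota>)
    obtain c where c: "c \<in> carrier C" "inv\<^bsub>C Quot S.I\<^esub> x = S.I +>\<^bsub>C\<^esub> c"
      using Q.Units_inv_closed[OF x] Q_carrier by blast
    have "\<iota> f \<otimes>\<^bsub>C\<^esub> c \<ominus>\<^bsub>C\<^esub> \<one>\<^bsub>C\<^esub> \<in> S.I"
      using Q.Units_r_inv[OF x] \<iota>f c by (simp add: f(2) Q_mult Q_one_iff)
    then obtain v where v: "v \<in> S.l1" "\<iota> f \<otimes>\<^bsub>C\<^esub> \<iota> v \<ominus>\<^bsub>C\<^esub> \<one>\<^bsub>C\<^esub> \<in> S.I"
      using S.right_inverse_modulo_I[OF assms(1) f(1) c(1)] by blast
    have \<iota>v: "\<iota> v \<in> carrier C" using v by (simp add: S.\<iota>)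
    let ?y = "S.I +>\<^bsub>C\<^esub> \<iota> v"
    have y: "?y \<in> carrier (C Quot S.I)" using \<iota>v Q_carrier by blast
    have xy: "x \<otimes>\<^bsub>C Quot S.I\<^esub> ?y = \<one>\<^bsub>C Quot S.I\<^esub>"
      using \<iota>f \<iota>v v by (simp add: f(2) Q_mult Q_one_iff)
    have "inv\<^bsub>C Quot S.I\<^esub> x \<otimes>\<^bsub>C Quot S.I\<^esub> (x \<otimes>\<^bsub>C Quot S.I\<^esub> ?y)
      = (inv\<^bsub>C Quot S.I\<^esub> x \<otimes>\<^bsub>C Quot S.I\<^esub> x) \<otimes>\<^bsub>C Quot S.I\<^esub> ?y"
      by (rule Q.m_assoc[OF Q.Units_inv_closed[OF x] Q.Units_closed[OF x] y, symmetric])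
    also have "\<dots> = ?y" using x y by (simp add: Q.Units_l_inv)
    finally have "inv\<^bsub>C Quot S.I\<^esub> x = ?y" using x by (simp add: xy)
    then show "inv\<^bsub>C Quot S.I\<^esub> x \<in> (\<lambda>b. S.I +>\<^bsub>C\<^esub> b) ` \<iota> ` S.l1" using v(1) by blast
  qed
qed

end
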